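(* Let $\pi$ be a stable factor-representation of $B=\mathbb{Z}_2\wr\mathfrak{S}_\infty$ on a Hilbert space $\mathcal{H}_\pi$. For $g\in B$ let ${\rm Cl}(g)=\{hgh^{-1}\}_{h\in B}$ and ${\rm Cl}_{n\infty}(g)={\rm Cl}(g)\cap B_{n\infty}$. Let $g\in B$ and let $(g_n)$ be a sequence with $g_n\in{\rm Cl}_{n\infty}(g)$. Then $\lim_{n\to\infty}\pi(g_n)$ exists in the weak operator topology and is a scalar operator $\chi_\pi^{as}(g)\cdot I_{\mathcal{H}_\pi}$, and $\chi_\pi^{as}$ is a positive definite function on $B$ with the following properties: (i) $\chi_\pi^{as}(g)$ does not depend on the choice of the sequence $(g_n)$; (ii) $\chi_\pi^{as}$ is central, i.e. $\chi_\pi^{as}(gh)=\chi_\pi^{as}(hg)$ for all $g,h\in B$; (iii) $\chi_\pi^{as}$ is an indecomposable character, i.e. $\chi_\pi^{as}=\chi_{\alpha\beta\gamma}^{\sigma}$ for some parameters $\alpha,\beta,\gamma,\sigma$.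
   Context: The group $B$. $\mathfrak{S}_\infty$ is the group of finitely supported permutations of $\mathbb{N}=\{1,2,\dots\}$; ${}_0\mathbb{Z}_2^\infty$ is the group of finitely supported sequences $z=(z_1,z_2,\dots)$ with $z_i\in\mathbb{Z}_2=\{0,1\}$. $B={}_0\mathbb{Z}_2^\infty\rtimes\mathfrak{S}_\infty$ with $(z,s)(z',s')=(z+sz',ss')$, $(sz)_i=z_{s^{-1}(i)}$; both factors are regarded as subgroups of $B$. For $b=sz$ put ${\rm supp}\,b=\{k: s(k)\ne k \text{ or } z_k\neq 0\}$, and $B_{n\infty}=\{b\in B:{\rm supp}\,b\subset\{n+1,n+2,\dots\}\}$. Stability. For a countable group $G$, give ${\rm Aut}\,G$ the topology whose neighbourhoods of the identity are generated (by finite intersections) by the sets $\mathfrak{U}_g=\{\theta:\theta(g)=g\}$, $g\in G$; ${\rm Ad}\,G$ is the subgroup of inner automorphisms with the induced topology. A unitary representation $\pi$ of $G$ on $\mathcal{H}$ is stable if for every $\eta\in\mathcal{H}$ the functional $\omega_\eta(a)=(\pi(a)\eta,\eta)$ on $C^*[G]$ is such that ${\rm Ad}\,G\ni\theta\mapsto\omega_\eta\circ\theta\in C^*[G]^*$ is continuous for the norm topology of the dual. It is a factor-representation if $\pi(G)''$ is a factor. Characters $\chi_{\alpha\beta\gamma}^\sigma$. Here $\alpha=(\alpha_1\ge\alpha_2\ge\dots>0)$ and $\beta=(\beta_1\ge\beta_2\ge\dots>0)$ are finite, infinite or empty sequences with $\sum\alpha_i+\sum\beta_i\le1$, $\sigma$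 assigns to each entry $\alpha_i$, $\beta_i$ a value in $\{0,1\}$, and $\gamma=(\gamma_0,\gamma_1)$ with $\gamma_0,\gamma_1\ge0$, $\gamma_0+\gamma_1=1-\sum\alpha_i-\sum\beta_i$. For $g=sz$ with $s=c_1\cdots c_l$ a product of disjoint nontrivial cycles, $\chi_{\alpha\beta\gamma}^\sigma(sz)=\prod_{j=1}^l\chi_{\alpha\beta\gamma}^\sigma(c_j\,{}^jz)\cdot\prod_{i\notin{\rm supp}\,s}\chi_{\alpha\beta\gamma}^\sigma(z_i^{(i)})$, where ${}^jz$ agrees with $z$ on ${\rm supp}\,c_j$ and is $0$ elsewhere, and $\zeta^{(i)}$ denotes the sequence with entry $\zeta$ at place $i$ and $0$ elsewhere. For a cycle $c$ of length $k>1$ and $z$ supported in ${\rm supp}\,c$, $\chi_{\alpha\beta\gamma}^\sigma(cz)=\sum_i\alpha_i^k(-1)^{\sigma(\alpha_i)\sum_j z_j}+(-1)^{k-1}\sum_i\beta_i^k(-1)^{\sigma(\beta_i)\sum_j z_j}$; and $\chi_{\alpha\beta\gamma}^\sigma(\zeta^{(i)})=\gamma_0+\gamma_1(-1)^{\zeta}+\sum_j\alpha_j(-1)^{\sigma(\alpha_j)\zeta}+\sum_j\beta_j(-1)^{\sigma(\beta_j)\zeta}$. *)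

theory Defs
  imports
    "HOL-Analysis.Analysis"
    "HOL-Algebra.Bij"
    "HOL-Algebra.Coset"
    "HOL-Combinatorics.Orbits"
    "HOL-Library.Nonpos_Ints"
    "HOL-Library.Z2"
begin

section \<open>Complex Hilbert spaces and operators\<close>

class complex_hilbert = banach +
  fixes scaleC :: "complex \<Rightarrow> 'a \<Rightarrow> 'a"  (infixr "*\<^sub>C" 75)
    and cinner :: "'a \<Rightarrow> 'a \<Rightarrow> complex"
  assumes scaleC_add_right: "c *\<^sub>C (x + y) = c *\<^sub>C x + c *\<^sub>C y"
    and scaleC_add_left: "(c + d) *\<^sub>C x = c *\<^sub>C x + d *\<^sub>C x"
    and scaleC_scaleC: "c *\<^sub>C (d *\<^sub>C x) = (c * d) *\<^sub>C x"
    and scaleC_of_real: "complex_of_real r *\<^sub>C x = r *\<^sub>R x"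
    and cinner_add_left: "cinner (x + y) z = cinner x z + cinner y z"
    and cinner_scaleC_left: "cinner (c *\<^sub>C x) y = c * cinner x y"
    and cinner_commute: "cinner x y = cnj (cinner y x)"
    and cinner_ge_zero: "0 \<le> Re (cinner x x)"
    and norm_eq_sqrt_cinner: "norm x = sqrt (Re (cinner x x))"

instantiation complex :: complex_hilbert
begin

definition scaleC_complex :: "complex \<Rightarrow> complex \<Rightarrow> complex"
  where "scaleC_complex c x = c * x"

definition cinner_complex :: "complex \<Rightarrow> complex \<Rightarrow> complex"
  where "cinner_complex x y = x * cnj y"

instance
proof
  fix x :: complex
  show "norm x = sqrt (Re (cinner x x))"
    by (simp add: cinner_complex_def complex_mult_cnj cmod_def)
qed (simp_all add: scaleC_complex_def cinner_complex_def distrib_left distrib_right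
    mult.assoc scaleR_conv_of_real)

end

definition bounded_clinear :: "('h::complex_hilbert \<Rightarrow> 'h) \<Rightarrow> bool"
  where "bounded_clinear T \<longleftrightarrow> bounded_linear T \<and> (\<forall>c x. T (c *\<^sub>C x) = c *\<^sub>C T x)"

definition unitary_op :: "('h::complex_hilbert \<Rightarrow> 'h) \<Rightarrow> bool"
  where "unitary_op U \<longleftrightarrow>
    bounded_clinear U \<and> surj U \<and> (\<forall>x y. cinner (U x) (U y) = cinner x y)"

definition wot_limit :: "(nat \<Rightarrow> 'h::complex_hilbert \<Rightarrow> 'h) \<Rightarrow> ('h \<Rightarrow> 'h) \<Rightarrow> bool"
  where "wot_limit T L \<longleftrightarrow>
    (\<forall>\<xi> \<eta>. (\<lambda>n. cinner (T n \<xi>) \<eta>) \<longlonglongrightarrow> cinner (L \<xi>) \<eta>)"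

definition commutant :: "('h::complex_hilbert \<Rightarrow> 'h) set \<Rightarrow> ('h \<Rightarrow> 'h) set"
  where "commutant S = {T. bounded_clinear T \<and> (\<forall>A\<in>S. T \<circ> A = A \<circ> T)}"

text \<open>The condition \<open>id \<noteq> (\<lambda>x. 0)\<close> excludes the zero Hilbert space.\<close>

definition is_factor :: "('h::complex_hilbert \<Rightarrow> 'h) set \<Rightarrow> bool"
  where "is_factor M \<longleftrightarrow>
    commutant (commutant M) = M \<and> M \<inter> commutant M = range (\<lambda>c x. c *\<^sub>C x) \<and>
    (id :: 'h \<Rightarrow> 'h) \<noteq> (\<lambda>x. 0)"


section \<open>Unitary representations, group algebras and stability\<close>

definition unitary_rep :: "('g, 'm) monoid_scheme \<Rightarrow> ('g \<Rightarrow> 'h::complex_hilbert \<Rightarrow> 'h) \<Rightarrow> bool"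
  where "unitary_rep G \<pi> \<longleftrightarrow>
    (\<forall>g\<in>carrier G. unitary_op (\<pi> g)) \<and>
    (\<forall>g\<in>carrier G. \<forall>h\<in>carrier G. \<pi> (g \<otimes>\<^bsub>G\<^esub> h) = \<pi> g \<circ> \<pi> h)"

definition factor_rep :: "('g, 'm) monoid_scheme \<Rightarrow> ('g \<Rightarrow> 'h::complex_hilbert \<Rightarrow> 'h) \<Rightarrow> bool"
  where "factor_rep G \<pi> \<longleftrightarrow>
    unitary_rep G \<pi> \<and> is_factor (commutant (commutant (\<pi> ` carrier G)))"

text \<open>The complex group algebra, as finitely supported functions, with convolution and involution.\<close>

definition group_alg :: "('g, 'm) monoid_scheme \<Rightarrow> ('g \<Rightarrow> complex) set"
  where "group_alg G = {a. finite {g. a g \<noteq> 0} \<and> {g. a g \<noteq> 0} \<subseteq> carrier G}"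

definition alg_mult ::
    "('g, 'm) monoid_scheme \<Rightarrow> ('g \<Rightarrow> complex) \<Rightarrow> ('g \<Rightarrow> complex) \<Rightarrow> 'g \<Rightarrow> complex"
  where "alg_mult G a b =
    (\<lambda>x. if x \<in> carrier G then \<Sum>g | a g \<noteq> 0. a g * b (inv\<^bsub>G\<^esub> g \<otimes>\<^bsub>G\<^esub> x) else 0)"

definition alg_star :: "('g, 'm) monoid_scheme \<Rightarrow> ('g \<Rightarrow> complex) \<Rightarrow> 'g \<Rightarrow> complex"
  where "alg_star G a = (\<lambda>x. if x \<in> carrier G then cnj (a (inv\<^bsub>G\<^esub> x)) else 0)"

definition cstar_seminorm :: "('g, 'm) monoid_scheme \<Rightarrow> (('g \<Rightarrow> complex) \<Rightarrow> real) \<Rightarrow> bool"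
  where "cstar_seminorm G p \<longleftrightarrow>
    (\<forall>a\<in>group_alg G. 0 \<le> p a) \<and>
    (\<forall>a\<in>group_alg G. \<forall>b\<in>group_alg G. p (\<lambda>g. a g + b g) \<le> p a + p b) \<and>
    (\<forall>a\<in>group_alg G. \<forall>c. p (\<lambda>g. c * a g) = cmod c * p a) \<and>
    (\<forall>a\<in>group_alg G. \<forall>b\<in>group_alg G. p (alg_mult G a b) \<le> p a * p b) \<and>
    (\<forall>a\<in>group_alg G. p (alg_mult G (alg_star G a) a) = (p a)\<^sup>2)"

text \<open>
  The norm of the full group \<open>C\<^sup>*\<close>-algebra \<open>C\<^sup>*[G]\<close>, which is the completion of the group algebra
  with respect to its greatest \<open>C\<^sup>*\<close>-seminorm. This is the supremum of the operator norms
  over all unitary representations of \<open>G\<close>, which range over arbitrary Hilbert spaces and hence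
  over arbitrary types. The supremum is of a bounded set by \<open>cstar_seminorm_bound\<close> below.
\<close>

definition cstar_norm :: "('g, 'm) monoid_scheme \<Rightarrow> ('g \<Rightarrow> complex) \<Rightarrow> real"
  where "cstar_norm G a = (SUP p\<in>{p. cstar_seminorm G p}. p a)"

text \<open>
  The norm of \<open>C\<^sup>*[G]\<^sup>*\<close>. A bounded functional on \<open>C\<^sup>*[G]\<close> is given by its restriction to the
  dense subalgebra \<open>group_alg G\<close>, and its norm is the supremum over the unit ball of the latter.
\<close>

definition cstar_dual_norm ::
    "('g, 'm) monoid_scheme \<Rightarrow> (('g \<Rightarrow> complex) \<Rightarrow> complex) \<Rightarrow> real"
  where "cstar_dual_norm G f =
    (SUP a\<in>{a\<in>group_alg G. cstar_norm G a \<le> 1}. cmod (f a))"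

definition alg_rep ::
    "('g \<Rightarrow> 'h::complex_hilbert \<Rightarrow> 'h) \<Rightarrow> ('g \<Rightarrow> complex) \<Rightarrow> 'h \<Rightarrow> 'h"
  where "alg_rep \<pi> a = (\<lambda>\<xi>. \<Sum>g | a g \<noteq> 0. a g *\<^sub>C \<pi> g \<xi>)"

definition vector_functional ::
    "('g \<Rightarrow> 'h::complex_hilbert \<Rightarrow> 'h) \<Rightarrow> 'h \<Rightarrow> ('g \<Rightarrow> complex) \<Rightarrow> complex"
  where "vector_functional \<pi> \<eta> a = cinner (alg_rep \<pi> a \<eta>) \<eta>"

text \<open>The action of an automorphism on the group algebra, sending \<open>\<Sum> a\<^sub>g g\<close> to \<open>\<Sum> a\<^sub>g \<theta>(g)\<close>.\<close>

definition alg_map :: "('g \<Rightarrow> 'g) \<Rightarrow> ('g \<Rightarrow> complex) \<Rightarrow> 'g \<Rightarrow> complex"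
  where "alg_map \<theta> a = (\<lambda>h. \<Sum>g | a g \<noteq> 0 \<and> \<theta> g = h. a g)"

definition fixing_nbhd :: "('g, 'm) monoid_scheme \<Rightarrow> 'g \<Rightarrow> ('g \<Rightarrow> 'g) set"
  where "fixing_nbhd G g = {\<theta>\<in>auto G. \<theta> g = g}"

text \<open>
  The group topology on \<open>auto G\<close> for which the sets \<open>fixing_nbhd G g\<close> form a subbase of
  neighbourhoods of the identity: their left translates form a subbase.
\<close>

definition aut_topology :: "('g, 'm) monoid_scheme \<Rightarrow> ('g \<Rightarrow> 'g) topology"
  where "aut_topology G = topology_generated_by
    {\<theta> <#\<^bsub>AutoGroup G\<^esub> fixing_nbhd G g |\<theta> g. \<theta> \<in> auto G \<and> g \<in> carrier G}"

definition inner_autos :: "('g, 'm) monoid_scheme \<Rightarrow> ('g \<Rightarrow> 'g) set"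
  where "inner_autos G =
    {\<lambda>x\<in>carrier G. h \<otimes>\<^bsub>G\<^esub> x \<otimes>\<^bsub>G\<^esub> inv\<^bsub>G\<^esub> h |h. h \<in> carrier G}"

definition stable_rep :: "('g, 'm) monoid_scheme \<Rightarrow> ('g \<Rightarrow> 'h::complex_hilbert \<Rightarrow> 'h) \<Rightarrow> bool"
  where "stable_rep G \<pi> \<longleftrightarrow> unitary_rep G \<pi> \<and>
    (\<forall>\<eta>. \<forall>\<theta>\<^sub>0\<in>inner_autos G. \<forall>\<epsilon>>0.
      \<exists>U. openin (subtopology (aut_topology G) (inner_autos G)) U \<and> \<theta>\<^sub>0 \<in> U \<and>
        (\<forall>\<theta>\<in>U. cstar_dual_norm G
          (\<lambda>a. vector_functional \<pi> \<eta> (alg_map \<theta> a) - vector_functional \<pi> \<eta> (alg_map \<theta>\<^sub>0 a)) < \<epsilon>))"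


section \<open>Characters\<close>

definition positive_definite :: "('g, 'm) monoid_scheme \<Rightarrow> ('g \<Rightarrow> complex) \<Rightarrow> bool"
  where "positive_definite G \<phi> \<longleftrightarrow>
    (\<forall>S c. finite S \<and> S \<subseteq> carrier G \<longrightarrow>
      (\<Sum>g\<in>S. \<Sum>h\<in>S. cnj (c g) * c h * \<phi> (inv\<^bsub>G\<^esub> g \<otimes>\<^bsub>G\<^esub> h)) \<in> \<real>\<^sub>\<ge>\<^sub>0)"

definition central_function :: "('g, 'm) monoid_scheme \<Rightarrow> ('g \<Rightarrow> complex) \<Rightarrow> bool"
  where "central_function G \<phi> \<longleftrightarrow>
    (\<forall>g\<in>carrier G. \<forall>h\<in>carrier G. \<phi> (g \<otimes>\<^bsub>G\<^esub> h) = \<phi> (h \<otimes>\<^bsub>G\<^esub> g))"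

definition group_character :: "('g, 'm) monoid_scheme \<Rightarrow> ('g \<Rightarrow> complex) \<Rightarrow> bool"
  where "group_character G \<phi> \<longleftrightarrow>
    positive_definite G \<phi> \<and> central_function G \<phi> \<and> \<phi> \<one>\<^bsub>G\<^esub> = 1"

definition indecomposable_character :: "('g, 'm) monoid_scheme \<Rightarrow> ('g \<Rightarrow> complex) \<Rightarrow> bool"
  where "indecomposable_character G chi \<longleftrightarrow> group_character G chi \<and>
    (\<forall>\<phi> \<psi>. \<forall>t::real. group_character G \<phi> \<and> group_character G \<psi> \<and> 0 < t \<and> t < 1 \<and>
      (\<forall>g\<in>carrier G. chi g = of_real t * \<phi> g + of_real (1 - t) * \<psi> g) \<longrightarrow>
      (\<forall>g\<in>carrier G. \<phi> g = chi g \<and> \<psi> g = chi g))"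

definition conj_class :: "('g, 'm) monoid_scheme \<Rightarrow> 'g \<Rightarrow> 'g set"
  where "conj_class G g = {h \<otimes>\<^bsub>G\<^esub> g \<otimes>\<^bsub>G\<^esub> inv\<^bsub>G\<^esub> h |h. h \<in> carrier G}"


section \<open>The infinite hyperoctahedral group\<close>

text \<open>
  The index set is \<open>{1..}\<close>; permutations fix \<open>0\<close> and sequences vanish at \<open>0\<close>.
\<close>

definition B_grp :: "((nat \<Rightarrow> bit) \<times> (nat \<Rightarrow> nat)) monoid"
  where "B_grp =
    \<lparr>carrier = {(z, s). finite {i. z i \<noteq> 0} \<and> z 0 = 0 \<and> s permutes {1..} \<and> finite {i. s i \<noteq> i}},
     mult = (\<lambda>(z, s) (z', s'). (\<lambda>i. z i + z' (inv_into UNIV s i), s \<circ> s')),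
     one = (\<lambda>i. 0, id)\<rparr>"

text \<open>
  The factors in \<open>b = sz\<close>, with \<open>s\<close> and \<open>z\<close> regarded as elements of \<open>B\<close>. As \<open>sz\<close> is the pair
  with first component \<open>i \<mapsto> z (s\<^sup>-\<^sup>1 i)\<close>, the factor \<open>z\<close> of the pair \<open>(w, s)\<close> is \<open>i \<mapsto> w (s i)\<close>;
  see \<open>B_factorization\<close> below.
\<close>

definition perm_part :: "(nat \<Rightarrow> bit) \<times> (nat \<Rightarrow> nat) \<Rightarrow> nat \<Rightarrow> nat"
  where "perm_part b = snd b"

definition seq_part :: "(nat \<Rightarrow> bit) \<times> (nat \<Rightarrow> nat) \<Rightarrow> nat \<Rightarrow> bit"
  where "seq_part b = (\<lambda>i. fst b (snd b i))"

definition B_supp :: "(nat \<Rightarrow> bit) \<times> (nat \<Rightarrow> nat) \<Rightarrow> nat set"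
  where "B_supp b = {k. perm_part b k \<noteq> k \<or> seq_part b k \<noteq> 0}"

definition B_tail :: "nat \<Rightarrow> ((nat \<Rightarrow> bit) \<times> (nat \<Rightarrow> nat)) set"
  where "B_tail n = {b\<in>carrier B_grp. B_supp b \<subseteq> {n+1..}}"

definition Cl_tail ::
    "nat \<Rightarrow> (nat \<Rightarrow> bit) \<times> (nat \<Rightarrow> nat) \<Rightarrow> ((nat \<Rightarrow> bit) \<times> (nat \<Rightarrow> nat)) set"
  where "Cl_tail n g = conj_class B_grp g \<inter> B_tail n"


section \<open>The characters $\chi_{\alpha\beta\gamma}^{\sigma}$\<close>

text \<open>
  Finite and empty sequences of positive numbers are padded with zeros, so the entries of the
  sequence \<open>\<alpha>\<close> are the \<open>\<alpha> i\<close> with \<open>\<alpha> i > 0\<close>. Padding does not contribute to any of the sums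
  below, for any value of the sign there. The function \<open>\<sigma>\<close> is split into its restrictions
  \<open>\<sigma>\<alpha>\<close> and \<open>\<sigma>\<beta>\<close> to the entries of \<open>\<alpha>\<close> and of \<open>\<beta>\<close>, indexed by position.
\<close>

definition thoma_params ::
    "(nat \<Rightarrow> real) \<Rightarrow> (nat \<Rightarrow> real) \<Rightarrow> real \<Rightarrow> real \<Rightarrow> bool"
  where "thoma_params \<alpha> \<beta> \<gamma>0 \<gamma>1 \<longleftrightarrow>
    decseq \<alpha> \<and> (\<forall>i. 0 \<le> \<alpha> i) \<and> summable \<alpha> \<and>
    decseq \<beta> \<and> (\<forall>i. 0 \<le> \<beta> i) \<and> summable \<beta> \<and>
    (\<Sum>i. \<alpha> i) + (\<Sum>i. \<beta> i) \<le> 1 \<and>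
    0 \<le> \<gamma>0 \<and> 0 \<le> \<gamma>1 \<and> \<gamma>0 + \<gamma>1 = 1 - (\<Sum>i. \<alpha> i) - (\<Sum>i. \<beta> i)"

definition bit_sign :: "bit \<Rightarrow> real"
  where "bit_sign b = (if b = 0 then 1 else - 1)"

text \<open>The value on \<open>cz\<close> for a cycle \<open>c\<close> of length \<open>k\<close>, where \<open>\<zeta>\<close> is the sum of the \<open>z j\<close>.\<close>

definition cycle_value ::
    "(nat \<Rightarrow> real) \<Rightarrow> (nat \<Rightarrow> real) \<Rightarrow> (nat \<Rightarrow> bit) \<Rightarrow> (nat \<Rightarrow> bit) \<Rightarrow> nat \<Rightarrow> bit \<Rightarrow> real"
  where "cycle_value \<alpha> \<beta> \<sigma>\<alpha> \<sigma>\<beta> k \<zeta> =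
    (\<Sum>i. \<alpha> i ^ k * bit_sign (\<sigma>\<alpha> i * \<zeta>)) +
    (- 1) ^ (k - 1) * (\<Sum>i. \<beta> i ^ k * bit_sign (\<sigma>\<beta> i * \<zeta>))"

definition point_value ::
    "(nat \<Rightarrow> real) \<Rightarrow> (nat \<Rightarrow> real) \<Rightarrow> real \<Rightarrow> real \<Rightarrow> (nat \<Rightarrow> bit) \<Rightarrow> (nat \<Rightarrow> bit) \<Rightarrow> bit \<Rightarrow> real"
  where "point_value \<alpha> \<beta> \<gamma>0 \<gamma>1 \<sigma>\<alpha> \<sigma>\<beta> \<zeta> =
    \<gamma>0 + \<gamma>1 * bit_sign \<zeta> +
    (\<Sum>i. \<alpha> i * bit_sign (\<sigma>\<alpha> i * \<zeta>)) + (\<Sum>i. \<beta> i * bit_sign (\<sigma>\<beta> i * \<zeta>))"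

definition cycle_supports :: "(nat \<Rightarrow> nat) \<Rightarrow> nat set set"
  where "cycle_supports s = {orbit s i |i. s i \<noteq> i}"

text \<open>
  The product over the fixed points of \<open>s\<close> is restricted to those with \<open>z i \<noteq> 0\<close>, which are
  finitely many: \<open>point_value\<close> is \<open>1\<close> at \<open>0\<close> by \<open>point_value_zero\<close> below.
\<close>

definition thoma_character ::
    "(nat \<Rightarrow> real) \<Rightarrow> (nat \<Rightarrow> real) \<Rightarrow> real \<Rightarrow> real \<Rightarrow> (nat \<Rightarrow> bit) \<Rightarrow> (nat \<Rightarrow> bit) \<Rightarrow>
      (nat \<Rightarrow> bit) \<times> (nat \<Rightarrow> nat) \<Rightarrow> real"
  where "thoma_character \<alpha> \<beta> \<gamma>0 \<gamma>1 \<sigma>\<alpha> \<sigma>\<beta> g =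
    (\<Prod>C\<in>cycle_supports (perm_part g).
      cycle_value \<alpha> \<beta> \<sigma>\<alpha> \<sigma>\<beta> (card C) (\<Sum>j\<in>C. seq_part g j)) *
    (\<Prod>i | perm_part g i = i \<and> seq_part g i \<noteq> 0.
      point_value \<alpha> \<beta> \<gamma>0 \<gamma>1 \<sigma>\<alpha> \<sigma>\<beta> (seq_part g i))"


section \<open>Basic facts\<close>

lemma point_value_zero:
  assumes "thoma_params \<alpha> \<beta> \<gamma>0 \<gamma>1"
  shows "point_value \<alpha> \<beta> \<gamma>0 \<gamma>1 \<sigma>\<alpha> \<sigma>\<beta> 0 = 1"
  using assms by (simp add: thoma_params_def point_value_def bit_sign_def)

lemma group_B_grp: "group B_grp"
proof (rule groupI)
  fix x y assume "x \<in> carrier B_grp" "y \<in> carrier B_grp"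
  then obtain z s z' s' where xy: "x = (z, s)" "y = (z', s')"
    and fin: "finite {i. z i \<noteq> 0}" "finite {i. z' i \<noteq> 0}" "finite {i. s i \<noteq> i}" "finite {i. s' i \<noteq> i}"
    and 0: "z 0 = 0" "z' 0 = 0" and p: "s permutes {1..}" "s' permutes {1..}"
    by (auto simp: B_grp_def)
  have "{i. z i + z' (inv_into UNIV s i) \<noteq> 0} \<subseteq> {i. z i \<noteq> 0} \<union> s ` {i. z' i \<noteq> 0}"
  proof
    fix i assume "i \<in> {i. z i + z' (inv_into UNIV s i) \<noteq> 0}"
    then have "z i \<noteq> 0 \<or> z' (inv_into UNIV s i) \<noteq> 0"
      by (cases "z i") auto
    moreover have "i = s (inv_into UNIV s i)"
      using permutes_inverses(1)[OF p(1)] by simp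
    ultimately show "i \<in> {i. z i \<noteq> 0} \<union> s ` {i. z' i \<noteq> 0}"
      by blast
  qed
  then have "finite {i. z i + z' (inv_into UNIV s i) \<noteq> 0}"
    by (rule finite_subset) (use fin in auto)
  moreover have "{i. s (s' i) \<noteq> i} \<subseteq> {i. s i \<noteq> i} \<union> {i. s' i \<noteq> i}" by auto
  then have "finite {i. s (s' i) \<noteq> i}"
    by (rule finite_subset) (use fin in auto)
  moreover have "inv_into UNIV s 0 = 0"
    using permutes_inv[OF p(1)] by (simp add: permutes_def)
  ultimately show "x \<otimes>\<^bsub>B_grp\<^esub> y \<in> carrier B_grp"
    using 0 permutes_compose[OF p(2) p(1)] by (simp add: xy B_grp_def)
next
  show "\<one>\<^bsub>B_grp\<^esub> \<in> carrier B_grp"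
    by (simp add: B_grp_def permutes_id)
next
  fix x y w assume "x \<in> carrier B_grp" "y \<in> carrier B_grp" "w \<in> carrier B_grp"
  then obtain z s z' s' z'' s'' where xyw: "x = (z, s)" "y = (z', s')" "w = (z'', s'')"
    and p: "s permutes {1..}" "s' permutes {1..}"
    by (auto simp: B_grp_def)
  have "inv_into UNIV (s \<circ> s') = inv_into UNIV s' \<circ> inv_into UNIV s"
    by (rule o_inv_distrib[OF permutes_bij[OF p(1)] permutes_bij[OF p(2)]])
  then show "x \<otimes>\<^bsub>B_grp\<^esub> y \<otimes>\<^bsub>B_grp\<^esub> w = x \<otimes>\<^bsub>B_grp\<^esub> (y \<otimes>\<^bsub>B_grp\<^esub> w)"
    by (simp only: xyw B_grp_def monoid.simps partial_object.simps prod.case comp_apply add.assoc o_assoc)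
next
  fix x assume "x \<in> carrier B_grp"
  then show "\<one>\<^bsub>B_grp\<^esub> \<otimes>\<^bsub>B_grp\<^esub> x = x"
    by (cases x) (simp only: B_grp_def monoid.simps partial_object.simps prod.case inv_id id_apply add_0_left id_comp)
next
  fix x assume "x \<in> carrier B_grp"
  then obtain z s where x: "x = (z, s)"
    and fin: "finite {i. z i \<noteq> 0}" "finite {i. s i \<noteq> i}"
    and 0: "z 0 = 0" and p: "s permutes {1..}"
    by (auto simp: B_grp_def)
  let ?t = "inv_into UNIV s"
  let ?y = "(\<lambda>i. z (s i), ?t)"
  have "{i. z (s i) \<noteq> 0} \<subseteq> ?t ` {i. z i \<noteq> 0}"
  proof
    fix i assume "i \<in> {i. z (s i) \<noteq> 0}"
    moreover have "i = ?t (s i)"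
      using permutes_inverses(2)[OF p] by simp
    ultimately show "i \<in> ?t ` {i. z i \<noteq> 0}"
      by blast
  qed
  then have "finite {i. z (s i) \<noteq> 0}"
    by (rule finite_subset) (use fin in auto)
  moreover have "{i. ?t i \<noteq> i} = {i. s i \<noteq> i}"
    using permutes_inverses(2)[OF p] permutes_inv_eq[OF p] by auto
  moreover have "s 0 = 0" using p by (simp add: permutes_def)
  ultimately have "?y \<in> carrier B_grp"
    using 0 fin permutes_inv[OF p] by (simp add: B_grp_def)
  moreover have "?y \<otimes>\<^bsub>B_grp\<^esub> x = \<one>\<^bsub>B_grp\<^esub>"
    by (auto simp: x B_grp_def permutes_inv_inv[OF p] permutes_inv_o[OF p] fun_eq_iff)
  ultimately show "\<exists>y\<in>carrier B_grp. y \<otimes>\<^bsub>B_grp\<^esub> x = \<one>\<^bsub>B_grp\<^esub>"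
    by blast
qed

lemma B_factorization:
  assumes "b \<in> carrier B_grp"
  shows "b = (\<lambda>i. 0, perm_part b) \<otimes>\<^bsub>B_grp\<^esub> (seq_part b, id)"
  using assms by (auto simp: B_grp_def perm_part_def seq_part_def permutes_inverses)

lemma Cl_tail_nonempty:
  assumes "g \<in> carrier B_grp"
  shows "Cl_tail n g \<noteq> {}"
proof -
  interpret group B_grp by (rule group_B_grp)
  obtain z s where g: "g = (z, s)"
    and fin: "finite {i. z i \<noteq> 0}" "finite {i. s i \<noteq> i}"
    and 0: "z 0 = 0" and p: "s permutes {1..}"
    using assms by (auto simp: B_grp_def)
  obtain N where N: "\<And>i. i > N \<Longrightarrow> z i = 0 \<and> s i = i"
  proof -
    have "finite ({i. z i \<noteq> 0} \<union> {i. s i \<noteq> i})" using fin by simp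
    then obtain N where "\<forall>i\<in>{i. z i \<noteq> 0} \<union> {i. s i \<noteq> i}. i \<le> N"
      using finite_nat_set_iff_bounded_le by meson
    then show thesis by (intro that[of N]) (meson UnI1 UnI2 leD mem_Collect_eq)
  qed
  define M where "M = N + n"
  define q where "q i = (if i = 0 then 0 else if i \<le> M then i + M
      else if i \<le> 2 * M then i - M else i)" for i :: nat
  have qq: "q (q i) = i" for i by (auto simp: q_def)
  have qinv: "inv_into UNIV q = q"
    using qq by (intro Hilbert_Choice.inv_equality) auto
  have "bij q" by (rule o_bij[of q]) (use qq in auto)
  have q0: "q 0 = 0" by (simp add: q_def)
  have "q permutes {1..}"
    unfolding permutes_def using q0 qq by (auto simp: not_le intro!: ex1I[of _ "q _"])
  moreover have "{i. q i \<noteq> i} \<subseteq> {..2 * M}" by (auto simp: q_def)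
  then have "finite {i. q i \<noteq> i}" by (rule finite_subset) simp
  ultimately have h: "(\<lambda>i. 0, q) \<in> carrier B_grp" by (simp add: B_grp_def)
  have "(\<lambda>i. 0, q) \<otimes>\<^bsub>B_grp\<^esub> (\<lambda>i. 0, q) = \<one>\<^bsub>B_grp\<^esub>"
    using qq by (auto simp: B_grp_def fun_eq_iff)
  then have hinv: "inv\<^bsub>B_grp\<^esub> (\<lambda>i. 0, q) = (\<lambda>i. 0, q)"
    using h by (simp add: inv_equality)
  let ?c = "(\<lambda>i. 0, q) \<otimes>\<^bsub>B_grp\<^esub> g \<otimes>\<^bsub>B_grp\<^esub> inv\<^bsub>B_grp\<^esub> (\<lambda>i. 0, q)"
  have c: "?c = (\<lambda>i. z (q i), \<lambda>i. q (s (q i)))"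
    unfolding hinv by (auto simp: g B_grp_def qinv fun_eq_iff)
  have "k \<notin> B_supp ?c" if "k \<le> n" for k
  proof (cases "k = 0")
    case True
    have "s 0 = 0" using p by (simp add: permutes_def)
    then show ?thesis
      by (simp add: c B_supp_def perm_part_def seq_part_def True q0 0)
  next
    case False
    then have "q k > N" using that by (auto simp: q_def M_def)
    then show ?thesis
      using N[of "q k"] by (simp add: c B_supp_def perm_part_def seq_part_def qq)
  qed
  then have "B_supp ?c \<subseteq> {n+1..}" by (metis Suc_eq_plus1 atLeast_iff not_less_eq_eq subsetI)
  moreover have "?c \<in> carrier B_grp" using h assms by simp
  ultimately have "?c \<in> Cl_tail n g"
    using h by (auto simp: Cl_tail_def B_tail_def conj_class_def)
  then show ?thesis by blast
qed

lemma cstar_seminorm_bound: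
  assumes "group G" "cstar_seminorm G p" "a \<in> group_alg G"
  shows "p a \<le> (\<Sum>g | a g \<noteq> 0. cmod (a g))"
proof -
  interpret group G by fact
  define \<delta> :: "'a \<Rightarrow> 'a \<Rightarrow> complex" where "\<delta> g = (\<lambda>x. if x = g then 1 else 0)" for g
  have \<delta>: "\<delta> g \<in> group_alg G" if "g \<in> carrier G" for g
    using that by (auto simp: group_alg_def \<delta>_def)
  have \<delta>2: "alg_mult G (alg_star G (\<delta> g)) (\<delta> g) = \<delta> \<one>\<^bsub>G\<^esub>" if g: "g \<in> carrier G" for g
  proof
    fix x
    have *: "alg_star G (\<delta> g) = \<delta> (inv\<^bsub>G\<^esub> g)"
      using g by (auto simp: alg_star_def \<delta>_def fun_eq_iff)
    have "{y. \<delta> (inv\<^bsub>G\<^esub> g) y \<noteq> 0} = {inv\<^bsub>G\<^esub> g}" by (auto simp: \<delta>_def)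
    then show "alg_mult G (alg_star G (\<delta> g)) (\<delta> g) x = \<delta> \<one>\<^bsub>G\<^esub> x"
      using g unfolding alg_mult_def * by (auto simp: \<delta>_def)
  qed
  have pow: "p (\<delta> \<one>\<^bsub>G\<^esub>) = (p (\<delta> g))\<^sup>2" "0 \<le> p (\<delta> g)" if "g \<in> carrier G" for g
    using assms(2) \<delta>[OF that] unfolding cstar_seminorm_def \<delta>2[OF that, symmetric]
    by blast+
  have "p (\<delta> \<one>\<^bsub>G\<^esub>) \<le> 1"
    using pow[OF one_closed]
    by (metis mult_cancel_left1 order_refl power2_eq_square zero_le_one)
  then have \<delta>1: "p (\<delta> g) \<le> 1" if "g \<in> carrier G" for g
    using pow[OF that] by (metis power2_le_imp_le one_power2 zero_le_one)
  have zero: "(\<lambda>x. 0) \<in> group_alg G" by (simp add: group_alg_def)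
  have hom: "p (\<lambda>g. c * b g) = cmod c * p b" if "b \<in> group_alg G" for b c
    using assms(2) that unfolding cstar_seminorm_def by blast
  from hom[OF zero, of 0] have p0: "p (\<lambda>x. 0) = 0" by simp
  have "p (\<lambda>x. if x \<in> S then a x else 0) \<le> (\<Sum>g\<in>S. cmod (a g))"
    if "finite S" "S \<subseteq> carrier G" for S
    using that
  proof (induction S)
    case empty
    then show ?case using p0 by simp
  next
    case (insert g S)
    let ?b = "\<lambda>x. if x \<in> S then a x else 0" and ?d = "\<lambda>x. a g * \<delta> g x"
    have d: "?d \<in> group_alg G" using insert.prems by (auto simp: group_alg_def \<delta>_def)
    have "{x. ?b x \<noteq> 0} \<subseteq> S" by auto
    then have b: "?b \<in> group_alg G"
      using insert.prems insert.hyps(1) finite_subset by (auto simp: group_alg_def)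
    have "(\<lambda>x. if x \<in> insert g S then a x else 0) = (\<lambda>x. ?d x + ?b x)"
      using insert.hyps by (auto simp: \<delta>_def fun_eq_iff)
    then have "p (\<lambda>x. if x \<in> insert g S then a x else 0) \<le> p ?d + p ?b"
      using assms(2) b d by (simp add: cstar_seminorm_def)
    also have "p ?d = cmod (a g) * p (\<delta> g)"
      using \<delta>[of g] insert.prems by (simp add: hom)
    also have "\<dots> \<le> cmod (a g)"
      using \<delta>1[of g] insert.prems by (simp add: mult_left_le)
    finally show ?case using insert by simp
  qed
  from this[of "{g. a g \<noteq> 0}"]
  have "p (\<lambda>x. if x \<in> {g. a g \<noteq> 0} then a x else 0) \<le> (\<Sum>g | a g \<noteq> 0. cmod (a g))"
    using assms(3) unfolding group_alg_def by blast
  moreover have "(\<lambda>x. if x \<in> {g. a g \<noteq> 0} then a x else 0) = a"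
    by auto
  ultimately show ?thesis by simp
qed

end

theory Submission
  imports
    Defs
    "HOL-Computational_Algebra.Polynomial"
    "HOL-Probability.Helly_Selection"
    "HOL-Real_Asymp.Real_Asymp"
begin

text \<open>
  Stability makes \<open>\<pi>(x) - \<pi>(y)\<close> weakly small for \<open>x\<close>, \<open>y\<close> in \<open>Cl_tail n g\<close>, and the weak limit commutes
  with \<open>\<pi>(B)\<close> and with its commutant, so it is a scalar \<open>\<chi>(g)\<close>. Moving factors far apart gives
  \<open>\<chi>(gh) = \<chi>(g) \<chi>(h)\<close> for disjoint supports, hence \<open>\<chi>\<close> is determined by its values on single cycles.

  Take \<open>m j\<close> to be the even or odd part, with respect to the sign of the cycle, of the values on cycles
  of length \<open>j + 1\<close>. Positive definiteness of \<open>\<chi>\<close> against the one-dimensional characters of the finite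
  hyperoctahedral groups gives positivity of the sums of \<open>\<delta>\<^sup>k\<^sup>-\<^sup>1 m (k - 1)\<close> over permutations, for both
  signs \<open>\<delta>\<close>. So \<open>m\<close> is the moment sequence of a positive measure on \<open>[-1, 1]\<close>, and after replacing letters by
  polynomials the same positivity holds with \<open>\<integral>f\<^sup>k x\<^sup>k\<^sup>-\<^sup>1\<close> instead of \<open>m (k - 1)\<close>, for every \<open>f \<ge> 0\<close>. For
  \<open>f = 1 / \<bar>x\<bar>\<close> on a tail \<open>x \<ge> a\<close> or \<open>x \<le> -a\<close> the sums over permutations are the falling factorials of
  the integral of \<open>1 / \<bar>x\<bar>\<close> over that tail, which is therefore an integer. Thus the measure consists of atoms at points
  \<open>x \<noteq> 0\<close> with mass \<open>\<bar>x\<bar>\<close> times the multiplicity, and an atom at \<open>0\<close>; these are the Thoma parameters.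

  Indecomposability follows since the averages of many conjugates of \<open>g\<close> with disjoint supports have
  square norm tending to \<open>\<bar>\<chi>(g)\<bar>\<^sup>2\<close>. If \<open>\<chi> = t \<phi> + (1 - t) \<psi>\<close>, this dominates \<open>t \<bar>\<phi>(g)\<bar>\<^sup>2 + (1 - t) \<bar>\<psi>(g)\<bar>\<^sup>2\<close>,
  so that \<open>\<phi>(g) = \<psi>(g)\<close> by strict convexity.
\<close>

section \<open>Complex Hilbert spaces\<close>

text \<open>The fresh letters explain the polynomials: a transposition of a letter i with a letter
  far away behaves like a self-adjoint contraction attached to i, and those of different letters
  commute. No such operators are constructed; \<open>X_relabel\<close> and \<open>X_perm\<close>
  express their existence and commutation on the level of class functions, and positivity with the
  bound |m j| <= 1 replaces the spectral theorem. Merging two cycles joins the polynomials q and r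
  of two letters to q r X, the extra X standing for the joining transposition. Hence k letters
  carrying f give f^k x^(k-1), and f = 1/|x| on one half axis makes every cycle value sign^(k-1)
  times one number \<nu>. With \<delta> opposite to the sign of x the sum over n letters is \<nu>
  (\<nu> - 1) ... (\<nu> - n + 1); with equal signs it is a rising factorial, which is nonnegative
  anyway. So each half axis uses its own \<delta>. The moment argument runs over the reals; that
  \<chi> is real comes from a cycle being conjugate to its inverse, with the same flip
  parity.\<close>

lemma scaleC_one [simp]: "1 *\<^sub>C (x::'h::complex_hilbert) = x"
  using scaleC_of_real[of 1 x] by simp

lemma scaleC_zero_left [simp]: "0 *\<^sub>C (x::'h::complex_hilbert) = 0"
  using scaleC_of_real[of 0 x] by simp

lemma scaleC_zero_right [simp]: "c *\<^sub>C (0::'h::complex_hilbert) = 0"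
  using scaleC_add_right[of c 0 "0::'h"] by simp

lemma scaleC_sum_right: "c *\<^sub>C (\<Sum>i\<in>I. f i) = (\<Sum>i\<in>I. c *\<^sub>C (f i::'h::complex_hilbert))"
  by (induction I rule: infinite_finite_induct) (auto simp: scaleC_add_right)

lemma cinner_add_right: "cinner x (y + z) = cinner x y + cinner x (z::'h::complex_hilbert)"
  by (subst (1 2 3) cinner_commute) (simp add: cinner_add_left)

lemma cinner_scaleC_right: "cinner x (c *\<^sub>C y) = cnj c * cinner x (y::'h::complex_hilbert)"
  by (subst (1 2) cinner_commute) (simp add: cinner_scaleC_left)

lemma cinner_zero_left [simp]: "cinner 0 (y::'h::complex_hilbert) = 0"
  using cinner_add_left[of 0 0 y] by simp

lemma cinner_zero_right [simp]: "cinner (y::'h::complex_hilbert) 0 = 0"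
  using cinner_add_right[of y 0 0] by simp

lemma cinner_minus_left: "cinner (- x) (y::'h::complex_hilbert) = - cinner x y"
  using cinner_add_left[of x "-x" y] by (simp add: eq_neg_iff_add_eq_0 add.commute)

lemma cinner_minus_right: "cinner x (- (y::'h::complex_hilbert)) = - cinner x y"
  using cinner_add_right[of x y "-y"] by (simp add: eq_neg_iff_add_eq_0 add.commute)

lemma cinner_diff_left: "cinner (x - y) (z::'h::complex_hilbert) = cinner x z - cinner y z"
  using cinner_add_left[of x "-y" z] by (simp add: cinner_minus_left)

lemma cinner_diff_right: "cinner z (x - (y::'h::complex_hilbert)) = cinner z x - cinner z y"
  using cinner_add_right[of z x "-y"] by (simp add: cinner_minus_right)

lemma cinner_sum_left:
  "cinner (\<Sum>i\<in>I. f i) (y::'h::complex_hilbert) = (\<Sum>i\<in>I. cinner (f i) y)"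
  by (induction I rule: infinite_finite_induct) (auto simp: cinner_add_left)

lemma cinner_sum_right:
  "cinner (y::'h::complex_hilbert) (\<Sum>i\<in>I. f i) = (\<Sum>i\<in>I. cinner y (f i))"
  by (induction I rule: infinite_finite_induct) (auto simp: cinner_add_right)

lemma cinner_self: "cinner x (x::'h::complex_hilbert) = complex_of_real ((norm x)\<^sup>2)"
proof -
  have "Im (cinner x x) = 0" using cinner_commute[of x x] by (simp add: complex_eq_iff)
  moreover have "Re (cinner x x) = (norm x)\<^sup>2"
    by (simp add: norm_eq_sqrt_cinner cinner_ge_zero)
  ultimately show ?thesis by (simp add: complex_eq_iff)
qed

lemma norm_scaleC: "norm (c *\<^sub>C (x::'h::complex_hilbert)) = cmod c * norm x"
proof -
  have "complex_of_real ((norm (c *\<^sub>C x))\<^sup>2) = c * cnj c * complex_of_real ((norm x)\<^sup>2)"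
    by (simp only: cinner_self[symmetric] cinner_scaleC_left cinner_scaleC_right mult.assoc
        mult.left_commute)
  also have "c * cnj c = complex_of_real ((cmod c)\<^sup>2)" by (rule complex_norm_square[symmetric])
  also have "\<dots> * complex_of_real ((norm x)\<^sup>2) = complex_of_real ((cmod c * norm x)\<^sup>2)"
    by (simp only: of_real_mult power_mult_distrib)
  finally have "(norm (c *\<^sub>C x))\<^sup>2 = (cmod c * norm x)\<^sup>2" by (simp only: of_real_eq_iff)
  then show ?thesis by simp
qed

lemma cinner_Cauchy_Schwarz: "cmod (cinner x (y::'h::complex_hilbert)) \<le> norm x * norm y"
proof (cases "y = 0")
  case False
  define c where "c = cinner x y / complex_of_real ((norm y)\<^sup>2)"
  have y: "cinner y y \<noteq> 0" using False by (simp add: cinner_self)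
  have "cinner (x - c *\<^sub>C y) (x - c *\<^sub>C y) = cinner x x - c * cinner y x"
    using y unfolding c_def cinner_self[symmetric]
    by (simp add: cinner_diff_left cinner_diff_right cinner_scaleC_left cinner_scaleC_right
        algebra_simps)
  also have "c * cinner y x = complex_of_real ((cmod (cinner x y))\<^sup>2 / (norm y)\<^sup>2)"
    unfolding c_def of_real_divide complex_norm_square cinner_commute[of y x] by simp
  finally have "0 \<le> (norm x)\<^sup>2 - (cmod (cinner x y))\<^sup>2 / (norm y)\<^sup>2"
    unfolding cinner_self of_real_diff[symmetric] of_real_eq_iff
    by (metis zero_le_power2)
  then have "(cmod (cinner x y))\<^sup>2 \<le> (norm x * norm y)\<^sup>2"
    using False by (simp add: field_simps)
  then show ?thesis by (rule power2_le_imp_le) simp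
qed simp

lemma cinner_eqI:
  assumes "\<And>y. cinner x y = cinner x' (y::'h::complex_hilbert)"
  shows "x = x'"
proof -
  have "cinner (x - x') (x - x') = 0" using assms by (simp add: cinner_diff_left)
  then show ?thesis by (simp add: cinner_self)
qed

lemma Re_cinner_parallelogram:
  "(norm (x + y))\<^sup>2 + (norm (x - y))\<^sup>2 = 2 * (norm x)\<^sup>2 + 2 * (norm (y::'h::complex_hilbert))\<^sup>2"
proof -
  have "complex_of_real ((norm (x + y))\<^sup>2 + (norm (x - y))\<^sup>2)
    = complex_of_real (2 * (norm x)\<^sup>2 + 2 * (norm y)\<^sup>2)"
    unfolding of_real_add of_real_mult cinner_self[symmetric]
    by (simp add: cinner_add_left cinner_add_right cinner_diff_left cinner_diff_right)
  then show ?thesis by (simp only: of_real_eq_iff)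
qed

lemma norm_add_scaleR_sq:
  "(norm (u + t *\<^sub>R v))\<^sup>2 = (norm u)\<^sup>2 + 2 * t * Re (cinner u v) + t\<^sup>2 * (norm (v::'h::complex_hilbert))\<^sup>2"
proof -
  have c: "cinner v u = cnj (cinner u v)" by (rule cinner_commute)
  have "cinner (u + t *\<^sub>R v) (u + t *\<^sub>R v) = cinner u u
      + of_real t * (cinner u v + cnj (cinner u v)) + of_real (t\<^sup>2) * cinner v v"
    unfolding scaleC_of_real[symmetric]
    by (simp add: cinner_add_left cinner_add_right cinner_scaleC_left cinner_scaleC_right c
        power2_eq_square algebra_simps)
  also have "\<dots> = complex_of_real ((norm u)\<^sup>2 + 2 * t * Re (cinner u v) + t\<^sup>2 * (norm v)\<^sup>2)"
    by (simp add: cinner_self complex_add_cnj)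
  finally show ?thesis unfolding cinner_self of_real_eq_iff .
qed

text \<open>The representing vector minimises \<open>\<parallel>x\<parallel>\<^sup>2 - 2 Re (f x)\<close>.\<close>

theorem Riesz_representation:
  fixes f :: "'h::complex_hilbert \<Rightarrow> complex"
  assumes add: "\<And>x y. f (x + y) = f x + f y" and scale: "\<And>c x. f (c *\<^sub>C x) = c * f x"
    and bound: "\<And>x. cmod (f x) \<le> K * norm x"
  shows "\<exists>u. \<forall>x. f x = cinner x u"
proof -
  define J where "J x = (norm x)\<^sup>2 - 2 * Re (f x)" for x
  have f0: "f 0 = 0" using add[of 0 0] by simp
  have scaleR: "f (t *\<^sub>R x) = of_real t * f x" for t x
    by (metis scale scaleC_of_real)
  \<comment> \<open>Completing the square in the norm of x bounds J below, so that the infimum d is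
    meaningful.\<close>
  have lb: "J x \<ge> - K\<^sup>2" for x
  proof -
    have "Re (f x) \<le> K * norm x" using bound[of x] complex_Re_le_cmod order_trans by blast
    moreover have "0 \<le> (norm x - K)\<^sup>2" by simp
    ultimately show ?thesis by (simp add: J_def power2_eq_square algebra_simps)
  qed
  define d where "d = (INF x. J x)"
  have bdd: "bdd_below (range J)" using lb by (auto intro!: bdd_belowI)
  have dle: "d \<le> J x" for x unfolding d_def by (rule cINF_lower[OF bdd]) simp
  have "\<exists>x. J x < d + 1 / real (Suc n)" for n
    using cINF_less_iff[of UNIV J "d + 1 / real (Suc n)"] bdd unfolding d_def[symmetric] by auto
  then obtain X where X: "\<And>n. J (X n) < d + 1 / real (Suc n)" by metis
  \<comment> \<open>The midpoint of x and y has J at least d; the parallelogram law turns this into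
    control of the distance, so minimising sequences are Cauchy.\<close>
  have par: "(norm (x - y))\<^sup>2 \<le> 2 * J x + 2 * J y - 4 * d" for x y
  proof -
    have "Re (of_real (1/2) * (f x + f y)) = Re (f x) / 2 + Re (f y) / 2" by simp
    moreover have "(norm ((1/2) *\<^sub>R (x + y)))\<^sup>2 = (norm (x + y))\<^sup>2 / 4"
      by (simp add: power_divide)
    ultimately have "J ((1/2) *\<^sub>R (x + y)) = (norm (x + y))\<^sup>2 / 4 - Re (f x) - Re (f y)"
      by (simp only: J_def scaleR add) (simp add: algebra_simps)
    moreover have "d \<le> J ((1/2) *\<^sub>R (x + y))" by (rule dle)
    ultimately show ?thesis using Re_cinner_parallelogram[of x y] by (simp add: J_def)
  qed
  have "Cauchy X"
  proof (rule metric_CauchyI)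
    fix e :: real assume e: "0 < e"
    obtain N where "4 / e\<^sup>2 < real N" using reals_Archimedean2 by blast
    then have "4 / e\<^sup>2 < real (Suc N)" by simp
    then have "4 < real (Suc N) * e\<^sup>2"
      using e by (subst (asm) pos_divide_less_eq) (rule zero_less_power)
    then have "4 / real (Suc N) < e\<^sup>2"
      by (subst pos_divide_less_eq) (rule of_nat_0_less_iff[THEN iffD2, OF zero_less_Suc], subst mult.commute)
    then have N: "4 * (1 / real (Suc N)) < e\<^sup>2" by (simp only: times_divide_eq_right mult_1_right)
    have "dist (X m) (X n) < e" if "m \<ge> N" "n \<ge> N" for m n
    proof -
      define q where "q = 1 / real (Suc N)"
      have "1 / real (Suc m) \<le> q" "1 / real (Suc n) \<le> q"
        using that by (auto simp: frac_le q_def)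
      then have "J (X m) < d + q" "J (X n) < d + q" using X[of m] X[of n] by linarith+
      then have "(norm (X m - X n))\<^sup>2 < 4 * q" using par[of "X m" "X n"] by linarith
      then have "(norm (X m - X n))\<^sup>2 < e\<^sup>2" using N by (simp only: q_def) 
      then show ?thesis using e by (simp add: dist_norm power_less_imp_less_base)
    qed
    then show "\<exists>M. \<forall>m\<ge>M. \<forall>n\<ge>M. dist (X m) (X n) < e" by blast
  qed
  then obtain u where u: "X \<longlonglongrightarrow> u" using Cauchy_convergent convergent_def by blast
  have "(\<lambda>n. f (X n)) \<longlonglongrightarrow> f u"
  proof -
    have fd: "f (x - y) = f x - f y" for x y using add[of "x - y" y] by simp
    have "(\<lambda>n. K * norm (X n - u)) \<longlonglongrightarrow> K * 0"
      using u by (intro tendsto_intros) (simp add: LIM_zero tendsto_norm_zero_iff)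
    then have K0: "(\<lambda>n. K * norm (X n - u)) \<longlonglongrightarrow> 0" by simp
    have "\<forall>\<^sub>F n in sequentially. norm (f (X n) - f u) \<le> K * norm (X n - u)"
      by (intro always_eventually allI) (simp only: fd[symmetric] bound)
    then have "(\<lambda>n. f (X n) - f u) \<longlonglongrightarrow> 0" using K0 by (rule Lim_null_comparison)
    then show ?thesis by (simp add: LIM_zero_iff)
  qed
  then have JX: "(\<lambda>n. J (X n)) \<longlonglongrightarrow> J u"
    unfolding J_def
    by (intro tendsto_diff tendsto_mult tendsto_const tendsto_power tendsto_norm tendsto_Re u)
  have "(\<lambda>n. d + 1 / real (Suc n)) \<longlonglongrightarrow> d + 0"
    by (rule tendsto_add[OF tendsto_const LIMSEQ_Suc[OF lim_1_over_n]])
  then have "J u \<le> d + 0"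
    by (rule LIMSEQ_le[OF JX]) (use X less_imp_le in blast)
  then have Ju: "J u \<le> J x" for x using dle[of x] by simp
  have re: "Re (f v) = Re (cinner u v)" for v
  proof (rule ccontr)
    define a where "a = Re (cinner u v) - Re (f v)"
    assume "Re (f v) \<noteq> Re (cinner u v)"
    then have a: "a \<noteq> 0" by (simp add: a_def)
    have q: "0 \<le> 2 * t * a + t\<^sup>2 * (norm v)\<^sup>2" for t
      using Ju[of "u + t *\<^sub>R v"]
      by (simp add: J_def norm_add_scaleR_sq add scaleR a_def algebra_simps)
    \<comment> \<open>Essentially the minimiser of the quadratic in t; the added 1 keeps the
      denominator positive when v = 0.\<close>
    define s where "s = - a / ((norm v)\<^sup>2 + 1)"
    have p: "(norm v)\<^sup>2 + 1 > 0" by (simp add: add_nonneg_pos)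
    then have sa: "s * ((norm v)\<^sup>2 + 1) = - a" by (simp add: s_def)
    have "2 * s * a + s\<^sup>2 * (norm v)\<^sup>2 = 2 * s * a + s * (s * ((norm v)\<^sup>2 + 1)) - s\<^sup>2"
      by (simp add: power2_eq_square algebra_simps)
    also have "\<dots> = s * a - s\<^sup>2" unfolding sa by simp
    also have "s * a = - (a\<^sup>2 / ((norm v)\<^sup>2 + 1))" by (simp add: s_def power2_eq_square)
    also have "- (a\<^sup>2 / ((norm v)\<^sup>2 + 1)) - s\<^sup>2 < 0"
    proof -
      have "a\<^sup>2 / ((norm v)\<^sup>2 + 1) > 0" using a p by simp
      then show ?thesis using zero_le_power2[of s] by linarith
    qed
    finally show False using q[of s] by simp
  qed
  have "f v = cinner v u" for v
  proof -
    have 1: "Re (f v) = Re (cinner v u)" using re[of v] cinner_commute[of u v] by simp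
    \<comment> \<open>Only real parts are compared so far; evaluating at
      \<open>\<i> *\<^sub>C v\<close> gives the imaginary part.\<close>
    have "Re (f (\<i> *\<^sub>C v)) = Re (cinner u (\<i> *\<^sub>C v))" by (rule re)
    also have "cinner u (\<i> *\<^sub>C v) = cnj (\<i> * cinner v u)"
      by (subst cinner_commute) (simp add: cinner_scaleC_left)
    finally have "Im (f v) = Im (cinner v u)" by (simp add: scale)
    with 1 show ?thesis by (simp add: complex_eq_iff)
  qed
  then show ?thesis by blast
qed

lemma bounded_clinearD:
  assumes "bounded_clinear (T::'h::complex_hilbert \<Rightarrow> 'h)"
  shows "T (x + y) = T x + T y" "T (c *\<^sub>C x) = c *\<^sub>C T x"
  using assms by (auto simp: bounded_clinear_def bounded_linear_def linear_add)

lemma bounded_clinearI: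
  fixes T :: "'h::complex_hilbert \<Rightarrow> 'h"
  assumes "\<And>x y. T (x + y) = T x + T y" "\<And>c x. T (c *\<^sub>C x) = c *\<^sub>C T x"
    "\<And>x. norm (T x) \<le> K * norm x"
  shows "bounded_clinear T"
  unfolding bounded_clinear_def
proof (intro conjI allI)
  show "bounded_linear T"
    using assms by (intro bounded_linear_intro[of T K])
      (auto simp: scaleC_of_real[symmetric] mult.commute)
qed (use assms in auto)

text \<open>\<open>b x\<close> is conjugate-linear in its second argument, so the Riesz
  representation is applied to its conjugate. Limits of matrix coefficients become operators in this
  way.\<close>

lemma sesquilinear_operator:
  fixes b :: "'h::complex_hilbert \<Rightarrow> 'h \<Rightarrow> complex"
  assumes addl: "\<And>x y z. b (x + y) z = b x z + b y z"
    and scalel: "\<And>c x z. b (c *\<^sub>C x) z = c * b x z"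
    and addr: "\<And>x y z. b x (y + z) = b x y + b x z"
    and scaler: "\<And>c x z. b x (c *\<^sub>C z) = cnj c * b x z"
    and bound: "\<And>x y. cmod (b x y) \<le> K * norm x * norm y" and K: "K \<ge> 0"
  shows "\<exists>L. bounded_clinear L \<and> (\<forall>x y. cinner (L x) y = b x y)"
proof -
  have "\<exists>u. \<forall>y. b x y = cinner u y" for x
  proof -
    have "\<exists>u. \<forall>y. cnj (b x y) = cinner y u"
      by (rule Riesz_representation[where K = "K * norm x"])
        (auto simp: addr scaler bound)
    then obtain u where "\<And>y. cnj (b x y) = cinner y u" by blast
    then have "b x y = cinner u y" for y
      using cinner_commute[of u y] by (metis complex_cnj_cnj)
    then show ?thesis by blast
  qed
  then obtain L where L: "\<And>x y. b x y = cinner (L x) y" by metis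
  have "bounded_clinear L"
  proof (rule bounded_clinearI[where K = K])
    show "L (x + y) = L x + L y" for x y
      by (rule cinner_eqI) (simp add: L[symmetric] addl cinner_add_left)
    show "L (c *\<^sub>C x) = c *\<^sub>C L x" for c x
      by (rule cinner_eqI) (simp add: L[symmetric] scalel cinner_scaleC_left)
    show "norm (L x) \<le> K * norm x" for x
    proof (cases "L x = 0")
      case False
      have "(norm (L x))\<^sup>2 = cmod (cinner (L x) (L x))" by (simp add: cinner_self norm_power)
      also have "\<dots> \<le> K * norm x * norm (L x)" using bound[of x "L x"] by (simp add: L)
      finally show ?thesis using False by (simp add: power2_eq_square)
    qed (use K in simp)
  qed
  then show ?thesis using L by metis
qed

text \<open>The functional sending x to (T x, y) is bounded, hence is the inner product with some u,
  which stands in for the adjoint of T applied to y.\<close>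

lemma wot_tendsto_bounded_clinear:
  fixes T :: "'h::complex_hilbert \<Rightarrow> 'h"
  assumes T: "bounded_clinear T" and lim: "\<And>y. (\<lambda>n. cinner (X n) y) \<longlonglongrightarrow> cinner x y"
  shows "(\<lambda>n. cinner (T (X n)) y) \<longlonglongrightarrow> cinner (T x) y"
proof -
  obtain K where K: "\<And>x. norm (T x) \<le> norm x * K"
    using T unfolding bounded_clinear_def using bounded_linear.bounded by blast
  have "\<exists>u. \<forall>x. cinner (T x) y = cinner x u"
  proof (rule Riesz_representation[where K = "K * norm y"])
    show "cmod (cinner (T x) y) \<le> K * norm y * norm x" for x
      using cinner_Cauchy_Schwarz[of "T x" y] mult_right_mono[OF K[of x], of "norm y"]
      by (simp add: ac_simps)
  qed (auto simp: bounded_clinearD[OF T] cinner_add_left cinner_scaleC_left)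
  then obtain u where "\<And>x. cinner (T x) y = cinner x u" by blast
  then show ?thesis using lim[of u] by simp
qed

text \<open>Stability controls only coefficients with two equal vectors; polarization recovers all
  the others.\<close>

lemma cinner_polarization:
  fixes T :: "'h::complex_hilbert \<Rightarrow> 'h"
  assumes T: "bounded_clinear T"
  shows "cinner (T x) y = (cinner (T (x + y)) (x + y) - cinner (T (x - y)) (x - y)
    + \<i> * cinner (T (x + \<i> *\<^sub>C y)) (x + \<i> *\<^sub>C y) - \<i> * cinner (T (x - \<i> *\<^sub>C y)) (x - \<i> *\<^sub>C y)) / 4"
proof -
  have d: "T (a - b) = T a - T b" for a b
    using bounded_clinearD(1)[OF T, of "a - b" b] by simp
  show ?thesis
    by (simp add: d bounded_clinearD[OF T] cinner_add_left cinner_add_right cinner_diff_left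
        cinner_diff_right cinner_scaleC_left cinner_scaleC_right algebra_simps)
qed

section \<open>Unitary representations and stability\<close>

lemma (in group) inv_mult_cancel_left [simp]:
  assumes "h \<in> carrier G" "x \<in> carrier G"
  shows "inv h \<otimes> (h \<otimes> x) = x" "h \<otimes> (inv h \<otimes> x) = x"
  using assms m_assoc[of "inv h" h x] m_assoc[of h "inv h" x] by auto

lemma unitary_opD:
  assumes "unitary_op (U::'h::complex_hilbert \<Rightarrow> 'h)"
  shows "bounded_clinear U" "U (x + y) = U x + U y" "U (c *\<^sub>C x) = c *\<^sub>C U x"
    "cinner (U x) (U y) = cinner x y" "norm (U x) = norm x" "inj U"
proof -
  show b: "bounded_clinear U" and c: "cinner (U x) (U y) = cinner x y" for x y
    using assms by (auto simp: unitary_op_def)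
  show add: "U (x + y) = U x + U y" for x y using bounded_clinearD[OF b] by blast
  show "U (c *\<^sub>C x) = c *\<^sub>C U x" using bounded_clinearD[OF b] by blast
  show n: "norm (U x) = norm x" for x by (simp add: norm_eq_sqrt_cinner c)
  show "inj U"
  proof (rule injI)
    fix x y assume "U x = U y"
    then have "U (x - y) = 0" using add[of "x - y" y] by simp
    then show "x = y" using n[of "x - y"] by simp
  qed
qed

section \<open>The representation of the group algebra and its operator norm\<close>

locale unitary_representation = group G for G (structure) +
  fixes \<rho> :: "'a \<Rightarrow> 'h::complex_hilbert \<Rightarrow> 'h"
  assumes unitary_rep: "unitary_rep G \<rho>"
begin

lemma unitary: "g \<in> carrier G \<Longrightarrow> unitary_op (\<rho> g)"
  and mult: "g \<in> carrier G \<Longrightarrow> h \<in> carrier G \<Longrightarrow> \<rho> (g \<otimes> h) x = \<rho> g (\<rho> h x)"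
  using unitary_rep by (auto simp: unitary_rep_def)

lemmas rep_add = unitary_opD(2)[OF unitary]
  and rep_scaleC = unitary_opD(3)[OF unitary]
  and rep_cinner = unitary_opD(4)[OF unitary]
  and rep_norm = unitary_opD(5)[OF unitary]
  and rep_clinear = unitary_opD(1)[OF unitary]

lemma rep_one [simp]: "\<rho> \<one> x = x"
proof -
  have "\<rho> \<one> (\<rho> \<one> x) = \<rho> \<one> x" using mult[of \<one> \<one> x] by simp
  then show ?thesis using unitary_opD(6)[OF unitary[OF one_closed]] by (simp add: inj_eq)
qed

lemma rep_inv [simp]:
  assumes "g \<in> carrier G"
  shows "\<rho> g (\<rho> (inv g) x) = x" "\<rho> (inv g) (\<rho> g x) = x"
  using assms mult[of g "inv g" x] mult[of "inv g" g x] by auto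

lemma rep_adjoint: "g \<in> carrier G \<Longrightarrow> cinner (\<rho> g x) y = cinner x (\<rho> (inv g) y)"
  using rep_cinner[of g x "\<rho> (inv g) y"] by simp

lemma rep_sum: "g \<in> carrier G \<Longrightarrow> \<rho> g (\<Sum>i\<in>I. f i) = (\<Sum>i\<in>I. \<rho> g (f i))"
proof (induction I rule: infinite_finite_induct)
  case (insert x F)
  then show ?case by (simp add: rep_add)
next
  case empty
  then show ?case using rep_add[of g 0 0] by simp
next
  case (infinite A)
  then show ?case using rep_add[of g 0 0] by simp
qed

lemma group_algD: "a \<in> group_alg G \<Longrightarrow> finite {g. a g \<noteq> 0}"
    "a \<in> group_alg G \<Longrightarrow> a g \<noteq> 0 \<Longrightarrow> g \<in> carrier G"
  by (auto simp: group_alg_def)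

lemma alg_rep_superset:
  assumes "finite T" "{g. a g \<noteq> 0} \<subseteq> T"
  shows "alg_rep \<rho> a x = (\<Sum>g\<in>T. a g *\<^sub>C \<rho> g x)"
  unfolding alg_rep_def by (rule sum.mono_neutral_left) (use assms in auto)

lemma alg_rep_add_right:
  "a \<in> group_alg G \<Longrightarrow> alg_rep \<rho> a (x + y) = alg_rep \<rho> a x + alg_rep \<rho> a y"
  by (simp add: alg_rep_def group_algD rep_add scaleC_add_right sum.distrib)

lemma alg_rep_scaleC_right:
  "a \<in> group_alg G \<Longrightarrow> alg_rep \<rho> a (c *\<^sub>C x) = c *\<^sub>C alg_rep \<rho> a x"
  by (simp add: alg_rep_def group_algD rep_scaleC scaleC_sum_right scaleC_scaleC mult.commute)

lemma norm_alg_rep_le: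
  "a \<in> group_alg G \<Longrightarrow> norm (alg_rep \<rho> a x) \<le> (\<Sum>g | a g \<noteq> 0. cmod (a g)) * norm x"
  unfolding alg_rep_def sum_distrib_right
  by (rule order_trans[OF norm_sum]) (rule sum_mono, auto simp: norm_scaleC rep_norm group_algD)

lemma bounded_linear_alg_rep: "a \<in> group_alg G \<Longrightarrow> bounded_linear (alg_rep \<rho> a)"
  using bounded_clinearI[OF alg_rep_add_right alg_rep_scaleC_right norm_alg_rep_le]
  by (simp add: bounded_clinear_def)

lemma alg_rep_add:
  assumes "a \<in> group_alg G" "b \<in> group_alg G"
  shows "alg_rep \<rho> (\<lambda>g. a g + b g) x = alg_rep \<rho> a x + alg_rep \<rho> b x"
proof -
  let ?T = "{g. a g \<noteq> 0} \<union> {g. b g \<noteq> 0}"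
  have "finite ?T" using assms by (simp add: group_algD)
  then show ?thesis
    by (subst (1 2 3) alg_rep_superset[of ?T]) (auto simp: scaleC_add_left sum.distrib)
qed

lemma alg_rep_scale: "alg_rep \<rho> (\<lambda>g. c * a g) x = c *\<^sub>C alg_rep \<rho> a x"
  by (cases "c = 0") (simp_all add: alg_rep_def scaleC_sum_right scaleC_scaleC)

lemma alg_rep_mult:
  assumes a: "a \<in> group_alg G" and b: "b \<in> group_alg G"
  shows "alg_rep \<rho> (alg_mult G a b) x = alg_rep \<rho> a (alg_rep \<rho> b x)"
proof -
  let ?A = "{g. a g \<noteq> 0}" and ?B = "{g. b g \<noteq> 0}"
  define T where "T = (\<lambda>(g, h). g \<otimes> h) ` (?A \<times> ?B)"
  note fin = group_algD(1)[OF a] group_algD(1)[OF b]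
  have A: "?A \<subseteq> carrier G" and B: "?B \<subseteq> carrier G" using a b by (auto simp: group_alg_def)
  have finT: "finite T" using fin by (simp add: T_def)
  have Tc: "T \<subseteq> carrier G" using A B by (auto simp: T_def)
  have "{y. alg_mult G a b y \<noteq> 0} \<subseteq> T"
  proof
    fix y assume "y \<in> {y. alg_mult G a b y \<noteq> 0}"
    then have y: "y \<in> carrier G" and "(\<Sum>g | a g \<noteq> 0. a g * b (inv g \<otimes> y)) \<noteq> 0"
      by (auto simp: alg_mult_def split: if_splits)
    then obtain g where g: "a g \<noteq> 0" "b (inv g \<otimes> y) \<noteq> 0"
      by (metis (mono_tags, lifting) mem_Collect_eq mult_eq_0_iff sum.neutral)
    moreover have "y = g \<otimes> (inv g \<otimes> y)" using g A y by (simp add: m_assoc[symmetric] subset_eq)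
    ultimately show "y \<in> T"
      unfolding T_def by (intro image_eqI[of _ _ "(g, inv g \<otimes> y)"]) auto
  qed
  then have "alg_rep \<rho> (alg_mult G a b) x = (\<Sum>y\<in>T. alg_mult G a b y *\<^sub>C \<rho> y x)"
    by (rule alg_rep_superset[OF finT])
  also have "\<dots> = (\<Sum>y\<in>T. \<Sum>g\<in>?A. (a g * b (inv g \<otimes> y)) *\<^sub>C \<rho> y x)"
  proof (rule sum.cong[OF refl])
    fix y assume "y \<in> T"
    then have "alg_mult G a b y = (\<Sum>g\<in>?A. a g * b (inv g \<otimes> y))"
      using Tc by (auto simp: alg_mult_def)
    moreover have "(\<Sum>i\<in>I. f i) *\<^sub>C z = (\<Sum>i\<in>I. f i *\<^sub>C z)" if "finite I"
      for I f and z :: 'h using that by induction (auto simp: scaleC_add_left)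
    ultimately show "alg_mult G a b y *\<^sub>C \<rho> y x = (\<Sum>g\<in>?A. (a g * b (inv g \<otimes> y)) *\<^sub>C \<rho> y x)"
      using fin by simp
  qed
  also have "\<dots> = (\<Sum>g\<in>?A. \<Sum>y\<in>T. (a g * b (inv g \<otimes> y)) *\<^sub>C \<rho> y x)" by (rule sum.swap)
  also have "\<dots> = (\<Sum>g\<in>?A. a g *\<^sub>C \<rho> g (alg_rep \<rho> b x))"
  proof (rule sum.cong[OF refl])
    fix g assume g: "g \<in> ?A"
    then have gc: "g \<in> carrier G" using A by blast
    have "(\<Sum>y\<in>T. (a g * b (inv g \<otimes> y)) *\<^sub>C \<rho> y x)
        = (\<Sum>y\<in>(\<lambda>h. g \<otimes> h) ` ?B. (a g * b (inv g \<otimes> y)) *\<^sub>C \<rho> y x)"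
    proof (rule sum.mono_neutral_right[OF finT])
      show "(\<lambda>h. g \<otimes> h) ` ?B \<subseteq> T" using g by (auto simp: T_def)
      show "\<forall>y\<in>T - (\<lambda>h. g \<otimes> h) ` ?B. (a g * b (inv g \<otimes> y)) *\<^sub>C \<rho> y x = 0"
      proof
        fix y assume y: "y \<in> T - (\<lambda>h. g \<otimes> h) ` ?B"
        then have "y = g \<otimes> (inv g \<otimes> y)" using gc Tc by (auto simp: m_assoc[symmetric])
        then have "b (inv g \<otimes> y) = 0" using y by blast
        then show "(a g * b (inv g \<otimes> y)) *\<^sub>C \<rho> y x = 0" by simp
      qed
    qed
    also have "\<dots> = (\<Sum>h\<in>?B. (a g * b h) *\<^sub>C \<rho> (g \<otimes> h) x)"
      by (subst sum.reindex)
        (use gc B in \<open>auto simp: inj_on_def m_assoc[symmetric] subset_eq intro!: sum.cong\<close>)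
    also have "\<dots> = (\<Sum>h\<in>?B. a g *\<^sub>C \<rho> g (b h *\<^sub>C \<rho> h x))"
      using gc B by (intro sum.cong) (auto simp: mult rep_scaleC scaleC_scaleC)
    also have "\<dots> = a g *\<^sub>C \<rho> g (alg_rep \<rho> b x)"
      by (simp add: alg_rep_def rep_sum[OF gc] scaleC_sum_right)
    finally show "(\<Sum>y\<in>T. (a g * b (inv g \<otimes> y)) *\<^sub>C \<rho> y x) = a g *\<^sub>C \<rho> g (alg_rep \<rho> b x)" .
  qed
  finally show ?thesis by (simp add: alg_rep_def)
qed

lemma alg_star_closed:
  assumes a: "a \<in> group_alg G"
  shows "alg_star G a \<in> group_alg G"
    "{g. alg_star G a g \<noteq> 0} = (\<lambda>g. inv g) ` {g. a g \<noteq> 0}"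
proof -
  show "{g. alg_star G a g \<noteq> 0} = (\<lambda>g. inv g) ` {g. a g \<noteq> 0}"
  proof (intro equalityI subsetI)
    fix g assume "g \<in> {g. alg_star G a g \<noteq> 0}"
    then have "g \<in> carrier G" "a (inv g) \<noteq> 0" by (auto simp: alg_star_def split: if_splits)
    then show "g \<in> (\<lambda>g. inv g) ` {g. a g \<noteq> 0}"
      by (intro image_eqI[of _ _ "inv g"]) auto
  next
    fix g assume "g \<in> (\<lambda>g. inv g) ` {g. a g \<noteq> 0}"
    then show "g \<in> {g. alg_star G a g \<noteq> 0}"
      using group_algD(2)[OF a] by (auto simp: alg_star_def)
  qed
  then show "alg_star G a \<in> group_alg G"
    using a by (auto simp: group_alg_def)
qed

lemma alg_rep_star:
  assumes a: "a \<in> group_alg G"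
  shows "cinner (alg_rep \<rho> a x) y = cinner x (alg_rep \<rho> (alg_star G a) y)"
proof -
  have "alg_rep \<rho> (alg_star G a) y
      = (\<Sum>g | a g \<noteq> 0. cnj (a g) *\<^sub>C \<rho> (inv g) y)"
    unfolding alg_rep_def alg_star_closed(2)[OF a]
    by (subst sum.reindex)
      (use group_algD[OF a] in \<open>auto simp: alg_star_def intro!: inj_on_subset[OF inv_inj]\<close>)
  then show ?thesis
    using group_algD[OF a]
    by (simp add: alg_rep_def cinner_sum_left cinner_sum_right cinner_scaleC_left
        cinner_scaleC_right rep_adjoint)
qed

text \<open>The square norm of the image z of y is the inner product of
  \<open>alg_rep \<rho> a z\<close> with y, by adjointness.\<close>

lemma onorm_alg_rep_star:
  assumes a: "a \<in> group_alg G"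
  shows "onorm (alg_rep \<rho> (alg_star G a)) \<le> onorm (alg_rep \<rho> a)"
proof (rule onorm_bound)
  show "0 \<le> onorm (alg_rep \<rho> a)" by (rule onorm_pos_le[OF bounded_linear_alg_rep[OF a]])
  fix y
  let ?z = "alg_rep \<rho> (alg_star G a) y"
  show "norm ?z \<le> onorm (alg_rep \<rho> a) * norm y"
  proof (cases "?z = 0")
    case False
    have "(norm ?z)\<^sup>2 = cmod (cinner (alg_rep \<rho> a ?z) y)"
      by (simp add: alg_rep_star[OF a] cinner_self norm_power)
    also have "\<dots> \<le> norm (alg_rep \<rho> a ?z) * norm y" by (rule cinner_Cauchy_Schwarz)
    also have "\<dots> \<le> onorm (alg_rep \<rho> a) * norm ?z * norm y"
      by (intro mult_right_mono onorm bounded_linear_alg_rep[OF a]) simp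
    finally show ?thesis using False by (simp add: power2_eq_square)
  qed (simp add: onorm_pos_le[OF bounded_linear_alg_rep[OF a]])
qed

text \<open>Makes the operator norm one of the seminorms in the supremum \<open>cstar_norm\<close>,
  which therefore dominates it.\<close>

lemma cstar_seminorm_onorm: "cstar_seminorm G (\<lambda>a. onorm (alg_rep \<rho> a))"
  unfolding cstar_seminorm_def
proof (intro conjI ballI allI)
  fix a assume a: "a \<in> group_alg G"
  note la = bounded_linear_alg_rep[OF a]
  show "0 \<le> onorm (alg_rep \<rho> a)" by (rule onorm_pos_le[OF la])
  show "onorm (alg_rep \<rho> (\<lambda>g. c * a g)) = cmod c * onorm (alg_rep \<rho> a)" for c
  proof -
    have "onorm (alg_rep \<rho> (\<lambda>g. c * a g)) = onorm (\<lambda>x. cmod c *\<^sub>R alg_rep \<rho> a x)"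
      by (simp add: onorm_def alg_rep_scale norm_scaleC)
    then show ?thesis using onorm_scaleR[OF la] by simp
  qed
  have comp: "alg_rep \<rho> (alg_mult G a b) = alg_rep \<rho> a \<circ> alg_rep \<rho> b"
    if "a \<in> group_alg G" "b \<in> group_alg G" for a b
    using alg_rep_mult[OF that] by auto
  show "onorm (alg_rep \<rho> (alg_mult G (alg_star G a) a)) = (onorm (alg_rep \<rho> a))\<^sup>2"
  proof (rule antisym)
    let ?s = "alg_star G a"
    note s = alg_star_closed(1)[OF a]
    note ls = bounded_linear_alg_rep[OF s]
    have "onorm (alg_rep \<rho> ?s \<circ> alg_rep \<rho> a) \<le> onorm (alg_rep \<rho> ?s) * onorm (alg_rep \<rho> a)"
      by (rule onorm_compose[OF ls la])
    also have "\<dots> \<le> (onorm (alg_rep \<rho> a))\<^sup>2"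
      unfolding power2_eq_square
      by (intro mult_right_mono onorm_alg_rep_star[OF a] onorm_pos_le[OF la])
    finally show "onorm (alg_rep \<rho> (alg_mult G ?s a)) \<le> (onorm (alg_rep \<rho> a))\<^sup>2"
      by (simp add: comp s a)
    let ?N = "onorm (alg_rep \<rho> ?s \<circ> alg_rep \<rho> a)"
    have lN: "bounded_linear (alg_rep \<rho> ?s \<circ> alg_rep \<rho> a)"
      using bounded_linear_compose[OF ls la] by (simp add: o_def)
    have N: "0 \<le> ?N" by (rule onorm_pos_le[OF lN])
    have "onorm (alg_rep \<rho> a) \<le> sqrt ?N"
    proof (rule onorm_bound)
      fix x
      have "(norm (alg_rep \<rho> a x))\<^sup>2 = cmod (cinner (alg_rep \<rho> a x) (alg_rep \<rho> a x))"
        by (simp add: cinner_self norm_power)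
      also have "\<dots> = cmod (cinner x ((alg_rep \<rho> ?s \<circ> alg_rep \<rho> a) x))"
        by (simp add: alg_rep_star[OF a])
      also have "\<dots> \<le> norm x * norm ((alg_rep \<rho> ?s \<circ> alg_rep \<rho> a) x)" by (rule cinner_Cauchy_Schwarz)
      also have "\<dots> \<le> norm x * (?N * norm x)"
        by (intro mult_left_mono onorm[OF lN]) simp
      also have "\<dots> = (sqrt ?N * norm x)\<^sup>2" using N by (simp add: power_mult_distrib power2_eq_square)
      finally show "norm (alg_rep \<rho> a x) \<le> sqrt ?N * norm x"
        by (rule power2_le_imp_le) (simp add: N)
    qed (simp add: N)
    then have "(onorm (alg_rep \<rho> a))\<^sup>2 \<le> (sqrt ?N)\<^sup>2"
      by (intro power_mono onorm_pos_le[OF la])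
    then show "(onorm (alg_rep \<rho> a))\<^sup>2 \<le> onorm (alg_rep \<rho> (alg_mult G ?s a))"
      using N by (simp add: comp s a)
  qed
  fix b assume b: "b \<in> group_alg G"
  note lb = bounded_linear_alg_rep[OF b]
  show "onorm (alg_rep \<rho> (\<lambda>g. a g + b g)) \<le> onorm (alg_rep \<rho> a) + onorm (alg_rep \<rho> b)"
    using onorm_triangle[OF la lb] by (simp add: alg_rep_add[OF a b, abs_def])
  show "onorm (alg_rep \<rho> (alg_mult G a b)) \<le> onorm (alg_rep \<rho> a) * onorm (alg_rep \<rho> b)"
    using onorm_compose[OF la lb] by (simp add: comp a b)
qed

text \<open>Serves to bound the set in the supremum \<open>cstar_dual_norm\<close>: a supremum over
  an unbounded set of reals would say nothing about its elements.\<close>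

lemma vector_functional_le:
  assumes a: "a \<in> group_alg G"
  shows "cmod (vector_functional \<rho> \<eta> a) \<le> cstar_norm G a * (norm \<eta>)\<^sup>2"
proof -
  have "onorm (alg_rep \<rho> a) \<le> cstar_norm G a"
    unfolding cstar_norm_def
    by (rule cSUP_upper) (use cstar_seminorm_onorm cstar_seminorm_bound[OF is_group _ a]
        in \<open>auto intro!: bdd_aboveI\<close>)
  then have "norm (alg_rep \<rho> a \<eta>) \<le> cstar_norm G a * norm \<eta>"
    using onorm[OF bounded_linear_alg_rep[OF a], of \<eta>]
    by (meson mult_right_mono norm_ge_zero order_trans)
  then have "norm (alg_rep \<rho> a \<eta>) * norm \<eta> \<le> cstar_norm G a * norm \<eta> * norm \<eta>"
    by (rule mult_right_mono) simp
  then show ?thesis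
    unfolding vector_functional_def power2_eq_square mult.assoc[symmetric]
    using cinner_Cauchy_Schwarz order_trans by blast
qed

text \<open>A vector functional composed with an automorphism is thus a vector functional of
  \<open>\<rho> \<circ> \<theta>\<close>, and the bound by \<open>cstar_norm\<close> applies without
  knowing how automorphisms act on that norm.\<close>

lemma alg_rep_alg_map:
  assumes a: "a \<in> group_alg G"
  shows "alg_rep \<rho> (alg_map \<theta> a) = alg_rep (\<rho> \<circ> \<theta>) a"
proof
  fix x
  let ?A = "{g. a g \<noteq> 0}"
  note fin = group_algD(1)[OF a]
  have sc: "(\<Sum>i\<in>I. f i) *\<^sub>C z = (\<Sum>i\<in>I. f i *\<^sub>C z)" if "finite I" for I f and z :: 'h
    using that by induction (auto simp: scaleC_add_left)
  have "{h. alg_map \<theta> a h \<noteq> 0} \<subseteq> \<theta> ` ?A"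
  proof
    fix h assume "h \<in> {h. alg_map \<theta> a h \<noteq> 0}"
    then have "{g. a g \<noteq> 0 \<and> \<theta> g = h} \<noteq> {}" by (auto simp: alg_map_def simp del: Collect_empty_eq)
    then show "h \<in> \<theta> ` ?A" by blast
  qed
  then have "alg_rep \<rho> (alg_map \<theta> a) x = (\<Sum>h\<in>\<theta> ` ?A. alg_map \<theta> a h *\<^sub>C \<rho> h x)"
    using fin by (intro alg_rep_superset) auto
  also have "\<dots> = (\<Sum>h\<in>\<theta> ` ?A. \<Sum>g | g \<in> ?A \<and> \<theta> g = h. a g *\<^sub>C \<rho> (\<theta> g) x)"
    using fin by (intro sum.cong) (auto simp: alg_map_def sc)
  also have "\<dots> = (\<Sum>g\<in>?A. a g *\<^sub>C \<rho> (\<theta> g) x)"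
    by (rule sum.image_gen[OF fin, symmetric])
  finally show "alg_rep \<rho> (alg_map \<theta> a) x = alg_rep (\<rho> \<circ> \<theta>) a x"
    by (simp add: alg_rep_def)
qed

end

text \<open>Point masses lie in the unit ball, so the dual norm controls every single matrix
  coefficient. The zero seminorm shows that the supremum is over a nonempty family.\<close>

lemma cstar_norm_delta_le:
  assumes "group G" "x \<in> carrier G"
  shows "cstar_norm G (\<lambda>g. if g = x then 1 else 0) \<le> 1"
  unfolding cstar_norm_def
proof (rule cSUP_least)
  have "cstar_seminorm G (\<lambda>_. 0)" by (simp add: cstar_seminorm_def)
  then show "{p. cstar_seminorm G p} \<noteq> {}" by blast
  fix p assume "p \<in> {p. cstar_seminorm G p}"
  then have "p (\<lambda>g. if g = x then 1 else 0)
      \<le> (\<Sum>g | (if g = x then 1 else 0) \<noteq> (0::complex). cmod (if g = x then 1 else 0))"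
    using assms by (intro cstar_seminorm_bound) (auto simp: group_alg_def)
  moreover have "{g. (if g = x then 1 else 0) \<noteq> (0::complex)} = {x}" by auto
  ultimately show "p (\<lambda>g. if g = x then 1 else 0) \<le> 1" by simp
qed

section \<open>Neighbourhoods of the identity automorphism\<close>

lemma inner_autos_subset_auto:
  assumes "group G"
  shows "inner_autos G \<subseteq> auto G"
proof
  interpret group G by fact
  fix \<theta> assume "\<theta> \<in> inner_autos G"
  then obtain h where h: "h \<in> carrier G" and \<theta>: "\<theta> = (\<lambda>x\<in>carrier G. h \<otimes>\<^bsub>G\<^esub> x \<otimes>\<^bsub>G\<^esub> inv\<^bsub>G\<^esub> h)"
    by (auto simp: inner_autos_def)
  have "\<theta> \<in> hom G G"
    using h by (auto simp: hom_def \<theta> m_assoc)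
  moreover have "bij_betw \<theta> (carrier G) (carrier G)"
  proof (rule bij_betw_byWitness[where f' = "\<lambda>x. inv\<^bsub>G\<^esub> h \<otimes>\<^bsub>G\<^esub> x \<otimes>\<^bsub>G\<^esub> h"])
    show "\<forall>a\<in>carrier G. inv\<^bsub>G\<^esub> h \<otimes>\<^bsub>G\<^esub> \<theta> a \<otimes>\<^bsub>G\<^esub> h = a"
      using h by (simp add: \<theta> m_assoc)
    show "\<forall>a\<in>carrier G. \<theta> (inv\<^bsub>G\<^esub> h \<otimes>\<^bsub>G\<^esub> a \<otimes>\<^bsub>G\<^esub> h) = a"
      using h by (simp add: \<theta> m_assoc)
  qed (use h in \<open>auto simp: \<theta>\<close>)
  ultimately show "\<theta> \<in> auto G" by (simp add: auto_def Bij_def \<theta>)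
qed

lemma aut_topology_nhd:
  assumes "group G" "openin (aut_topology G) V" "\<theta>\<^sub>0 \<in> V"
    and \<theta>0: "\<And>g. g \<in> carrier G \<Longrightarrow> \<theta>\<^sub>0 g = g"
  shows "\<exists>F. finite F \<and> F \<subseteq> carrier G \<and> (\<forall>\<theta>\<in>auto G. (\<forall>g\<in>F. \<theta> g = g) \<longrightarrow> \<theta> \<in> V)"
proof -
  interpret group G by fact
  have "generate_topology_on
      {\<theta> <#\<^bsub>AutoGroup G\<^esub> fixing_nbhd G g |\<theta> g. \<theta> \<in> auto G \<and> g \<in> carrier G} V"
    using assms(2) by (simp add: aut_topology_def openin_topology_generated_by_iff)
  then show ?thesis using \<open>\<theta>\<^sub>0 \<in> V\<close>
  proof induction
    case (Int a b)
    then obtain F1 F2 where "finite F1 \<and> F1 \<subseteq> carrier G \<and> (\<forall>\<theta>\<in>auto G. (\<forall>g\<in>F1. \<theta> g = g) \<longrightarrow> \<theta> \<in> a)"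
      "finite F2 \<and> F2 \<subseteq> carrier G \<and> (\<forall>\<theta>\<in>auto G. (\<forall>g\<in>F2. \<theta> g = g) \<longrightarrow> \<theta> \<in> b)"
      by blast
    then show ?case by (intro exI[of _ "F1 \<union> F2"]) auto
  next
    case (UN K)
    then show ?case by (meson Union_iff)
  next
    case (Basis s)
    then obtain \<theta>\<^sub>1 g where s: "s = \<theta>\<^sub>1 <#\<^bsub>AutoGroup G\<^esub> fixing_nbhd G g"
      and \<theta>1: "\<theta>\<^sub>1 \<in> auto G" and g: "g \<in> carrier G" by blast
    have mult: "a \<otimes>\<^bsub>AutoGroup G\<^esub> b = compose (carrier G) a b" if "a \<in> auto G" "b \<in> auto G" for a b
      using that by (simp add: AutoGroup_def BijGroup_def auto_def)
    interpret A: group "AutoGroup G" by (rule AutoGroup)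
    have carr: "carrier (AutoGroup G) = auto G" by (simp add: AutoGroup_def)
    obtain \<phi> where \<phi>: "\<phi> \<in> auto G" "\<phi> g = g" "\<theta>\<^sub>0 = compose (carrier G) \<theta>\<^sub>1 \<phi>"
      using Basis.prems by (auto simp: s l_coset_def fixing_nbhd_def mult \<theta>1)
    \<comment> \<open>If the translate by \<open>\<theta>\<^sub>1\<close> of the stabiliser of g
      contains a map fixing g, then \<open>\<theta>\<^sub>1\<close> fixes g and the translate is the
      stabiliser itself.\<close>
    then have 1: "\<theta>\<^sub>1 g = g" using \<theta>0[OF g] g by (simp add: compose_def)
    have "\<theta> \<in> s" if \<theta>: "\<theta> \<in> auto G" "\<theta> g = g" for \<theta>
    proof -
      define \<psi> where "\<psi> = inv\<^bsub>AutoGroup G\<^esub> \<theta>\<^sub>1 \<otimes>\<^bsub>AutoGroup G\<^esub> \<theta>"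
      have \<psi>: "\<psi> \<in> auto G" unfolding \<psi>_def using \<theta>1 \<theta>(1)
        by (metis A.inv_closed A.m_closed carr)
      have "\<theta>\<^sub>1 \<otimes>\<^bsub>AutoGroup G\<^esub> \<psi> = \<theta>"
        unfolding \<psi>_def using \<theta>1[folded carr] \<theta>(1)[folded carr] by (simp add: A.m_assoc[symmetric])
      then have c: "compose (carrier G) \<theta>\<^sub>1 \<psi> = \<theta>" using mult \<theta>1 \<psi> by simp
      then have "\<theta>\<^sub>1 (\<psi> g) = \<theta> g" using g by (metis compose_eq)
      then have "\<theta>\<^sub>1 (\<psi> g) = g" using \<theta>(2) by simp
      moreover have "\<psi> g \<in> carrier G" using \<psi> g by (auto simp: auto_def hom_def)
      moreover have "inj_on \<theta>\<^sub>1 (carrier G)" using \<theta>1 by (auto simp: auto_def Bij_def bij_betw_def)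
      ultimately have "\<psi> g = g" using 1 g by (metis inj_onD)
      then show ?thesis
        using \<psi> c mult[OF \<theta>1 \<psi>] by (auto simp: s l_coset_def fixing_nbhd_def)
    qed
    then show ?case using g by (intro exI[of _ "{g}"]) auto
  qed simp
qed

text \<open>The gain is uniformity in x: the dual norm bounds the values on all point masses at
  once. The finite set F describes a neighbourhood of the identity automorphism.\<close>

theorem stable_rep_uniform:
  fixes \<pi> :: "'g \<Rightarrow> 'h::complex_hilbert \<Rightarrow> 'h"
  assumes G: "group G" and st: "stable_rep G \<pi>" and e: "\<epsilon> > 0"
  shows "\<exists>F. finite F \<and> F \<subseteq> carrier G \<and> (\<forall>h\<in>carrier G.
    (\<forall>g\<in>F. h \<otimes>\<^bsub>G\<^esub> g \<otimes>\<^bsub>G\<^esub> inv\<^bsub>G\<^esub> h = g) \<longrightarrow> (\<forall>x\<in>carrier G.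
      cmod (cinner (\<pi> (h \<otimes>\<^bsub>G\<^esub> x \<otimes>\<^bsub>G\<^esub> inv\<^bsub>G\<^esub> h) \<eta>) \<eta> - cinner (\<pi> x \<eta>) \<eta>) < \<epsilon>))"
proof -
  interpret unitary_representation G \<pi>
    using G st by (simp add: unitary_representation_def unitary_representation_axioms_def stable_rep_def)
  define \<theta>\<^sub>0 where "\<theta>\<^sub>0 = (\<lambda>x\<in>carrier G. \<one>\<^bsub>G\<^esub> \<otimes>\<^bsub>G\<^esub> x \<otimes>\<^bsub>G\<^esub> inv\<^bsub>G\<^esub> \<one>\<^bsub>G\<^esub>)"
  have \<theta>0: "\<theta>\<^sub>0 \<in> inner_autos G" unfolding inner_autos_def \<theta>\<^sub>0_def by blast
  define f where "f \<theta> a = vector_functional \<pi> \<eta> (alg_map \<theta> a) - vector_functional \<pi> \<eta> (alg_map \<theta>\<^sub>0 a)" for \<theta> a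
  have "\<forall>\<eta>. \<forall>\<theta>\<^sub>0\<in>inner_autos G. \<forall>\<epsilon>>0.
      \<exists>U. openin (subtopology (aut_topology G) (inner_autos G)) U \<and> \<theta>\<^sub>0 \<in> U \<and>
        (\<forall>\<theta>\<in>U. cstar_dual_norm G
          (\<lambda>a. vector_functional \<pi> \<eta> (alg_map \<theta> a) - vector_functional \<pi> \<eta> (alg_map \<theta>\<^sub>0 a)) < \<epsilon>)"
    using st unfolding stable_rep_def by (rule conjunct2)
  from this[rule_format, OF \<theta>0 e, of \<eta>]
  obtain U where U: "openin (subtopology (aut_topology G) (inner_autos G)) U" "\<theta>\<^sub>0 \<in> U"
    and small': "\<forall>\<theta>\<in>U. cstar_dual_norm G (f \<theta>) < \<epsilon>"
    unfolding f_def[abs_def] by (elim exE conjE)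
  have small: "cstar_dual_norm G (f \<theta>) < \<epsilon>" if "\<theta> \<in> U" for \<theta>
    using small' that by (rule bspec)
  obtain V where V: "openin (aut_topology G) V" "U = V \<inter> inner_autos G"
    using U(1) by (auto simp: openin_subtopology)
  have id0: "\<theta>\<^sub>0 g = g" if "g \<in> carrier G" for g using that by (simp add: \<theta>\<^sub>0_def)
  have "\<theta>\<^sub>0 \<in> V" using U(2) V(2) by simp
  have "\<exists>F. finite F \<and> F \<subseteq> carrier G \<and> (\<forall>\<theta>\<in>auto G. (\<forall>g\<in>F. \<theta> g = g) \<longrightarrow> \<theta> \<in> V)"
    by (rule aut_topology_nhd[OF G V(1) \<open>\<theta>\<^sub>0 \<in> V\<close>]) (rule id0)
  then obtain F where F: "finite F" "F \<subseteq> carrier G"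
    and FV: "\<forall>\<theta>\<in>auto G. (\<forall>g\<in>F. \<theta> g = g) \<longrightarrow> \<theta> \<in> V"
    by (elim exE conjE)
  have rep\<theta>: "unitary_representation G (\<pi> \<circ> \<theta>)" if "\<theta> \<in> inner_autos G" for \<theta>
  proof -
    have "\<theta> \<in> hom G G" using that inner_autos_subset_auto[OF G] by (auto simp: auto_def)
    then show ?thesis
      using unitary_rep G
      by (auto simp: unitary_representation_def unitary_representation_axioms_def
          unitary_rep_def hom_def Pi_iff)
  qed
  have vf: "vector_functional \<pi> \<eta> (alg_map \<theta> a) = vector_functional (\<pi> \<circ> \<theta>) \<eta> a"
    if "a \<in> group_alg G" for \<theta> a
    using alg_rep_alg_map[OF that] by (simp add: vector_functional_def)
  show ?thesis
  proof (intro exI[of _ F] conjI F ballI impI)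
    fix h x assume h: "h \<in> carrier G" and fixF: "\<forall>g\<in>F. h \<otimes>\<^bsub>G\<^esub> g \<otimes>\<^bsub>G\<^esub> inv\<^bsub>G\<^esub> h = g" and x: "x \<in> carrier G"
    define \<theta> where "\<theta> = (\<lambda>x\<in>carrier G. h \<otimes>\<^bsub>G\<^esub> x \<otimes>\<^bsub>G\<^esub> inv\<^bsub>G\<^esub> h)"
    have \<theta>: "\<theta> \<in> inner_autos G" using h by (auto simp: \<theta>_def inner_autos_def)
    have "\<theta> \<in> auto G" using \<theta> inner_autos_subset_auto[OF G] by blast
    moreover have "\<forall>g\<in>F. \<theta> g = g" using fixF F(2) by (simp add: \<theta>_def subset_eq)
    ultimately have "\<theta> \<in> V" using FV by blast
    then have "\<theta> \<in> U" using \<theta> V by simp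
    then have sm: "cstar_dual_norm G (f \<theta>) < \<epsilon>" by (rule small)
    let ?d = "\<lambda>g. if g = x then 1 else (0::complex)"
    have d: "?d \<in> group_alg G" using x by (auto simp: group_alg_def)
    have bdd: "bdd_above ((\<lambda>a. cmod (f \<theta> a)) ` {a \<in> group_alg G. cstar_norm G a \<le> 1})"
    proof (rule bdd_aboveI2)
      fix a assume a: "a \<in> {a \<in> group_alg G. cstar_norm G a \<le> 1}"
      have "cmod (vector_functional \<pi> \<eta> (alg_map \<theta>' a)) \<le> (norm \<eta>)\<^sup>2" if "\<theta>' \<in> inner_autos G" for \<theta>'
      proof -
        have "cmod (vector_functional \<pi> \<eta> (alg_map \<theta>' a)) \<le> cstar_norm G a * (norm \<eta>)\<^sup>2"
          using unitary_representation.vector_functional_le[OF rep\<theta>[OF that]] a by (simp add: vf)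
        also have "\<dots> \<le> 1 * (norm \<eta>)\<^sup>2" using a by (intro mult_right_mono) auto
        finally show ?thesis by simp
      qed
      from this[OF \<theta>] this[OF \<theta>0]
      show "cmod (f \<theta> a) \<le> (norm \<eta>)\<^sup>2 + (norm \<eta>)\<^sup>2"
        unfolding f_def using norm_triangle_ineq4 order_trans add_mono by meson
    qed
    have "cmod (f \<theta> ?d) \<le> cstar_dual_norm G (f \<theta>)"
      unfolding cstar_dual_norm_def
      by (rule cSUP_upper[OF _ bdd]) (use d cstar_norm_delta_le[OF G x] in auto)
    then have "cmod (f \<theta> ?d) < \<epsilon>" using sm by simp
    moreover have "vector_functional (\<pi> \<circ> \<theta>') \<eta> ?d = cinner (\<pi> (\<theta>' x) \<eta>) \<eta>" for \<theta>'
    proof -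
      have "{g. ?d g \<noteq> 0} = {x}" by auto
      then show ?thesis unfolding vector_functional_def alg_rep_def by simp
    qed
    ultimately show "cmod (cinner (\<pi> (h \<otimes>\<^bsub>G\<^esub> x \<otimes>\<^bsub>G\<^esub> inv\<^bsub>G\<^esub> h) \<eta>) \<eta> - cinner (\<pi> x \<eta>) \<eta>) < \<epsilon>"
      using x by (simp add: f_def vf[OF d] \<theta>_def \<theta>\<^sub>0_def)
  qed
qed

section \<open>Elements of the hyperoctahedral group\<close>

interpretation B: group B_grp by (rule group_B_grp)

abbreviation (input) bmult (infixl "\<odot>" 70) where "g \<odot> h \<equiv> g \<otimes>\<^bsub>B_grp\<^esub> h"
abbreviation (input) binv where "binv g \<equiv> inv\<^bsub>B_grp\<^esub> g"
abbreviation (input) Bc where "Bc \<equiv> carrier B_grp"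

definition bperm :: "(nat \<Rightarrow> nat) \<Rightarrow> (nat \<Rightarrow> bit) \<times> (nat \<Rightarrow> nat)"
  where "bperm s = (\<lambda>_. 0, s)"

definition bflip :: "nat \<Rightarrow> (nat \<Rightarrow> bit) \<times> (nat \<Rightarrow> nat)"
  where "bflip i = (\<lambda>k. if k = i then 1 else 0, id)"

definition btr :: "nat \<Rightarrow> nat \<Rightarrow> (nat \<Rightarrow> bit) \<times> (nat \<Rightarrow> nat)"
  where "btr i j = bperm (Transposition.transpose i j)"

lemma snd_B_mult [simp]: "snd (g \<odot> h) = snd g \<circ> snd h"
  by (cases g; cases h) (simp add: B_grp_def)

lemma fst_B_mult: "fst (g \<odot> h) i = fst g i + fst h (inv_into UNIV (snd g) i)"
  by (cases g; cases h) (simp add: B_grp_def)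

lemma B_one: "\<one>\<^bsub>B_grp\<^esub> = (\<lambda>_. 0, id)"
  by (simp add: B_grp_def)

lemma B_carrier_iff: "g \<in> Bc \<longleftrightarrow> finite {i. fst g i \<noteq> 0} \<and> fst g 0 = 0 \<and>
    snd g permutes {1..} \<and> finite {i. snd g i \<noteq> i}"
  by (cases g) (simp add: B_grp_def)

lemma B_permutes: "g \<in> Bc \<Longrightarrow> snd g permutes {1..}"
  by (simp add: B_carrier_iff)

lemma B_bij: "g \<in> Bc \<Longrightarrow> bij (snd g)"
  by (rule permutes_bij[OF B_permutes])

lemma B_inj: "g \<in> Bc \<Longrightarrow> snd g i = snd g j \<longleftrightarrow> i = j"
  by (metis B_bij bij_pointE)

lemma B_inv_into [simp]:
  assumes "g \<in> Bc"
  shows "inv_into UNIV (snd g) (snd g i) = i" "snd g (inv_into UNIV (snd g) i) = i"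
  using permutes_inverses[OF B_permutes[OF assms]] by auto

lemma fst_B_mult_apply:
  "g \<in> Bc \<Longrightarrow> fst (g \<odot> h) (snd g i) = fst g (snd g i) + fst h i"
  by (simp add: fst_B_mult)

lemma bit_add_self [simp]: "(b::bit) + b = 0"
  by (cases b) auto

lemma B_inv:
  assumes "g \<in> Bc"
  shows "binv g = (\<lambda>i. fst g (snd g i), inv_into UNIV (snd g))"
proof -
  let ?y = "(\<lambda>i. fst g (snd g i), inv_into UNIV (snd g))"
  have p: "snd g permutes {1..}" using assms by (rule B_permutes)
  have fi: "finite {i. fst g i \<noteq> 0}" "finite {i. snd g i \<noteq> i}" "fst g 0 = 0"
    using assms by (auto simp: B_carrier_iff)
  have "{i. fst g (snd g i) \<noteq> 0} \<subseteq> inv_into UNIV (snd g) ` {i. fst g i \<noteq> 0}"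
    using assms by (auto intro!: image_eqI[of _ _ "snd g _"])
  then have "finite {i. fst g (snd g i) \<noteq> 0}" using fi finite_subset by blast
  moreover have "{i. inv_into UNIV (snd g) i \<noteq> i} = {i. snd g i \<noteq> i}"
    using permutes_inv_eq[OF p] by auto
  moreover have "snd g 0 = 0" using p by (simp add: permutes_def)
  ultimately have y: "?y \<in> Bc"
    using fi permutes_inv[OF p] by (simp add: B_carrier_iff)
  have "?y \<odot> g = \<one>\<^bsub>B_grp\<^esub>"
    by (rule prod_eqI) (auto simp: B_one fst_B_mult fun_eq_iff assms permutes_inv_inv[OF p])
  then show ?thesis using B.inv_equality[OF _ assms y] by simp
qed

lemma snd_B_inv: "g \<in> Bc \<Longrightarrow> snd (binv g) = inv_into UNIV (snd g)"
  and fst_B_inv: "g \<in> Bc \<Longrightarrow> fst (binv g) i = fst g (snd g i)"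
  by (simp_all add: B_inv)

section \<open>Supports, commutation and conjugation\<close>

lemma B_supp_iff: "k \<in> B_supp g \<longleftrightarrow> snd g k \<noteq> k \<or> fst g k \<noteq> 0"
  by (auto simp: B_supp_def perm_part_def seq_part_def)

lemma finite_B_supp: "g \<in> Bc \<Longrightarrow> finite (B_supp g)"
proof -
  assume "g \<in> Bc"
  moreover have "B_supp g \<subseteq> {i. fst g i \<noteq> 0} \<union> {i. snd g i \<noteq> i}" by (auto simp: B_supp_iff)
  ultimately show ?thesis by (auto simp: B_carrier_iff intro: finite_subset)
qed

lemma zero_notin_B_supp: "g \<in> Bc \<Longrightarrow> 0 \<notin> B_supp g"
  by (auto simp: B_supp_iff B_carrier_iff permutes_def)

lemma B_supp_apply: "g \<in> Bc \<Longrightarrow> snd g k \<in> B_supp g \<longleftrightarrow> k \<in> B_supp g"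
  by (metis B_inj B_supp_iff)

lemma B_supp_inv_into: "g \<in> Bc \<Longrightarrow> inv_into UNIV (snd g) k \<in> B_supp g \<longleftrightarrow> k \<in> B_supp g"
  by (metis B_inv_into(2) B_supp_apply)

lemma B_supp_not_apply: "k \<notin> B_supp g \<Longrightarrow> snd g k = k" "k \<notin> B_supp g \<Longrightarrow> fst g k = 0"
  by (auto simp: B_supp_iff)

lemma B_supp_not_inv_into: "g \<in> Bc \<Longrightarrow> k \<notin> B_supp g \<Longrightarrow> inv_into UNIV (snd g) k = k"
  by (metis B_inv_into(1) B_supp_not_apply(1))

lemma B_supp_mult: "g \<in> Bc \<Longrightarrow> B_supp (g \<odot> h) \<subseteq> B_supp g \<union> B_supp h"
proof
  fix k assume g: "g \<in> Bc" and k: "k \<in> B_supp (g \<odot> h)"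
  show "k \<in> B_supp g \<union> B_supp h"
  proof (rule ccontr)
    assume "k \<notin> B_supp g \<union> B_supp h"
    then have "k \<notin> B_supp (g \<odot> h)"
      using B_supp_not_inv_into[OF g] by (simp add: B_supp_iff[of k "g \<odot> h"] fst_B_mult B_supp_not_apply)
    then show False using k by blast
  qed
qed

lemma B_supp_inv [simp]: "g \<in> Bc \<Longrightarrow> B_supp (binv g) = B_supp g"
proof -
  have *: "B_supp (binv g) \<subseteq> B_supp g" if "g \<in> Bc" for g
  proof
    fix k assume k: "k \<in> B_supp (binv g)"
    show "k \<in> B_supp g"
    proof (rule ccontr)
      assume n: "k \<notin> B_supp g"
      have "snd (binv g) k = k" "fst (binv g) k = 0"
        using n by (simp_all add: snd_B_inv fst_B_inv that B_supp_not_inv_into B_supp_not_apply)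
      then have "k \<notin> B_supp (binv g)" by (simp add: B_supp_iff)
      then show False using k by blast
    qed
  qed
  assume g: "g \<in> Bc"
  show ?thesis using *[OF g] *[OF B.inv_closed[OF g]] g by auto
qed

lemma B_supp_one [simp]: "B_supp \<one>\<^bsub>B_grp\<^esub> = {}"
  by (auto simp: B_supp_iff B_one)

lemma B_supp_empty: "B_supp g = {} \<Longrightarrow> g = \<one>\<^bsub>B_grp\<^esub>"
proof -
  assume "B_supp g = {}"
  then have "snd g k = k" "fst g k = 0" for k using B_supp_not_apply by auto
  then show ?thesis by (intro prod_eqI) (auto simp: B_one)
qed

lemma B_commute:
  assumes g: "g \<in> Bc" and h: "h \<in> Bc" and d: "B_supp g \<inter> B_supp h = {}"
  shows "g \<odot> h = h \<odot> g"
proof (rule prod_eqI)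
  have gh: "k \<notin> B_supp h" if "k \<in> B_supp g" for k using d that by blast
  have hg: "k \<notin> B_supp g" if "k \<in> B_supp h" for k using d that by blast
  show "snd (g \<odot> h) = snd (h \<odot> g)"
  proof
    fix k
    consider "k \<in> B_supp g" | "k \<in> B_supp h" | "k \<notin> B_supp g" "k \<notin> B_supp h" by blast
    then show "snd (g \<odot> h) k = snd (h \<odot> g) k"
    proof cases
      case 1
      then have "snd g k \<in> B_supp g" by (simp add: B_supp_apply[OF g])
      then show ?thesis using gh[OF 1] gh[of "snd g k"] by (simp add: B_supp_not_apply)
    next
      case 2
      then have "snd h k \<in> B_supp h" by (simp add: B_supp_apply[OF h])
      then show ?thesis using hg[OF 2] hg[of "snd h k"] by (simp add: B_supp_not_apply)
    qed (simp add: B_supp_not_apply)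
  qed
  show "fst (g \<odot> h) = fst (h \<odot> g)"
  proof
    fix k
    let ?gi = "inv_into UNIV (snd g) k" and ?hi = "inv_into UNIV (snd h) k"
    consider "k \<in> B_supp g" | "k \<in> B_supp h" | "k \<notin> B_supp g" "k \<notin> B_supp h" by blast
    then show "fst (g \<odot> h) k = fst (h \<odot> g) k"
    proof cases
      case 1
      then have "?gi \<in> B_supp g" by (simp add: B_supp_inv_into[OF g])
      then show ?thesis
        using gh[OF 1] gh[of ?gi] B_supp_not_inv_into[OF h gh[OF 1]] by (simp add: fst_B_mult B_supp_not_apply)
    next
      case 2
      then have "?hi \<in> B_supp h" by (simp add: B_supp_inv_into[OF h])
      then show ?thesis
        using hg[OF 2] hg[of ?hi] B_supp_not_inv_into[OF g hg[OF 2]] by (simp add: fst_B_mult B_supp_not_apply)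
    next
      case 3
      then show ?thesis
        using B_supp_not_inv_into[OF g] B_supp_not_inv_into[OF h] by (simp add: fst_B_mult B_supp_not_apply)
    qed
  qed
qed

lemma B_supp_conj:
  assumes u: "u \<in> Bc" and g: "g \<in> Bc"
  shows "B_supp (u \<odot> g \<odot> binv u) = snd u ` B_supp g"
proof -
  have *: "B_supp (u \<odot> g \<odot> binv u) \<subseteq> snd u ` B_supp g" if u: "u \<in> Bc" and g: "g \<in> Bc" for u g
  proof
    fix j assume j: "j \<in> B_supp (u \<odot> g \<odot> binv u)"
    define k where "k = inv_into UNIV (snd u) j"
    have jk: "j = snd u k" by (simp add: k_def u)
    have ug: "u \<odot> g \<in> Bc" using u g by simp
    have "k \<in> B_supp g"
    proof (rule ccontr)
      assume k: "k \<notin> B_supp g"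
      have gk: "snd g k = k" "fst g k = 0" using k by (simp_all add: B_supp_not_apply)
      have s: "snd (u \<odot> g) k = j" by (simp add: jk gk)
      have "fst (u \<odot> g \<odot> binv u) j = fst (u \<odot> g) j + fst (binv u) k"
        using fst_B_mult_apply[OF ug, of "binv u" k] s by simp
      also have "fst (u \<odot> g) j = fst u j"
        using fst_B_mult_apply[OF u, of g k] by (simp add: jk gk)
      also have "fst (binv u) k = fst u j" by (simp add: fst_B_inv u jk)
      finally have "fst (u \<odot> g \<odot> binv u) j = 0" by simp
      moreover have "snd (u \<odot> g \<odot> binv u) j = j"
        unfolding jk by (simp add: snd_B_inv u gk)
      ultimately show False using j unfolding B_supp_iff by blast
    qed
    then show "j \<in> snd u ` B_supp g" by (simp add: jk)
  qed
  have "g = binv u \<odot> (u \<odot> g \<odot> binv u) \<odot> binv (binv u)"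
    using u g by (simp add: B.m_assoc)
  then have "B_supp g \<subseteq> snd (binv u) ` B_supp (u \<odot> g \<odot> binv u)"
    using *[of "binv u" "u \<odot> g \<odot> binv u"] u g by simp
  then have "snd u ` B_supp g \<subseteq> snd u ` snd (binv u) ` B_supp (u \<odot> g \<odot> binv u)"
    by (rule image_mono)
  moreover have "snd u ` snd (binv u) ` B_supp (u \<odot> g \<odot> binv u) = B_supp (u \<odot> g \<odot> binv u)"
    by (simp add: image_comp snd_B_inv[OF u] o_def u)
  ultimately show ?thesis using *[OF u g] by auto
qed

text \<open>\<open>binv v \<odot> u\<close> acts trivially on the support of g and so commutes with
  g. The flip that u applies on the way from k is stored in \<open>fst u\<close> at the target
  \<open>snd u k\<close>, whence the form of the hypothesis.\<close>

lemma B_conj_cong: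
  assumes u: "u \<in> Bc" and v: "v \<in> Bc" and g: "g \<in> Bc"
    and ag: "\<And>k. k \<in> B_supp g \<Longrightarrow> snd u k = snd v k \<and> fst u (snd u k) = fst v (snd v k)"
  shows "u \<odot> g \<odot> binv u = v \<odot> g \<odot> binv v"
proof -
  define w where "w = binv v \<odot> u"
  have w: "w \<in> Bc" using u v by (simp add: w_def)
  have "k \<notin> B_supp w" if "k \<in> B_supp g" for k
  proof -
    have s: "snd u k = snd v k" and f: "fst u (snd v k) = fst v (snd v k)" using ag[OF that] by auto
    have "snd w k = k" using s v by (simp add: w_def snd_B_inv)
    moreover have "inv_into UNIV (snd (binv v)) k = snd v k"
      using v by (simp add: snd_B_inv permutes_inv_inv[OF B_permutes])
    then have "fst w k = 0" using f by (simp add: w_def fst_B_mult fst_B_inv v)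
    ultimately show ?thesis by (simp add: B_supp_iff)
  qed
  then have wg: "w \<odot> g = g \<odot> w" using w g by (intro B_commute) auto
  have "u = v \<odot> w" using u v by (simp add: w_def)
  then have "u \<odot> g \<odot> binv u = v \<odot> (w \<odot> g) \<odot> binv w \<odot> binv v"
    using v w g by (simp add: B.m_assoc B.inv_mult_group)
  also have "\<dots> = v \<odot> g \<odot> binv v" unfolding wg using v w g by (simp add: B.m_assoc)
  finally show ?thesis .
qed

lemma B_conj_disjoint:
  assumes "u \<in> Bc" "g \<in> Bc" "B_supp u \<inter> B_supp g = {}"
  shows "u \<odot> g \<odot> binv u = g"
  using B_commute[OF assms] assms by (simp add: B.m_assoc)

lemma B_conj_mult:
  "u \<in> Bc \<Longrightarrow> g \<in> Bc \<Longrightarrow> h \<in> Bc \<Longrightarrow>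
    u \<odot> (g \<odot> h) \<odot> binv u = (u \<odot> g \<odot> binv u) \<odot> (u \<odot> h \<odot> binv u)"
  by (simp add: B.m_assoc)

text \<open>The parts of A and of its image outside each other have equally many elements; any
  bijection between them closes the injection to a permutation.\<close>

lemma bij_extend_permutes:
  assumes A: "finite A" and f: "inj_on f A"
  shows "\<exists>p. p permutes (A \<union> f ` A) \<and> (\<forall>a\<in>A. p a = f a)"
proof -
  have "card (f ` A - A) = card (A - f ` A)"
    using A card_image[OF f] card_Diff_subset_Int[of "f ` A" A] card_Diff_subset_Int[of A "f ` A"]
    by (simp add: Int_commute)
  then obtain h where h: "bij_betw h (f ` A - A) (A - f ` A)"
    using finite_same_card_bij[of "f ` A - A" "A - f ` A"] A by blast
  define p where "p x = (if x \<in> A then f x else if x \<in> f ` A then h x else x)" for x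
  have "bij_betw p A (f ` A)"
    using inj_on_imp_bij_betw[OF f] by (rule bij_betw_cong[THEN iffD1, rotated]) (simp add: p_def)
  moreover have "bij_betw p (f ` A - A) (A - f ` A)"
    using h by (rule bij_betw_cong[THEN iffD1, rotated]) (auto simp: p_def)
  ultimately have "bij_betw p (A \<union> (f ` A - A)) (f ` A \<union> (A - f ` A))"
    by (rule bij_betw_combine) auto
  moreover have "A \<union> (f ` A - A) = A \<union> f ` A" "f ` A \<union> (A - f ` A) = A \<union> f ` A" by auto
  ultimately have "p permutes (A \<union> f ` A)"
    by (intro bij_imp_permutes) (auto simp: p_def)
  then show ?thesis by (intro exI[of _ p]) (auto simp: p_def)
qed

text \<open>A conjugator u is cut down to what it does on the support of x and completed to a
  permutation of both supports, which lie in the tail. So two elements of \<open>Cl_tail N g\<close>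
  differ by a conjugation that stability controls.\<close>

lemma Cl_tail_conj:
  assumes g: "g \<in> Bc" and x: "x \<in> Cl_tail N g" and y: "y \<in> Cl_tail N g"
  shows "\<exists>v\<in>B_tail N. y = v \<odot> x \<odot> binv v"
proof -
  obtain h k where h: "h \<in> Bc" "x = h \<odot> g \<odot> binv h" and k: "k \<in> Bc" "y = k \<odot> g \<odot> binv k"
    using x y by (auto simp: Cl_tail_def conj_class_def)
  define u where "u = k \<odot> binv h"
  have u: "u \<in> Bc" using h k by (simp add: u_def)
  have xc: "x \<in> Bc" and yc: "y \<in> Bc" using h k g by auto
  have yu: "y = u \<odot> x \<odot> binv u"
    using h k g by (simp add: u_def B.m_assoc B.inv_mult_group)
  have sy: "B_supp y = snd u ` B_supp x" unfolding yu by (rule B_supp_conj[OF u xc])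
  have inj: "inj_on (snd u) (B_supp x)" using B_bij[OF u] by (meson bij_is_inj inj_on_subset subset_UNIV)
  obtain p where p: "p permutes (B_supp x \<union> B_supp y)" and pu: "\<And>a. a \<in> B_supp x \<Longrightarrow> p a = snd u a"
    using bij_extend_permutes[OF finite_B_supp[OF xc] inj] unfolding sy by blast
  have tail: "B_supp x \<subseteq> {N+1..}" "B_supp y \<subseteq> {N+1..}" using x y by (auto simp: Cl_tail_def B_tail_def)
  define v where "v = ((\<lambda>i. if i \<in> B_supp y then fst u i else 0), p)"
  have fin: "finite (B_supp x \<union> B_supp y)" using finite_B_supp xc yc by blast
  have sv: "B_supp v \<subseteq> B_supp x \<union> B_supp y"
  proof
    fix k assume "k \<in> B_supp v"
    then have "p k \<noteq> k \<or> k \<in> B_supp y" unfolding B_supp_iff[of k v] by (auto simp: v_def split: if_splits)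
    then show "k \<in> B_supp x \<union> B_supp y" using permutes_not_in[OF p] by blast
  qed
  have "p permutes {1..}" by (rule permutes_subset[OF p]) (use tail in auto)
  moreover have "{i. p i \<noteq> i} \<subseteq> B_supp x \<union> B_supp y" using permutes_not_in[OF p] by blast
  then have "finite {i. p i \<noteq> i}" using fin finite_subset by blast
  moreover have "finite {i. fst v i \<noteq> 0}"
    by (rule finite_subset[OF _ fin]) (auto simp: v_def split: if_splits)
  moreover have "fst v 0 = 0" using tail by (auto simp: v_def)
  ultimately have vc: "v \<in> Bc" by (simp add: B_carrier_iff v_def)
  have "u \<odot> x \<odot> binv u = v \<odot> x \<odot> binv v"
    by (rule B_conj_cong[OF u vc xc]) (auto simp: v_def pu sy)
  moreover have "v \<in> B_tail N" using vc sv tail by (auto simp: B_tail_def)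
  ultimately show ?thesis using yu by blast
qed

section \<open>Flips, transpositions and their products\<close>

lemma fst_bperm [simp]: "fst (bperm s) = (\<lambda>_. 0)" and snd_bperm [simp]: "snd (bperm s) = s"
  by (simp_all add: bperm_def)

lemma bperm_closed:
  assumes "p permutes S" "finite S" "0 \<notin> S"
  shows "bperm p \<in> Bc"
proof -
  have "p permutes {1..}" by (rule permutes_subset[OF assms(1)]) (use assms(3) in \<open>auto simp: Suc_le_eq intro: gr0I\<close>)
  moreover have "{i. p i \<noteq> i} \<subseteq> S" using permutes_not_in[OF assms(1)] by blast
  ultimately show ?thesis using assms(2) finite_subset by (auto simp: B_carrier_iff)
qed

lemma B_supp_bperm: "B_supp (bperm p) = {k. p k \<noteq> k}"
  by (auto simp: B_supp_iff)

lemma btr_closed [simp]: "i \<noteq> 0 \<Longrightarrow> j \<noteq> 0 \<Longrightarrow> btr i j \<in> Bc"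
  unfolding btr_def by (rule bperm_closed[of _ "{i, j}"]) (auto intro: permutes_swap_id)

lemma bflip_closed [simp]: "i \<noteq> 0 \<Longrightarrow> bflip i \<in> Bc"
  by (simp add: B_carrier_iff bflip_def permutes_id)

lemma snd_btr [simp]: "snd (btr i j) = Transposition.transpose i j" and fst_btr [simp]: "fst (btr i j) = (\<lambda>_. 0)"
  by (simp_all add: btr_def)

lemma snd_bflip [simp]: "snd (bflip i) = id" and fst_bflip: "fst (bflip i) k = (if k = i then 1 else 0)"
  by (simp_all add: bflip_def)

lemma B_supp_btr: "B_supp (btr i j) \<subseteq> {i, j}"
  by (auto simp: B_supp_iff Transposition.transpose_def split: if_splits)

lemma B_supp_bflip [simp]: "B_supp (bflip i) = {i}"
  by (auto simp: B_supp_iff fst_bflip split: if_splits)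

lemma bflip_sq: "i \<noteq> 0 \<Longrightarrow> bflip i \<odot> bflip i = \<one>\<^bsub>B_grp\<^esub>"
  by (rule prod_eqI) (auto simp: B_one fst_B_mult fst_bflip inv_id)

lemma btr_sq [simp]: "i \<noteq> 0 \<Longrightarrow> j \<noteq> 0 \<Longrightarrow> btr i j \<odot> btr i j = \<one>\<^bsub>B_grp\<^esub>"
  by (rule prod_eqI) (auto simp: B_one fst_B_mult)

lemma binv_btr [simp]: "i \<noteq> 0 \<Longrightarrow> j \<noteq> 0 \<Longrightarrow> binv (btr i j) = btr i j"
  by (simp add: B.inv_equality)

lemma binv_bflip [simp]: "i \<noteq> 0 \<Longrightarrow> binv (bflip i) = bflip i"
  by (simp add: B.inv_equality bflip_sq)

lemma bperm_conj_btr: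
  assumes "bperm p \<in> Bc" "i \<noteq> 0" "j \<noteq> 0"
  shows "bperm p \<odot> btr i j \<odot> binv (bperm p) = btr (p i) (p j)"
proof (rule prod_eqI)
  have b: "bij p" using B_bij[OF assms(1)] by simp
  show "snd (bperm p \<odot> btr i j \<odot> binv (bperm p)) = snd (btr (p i) (p j))"
    using b B_inv_into[OF assms(1)] by (auto simp: snd_B_inv assms(1) fun_eq_iff Transposition.transpose_def)
  show "fst (bperm p \<odot> btr i j \<odot> binv (bperm p)) = fst (btr (p i) (p j))"
    by (auto simp: fst_B_mult fst_B_inv assms(1))
qed

lemma bperm_conj_bflip:
  assumes "bperm p \<in> Bc" "i \<noteq> 0"
  shows "bperm p \<odot> bflip i \<odot> binv (bperm p) = bflip (p i)"
proof (rule prod_eqI)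
  show "snd (bperm p \<odot> bflip i \<odot> binv (bperm p)) = snd (bflip (p i))"
    using B_inv_into[OF assms(1)] by (auto simp: snd_B_inv assms(1) fun_eq_iff)
  show "fst (bperm p \<odot> bflip i \<odot> binv (bperm p)) = fst (bflip (p i))"
    using B_inv_into[OF assms(1)] by (auto simp: fst_B_mult fst_B_inv assms(1) fun_eq_iff fst_bflip)
qed

lemma B_perm_zero: "g \<in> Bc \<Longrightarrow> snd g i = 0 \<longleftrightarrow> i = 0"
  using B_permutes[of g] B_inj[of g i 0] by (simp add: permutes_def)

text \<open>In a pair the first entry is usually an old letter and the second a fresh one. Repeating
  the same i with different m gives a cycle through i, a star of transpositions; cycles are
  lengthened in this way throughout.\<close>

fun transps :: "(nat \<times> nat) list \<Rightarrow> (nat \<Rightarrow> bit) \<times> (nat \<Rightarrow> nat)" where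
  "transps [] = \<one>\<^bsub>B_grp\<^esub>"
| "transps ((i, m) # l) = btr i m \<odot> transps l"

definition transps_ok :: "(nat \<times> nat) list \<Rightarrow> bool"
  where "transps_ok l \<longleftrightarrow> (\<forall>(i, m)\<in>set l. i \<noteq> 0 \<and> m \<noteq> 0)"

lemma transps_ok_simps [simp]: "transps_ok []" "transps_ok ((i, m) # l) \<longleftrightarrow> i \<noteq> 0 \<and> m \<noteq> 0 \<and> transps_ok l"
    "transps_ok (l @ l') \<longleftrightarrow> transps_ok l \<and> transps_ok l'" "transps_ok (rev l) \<longleftrightarrow> transps_ok l"
  by (auto simp: transps_ok_def)

lemma transps_closed [simp]: "transps_ok l \<Longrightarrow> transps l \<in> Bc"
  by (induction l rule: transps.induct) auto

lemma transps_append: "transps_ok l \<Longrightarrow> transps_ok l' \<Longrightarrow> transps (l @ l') = transps l \<odot> transps l'"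
  by (induction l rule: transps.induct) (auto simp: B.m_assoc)

lemma transps_inv: "transps_ok l \<Longrightarrow> binv (transps l) = transps (rev l)"
  by (induction l rule: transps.induct) (auto simp: B.inv_mult_group transps_append)

lemma B_supp_transps: "transps_ok l \<Longrightarrow> B_supp (transps l) \<subseteq> fst ` set l \<union> snd ` set l"
proof (induction l rule: transps.induct)
  case (2 i m l)
  then have "B_supp (transps ((i, m) # l)) \<subseteq> B_supp (btr i m) \<union> B_supp (transps l)"
    using B_supp_mult[of "btr i m" "transps l"] by simp
  then show ?case using 2 B_supp_btr[of i m] by auto
qed simp

lemma transps_conj:
  assumes p: "bperm p \<in> Bc" and l: "transps_ok l"
  shows "bperm p \<odot> transps l \<odot> binv (bperm p) = transps (map (map_prod p p) l)"
  using l
proof (induction l rule: transps.induct)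
  case (2 i m l)
  then have "bperm p \<odot> transps ((i, m) # l) \<odot> binv (bperm p)
      = (bperm p \<odot> btr i m \<odot> binv (bperm p)) \<odot> (bperm p \<odot> transps l \<odot> binv (bperm p))"
    using p by (simp add: B_conj_mult)
  then show ?case using 2 p by (simp add: bperm_conj_btr)
qed (use p in simp)

section \<open>The asymptotic character\<close>

lemma Cl_tail_antimono: "m \<le> n \<Longrightarrow> Cl_tail n g \<subseteq> Cl_tail m g"
  by (auto simp: Cl_tail_def B_tail_def)

lemma Cl_tail_closed: "x \<in> Cl_tail n g \<Longrightarrow> x \<in> Bc"
  by (simp add: Cl_tail_def B_tail_def)

text \<open>An element whose support lies beyond all supports in F commutes with F, so
  \<open>stable_rep_uniform\<close> covers it.\<close>

lemma stable_rep_tail_uniform: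
  fixes \<pi> :: "(nat \<Rightarrow> bit) \<times> (nat \<Rightarrow> nat) \<Rightarrow> 'h::complex_hilbert \<Rightarrow> 'h"
  assumes "stable_rep B_grp \<pi>" "\<epsilon> > 0"
  shows "\<exists>N. \<forall>h\<in>B_tail N. \<forall>x\<in>Bc. cmod (cinner (\<pi> (h \<odot> x \<odot> binv h) \<eta>) \<eta> - cinner (\<pi> x \<eta>) \<eta>) < \<epsilon>"
proof -
  obtain F where F: "finite F" "F \<subseteq> Bc"
    and u: "\<And>h x. h \<in> Bc \<Longrightarrow> (\<forall>g\<in>F. h \<odot> g \<odot> binv h = g) \<Longrightarrow> x \<in> Bc \<Longrightarrow>
      cmod (cinner (\<pi> (h \<odot> x \<odot> binv h) \<eta>) \<eta> - cinner (\<pi> x \<eta>) \<eta>) < \<epsilon>"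
    using stable_rep_uniform[OF group_B_grp assms, of \<eta>] by blast
  have "finite (\<Union>g\<in>F. B_supp g)" using F finite_B_supp by (intro finite_UN_I) auto
  then obtain N where N: "\<forall>k\<in>(\<Union>g\<in>F. B_supp g). k \<le> N"
    unfolding finite_nat_set_iff_bounded_le by (elim exE)
  have "h \<odot> g \<odot> binv h = g" if "h \<in> B_tail N" "g \<in> F" for h g
  proof (rule B_conj_disjoint)
    show "B_supp h \<inter> B_supp g = {}" using that N by (fastforce simp: B_tail_def)
  qed (use that F in \<open>auto simp: B_tail_def\<close>)
  then show ?thesis using u by (intro exI[of _ N]) (auto simp: B_tail_def)
qed

text \<open>The shift is not a finite permutation; only its effect on the first M letters is
  kept.\<close>

lemma bperm_shift:
  "\<exists>p. bperm p \<in> Bc \<and> (\<forall>k\<in>{1..M}. p k = k + n)"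
proof -
  obtain p where p: "p permutes ({1..M} \<union> (\<lambda>k. k + n) ` {1..M})" "\<forall>k\<in>{1..M}. p k = k + n"
    using bij_extend_permutes[of "{1..M}" "\<lambda>k. k + n"] by auto
  have "bperm p \<in> Bc" by (rule bperm_closed[OF p(1)]) auto
  then show ?thesis using p(2) by blast
qed

lemma B_supp_bounded: "finite S \<Longrightarrow> S \<subseteq> Bc \<Longrightarrow> \<exists>M. \<forall>g\<in>S. B_supp g \<subseteq> {1..M}"
proof -
  assume S: "finite S" "S \<subseteq> Bc"
  then have "finite (\<Union>g\<in>S. B_supp g)" using finite_B_supp by (intro finite_UN_I) auto
  then obtain M where M: "\<forall>k\<in>(\<Union>g\<in>S. B_supp g). k \<le> M"
    unfolding finite_nat_set_iff_bounded_le by (elim exE)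
  have "k \<in> {1..M}" if "g \<in> S" "k \<in> B_supp g" for g k
    using M that zero_notin_B_supp[of g] S(2) by (cases "k = 0") auto
  then show ?thesis by blast
qed

lemma conj_class_conj:
  assumes u: "u \<in> Bc" and g: "g \<in> Bc"
  shows "conj_class B_grp (u \<odot> g \<odot> binv u) = conj_class B_grp g"
proof -
  have *: "conj_class B_grp (u \<odot> g \<odot> binv u) \<subseteq> conj_class B_grp g" if "u \<in> Bc" "g \<in> Bc" for u g
  proof
    fix x assume "x \<in> conj_class B_grp (u \<odot> g \<odot> binv u)"
    then obtain h where h: "h \<in> Bc" "x = h \<odot> (u \<odot> g \<odot> binv u) \<odot> binv h" by (auto simp: conj_class_def)
    then have "x = (h \<odot> u) \<odot> g \<odot> binv (h \<odot> u)" using that by (simp add: B.inv_mult_group B.m_assoc)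
    then show "x \<in> conj_class B_grp g" using h that unfolding conj_class_def by blast
  qed
  have "binv u \<odot> (u \<odot> g \<odot> binv u) \<odot> binv (binv u) = g" using u g by (simp add: B.m_assoc)
  then show ?thesis using *[OF u g] *[of "binv u" "u \<odot> g \<odot> binv u"] u g by auto
qed

lemma conj_shift_Cl_tail:
  assumes g: "g \<in> Bc" and s: "B_supp g \<subseteq> {1..M}" and p: "bperm p \<in> Bc" "\<forall>k\<in>{1..M}. p k = k + n"
  shows "bperm p \<odot> g \<odot> binv (bperm p) \<in> Cl_tail n g"
proof -
  have "B_supp (bperm p \<odot> g \<odot> binv (bperm p)) = p ` B_supp g" using B_supp_conj[OF p(1) g] by simp
  also have "\<dots> \<subseteq> {n + 1..}" using s p(2) by auto
  finally have "B_supp (bperm p \<odot> g \<odot> binv (bperm p)) \<subseteq> {n + 1..}" .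
  moreover have "bperm p \<odot> g \<odot> binv (bperm p) \<in> conj_class B_grp g"
    using p(1) unfolding conj_class_def by blast
  ultimately show ?thesis using g p(1) by (simp add: Cl_tail_def B_tail_def)
qed

section \<open>The scalar weak limit\<close>

locale stable_factor_rep =
  fixes \<pi> :: "(nat \<Rightarrow> bit) \<times> (nat \<Rightarrow> nat) \<Rightarrow> 'h::complex_hilbert \<Rightarrow> 'h"
  assumes stable: "stable_rep B_grp \<pi>" and factor: "factor_rep B_grp \<pi>"
begin

sublocale unitary_representation B_grp \<pi>
  using stable group_B_grp
  by (simp add: unitary_representation_def unitary_representation_axioms_def stable_rep_def)

lemma Cl_tail_Cauchy:
  assumes g: "g \<in> Bc" and e: "\<epsilon> > 0"
  shows "\<exists>N. \<forall>x\<in>Cl_tail N g. \<forall>y\<in>Cl_tail N g. cmod (cinner (\<pi> y \<eta>) \<eta> - cinner (\<pi> x \<eta>) \<eta>) < \<epsilon>"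
proof -
  obtain N where N: "\<forall>h\<in>B_tail N. \<forall>x\<in>Bc. cmod (cinner (\<pi> (h \<odot> x \<odot> binv h) \<eta>) \<eta> - cinner (\<pi> x \<eta>) \<eta>) < \<epsilon>"
    using stable_rep_tail_uniform[OF stable e] by blast
  have "cmod (cinner (\<pi> y \<eta>) \<eta> - cinner (\<pi> x \<eta>) \<eta>) < \<epsilon>" if x: "x \<in> Cl_tail N g" and y: "y \<in> Cl_tail N g" for x y
  proof -
    obtain v where "v \<in> B_tail N" "y = v \<odot> x \<odot> binv v" using Cl_tail_conj[OF g x y] by blast
    then show ?thesis using N Cl_tail_closed[OF x] by blast
  qed
  then show ?thesis by blast
qed

text \<open>A reference sequence to which every other one is compared. It depends on g only through
  its conjugacy class, which makes \<open>chi\<close> invariant under conjugation.\<close>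

definition Cl_seq :: "(nat \<Rightarrow> bit) \<times> (nat \<Rightarrow> nat) \<Rightarrow> nat \<Rightarrow> (nat \<Rightarrow> bit) \<times> (nat \<Rightarrow> nat)"
  where "Cl_seq g n = (SOME x. x \<in> Cl_tail n g)"

lemma Cl_seq: "g \<in> Bc \<Longrightarrow> Cl_seq g n \<in> Cl_tail n g"
  unfolding Cl_seq_def using Cl_tail_nonempty by (meson ex_in_conv someI_ex)

lemma Cl_tail_diff_tendsto:
  assumes g: "g \<in> Bc" and gs: "\<forall>n\<ge>1. gs n \<in> Cl_tail n g"
  shows "(\<lambda>n. cinner (\<pi> (gs n) \<eta>) \<eta> - cinner (\<pi> (Cl_seq g n) \<eta>) \<eta>) \<longlonglongrightarrow> 0"
proof (rule LIMSEQ_I)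
  fix r :: real assume "0 < r"
  from Cl_tail_Cauchy[OF g this, of \<eta>] obtain N where
    N: "\<forall>x\<in>Cl_tail N g. \<forall>y\<in>Cl_tail N g. cmod (cinner (\<pi> y \<eta>) \<eta> - cinner (\<pi> x \<eta>) \<eta>) < r" by blast
  have "norm (cinner (\<pi> (gs n) \<eta>) \<eta> - cinner (\<pi> (Cl_seq g n) \<eta>) \<eta> - 0) < r" if "n \<ge> max 1 N" for n
    using N gs Cl_seq[OF g, of n] Cl_tail_antimono[of N n g] that by auto
  then show "\<exists>no. \<forall>n\<ge>no. norm (cinner (\<pi> (gs n) \<eta>) \<eta> - cinner (\<pi> (Cl_seq g n) \<eta>) \<eta> - 0) < r" by blast
qed

lemma Cl_seq_convergent_diag:
  assumes g: "g \<in> Bc"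
  shows "convergent (\<lambda>n. cinner (\<pi> (Cl_seq g n) \<eta>) \<eta>)"
proof -
  have "Cauchy (\<lambda>n. cinner (\<pi> (Cl_seq g n) \<eta>) \<eta>)"
  proof (rule metric_CauchyI)
    fix e :: real assume "0 < e"
    from Cl_tail_Cauchy[OF g this, of \<eta>] obtain N where
      N: "\<forall>x\<in>Cl_tail N g. \<forall>y\<in>Cl_tail N g. cmod (cinner (\<pi> y \<eta>) \<eta> - cinner (\<pi> x \<eta>) \<eta>) < e" by blast
    have "dist (cinner (\<pi> (Cl_seq g m) \<eta>) \<eta>) (cinner (\<pi> (Cl_seq g n) \<eta>) \<eta>) < e" if "m \<ge> N" "n \<ge> N" for m n
      using N Cl_seq[OF g, of n] Cl_seq[OF g, of m] Cl_tail_antimono[of N n g] Cl_tail_antimono[of N m g] that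
      unfolding dist_norm by blast
    then show "\<exists>M. \<forall>m\<ge>M. \<forall>n\<ge>M. dist (cinner (\<pi> (Cl_seq g m) \<eta>) \<eta>) (cinner (\<pi> (Cl_seq g n) \<eta>) \<eta>) < e" by blast
  qed
  then show ?thesis by (rule Cauchy_convergent)
qed

lemma tendsto_polarization:
  assumes T: "\<And>n. bounded_clinear (T n)"
    and lim: "\<And>\<eta>. (\<lambda>n. cinner (T n \<eta>) \<eta>) \<longlonglongrightarrow> q \<eta>"
  shows "(\<lambda>n. cinner (T n x) (y::'h)) \<longlonglongrightarrow> (q (x + y) - q (x - y)
    + \<i> * q (x + \<i> *\<^sub>C y) - \<i> * q (x - \<i> *\<^sub>C y)) / 4"
  by (subst cinner_polarization[OF T]) (intro tendsto_intros lim; simp)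

lemma Cl_seq_rep: "g \<in> Bc \<Longrightarrow> bounded_clinear (\<pi> (Cl_seq g n))"
  using rep_clinear Cl_tail_closed Cl_seq by blast

text \<open>Stability makes the diagonal coefficients converge and polarization gives the others;
  the limit form has bound 1 because the approximating operators are unitary.\<close>

lemma weak_limit_exists:
  assumes g: "g \<in> Bc"
  shows "\<exists>L. bounded_clinear L \<and> (\<forall>x y. (\<lambda>n. cinner (\<pi> (Cl_seq g n) x) y) \<longlonglongrightarrow> cinner (L x) y)"
proof -
  have c: "Cl_seq g n \<in> Bc" for n using Cl_seq[OF g] Cl_tail_closed by blast
  define q where "q \<eta> = lim (\<lambda>n. cinner (\<pi> (Cl_seq g n) \<eta>) \<eta>)" for \<eta>
  have q: "(\<lambda>n. cinner (\<pi> (Cl_seq g n) \<eta>) \<eta>) \<longlonglongrightarrow> q \<eta>" for \<eta>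
    unfolding q_def using Cl_seq_convergent_diag[OF g] by (simp add: convergent_LIMSEQ_iff)
  define b where "b x y = lim (\<lambda>n. cinner (\<pi> (Cl_seq g n) x) y)" for x y
  have b: "(\<lambda>n. cinner (\<pi> (Cl_seq g n) x) y) \<longlonglongrightarrow> b x y" for x y
    unfolding b_def using tendsto_polarization[OF Cl_seq_rep[OF g] q, of x y]
    by (metis convergentI convergent_LIMSEQ_iff)
  have "\<exists>L. bounded_clinear L \<and> (\<forall>x y. cinner (L x) y = b x y)"
  proof (rule sesquilinear_operator)
    fix x y z :: 'h and c' :: complex
    show "b (x + y) z = b x z + b y z"
    proof (rule LIMSEQ_unique[OF b])
      show "(\<lambda>n. cinner (\<pi> (Cl_seq g n) (x + y)) z) \<longlonglongrightarrow> b x z + b y z"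
        using tendsto_add[OF b b, of x z y z] by (simp add: rep_add c cinner_add_left)
    qed
    show "b (c' *\<^sub>C x) z = c' * b x z"
    proof (rule LIMSEQ_unique[OF b])
      show "(\<lambda>n. cinner (\<pi> (Cl_seq g n) (c' *\<^sub>C x)) z) \<longlonglongrightarrow> c' * b x z"
        using tendsto_mult_left[OF b, of c' x z] by (simp add: rep_scaleC c cinner_scaleC_left)
    qed
    show "b x (y + z) = b x y + b x z"
    proof (rule LIMSEQ_unique[OF b])
      show "(\<lambda>n. cinner (\<pi> (Cl_seq g n) x) (y + z)) \<longlonglongrightarrow> b x y + b x z"
        using tendsto_add[OF b b, of x y x z] by (simp add: cinner_add_right)
    qed
    show "b x (c' *\<^sub>C z) = cnj c' * b x z"
    proof (rule LIMSEQ_unique[OF b])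
      show "(\<lambda>n. cinner (\<pi> (Cl_seq g n) x) (c' *\<^sub>C z)) \<longlonglongrightarrow> cnj c' * b x z"
        using tendsto_mult_left[OF b, of "cnj c'" x z] by (simp add: cinner_scaleC_right)
    qed
    show "cmod (b x y) \<le> 1 * norm x * norm y"
    proof (rule LIMSEQ_le_const2[OF tendsto_norm[OF b]], intro exI allI impI)
      fix n
      show "cmod (cinner (\<pi> (Cl_seq g n) x) y) \<le> 1 * norm x * norm y"
        using cinner_Cauchy_Schwarz[of "\<pi> (Cl_seq g n) x" y] by (simp add: rep_norm c)
    qed
  qed simp
  then show ?thesis using b by metis
qed

text \<open>The limit L commutes with each \<open>\<pi> h\<close> because eventually
  \<open>Cl_seq g n\<close> and h have disjoint supports, and with the commutant because every
  \<open>\<pi> (Cl_seq g n)\<close> does. So L lies in the centre of the factor.\<close>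

lemma weak_limit_scalar:
  assumes g: "g \<in> Bc"
  shows "\<exists>a. \<forall>x y. (\<lambda>n. cinner (\<pi> (Cl_seq g n) x) y) \<longlonglongrightarrow> a * cinner x y"
proof -
  have c: "Cl_seq g n \<in> Bc" for n using Cl_seq[OF g] Cl_tail_closed by blast
  obtain L where L: "bounded_clinear L" and lim: "\<And>x y. (\<lambda>n. cinner (\<pi> (Cl_seq g n) x) y) \<longlonglongrightarrow> cinner (L x) y"
    using weak_limit_exists[OF g] by blast
  define S where "S = commutant (\<pi> ` Bc)"
  have 1: "L \<in> S"
  proof -
    have "L (\<pi> h x) = \<pi> h (L x)" if h: "h \<in> Bc" for h x
    proof (rule cinner_eqI)
      fix y
      obtain N where N: "\<forall>k\<in>B_supp h. k \<le> N"
        using finite_B_supp[OF h] unfolding finite_nat_set_iff_bounded_le by (elim exE)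
      have "cinner (\<pi> (Cl_seq g n) (\<pi> h x)) y = cinner (\<pi> (Cl_seq g n) x) (\<pi> (binv h) y)" if "n \<ge> N" for n
      proof -
        have "B_supp (Cl_seq g n) \<inter> B_supp h = {}"
          using N that Cl_seq[OF g, of n] by (fastforce simp: Cl_tail_def B_tail_def)
        then have "Cl_seq g n \<odot> h = h \<odot> Cl_seq g n" using B_commute[OF c h] by blast
        then have "\<pi> (Cl_seq g n) (\<pi> h x) = \<pi> h (\<pi> (Cl_seq g n) x)"
          using mult[OF c h] mult[OF h c] by metis
        then show ?thesis by (simp add: rep_adjoint[OF h])
      qed
      then have "eventually (\<lambda>n. cinner (\<pi> (Cl_seq g n) (\<pi> h x)) y = cinner (\<pi> (Cl_seq g n) x) (\<pi> (binv h) y)) sequentially"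
        unfolding eventually_sequentially by blast
      then have "(\<lambda>n. cinner (\<pi> (Cl_seq g n) (\<pi> h x)) y) \<longlonglongrightarrow> cinner (L x) (\<pi> (binv h) y)"
        using lim by (simp add: tendsto_cong)
      then have "cinner (L (\<pi> h x)) y = cinner (L x) (\<pi> (binv h) y)"
        by (rule LIMSEQ_unique[OF lim])
      then show "cinner (L (\<pi> h x)) y = cinner (\<pi> h (L x)) y" by (simp add: rep_adjoint[OF h])
    qed
    then show ?thesis using L by (auto simp: S_def commutant_def)
  qed
  have 2: "L \<in> commutant S"
  proof -
    have "L (T x) = T (L x)" if T: "T \<in> S" for T x
    proof (rule cinner_eqI)
      fix y
      have Tb: "bounded_clinear T" using T by (simp add: S_def commutant_def)
      have "T \<circ> \<pi> (Cl_seq g n) = \<pi> (Cl_seq g n) \<circ> T" for n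
        using T c unfolding S_def commutant_def by blast
      then have "T (\<pi> (Cl_seq g n) x) = \<pi> (Cl_seq g n) (T x)" for n by (metis comp_apply)
      then have "(\<lambda>n. cinner (\<pi> (Cl_seq g n) (T x)) y) \<longlonglongrightarrow> cinner (T (L x)) y"
        using wot_tendsto_bounded_clinear[OF Tb lim, of x y] by simp
      then show "cinner (L (T x)) y = cinner (T (L x)) y" by (rule LIMSEQ_unique[OF lim])
    qed
    then show ?thesis using L by (auto simp: commutant_def)
  qed
  have "L \<circ> A = A \<circ> L" if "A \<in> commutant S" for A using that 1 by (auto simp: commutant_def)
  then have "L \<in> commutant (commutant S)" using L by (simp add: commutant_def[of "commutant S"])
  moreover have "commutant S \<inter> commutant (commutant S) = range (\<lambda>c x. c *\<^sub>C x)"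
    using factor by (simp add: factor_rep_def is_factor_def S_def)
  ultimately obtain a where "L = (\<lambda>x. a *\<^sub>C x)" using 2 by auto
  then show ?thesis using lim by (metis cinner_scaleC_left)
qed

definition chi :: "(nat \<Rightarrow> bit) \<times> (nat \<Rightarrow> nat) \<Rightarrow> complex"
  where "chi g = (SOME a. \<forall>x y. (\<lambda>n. cinner (\<pi> (Cl_seq g n) x) y) \<longlonglongrightarrow> a * cinner x y)"

lemma chi_lim:
  assumes g: "g \<in> Bc" and gs: "\<forall>n\<ge>1. gs n \<in> Cl_tail n g"
  shows "(\<lambda>n. cinner (\<pi> (gs n) x) y) \<longlonglongrightarrow> chi g * cinner x y"
proof -
  have 1: "(\<lambda>n. cinner (\<pi> (Cl_seq g n) x) y) \<longlonglongrightarrow> chi g * cinner x y" for x y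
    unfolding chi_def using someI_ex[OF weak_limit_scalar[OF g]] by blast
  have "(\<lambda>n. cinner (\<pi> (gs n) \<eta>) \<eta>) \<longlonglongrightarrow> chi g * cinner \<eta> \<eta>" for \<eta>
    using tendsto_add[OF Cl_tail_diff_tendsto[OF g gs, of \<eta>] 1[of \<eta> \<eta>]] by simp
  \<comment> \<open>The entry \<open>gs 0\<close> is unconstrained and may lie outside the group, so
    linearity of the operators is available only for the shifted sequence.\<close>
  then have d: "(\<lambda>n. cinner (\<pi> (gs (Suc n)) \<eta>) \<eta>) \<longlonglongrightarrow> chi g * cinner \<eta> \<eta>" for \<eta>
    by (rule LIMSEQ_Suc)
  have b: "bounded_clinear (\<pi> (gs (Suc n)))" for n
  proof -
    have "gs (Suc n) \<in> Cl_tail (Suc n) g" using gs by simp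
    then show ?thesis by (rule rep_clinear[OF Cl_tail_closed])
  qed
  have bs: "bounded_clinear (\<lambda>x::'h. chi g *\<^sub>C x)"
    by (rule bounded_clinearI[where K = "cmod (chi g)"])
      (simp_all add: scaleC_add_right scaleC_scaleC mult.commute norm_scaleC)
  have "(\<lambda>n. cinner (\<pi> (gs (Suc n)) x) y) \<longlonglongrightarrow> cinner (chi g *\<^sub>C x) y"
    using tendsto_polarization[OF b d, of x y] cinner_polarization[OF bs, of x y]
    unfolding cinner_scaleC_left by (simp only:)
  then show ?thesis by (simp add: cinner_scaleC_left filterlim_sequentially_Suc[of "\<lambda>n. cinner (\<pi> (gs n) x) y"])
qed

lemma chi_wot_limit:
  assumes "g \<in> Bc" "\<forall>n\<ge>1. gs n \<in> Cl_tail n g"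
  shows "wot_limit (\<lambda>n. \<pi> (gs n)) (\<lambda>\<xi>. chi g *\<^sub>C \<xi>)"
  unfolding wot_limit_def using chi_lim[OF assms] by (simp add: cinner_scaleC_left)

lemma unit_vector: "\<exists>\<eta>::'h. cinner \<eta> \<eta> = 1"
proof -
  have "(id :: 'h \<Rightarrow> 'h) \<noteq> (\<lambda>x. 0)" using factor by (simp add: factor_rep_def is_factor_def)
  then obtain x :: 'h where "x \<noteq> 0" by fastforce
  then show ?thesis by (intro exI[of _ "(1 / norm x) *\<^sub>R x"]) (simp add: cinner_self)
qed

lemma chi_conj:
  assumes u: "u \<in> Bc" and g: "g \<in> Bc"
  shows "chi (u \<odot> g \<odot> binv u) = chi g"
proof -
  have "Cl_tail n (u \<odot> g \<odot> binv u) = Cl_tail n g" for n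
    by (simp add: Cl_tail_def conj_class_conj[OF u g])
  then show ?thesis by (simp add: chi_def Cl_seq_def)
qed

text \<open>An iterated limit: for fixed n and m to infinity the coefficient of
  \<open>x n \<odot> y m\<close> tends to \<open>chi h\<close> times that of \<open>x n\<close>, and
  then n tends to infinity. The uniform Cauchy estimate on \<open>Cl_tail\<close> shows that the
  result is also \<open>chi (g \<odot> h)\<close>.\<close>

lemma chi_mult:
  assumes g: "g \<in> Bc" and h: "h \<in> Bc" and d: "B_supp g \<inter> B_supp h = {}"
  shows "chi (g \<odot> h) = chi g * chi h"
proof -
  obtain \<eta> :: 'h where \<eta>: "cinner \<eta> \<eta> = 1" using unit_vector by blast
  obtain M where M: "B_supp g \<subseteq> {1..M}" "B_supp h \<subseteq> {1..M}"
    using B_supp_bounded[of "{g, h}"] g h by auto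
  obtain P where P: "\<And>n. bperm (P n) \<in> Bc" "\<And>n. \<forall>k\<in>{1..M}. P n k = k + n"
    using bperm_shift by metis
  define x where "x n = bperm (P n) \<odot> g \<odot> binv (bperm (P n))" for n
  define y where "y n = bperm (P n) \<odot> h \<odot> binv (bperm (P n))" for n
  have x: "x n \<in> Cl_tail n g" and y: "y n \<in> Cl_tail n h" for n
    unfolding x_def y_def using conj_shift_Cl_tail[OF g M(1) P] conj_shift_Cl_tail[OF h M(2) P] by auto
  have xc: "x n \<in> Bc" and yc: "y n \<in> Bc" for n using x y Cl_tail_closed by blast+
  \<comment> \<open>For m at least n + M the two shifted copies do not overlap, so a single
    permutation p carries g to \<open>x n\<close> and h to \<open>y m\<close>.\<close>
  have xy: "x n \<odot> y m \<in> Cl_tail n (g \<odot> h)" if nm: "n + M \<le> m" for n m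
  proof -
    define f where "f k = (if k \<in> B_supp g then k + n else k + m)" for k
    let ?A = "B_supp g \<union> B_supp h"
    have fin: "finite ?A" using finite_B_supp g h by blast
    have inj: "inj_on f ?A"
    proof (rule inj_onI)
      fix a b assume "a \<in> ?A" "b \<in> ?A" "f a = f b"
      then show "a = b" using M nm by (fastforce simp: f_def split: if_splits)
    qed
    obtain p where p: "p permutes (?A \<union> f ` ?A)" and pf: "\<forall>a\<in>?A. p a = f a"
      using bij_extend_permutes[OF fin inj] by blast
    have z: "0 \<notin> ?A \<union> f ` ?A" using zero_notin_B_supp[OF g] zero_notin_B_supp[OF h] by (auto simp: f_def)
    have pc: "bperm p \<in> Bc" by (rule bperm_closed[OF p _ z]) (use fin in auto)
    have "bperm p \<odot> g \<odot> binv (bperm p) = x n"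
      unfolding x_def by (rule B_conj_cong[OF pc P(1) g]) (use pf P(2) M in \<open>auto simp: f_def\<close>)
    moreover have "bperm p \<odot> h \<odot> binv (bperm p) = y m"
      unfolding y_def
    proof (rule B_conj_cong[OF pc P(1) h])
      fix k assume k: "k \<in> B_supp h"
      then have "k \<notin> B_supp g" using d by blast
      then show "snd (bperm p) k = snd (bperm (P m)) k \<and>
          fst (bperm p) (snd (bperm p) k) = fst (bperm (P m)) (snd (bperm (P m)) k)"
        using k pf P(2)[of m] M by (auto simp: f_def)
    qed
    ultimately have "x n \<odot> y m = bperm p \<odot> (g \<odot> h) \<odot> binv (bperm p)"
      using B_conj_mult[OF pc g h] by simp
    then have "x n \<odot> y m \<in> conj_class B_grp (g \<odot> h)" using pc unfolding conj_class_def by blast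
    moreover have "B_supp (x n \<odot> y m) \<subseteq> {n + 1..}"
      using B_supp_mult[OF xc, of n "y m"] x[of n] y[of m] nm by (fastforce simp: Cl_tail_def B_tail_def)
    ultimately show ?thesis using xc yc by (simp add: Cl_tail_def B_tail_def)
  qed
  have gh: "g \<odot> h \<in> Bc" using g h by simp
  have lim_y: "(\<lambda>m. cinner (\<pi> (x n \<odot> y m) \<eta>) \<eta>) \<longlonglongrightarrow> chi h * cinner (\<pi> (x n) \<eta>) \<eta>" for n
  proof -
    have "(\<lambda>m. cinner (\<pi> (y m) \<eta>) (\<pi> (binv (x n)) \<eta>)) \<longlonglongrightarrow> chi h * cinner \<eta> (\<pi> (binv (x n)) \<eta>)"
      by (rule chi_lim[OF h]) (simp add: y)
    then show ?thesis by (simp add: mult xc yc rep_adjoint)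
  qed
  have lim_x: "(\<lambda>n. chi h * cinner (\<pi> (x n) \<eta>) \<eta>) \<longlonglongrightarrow> chi h * (chi g * cinner \<eta> \<eta>)"
    by (intro tendsto_mult tendsto_const chi_lim[OF g]) (simp add: x)
  have "(\<lambda>n. chi h * cinner (\<pi> (x n) \<eta>) \<eta>) \<longlonglongrightarrow> chi (g \<odot> h)"
  proof (rule LIMSEQ_I)
    fix r :: real assume r: "0 < r"
    from Cl_tail_Cauchy[OF gh, of "r / 3" \<eta>] r obtain N where
      N: "\<forall>a\<in>Cl_tail N (g \<odot> h). \<forall>b\<in>Cl_tail N (g \<odot> h). cmod (cinner (\<pi> b \<eta>) \<eta> - cinner (\<pi> a \<eta>) \<eta>) < r / 3" by auto
    have near: "cmod (cinner (\<pi> b \<eta>) \<eta> - chi (g \<odot> h)) \<le> r / 3" if b: "b \<in> Cl_tail N (g \<odot> h)" for b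
    proof -
      have "(\<lambda>n. cinner (\<pi> (Cl_seq (g \<odot> h) n) \<eta>) \<eta>) \<longlonglongrightarrow> chi (g \<odot> h) * cinner \<eta> \<eta>"
        by (rule chi_lim[OF gh]) (simp add: Cl_seq[OF gh])
      then have "(\<lambda>n. cmod (cinner (\<pi> b \<eta>) \<eta> - cinner (\<pi> (Cl_seq (g \<odot> h) n) \<eta>) \<eta>)) \<longlonglongrightarrow> cmod (cinner (\<pi> b \<eta>) \<eta> - chi (g \<odot> h))"
        unfolding \<eta> mult_1_right by (intro tendsto_intros)
      then show ?thesis
      proof (rule LIMSEQ_le_const2, intro exI allI impI)
        fix n assume "n \<ge> N"
        then have "Cl_seq (g \<odot> h) n \<in> Cl_tail N (g \<odot> h)"
          using Cl_seq[OF gh, of n] Cl_tail_antimono[of N n] by blast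
        then show "cmod (cinner (\<pi> b \<eta>) \<eta> - cinner (\<pi> (Cl_seq (g \<odot> h) n) \<eta>) \<eta>) \<le> r / 3"
          using N b less_imp_le by blast
      qed
    qed
    have "norm (chi h * cinner (\<pi> (x n) \<eta>) \<eta> - chi (g \<odot> h)) < r" if n: "n \<ge> N" for n
    proof -
      have "(\<lambda>m. cmod (cinner (\<pi> (x n \<odot> y m) \<eta>) \<eta> - chi (g \<odot> h))) \<longlonglongrightarrow> cmod (chi h * cinner (\<pi> (x n) \<eta>) \<eta> - chi (g \<odot> h))"
        by (intro tendsto_intros lim_y)
      then have "cmod (chi h * cinner (\<pi> (x n) \<eta>) \<eta> - chi (g \<odot> h)) \<le> r / 3"
      proof (rule LIMSEQ_le_const2, intro exI allI impI)
        fix m assume "m \<ge> n + M"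
        then have "x n \<odot> y m \<in> Cl_tail N (g \<odot> h)" using xy[of n m] Cl_tail_antimono[OF n] by blast
        then show "cmod (cinner (\<pi> (x n \<odot> y m) \<eta>) \<eta> - chi (g \<odot> h)) \<le> r / 3" by (rule near)
      qed
      then show ?thesis using r by simp
    qed
    then show "\<exists>no. \<forall>n\<ge>no. norm (chi h * cinner (\<pi> (x n) \<eta>) \<eta> - chi (g \<odot> h)) < r" by blast
  qed
  from LIMSEQ_unique[OF this lim_x] show ?thesis by (simp add: \<eta> mult.commute)
qed

lemma chi_one: "chi \<one>\<^bsub>B_grp\<^esub> = 1"
proof -
  obtain \<eta> :: 'h where \<eta>: "cinner \<eta> \<eta> = 1" using unit_vector by blast
  have "\<one>\<^bsub>B_grp\<^esub> = \<one>\<^bsub>B_grp\<^esub> \<odot> \<one>\<^bsub>B_grp\<^esub> \<odot> binv \<one>\<^bsub>B_grp\<^esub>" by simp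
  then have "\<one>\<^bsub>B_grp\<^esub> \<in> conj_class B_grp \<one>\<^bsub>B_grp\<^esub>" unfolding conj_class_def using B.one_closed by blast
  then have "\<forall>n\<ge>1. \<one>\<^bsub>B_grp\<^esub> \<in> Cl_tail n \<one>\<^bsub>B_grp\<^esub>" by (simp add: Cl_tail_def B_tail_def)
  from chi_lim[OF B.one_closed this, of \<eta> \<eta>] show ?thesis by (simp add: \<eta> LIMSEQ_const_iff)
qed

text \<open>One permutation shifts all of S, so quotients of shifted elements are shifted quotients,
  and each approximating sum is the square norm of one vector.\<close>

lemma chi_positive_definite: "positive_definite B_grp chi"
  unfolding positive_definite_def
proof (intro allI impI)
  fix S and c :: "_ \<Rightarrow> complex" assume S: "finite S \<and> S \<subseteq> Bc"
  obtain \<eta> :: 'h where \<eta>: "cinner \<eta> \<eta> = 1" using unit_vector by blast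
  obtain M where M: "\<And>g. g \<in> S \<Longrightarrow> B_supp g \<subseteq> {1..M}" using B_supp_bounded S by metis
  obtain P where P: "\<And>n. bperm (P n) \<in> Bc" "\<And>n. \<forall>k\<in>{1..M}. P n k = k + n"
    using bperm_shift by metis
  define t where "t n g = bperm (P n) \<odot> g \<odot> binv (bperm (P n))" for n g
  have tc: "t n g \<in> Bc" if "g \<in> S" for n g using that S P(1) by (auto simp: t_def)
  have tg: "t n (binv g \<odot> h) = binv (t n g) \<odot> t n h" if "g \<in> S" "h \<in> S" for n g h
    using that S P(1)[of n] by (auto simp: t_def B.inv_mult_group B.m_assoc subset_eq)
  have lim: "(\<lambda>n. cinner (\<pi> (t n (binv g \<odot> h)) \<eta>) \<eta>) \<longlonglongrightarrow> chi (binv g \<odot> h)" if "g \<in> S" "h \<in> S" for g h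
  proof -
    have gh: "g \<in> Bc" "h \<in> Bc" using that S by auto
    have "B_supp (binv g \<odot> h) \<subseteq> {1..M}" using B_supp_mult[of "binv g" h] M[OF that(1)] M[OF that(2)] gh by auto
    then have "\<forall>n\<ge>1. t n (binv g \<odot> h) \<in> Cl_tail n (binv g \<odot> h)"
      unfolding t_def using conj_shift_Cl_tail[OF _ _ P] gh by simp
    from chi_lim[OF _ this, of \<eta> \<eta>] show ?thesis using gh by (simp add: \<eta>)
  qed
  let ?s = "\<lambda>n. \<Sum>g\<in>S. \<Sum>h\<in>S. cnj (c g) * c h * cinner (\<pi> (t n (binv g \<odot> h)) \<eta>) \<eta>"
  have s: "?s \<longlonglongrightarrow> (\<Sum>g\<in>S. \<Sum>h\<in>S. cnj (c g) * c h * chi (binv g \<odot> h))"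
    by (intro tendsto_sum tendsto_mult tendsto_const lim)
  have pos: "?s n = complex_of_real ((norm (\<Sum>h\<in>S. c h *\<^sub>C \<pi> (t n h) \<eta>))\<^sup>2)" for n
  proof -
    have "cinner (\<pi> (t n (binv g \<odot> h)) \<eta>) \<eta> = cinner (\<pi> (t n h) \<eta>) (\<pi> (t n g) \<eta>)" if "g \<in> S" "h \<in> S" for g h
      using tc[OF that(1)] tc[OF that(2)] by (simp add: tg[OF that] mult rep_adjoint)
    then have "?s n = (\<Sum>g\<in>S. \<Sum>h\<in>S. cnj (c g) * c h * cinner (\<pi> (t n h) \<eta>) (\<pi> (t n g) \<eta>))"
      by (intro sum.cong refl) simp
    also have "\<dots> = cinner (\<Sum>h\<in>S. c h *\<^sub>C \<pi> (t n h) \<eta>) (\<Sum>h\<in>S. c h *\<^sub>C \<pi> (t n h) \<eta>)"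
      by (simp add: cinner_sum_left cinner_sum_right cinner_scaleC_left cinner_scaleC_right
          sum_distrib_left mult_ac)
    finally show ?thesis by (simp only: cinner_self)
  qed
  have "Re (?s n) \<ge> 0" "Im (?s n) = 0" for n unfolding pos by simp_all
  then have "Re (\<Sum>g\<in>S. \<Sum>h\<in>S. cnj (c g) * c h * chi (binv g \<odot> h)) \<ge> 0"
    "Im (\<Sum>g\<in>S. \<Sum>h\<in>S. cnj (c g) * c h * chi (binv g \<odot> h)) = 0"
    using LIMSEQ_le_const[OF tendsto_Re[OF s], of 0] LIMSEQ_unique[OF tendsto_Im[OF s], of 0]
    by (auto simp del: Re_sum Im_sum)
  then show "(\<Sum>g\<in>S. \<Sum>h\<in>S. cnj (c g) * c h * chi (binv g \<odot> h)) \<in> \<real>\<^sub>\<ge>\<^sub>0"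
    unfolding complex_nonneg_Reals_iff by blast
qed

end

section \<open>Multiplicative characters\<close>

lemma distinct_lists_permutes:
  fixes xs ys :: "'a list"
  assumes "distinct xs" "distinct ys" "length xs = length ys"
  shows "\<exists>p. p permutes (set xs \<union> set ys) \<and> map p xs = ys"
proof -
  define f where "f x = the (map_of (zip xs ys) x)" for x
  have f: "f (xs ! i) = ys ! i" if "i < length xs" for i
    using that assms by (simp add: f_def map_of_zip_nth)
  then have mf: "map f xs = ys" using assms by (auto intro: nth_equalityI)
  have "inj_on f (set xs)"
    using assms mf by (metis distinct_map)
  from bij_extend_permutes[OF _ this]
  obtain p where p: "p permutes (set xs \<union> f ` set xs)" "\<forall>a\<in>set xs. p a = f a" by auto
  have "f ` set xs = set ys" using mf by (metis set_map)
  moreover have "map p xs = ys" using p(2) mf by (metis map_eq_conv)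
  ultimately show ?thesis using p(1) by auto
qed

definition bflip_pow :: "bit \<Rightarrow> nat \<Rightarrow> (nat \<Rightarrow> bit) \<times> (nat \<Rightarrow> nat)"
  where "bflip_pow e i = (if e = 0 then \<one>\<^bsub>B_grp\<^esub> else bflip i)"

lemma bflip_pow_closed [simp]: "i \<noteq> 0 \<Longrightarrow> bflip_pow e i \<in> Bc"
  by (simp add: bflip_pow_def)

lemma snd_bflip_pow [simp]: "snd (bflip_pow e i) = id"
  by (simp add: bflip_pow_def B_one)

lemma fst_bflip_pow: "fst (bflip_pow e i) k = (if k = i then e else 0)"
  by (auto simp: bflip_pow_def B_one fst_bflip)

lemma B_supp_bflip_pow: "B_supp (bflip_pow e i) \<subseteq> {i}"
  by (simp add: bflip_pow_def)

lemma bflip_pow_sq [simp]: "i \<noteq> 0 \<Longrightarrow> bflip_pow e i \<odot> bflip_pow e i = \<one>\<^bsub>B_grp\<^esub>"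
  by (simp add: bflip_pow_def bflip_sq)

lemma binv_bflip_pow [simp]: "i \<noteq> 0 \<Longrightarrow> binv (bflip_pow e i) = bflip_pow e i"
  by (simp add: bflip_pow_def)

lemma bperm_conj_bflip_pow:
  "bperm p \<in> Bc \<Longrightarrow> i \<noteq> 0 \<Longrightarrow> bperm p \<odot> bflip_pow e i \<odot> binv (bperm p) = bflip_pow e (p i)"
  by (simp add: bflip_pow_def bperm_conj_bflip)

lemma bflip_pow_btr:
  assumes "i \<noteq> 0" "j \<noteq> 0"
  shows "bflip_pow e i \<odot> btr i j = btr i j \<odot> bflip_pow e j" "bflip_pow e j \<odot> btr i j = btr i j \<odot> bflip_pow e i"
  using assms
  by (auto intro!: prod_eqI simp: fst_B_mult fst_bflip_pow fun_eq_iff Transposition.transpose_def)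

lemma btr_self [simp]: "btr i i = \<one>\<^bsub>B_grp\<^esub>"
  by (simp add: btr_def bperm_def B_one)

lemma btr_move:
  assumes "i \<noteq> 0" "j \<noteq> 0" "m \<noteq> 0" "m \<noteq> i" "m \<noteq> j"
  shows "btr i j \<odot> btr j m = btr i m \<odot> btr i j"
  using assms
  by (auto intro!: prod_eqI simp: fst_B_mult fun_eq_iff Transposition.transpose_def)

lemma transps_ok_zip:
  assumes "0 \<notin> set is" "0 \<notin> set ms"
  shows "transps_ok (zip is ms)"
  unfolding transps_ok_def
proof (intro ballI, clarify)
  fix a b assume "(a, b) \<in> set (zip is ms)"
  then have "a \<in> set is" "b \<in> set ms" by (auto dest: set_zip_leftD set_zip_rightD)
  then show "a \<noteq> 0 \<and> b \<noteq> 0" using assms by metis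
qed

lemma B_supp_transps_zip:
  assumes "0 \<notin> set is" "0 \<notin> set ms"
  shows "B_supp (transps (zip is ms)) \<subseteq> set is \<union> set ms"
  using B_supp_transps[OF transps_ok_zip[OF assms]] set_zip_leftD[of _ _ "is" ms] set_zip_rightD[of _ _ "is" ms]
  by fastforce

lemma map_prod_zip: "map (map_prod p q) (zip xs ys) = zip (map p xs) (map q ys)"
  by (simp add: zip_map_map map_prod_def)

text \<open>The transposition of i and j carries the star with centre j to the star with centre
  i.\<close>

lemma transps_btr_move:
  assumes "i \<noteq> 0" "j \<noteq> 0" "0 \<notin> set ms" "i \<notin> set ms" "j \<notin> set ms" "length ms = k"
  shows "btr i j \<odot> transps (zip (replicate k j) ms) = transps (zip (replicate k i) ms) \<odot> btr i j"
  using assms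
proof (induction ms arbitrary: k)
  case (Cons m ms)
  then obtain k' where k: "k = Suc k'" "length ms = k'" by auto
  have ok: "transps_ok (zip (replicate k' i) ms)" "transps_ok (zip (replicate k' j) ms)"
    using Cons.prems by (auto intro!: transps_ok_zip)
  have "btr i j \<odot> transps (zip (replicate k j) (m # ms)) = (btr i j \<odot> btr j m) \<odot> transps (zip (replicate k' j) ms)"
    using Cons.prems ok by (auto simp: k(1) B.m_assoc)
  also have "btr i j \<odot> btr j m = btr i m \<odot> btr i j"
    using Cons.prems by (intro btr_move) auto
  also have "btr i m \<odot> btr i j \<odot> transps (zip (replicate k' j) ms)
      = btr i m \<odot> (btr i j \<odot> transps (zip (replicate k' j) ms))"
    using Cons.prems ok by (intro B.m_assoc) auto
  also have "btr i j \<odot> transps (zip (replicate k' j) ms) = transps (zip (replicate k' i) ms) \<odot> btr i j"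
    using Cons.prems k by (intro Cons.IH) auto
  finally show ?case using Cons.prems ok by (auto simp: k(1) B.m_assoc)
qed simp

section \<open>Class functions on products with fresh letters\<close>

locale B_class =
  fixes X :: "(nat \<Rightarrow> bit) \<times> (nat \<Rightarrow> nat) \<Rightarrow> 'v"
  assumes X_conj: "u \<in> Bc \<Longrightarrow> g \<in> Bc \<Longrightarrow> X (u \<odot> g \<odot> binv u) = X g"
begin

lemma X_comm: "g \<in> Bc \<Longrightarrow> h \<in> Bc \<Longrightarrow> X (g \<odot> h) = X (h \<odot> g)"
  using X_conj[of h "g \<odot> h"] by (simp add: B.m_assoc)

text \<open>Each letter of ms occurs exactly once and nowhere else in the product, so conjugation
  may rename it at will.\<close>

definition fresh :: "(nat \<Rightarrow> bit) \<times> (nat \<Rightarrow> nat) \<Rightarrow> nat list \<Rightarrow> nat list \<Rightarrow> bool"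
  where "fresh q is ms \<longleftrightarrow> length ms = length is \<and> distinct ms \<and> 0 \<notin> set is \<and> 0 \<notin> set ms \<and>
    set ms \<inter> (B_supp q \<union> set is) = {}"

lemma fresh_ok: "fresh q is ms \<Longrightarrow> transps_ok (zip is ms)"
  by (auto simp: fresh_def intro: transps_ok_zip)

text \<open>Listing the letters of q and of the centres in front of both ms and ms' yields a
  permutation that fixes these letters and renames only the fresh ones.\<close>

lemma X_relabel:
  assumes q: "q \<in> Bc" and f: "fresh q is ms" and f': "fresh q is ms'"
  shows "X (q \<odot> transps (zip is ms)) = X (q \<odot> transps (zip is ms'))"
proof -
  define A where "A = B_supp q \<union> set is"
  have finA: "finite A" using finite_B_supp[OF q] by (simp add: A_def)
  define as where "as = sorted_list_of_set A"
  have as: "set as = A" "distinct as" using finA by (auto simp: as_def)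
  have d: "set ms \<inter> A = {}" "set ms' \<inter> A = {}" using f f' by (auto simp: fresh_def A_def)
  obtain p where p: "p permutes (set (as @ ms) \<union> set (as @ ms'))" "map p (as @ ms) = as @ ms'"
    using distinct_lists_permutes[of "as @ ms" "as @ ms'"] as d f f' by (auto simp: fresh_def)
  have "0 \<notin> A" using zero_notin_B_supp[OF q] f by (auto simp: A_def fresh_def)
  then have pc: "bperm p \<in> Bc"
    by (intro bperm_closed[OF p(1)]) (use as f f' in \<open>auto simp: fresh_def\<close>)
  have pA: "map p as = as" and pm: "map p ms = ms'" using p(2) by auto
  have fix': "p a = a" if "a \<in> A" for a
    using pA that as(1) by (metis map_eq_conv map_ident)
  have "B_supp (bperm p) \<inter> B_supp q = {}" using fix' by (auto simp: B_supp_bperm A_def)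
  then have "bperm p \<odot> q \<odot> binv (bperm p) = q" by (rule B_conj_disjoint[OF pc q])
  moreover have "map p is = is" using fix' by (auto simp: A_def intro: map_idI)
  then have "bperm p \<odot> transps (zip is ms) \<odot> binv (bperm p) = transps (zip is ms')"
    using transps_conj[OF pc fresh_ok[OF f]] pm by (simp add: map_prod_zip)
  ultimately have "bperm p \<odot> (q \<odot> transps (zip is ms)) \<odot> binv (bperm p) = q \<odot> transps (zip is ms')"
    using B_conj_mult[OF pc q transps_closed[OF fresh_ok[OF f]]] by simp
  then show ?thesis using X_conj[OF pc, of "q \<odot> transps (zip is ms)"] q fresh_ok[OF f] by simp
qed

lemma fresh_absorb:
  assumes "q \<in> Bc" "fresh q (a # is) (m # ms)"
  shows "fresh (q \<odot> btr a m) is ms" "q \<odot> btr a m \<in> Bc"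
    "X (q \<odot> transps (zip (a # is) (m # ms))) = X ((q \<odot> btr a m) \<odot> transps (zip is ms))"
proof -
  have am: "a \<noteq> 0" "m \<noteq> 0" using assms by (auto simp: fresh_def)
  have "B_supp (q \<odot> btr a m) \<subseteq> B_supp q \<union> {a, m}"
    using B_supp_mult[OF assms(1), of "btr a m"] B_supp_btr[of a m] by blast
  then show f: "fresh (q \<odot> btr a m) is ms" using assms by (auto simp: fresh_def)
  show "q \<odot> btr a m \<in> Bc" using assms am by simp
  show "X (q \<odot> transps (zip (a # is) (m # ms))) = X ((q \<odot> btr a m) \<odot> transps (zip is ms))"
    using assms am fresh_ok[OF f] by (simp add: B.m_assoc)
qed

text \<open>Transpositions of different old letters with different fresh letters have disjoint
  supports and commute; exchanging them only exchanges fresh letters, which \<open>X_relabel\<close>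
  undoes. So only the multiset of old letters matters.\<close>

lemma X_perm:
  assumes "q \<in> Bc" "fresh q is ms" "mset is = mset is'"
  shows "X (q \<odot> transps (zip is ms)) = X (q \<odot> transps (zip is' ms))"
  using assms
proof (induction "length is" arbitrary: q "is" is' ms rule: less_induct)
  case less
  have same: "set is = set is'" using less.prems(3) by (metis set_mset_mset)
  have leneq: "length is = length is'" using less.prems(3) by (metis size_mset)
  have f': "fresh q is' ms" using less.prems(2) same leneq by (auto simp: fresh_def)
  show ?case
  proof (cases "is")
    case Nil
    then show ?thesis using less.prems(3) by simp
  next
    case (Cons a r)
    obtain m ns where ms: "ms = m # ns" using less.prems(2) Cons by (cases ms) (auto simp: fresh_def)
    obtain b r' where is': "is' = b # r'" using leneq Cons by (cases is') auto
    note A = fresh_absorb[OF less.prems(1), of a r m ns, folded Cons ms, OF less.prems(2)]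
    note B = fresh_absorb[OF less.prems(1), of b r' m ns, folded is' ms, OF f']
    show ?thesis
    proof (cases "a = b")
      case True
      then have "mset r = mset r'" using less.prems(3) Cons is' by simp
      then have "X ((q \<odot> btr a m) \<odot> transps (zip r ns)) = X ((q \<odot> btr a m) \<odot> transps (zip r' ns))"
        using less.hyps[of r "q \<odot> btr a m" ns r'] A Cons by simp
      then show ?thesis using A B True by simp
    next
      case False
      \<comment> \<open>The induction hypothesis brings the head of the other list to the front of
        each tail; a single exchange of a and b then remains.\<close>
      define t where "t = remove1 b r"
      have "add_mset a (mset r) = add_mset b (mset r')" using less.prems(3) Cons is' by simp
      then obtain K where K: "mset r = add_mset b K" "mset r' = add_mset a K"
        using False by (auto simp: add_eq_conv_ex)
      then have mr: "mset r = mset (b # t)" and mr'': "mset r' = mset (a # t)"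
        by (simp_all add: t_def)
      have "length r = Suc (length t)" using mr by (metis length_Cons size_mset)
      then obtain m' ks where ns: "ns = m' # ks"
        using less.prems(2) Cons ms by (cases ns) (auto simp: fresh_def)
      have st: "set r = insert b (set t)" using mr by (metis list.simps(15) set_mset_mset)
      have d: "a \<noteq> 0" "b \<noteq> 0" "m \<noteq> 0" "m' \<noteq> 0" "m \<noteq> m'" "a \<noteq> m" "a \<noteq> m'" "b \<noteq> m" "b \<noteq> m'"
        using less.prems(2) Cons ms ns st by (auto simp: fresh_def)
      have "length (b # t) < length is" using mr Cons by (metis length_Cons lessI size_mset)
      then have 1: "X ((q \<odot> btr a m) \<odot> transps (zip r ns)) = X ((q \<odot> btr a m) \<odot> transps (zip (b # t) ns))"
        using less.hyps[of r "q \<odot> btr a m" ns "b # t"] A mr Cons by simp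
      have 2: "X ((q \<odot> btr b m) \<odot> transps (zip r' ns)) = X ((q \<odot> btr b m) \<odot> transps (zip (a # t) ns))"
        using less.hyps[of r' "q \<odot> btr b m" ns "a # t"] B mr'' is' leneq by simp
      have lt: "length ks = length t"
        using less.prems(2) Cons ms ns \<open>length r = Suc (length t)\<close> by (simp add: fresh_def)
      have fr: "fresh q (b # a # t) (m # m' # ks)" "fresh q (b # a # t) (m' # m # ks)"
      proof -
        have e: "set (b # a # t) = set is" "set (m # m' # ks) = set ms" "set (m' # m # ks) = set ms"
          using st Cons ms ns by auto
        have "distinct ms" "0 \<notin> set is" "0 \<notin> set ms" "set ms \<inter> (B_supp q \<union> set is) = {}"
          using less.prems(2) unfolding fresh_def by blast+
        then show "fresh q (b # a # t) (m # m' # ks)" "fresh q (b # a # t) (m' # m # ks)"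
          unfolding fresh_def e using lt by (simp_all add: ms ns)
      qed
      have ok: "transps (zip t ks) \<in> Bc" using fresh_ok[OF fr(1)] by simp
      have "btr a m \<odot> btr b m' = btr b m' \<odot> btr a m"
        using d B_supp_btr[of a m] B_supp_btr[of b m'] False by (intro B_commute) auto
      then have "(q \<odot> btr a m) \<odot> transps (zip (b # t) ns) = q \<odot> transps (zip (b # a # t) (m' # m # ks))"
        using d ok less.prems(1) by (simp add: ns B.m_assoc[symmetric]) (simp add: B.m_assoc)
      then have "X ((q \<odot> btr a m) \<odot> transps (zip (b # t) ns)) = X (q \<odot> transps (zip (b # a # t) (m # m' # ks)))"
        using X_relabel[OF less.prems(1) fr] by simp
      also have "q \<odot> transps (zip (b # a # t) (m # m' # ks)) = (q \<odot> btr b m) \<odot> transps (zip (a # t) ns)"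
        using d ok less.prems(1) by (simp add: ns B.m_assoc)
      finally show ?thesis using A(3) B(3) 1 2 by simp
    qed
  qed
qed

text \<open>The index counts transpositions, so it is one less than the length of the cycle.\<close>

definition cycle_val :: "nat \<Rightarrow> bit \<Rightarrow> 'v"
  where "cycle_val j e = X (bflip_pow e 1 \<odot> transps (zip (replicate j 1) [2..<j+2]))"

lemma X_cycle:
  assumes "i \<noteq> 0" "distinct ms" "0 \<notin> set ms" "i \<notin> set ms" "length ms = j"
  shows "X (bflip_pow e i \<odot> transps (zip (replicate j i) ms)) = cycle_val j e"
proof -
  define ys where "ys = [2..<j+2]"
  have ys: "distinct (1 # ys)" "length ys = j" "0 \<notin> set ys" by (auto simp: ys_def simp del: upt_Suc)
  obtain p where p: "p permutes (set (i # ms) \<union> set (1 # ys))" "map p (i # ms) = 1 # ys"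
    using distinct_lists_permutes[of "i # ms" "1 # ys"] assms ys by auto
  have pc: "bperm p \<in> Bc" by (rule bperm_closed[OF p(1)]) (use assms ys in auto)
  have ok: "transps_ok (zip (replicate j i) ms)" using assms by (intro transps_ok_zip) auto
  have "bperm p \<odot> transps (zip (replicate j i) ms) \<odot> binv (bperm p) = transps (zip (replicate j 1) ys)"
    using transps_conj[OF pc ok] p(2) by (simp add: map_prod_zip map_replicate)
  moreover have "bperm p \<odot> bflip_pow e i \<odot> binv (bperm p) = bflip_pow e 1"
    using bperm_conj_bflip_pow[OF pc assms(1)] p(2) by simp
  ultimately have "bperm p \<odot> (bflip_pow e i \<odot> transps (zip (replicate j i) ms)) \<odot> binv (bperm p)
      = bflip_pow e 1 \<odot> transps (zip (replicate j 1) ys)"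
    using B_conj_mult[OF pc, of "bflip_pow e i" "transps (zip (replicate j i) ms)"] assms(1) ok by simp
  then show ?thesis
    using X_conj[OF pc, of "bflip_pow e i \<odot> transps (zip (replicate j i) ms)"] assms(1) ok by (simp add: cycle_val_def ys_def)
qed

text \<open>Conjugation by \<open>bflip_pow e m\<close> interchanges \<open>bflip_pow e m\<close> and \<open>bflip_pow e i\<close> next to \<open>btr i m\<close>.\<close>

lemma X_flip_swap:
  assumes q: "q \<in> Bc" and w: "w \<in> Bc" and im: "i \<noteq> 0" "m \<noteq> 0"
    and m: "m \<notin> B_supp q" "m \<notin> B_supp w"
  shows "X (q \<odot> bflip_pow e m \<odot> btr i m \<odot> w) = X (q \<odot> bflip_pow e i \<odot> btr i m \<odot> w)"
proof -
  let ?z = "bflip_pow e m"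
  have z: "?z \<in> Bc" using im by simp
  have zq: "?z \<odot> q = q \<odot> ?z" and zw: "?z \<odot> w = w \<odot> ?z"
    using B_supp_bflip_pow[of e m] m z q w by (auto intro!: B_commute)
  have "X (q \<odot> ?z \<odot> btr i m \<odot> w) = X (q \<odot> (?z \<odot> (btr i m \<odot> w)))"
    using q w z im by (simp add: B.m_assoc)
  also have "\<dots> = X ((?z \<odot> q) \<odot> (btr i m \<odot> w))" 
    unfolding zq using q w z im by (simp add: B.m_assoc)
  also have "\<dots> = X (q \<odot> (btr i m \<odot> (w \<odot> ?z)))"
    using X_comm[of ?z "q \<odot> (btr i m \<odot> w)"] q w z im by (simp add: B.m_assoc)
  also have "\<dots> = X (q \<odot> ((btr i m \<odot> ?z) \<odot> w))"
    unfolding zw[symmetric] using q w z im by (simp add: B.m_assoc)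
  also have "btr i m \<odot> ?z = bflip_pow e i \<odot> btr i m" using bflip_pow_btr(1)[OF im, of e] by simp
  finally show ?thesis using q w z im by (simp add: B.m_assoc)
qed

text \<open>The flip passes one transposition of the star at a time: moved to the left of
  \<open>btr i m\<close> it becomes a flip at m, which \<open>X_flip_swap\<close> turns back into a
  flip at i.\<close>

lemma X_flip_move:
  assumes "q \<in> Bc" "w \<in> Bc" "i \<noteq> 0" "0 \<notin> set ms" "distinct ms" "i \<notin> set ms"
    "set ms \<inter> (B_supp q \<union> B_supp w) = {}" "length ms = k"
  shows "X (q \<odot> transps (zip (replicate k i) ms) \<odot> bflip_pow e i \<odot> w)
    = X (q \<odot> bflip_pow e i \<odot> transps (zip (replicate k i) ms) \<odot> w)"
  using assms
proof (induction ms arbitrary: q k)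
  case (Cons m ms)
  then obtain k' where k: "k = Suc k'" "length ms = k'" by auto
  let ?W = "transps (zip (replicate k' i) ms)" and ?t = "btr i m"
  have ok: "transps_ok (zip (replicate k' i) ms)" using Cons.prems by (intro transps_ok_zip) auto
  have c: "?W \<in> Bc" "?t \<in> Bc" "bflip_pow e i \<in> Bc" "bflip_pow e m \<in> Bc" using ok Cons.prems by auto
  have im: "i \<noteq> 0" "m \<noteq> 0" using Cons.prems by auto
  have st: "B_supp (q \<odot> ?t) \<subseteq> B_supp q \<union> {i, m}"
    using B_supp_mult[OF Cons.prems(1), of ?t] B_supp_btr[of i m] by blast
  have sW: "B_supp ?W \<subseteq> insert i (set ms)"
    using B_supp_transps_zip[of "replicate k' i" ms] Cons.prems by auto
  have "X (q \<odot> transps (zip (replicate k i) (m # ms)) \<odot> bflip_pow e i \<odot> w)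
      = X ((q \<odot> ?t) \<odot> ?W \<odot> bflip_pow e i \<odot> w)"
    using Cons.prems c by (simp add: k(1) B.m_assoc)
  also have "\<dots> = X ((q \<odot> ?t) \<odot> bflip_pow e i \<odot> ?W \<odot> w)"
    using Cons.prems k st c by (intro Cons.IH) auto
  also have "\<dots> = X (q \<odot> (?t \<odot> bflip_pow e i) \<odot> (?W \<odot> w))"
    using Cons.prems c by (simp add: B.m_assoc)
  also have "?t \<odot> bflip_pow e i = bflip_pow e m \<odot> ?t" using bflip_pow_btr(2)[OF im, of e] by simp
  also have "X (q \<odot> (bflip_pow e m \<odot> ?t) \<odot> (?W \<odot> w)) = X (q \<odot> bflip_pow e m \<odot> ?t \<odot> (?W \<odot> w))"
    using Cons.prems c by (simp add: B.m_assoc)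
  also have "\<dots> = X (q \<odot> bflip_pow e i \<odot> ?t \<odot> (?W \<odot> w))"
  proof (rule X_flip_swap)
    show "m \<notin> B_supp (?W \<odot> w)"
      using B_supp_mult[OF c(1), of w] sW Cons.prems by auto
  qed (use Cons.prems c in auto)
  finally show ?case using Cons.prems c by (simp add: k(1) B.m_assoc)
qed simp

end

text \<open>Collects equal values of u, so that positive definiteness, stated for sets, applies to
  families with repetitions.\<close>

lemma sum_sum_image_gen:
  fixes a b :: "'i \<Rightarrow> 'a::comm_semiring_0"
  assumes I: "finite I"
  shows "(\<Sum>i\<in>I. \<Sum>j\<in>I. a i * b j * K (u i) (u j)) =
    (\<Sum>g\<in>u ` I. \<Sum>h\<in>u ` I. (\<Sum>i | i \<in> I \<and> u i = g. a i) * (\<Sum>j | j \<in> I \<and> u j = h. b j) * K g h)"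
proof -
  have fi: "(\<Sum>i\<in>I. f i) = (\<Sum>g\<in>u ` I. \<Sum>i | i \<in> I \<and> u i = g. f i)" for f :: "'i \<Rightarrow> 'a"
    by (rule sum.image_gen[OF I])
  have "(\<Sum>j\<in>I. a i * b j * K (u i) (u j)) = (\<Sum>h\<in>u ` I. a i * (\<Sum>j | j \<in> I \<and> u j = h. b j) * K (u i) h)" for i
    by (subst fi, intro sum.cong refl) (simp add: sum_distrib_left sum_distrib_right)
  then have "(\<Sum>i\<in>I. \<Sum>j\<in>I. a i * b j * K (u i) (u j)) = (\<Sum>g\<in>u ` I. \<Sum>i | i \<in> I \<and> u i = g.
      \<Sum>h\<in>u ` I. a i * (\<Sum>j | j \<in> I \<and> u j = h. b j) * K (u i) h)"
    by (simp only: fi[symmetric])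
  also have "\<dots> = (\<Sum>g\<in>u ` I. \<Sum>h\<in>u ` I. (\<Sum>i | i \<in> I \<and> u i = g. a i) * (\<Sum>j | j \<in> I \<and> u j = h. b j) * K g h)"
    by (intro sum.cong refl, subst sum.swap, intro sum.cong refl) (simp add: sum_distrib_right)
  finally show ?thesis .
qed

section \<open>Multiplicative class functions and real characters\<close>

locale B_mult_class = B_class X for X :: "(nat \<Rightarrow> bit) \<times> (nat \<Rightarrow> nat) \<Rightarrow> 'v :: comm_monoid_mult" +
  assumes X_one: "X \<one>\<^bsub>B_grp\<^esub> = 1"
    and X_mult: "g \<in> Bc \<Longrightarrow> h \<in> Bc \<Longrightarrow> B_supp g \<inter> B_supp h = {} \<Longrightarrow> X (g \<odot> h) = X g * X h"

locale B_char = B_mult_class X for X :: "(nat \<Rightarrow> bit) \<times> (nat \<Rightarrow> nat) \<Rightarrow> real" +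
  assumes X_inv: "g \<in> Bc \<Longrightarrow> X (binv g) = X g"
    and X_pd: "finite S \<Longrightarrow> S \<subseteq> Bc \<Longrightarrow> 0 \<le> (\<Sum>g\<in>S. \<Sum>h\<in>S. c g * c h * X (binv g \<odot> h))"
begin

lemma X_pd_index:
  assumes I: "finite I" and u: "\<And>i. i \<in> I \<Longrightarrow> u i \<in> Bc"
  shows "0 \<le> (\<Sum>i\<in>I. \<Sum>j\<in>I. c i * c j * X (binv (u i) \<odot> u j))"
  unfolding sum_sum_image_gen[OF I, where K = "\<lambda>g h. X (binv g \<odot> h)"]
  by (rule X_pd) (use I u in auto)

text \<open>Positivity for the identity and g, with coefficients 1, 1 and 1, -1.\<close>

lemma X_bound:
  assumes g: "g \<in> Bc"
  shows "\<bar>X g\<bar> \<le> 1"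
proof -
  have *: "0 \<le> (\<Sum>i\<in>{0,1}. \<Sum>j\<in>{0,1::nat}. c i * c j *
      X (binv (if i = 0 then \<one>\<^bsub>B_grp\<^esub> else g) \<odot> (if j = 0 then \<one>\<^bsub>B_grp\<^esub> else g)))" for c
    by (rule X_pd_index) (use g in auto)
  show ?thesis
    using *[of "\<lambda>i. 1"] *[of "\<lambda>i. if i = 0 then 1 else - 1"] g by (simp add: X_one X_inv)
qed

end

section \<open>Signed sums over finite hyperoctahedral groups\<close>

text \<open>
  For \<open>as = replicate n 1\<close> this is the sum, over the permutations of \<open>n\<close> letters, of the products
  of \<open>\<delta> ^ (k - 1) * p k\<close> over the cycle lengths \<open>k\<close>; the entries of \<open>as\<close> are weights of the letters.
\<close>

function cycsum :: "real \<Rightarrow> (nat \<Rightarrow> real) \<Rightarrow> nat list \<Rightarrow> real" where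
  "cycsum \<delta> p [] = 1"
| "cycsum \<delta> p (a # as) = p a * cycsum \<delta> p as + \<delta> * (\<Sum>i<length as. cycsum \<delta> p (as[i := as ! i + a]))"
  by pat_completeness auto
termination by (relation "Wellfounded.measure (\<lambda>(\<delta>, p, as). length as)") auto

text \<open>The finite hyperoctahedral group of rank n.\<close>

definition B_upto :: "nat \<Rightarrow> ((nat \<Rightarrow> bit) \<times> (nat \<Rightarrow> nat)) set"
  where "B_upto n = {q \<in> Bc. B_supp q \<subseteq> {1..n}}"

lemma finite_B_upto: "finite (B_upto n)"
proof -
  have "q \<in> (\<lambda>(A, p). (\<lambda>i. if i \<in> A then 1 else 0, p)) ` (Pow {1..n} \<times> {p. p permutes {1..n}})"
    if "q \<in> B_upto n" for q
  proof -
    have q: "q \<in> Bc" and s: "B_supp q \<subseteq> {1..n}" using that by (auto simp: B_upto_def)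
    have out: "snd q k = k" "fst q k = 0" if "k \<notin> {1..n}" for k
      using that s B_supp_not_apply by blast+
    have "snd q permutes {1..n}"
    proof (rule permutes_superset[OF B_permutes[OF q]])
      show "\<And>x. x \<in> {1..} - {1..n} \<Longrightarrow> snd q x = x" using out by auto
    qed
    moreover have "q = (\<lambda>i. if i \<in> {i. fst q i = 1} then 1 else 0, snd q)"
    proof (rule prod_eqI)
      show "fst q = fst (\<lambda>i. if i \<in> {i. fst q i = 1} then 1 else 0, snd q)"
      proof
        fix i show "fst q i = fst (\<lambda>i. if i \<in> {i. fst q i = 1} then 1 else 0, snd q) i"
          by (cases "fst q i") auto
      qed
    qed simp
    moreover have "{i. fst q i = 1} \<subseteq> {1..n}"
    proof
      fix i assume "i \<in> {i. fst q i = 1}"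
      then show "i \<in> {1..n}" using out(2)[of i] by (cases "i \<in> {1..n}") auto
    qed
    ultimately show ?thesis by (intro image_eqI[of _ _ "({i. fst q i = 1}, snd q)"]) auto
  qed
  then have "B_upto n \<subseteq> (\<lambda>(A, p). (\<lambda>i. if i \<in> A then 1 else 0, p)) ` (Pow {1..n} \<times> {p. p permutes {1..n}})"
    by blast
  then show ?thesis by (rule finite_subset) (simp add: finite_permutations)
qed

lemma B_upto_closed: "q \<in> B_upto n \<Longrightarrow> q \<in> Bc"
  by (simp add: B_upto_def)

lemma B_upto_mult: "q \<in> B_upto n \<Longrightarrow> q' \<in> B_upto n \<Longrightarrow> q \<odot> q' \<in> B_upto n"
  using B_supp_mult[of q q'] by (auto simp: B_upto_def)

lemma B_upto_inv: "q \<in> B_upto n \<Longrightarrow> binv q \<in> B_upto n"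
  by (simp add: B_upto_def)

lemma B_upto_one: "\<one>\<^bsub>B_grp\<^esub> \<in> B_upto n"
  by (simp add: B_upto_def)

lemma B_upto_bflip_pow: "i \<in> {1..n} \<Longrightarrow> bflip_pow e i \<in> B_upto n"
  using B_supp_bflip_pow[of e i] by (auto simp: B_upto_def)

lemma B_upto_btr: "i \<in> {1..n} \<Longrightarrow> j \<in> {1..n} \<Longrightarrow> btr i j \<in> B_upto n"
  using B_supp_btr[of i j] by (auto simp: B_upto_def)

lemma B_upto_mono: "n \<le> m \<Longrightarrow> q \<in> B_upto n \<Longrightarrow> q \<in> B_upto m"
  by (auto simp: B_upto_def)

lemma bij_betw_B_upto_mult:
  assumes "u \<in> B_upto n"
  shows "bij_betw (\<lambda>q. u \<odot> q) (B_upto n) (B_upto n)" "bij_betw (\<lambda>q. q \<odot> u) (B_upto n) (B_upto n)"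
proof -
  have u: "u \<in> Bc" "binv u \<in> B_upto n" using assms B_upto_inv B_upto_closed by auto
  show "bij_betw (\<lambda>q. u \<odot> q) (B_upto n) (B_upto n)"
    by (rule bij_betw_byWitness[where f' = "\<lambda>q. binv u \<odot> q"])
      (use u assms B_upto_closed in \<open>auto intro!: B_upto_mult\<close>)
  show "bij_betw (\<lambda>q. q \<odot> u) (B_upto n) (B_upto n)"
    by (rule bij_betw_byWitness[where f' = "\<lambda>q. q \<odot> binv u"])
      (use u assms B_upto_closed in \<open>auto simp: B.m_assoc intro!: B_upto_mult\<close>)
qed

text \<open>Coset decomposition along \<open>B_upto n\<close>: i is the letter sent to N and e the
  flip stored at N. For i = N the transposition is the identity, which accounts for the elements
  whose permutation fixes N.\<close>

lemma bij_betw_B_upto_Suc: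
  fixes n :: nat
  defines "N \<equiv> Suc n"
  shows "bij_betw (\<lambda>(q, e, i). q \<odot> bflip_pow e N \<odot> btr i N) (B_upto n \<times> UNIV \<times> {1..N}) (B_upto N)"
proof -
  let ?F = "\<lambda>(q, e, i). q \<odot> bflip_pow e N \<odot> btr i N"
  have N0: "N \<noteq> 0" by (simp add: N_def)
  have KN: "snd q N = N" "fst q N = 0" if "q \<in> B_upto n" for q
  proof -
    have "N \<notin> B_supp q" using that by (force simp: B_upto_def N_def)
    then show "snd q N = N" "fst q N = 0" by (rule B_supp_not_apply)+
  qed
  have snd_i: "snd (?F (q, e, i)) i = N" if "q \<in> B_upto n" for q e i
    using KN(1)[OF that] by simp
  have fst_N: "fst (?F (q, e, i)) N = e" if q: "q \<in> B_upto n" and i: "i \<in> {1..N}" for q e i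
  proof -
    have "fst (q \<odot> (bflip_pow e N \<odot> btr i N)) (snd q N) = e"
      using fst_B_mult_apply[OF B_upto_closed[OF q], of "bflip_pow e N \<odot> btr i N" N] KN[OF q]
      by (simp add: fst_B_mult fst_bflip_pow)
    then show ?thesis using KN(1)[OF q] B_upto_closed[OF q] i N0 by (simp add: B.m_assoc)
  qed
  have inj: "inj_on ?F (B_upto n \<times> UNIV \<times> {1..N})"
  proof (rule inj_onI)
    fix x y assume xy: "x \<in> B_upto n \<times> UNIV \<times> {1..N}" "y \<in> B_upto n \<times> UNIV \<times> {1..N}" and F: "?F x = ?F y"
    obtain q e i q' e' i' where x: "x = (q, e, i)" and y: "y = (q', e', i')"
      by (cases x; cases y) auto
    have q: "q \<in> B_upto n" "q' \<in> B_upto n" and i: "i \<in> {1..N}" "i' \<in> {1..N}" using xy x y by auto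
    have eq: "q \<odot> bflip_pow e N \<odot> btr i N = q' \<odot> bflip_pow e' N \<odot> btr i' N" using F by (simp add: x y)
    have ee: "e = e'" using fst_N[OF q(1) i(1), of e] fst_N[OF q(2) i(2), of e'] eq by simp
    have c: "q' \<odot> bflip_pow e' N \<odot> btr i' N \<in> Bc" using q i N0 B_upto_closed by auto
    have "snd (q' \<odot> bflip_pow e' N \<odot> btr i' N) i = snd (q' \<odot> bflip_pow e' N \<odot> btr i' N) i'"
      using snd_i[OF q(1), of e i] snd_i[OF q(2), of e' i'] eq by simp
    then have ii: "i = i'" by (rule B_inj[OF c, THEN iffD1])
    have "q \<odot> (bflip_pow e N \<odot> btr i N) = q' \<odot> (bflip_pow e N \<odot> btr i N)"
      using eq q i N0 B_upto_closed by (simp add: ee ii B.m_assoc)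
    then have "q = q'" using B.right_cancel[of "bflip_pow e N \<odot> btr i N" q q'] q i N0 B_upto_closed by simp
    then show "x = y" using ee ii x y by simp
  qed
  have "?F ` (B_upto n \<times> UNIV \<times> {1..N}) = B_upto N"
  proof (intro equalityI subsetI)
    fix g assume "g \<in> ?F ` (B_upto n \<times> UNIV \<times> {1..N})"
    then obtain q e i where "q \<in> B_upto n" "i \<in> {1..N}" "g = q \<odot> bflip_pow e N \<odot> btr i N" by auto
    then show "g \<in> B_upto N"
      using B_upto_mono[of n N q] N0 by (auto simp: N_def intro!: B_upto_mult B_upto_bflip_pow B_upto_btr)
  next
    fix g assume g: "g \<in> B_upto N"
    note gc = B_upto_closed[OF g]
    define i where "i = inv_into UNIV (snd g) N"
    define e where "e = fst g N"
    have gi: "snd g i = N" using gc by (simp add: i_def)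
    have i: "i \<in> {1..N}"
    proof (cases "i \<in> B_supp g")
      case True then show ?thesis using g by (auto simp: B_upto_def)
    next
      case False
      then have "i = N" using gi B_supp_not_apply(1) by simp
      then show ?thesis using N0 by simp
    qed
    define q where "q = g \<odot> btr i N \<odot> bflip_pow e N"
    have qK: "q \<in> B_upto N" using g i N0 by (auto simp: q_def intro!: B_upto_mult B_upto_bflip_pow B_upto_btr)
    have "snd q N = N" by (simp add: q_def gi)
    moreover have "fst q N = 0"
    proof -
      have "fst (g \<odot> (btr i N \<odot> bflip_pow e N)) (snd g i) = fst g (snd g i) + fst (btr i N \<odot> bflip_pow e N) i"
        by (rule fst_B_mult_apply[OF gc])
      moreover have "fst (btr i N \<odot> bflip_pow e N) i = e" by (simp add: fst_B_mult fst_bflip_pow)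
      ultimately have "fst (g \<odot> (btr i N \<odot> bflip_pow e N)) N = 0"
        by (simp only: gi e_def[symmetric] bit_add_self)
      then show ?thesis using gc i N0 by (simp add: q_def B.m_assoc)
    qed
    ultimately have "N \<notin> B_supp q" by (simp add: B_supp_iff)
    then have "q \<in> B_upto n" using qK by (auto simp: B_upto_def N_def atLeastAtMostSuc_conv)
    moreover have "q \<odot> bflip_pow e N \<odot> btr i N = g"
    proof -
      have "q \<odot> bflip_pow e N = g \<odot> btr i N" using gc i N0 by (simp add: q_def B.m_assoc)
      then show ?thesis using gc i N0 by (simp add: B.m_assoc)
    qed
    ultimately show "g \<in> ?F ` (B_upto n \<times> UNIV \<times> {1..N})"
      using i by (intro image_eqI[of _ _ "(q, e, i)"]) auto
  qed
  then show ?thesis using inj by (simp add: bij_betw_def)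
qed

text \<open>
  The head of the list belongs to the largest letter. Multiplying \<open>q\<close> by transpositions that join \<open>j\<close> fresh
  letters to a letter lengthens the cycle of \<open>q\<close> through that letter by \<open>j\<close>.
\<close>

fun blocks :: "nat list \<Rightarrow> nat list" where
  "blocks [] = []"
| "blocks (j # js) = replicate j (Suc (length js)) @ blocks js"

lemma set_blocks: "set (blocks js) \<subseteq> {1..length js}"
  by (induction js rule: blocks.induct) auto

text \<open>Position k of the list belongs to the letter \<open>length js - k\<close>, counting down
  from the largest.\<close>

lemma mset_blocks_update:
  "k < length js \<Longrightarrow> mset (blocks (js[k := js ! k + l])) = mset (blocks js) + replicate_mset l (length js - k)"
proof (induction js arbitrary: k)
  case (Cons j js)
  then show ?case
    by (cases k) (simp_all add: replicate_add)
qed simp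

lemma mset_blocks_add:
  "length js = length ks \<Longrightarrow> mset (blocks (map2 (+) js ks)) = mset (blocks js) + mset (blocks ks)"
  by (induction js ks rule: list_induct2) (simp_all add: replicate_add)

section \<open>Character sums over \<open>B_upto n\<close>: recursion and positivity\<close>

locale B_char_sign = B_char X for X +
  fixes eps :: "(nat \<Rightarrow> bit) \<times> (nat \<Rightarrow> nat) \<Rightarrow> real" and \<delta> \<tau> :: real
  assumes eps_mult: "g \<in> Bc \<Longrightarrow> h \<in> Bc \<Longrightarrow> eps (g \<odot> h) = eps g * eps h"
    and eps_sq: "g \<in> Bc \<Longrightarrow> eps g * eps g = 1"
    and eps_btr: "i \<noteq> 0 \<Longrightarrow> j \<noteq> 0 \<Longrightarrow> i \<noteq> j \<Longrightarrow> eps (btr i j) = \<delta>"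
    and eps_bflip: "i \<noteq> 0 \<Longrightarrow> eps (bflip i) = \<tau>"
begin

lemma eps_one [simp]: "eps \<one>\<^bsub>B_grp\<^esub> = 1"
  using eps_mult[of "\<one>\<^bsub>B_grp\<^esub>" "\<one>\<^bsub>B_grp\<^esub>"] eps_sq[of "\<one>\<^bsub>B_grp\<^esub>"] by simp

lemma eps_abs: "g \<in> Bc \<Longrightarrow> \<bar>eps g\<bar> = 1"
  using eps_sq[of g] by (metis abs_mult_self_eq abs_one abs_square_eq_1 power2_eq_square)

definition tp :: "bit \<Rightarrow> real" where "tp e = (if e = 0 then 1 else \<tau>)"

lemma eps_bflip_pow: "i \<noteq> 0 \<Longrightarrow> eps (bflip_pow e i) = tp e"
  by (simp add: bflip_pow_def tp_def eps_bflip)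

lemma eps_binv_mult: "g \<in> Bc \<Longrightarrow> h \<in> Bc \<Longrightarrow> eps (binv g \<odot> h) = eps g * eps h"
proof -
  assume g: "g \<in> Bc" and h: "h \<in> Bc"
  have "eps (binv g) * eps g = 1" using eps_mult[of "binv g" g] g by simp
  then have "eps (binv g) = eps g" using eps_sq[OF g] by (metis mult.assoc mult.right_neutral mult_1)
  then show ?thesis using eps_mult[of "binv g" h] g h by simp
qed

text \<open>The argument k is the length of the cycle, one more than the index of
  \<open>cycle_val\<close>. For \<tau> = 1 and \<tau> = -1 these are the even and the odd part in
  the flip parity.\<close>

definition ptau :: "nat \<Rightarrow> real" where "ptau k = (cycle_val (k - 1) 0 + \<tau> * cycle_val (k - 1) 1) / 2"

definition block_val :: "(nat \<Rightarrow> bit) \<times> (nat \<Rightarrow> nat) \<Rightarrow> nat list \<Rightarrow> real" where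
  "block_val q js = X (q \<odot> transps (zip (blocks js) [Suc (length js)..<Suc (length js) + length (blocks js)]))"

text \<open>Up to a factor, X extended to the group algebra and evaluated at the projection
  belonging to \<open>eps\<close>, multiplied by stars with fresh letters.\<close>

definition block_sum :: "nat list \<Rightarrow> real" where
  "block_sum js = (\<Sum>q\<in>B_upto (length js). eps q * block_val q js)"

text \<open>The definition uses particular fresh letters in a particular order; by
  \<open>X_perm\<close> and \<open>X_relabel\<close> neither choice matters.\<close>

lemma block_val_eq:
  assumes q: "q \<in> B_upto n" and n: "length js = n" and m: "mset is = mset (blocks js)"
    and ms: "length ms = length is" "distinct ms" "set ms \<inter> {0..n} = {}"
  shows "block_val q js = X (q \<odot> transps (zip is ms))"
proof -
  let ?m0 = "[Suc (length js)..<Suc (length js) + length (blocks js)]"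
  have qc: "q \<in> Bc" and sq: "B_supp q \<subseteq> {1..n}" using q by (auto simp: B_upto_def)
  have se: "set (blocks js) \<subseteq> {1..n}" using set_blocks[of js] n by simp
  have sis: "set is = set (blocks js)" using m by (metis set_mset_mset)
  have sub: "B_supp q \<union> set (blocks js) \<subseteq> {0..n}" "0 \<notin> set (blocks js)" using sq se by auto
  have m0: "set ?m0 \<inter> {0..n} = {}" "distinct ?m0" "length ?m0 = length (blocks js)"
    using n by (auto simp del: upt_Suc)
  have d: "0 \<notin> set l \<and> set l \<inter> (B_supp q \<union> set (blocks js)) = {}" if "set l \<inter> {0..n} = {}" for l
  proof -
    have "(0::nat) \<in> {0..n}" by simp
    then show ?thesis using that sub(1) by blast
  qed
  have fr: "fresh q is ms" "fresh q (blocks js) ms" "fresh q (blocks js) ?m0"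
    unfolding fresh_def sis using ms(1,2) m0(2,3) sub(2) d[OF ms(3)] d[OF m0(1)] mset_eq_length[OF m]
    by (simp_all del: upt_Suc)
  have "X (q \<odot> transps (zip is ms)) = X (q \<odot> transps (zip (blocks js) ms))"
    by (rule X_perm[OF qc fr(1) m])
  also have "\<dots> = X (q \<odot> transps (zip (blocks js) ?m0))" by (rule X_relabel[OF qc fr(2,3)])
  finally show ?thesis by (simp add: block_val_def)
qed

text \<open>q leaves the letter \<open>Suc n\<close> alone, so this letter with its j fresh partners
  is a cycle disjoint from the rest and splits off by multiplicativity.\<close>

lemma block_val_bflip_pow:
  assumes q: "q \<in> B_upto n" and n: "length js = n"
  shows "block_val (q \<odot> bflip_pow e (Suc n)) (j # js) = cycle_val j e * block_val q js"
proof -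
  let ?N = "Suc n"
  define L where "L = length (blocks js)"
  define ms1 where "ms1 = [n+2..<n+2+j]"
  define ms2 where "ms2 = [n+2+j..<n+2+j+L]"
  have ms: "length ms1 = j" "length ms2 = L" "distinct ms1" "distinct ms2" "set ms1 = {n+2..<n+2+j}"
    "set ms2 = {n+2+j..<n+2+j+L}" by (auto simp: ms1_def ms2_def simp del: upt_Suc)
  have qc: "q \<in> Bc" and sq: "B_supp q \<subseteq> {1..n}" using q by (auto simp: B_upto_def)
  let ?W1 = "transps (zip (replicate j ?N) ms1)" and ?W2 = "transps (zip (blocks js) ms2)"
  have se: "set (blocks js) \<subseteq> {1..n}" using set_blocks[of js] n by simp
  have ok: "transps_ok (zip (replicate j ?N) ms1)" "transps_ok (zip (blocks js) ms2)"
    using ms se by (auto intro!: transps_ok_zip)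
  have c: "?W1 \<in> Bc" "?W2 \<in> Bc" "bflip_pow e ?N \<in> Bc" using ok by auto
  have "zip (replicate j ?N @ blocks js) (ms1 @ ms2) = zip (replicate j ?N) ms1 @ zip (blocks js) ms2"
    using ms by (simp add: L_def)
  then have W: "transps (zip (replicate j ?N @ blocks js) (ms1 @ ms2)) = ?W1 \<odot> ?W2"
    using transps_append[OF ok] by simp
  have sW1: "B_supp ?W1 \<subseteq> insert ?N (set ms1)" and sW2: "B_supp ?W2 \<subseteq> {1..n} \<union> set ms2"
    by (rule subset_trans[OF B_supp_transps_zip]; use ms se in auto)+
  have dj: "insert ?N (set ms1) \<inter> ({1..n} \<union> set ms2) = {}" using ms by auto
  have szW: "B_supp (bflip_pow e ?N \<odot> ?W1) \<subseteq> insert ?N (set ms1)"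
    using B_supp_mult[OF c(3), of ?W1] B_supp_bflip_pow[of e ?N] sW1 by blast
  have sqW: "B_supp (q \<odot> ?W2) \<subseteq> {1..n} \<union> set ms2"
    using B_supp_mult[OF qc, of ?W2] sq sW2 by blast
  have qz: "q \<odot> bflip_pow e ?N \<in> B_upto ?N" by (intro B_upto_mult B_upto_mono[OF _ q] B_upto_bflip_pow) auto
  have "block_val (q \<odot> bflip_pow e ?N) (j # js) = X ((q \<odot> bflip_pow e ?N) \<odot> transps (zip (blocks (j # js)) (ms1 @ ms2)))"
    by (rule block_val_eq[OF qz]) (use n ms in \<open>auto simp: L_def\<close>)
  also have "\<dots> = X (q \<odot> (bflip_pow e ?N \<odot> ?W1 \<odot> ?W2))"
    using W n qc c by (simp add: B.m_assoc)
  also have "bflip_pow e ?N \<odot> ?W1 \<odot> ?W2 = ?W2 \<odot> (bflip_pow e ?N \<odot> ?W1)"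
    by (rule B_commute) (use c in simp, rule c, use szW sW2 dj in blast)
  also have "q \<odot> (?W2 \<odot> (bflip_pow e ?N \<odot> ?W1)) = (q \<odot> ?W2) \<odot> (bflip_pow e ?N \<odot> ?W1)"
    using qc c by (simp add: B.m_assoc)
  also have "X \<dots> = X (q \<odot> ?W2) * X (bflip_pow e ?N \<odot> ?W1)"
    by (rule X_mult) (use qc c in simp, use c in simp, use szW sqW dj in blast)
  also have "X (bflip_pow e ?N \<odot> ?W1) = cycle_val j e" by (rule X_cycle) (use ms in auto)
  also have "X (q \<odot> ?W2) = block_val q js" by (rule block_val_eq[symmetric, OF q n]) (use ms in \<open>auto simp: L_def\<close>)
  finally show ?thesis by simp
qed

text \<open>The letter n + 1 becomes itself a fresh partner of i, and its j partners pass over to i;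
  hence i gains \<open>Suc j\<close>, at position n - i of the list. The flip at n + 1 is moved to i
  by conjugations and absorbed into q.\<close>

lemma block_val_btr:
  assumes q: "q \<in> B_upto n" and n: "length js = n" and i: "i \<in> {1..n}"
  shows "block_val (q \<odot> bflip_pow e (Suc n) \<odot> btr i (Suc n)) (j # js)
    = block_val (q \<odot> bflip_pow e i) (js[n - i := js ! (n - i) + Suc j])"
proof -
  let ?N = "Suc n"
  let ?js = "js[n - i := js ! (n - i) + Suc j]"
  define L where "L = length (blocks js)"
  define ms1 where "ms1 = [n+2..<n+2+j]"
  define ms2 where "ms2 = [n+2+j..<n+2+j+L]"
  have ms: "length ms1 = j" "length ms2 = L" "distinct ms1" "distinct ms2" "set ms1 = {n+2..<n+2+j}"
    "set ms2 = {n+2+j..<n+2+j+L}" by (auto simp: ms1_def ms2_def simp del: upt_Suc)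
  have qc: "q \<in> Bc" and sq: "B_supp q \<subseteq> {1..n}" using q by (auto simp: B_upto_def)
  let ?W1 = "transps (zip (replicate j ?N) ms1)" and ?W2 = "transps (zip (blocks js) ms2)"
  let ?W1' = "transps (zip (replicate j i) ms1)"
  have se: "set (blocks js) \<subseteq> {1..n}" using set_blocks[of js] n by simp
  have ok: "transps_ok (zip (replicate j ?N) ms1)" "transps_ok (zip (blocks js) ms2)" "transps_ok (zip (replicate j i) ms1)"
    using ms se i by (auto intro!: transps_ok_zip)
  let ?t = "btr i ?N" and ?z = "bflip_pow e ?N" and ?zi = "bflip_pow e i"
  have c: "?W1 \<in> Bc" "?W2 \<in> Bc" "?z \<in> Bc" "?zi \<in> Bc" "?W1' \<in> Bc" "?t \<in> Bc" using ok i by auto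
  have "zip (replicate j ?N @ blocks js) (ms1 @ ms2) = zip (replicate j ?N) ms1 @ zip (blocks js) ms2"
    using ms by (simp add: L_def)
  then have W: "transps (zip (replicate j ?N @ blocks js) (ms1 @ ms2)) = ?W1 \<odot> ?W2"
    using transps_append[OF ok(1,2)] by simp
  have sW1': "B_supp ?W1' \<subseteq> insert i (set ms1)" and sW2: "B_supp ?W2 \<subseteq> {1..n} \<union> set ms2"
    by (rule subset_trans[OF B_supp_transps_zip]; use ms se i in auto)+
  have dj: "?N \<notin> insert i (set ms1)" "?N \<notin> {1..n} \<union> set ms2" "?N \<notin> {1..n}"
    "set ms1 \<inter> ({1..n} \<union> insert ?N (insert i (set ms2))) = {}" using ms i by auto
  have qz: "q \<odot> ?z \<odot> ?t \<in> B_upto ?N" using i by (intro B_upto_mult B_upto_mono[OF _ q] B_upto_bflip_pow B_upto_btr) auto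
  have "block_val (q \<odot> ?z \<odot> ?t) (j # js) = X ((q \<odot> ?z \<odot> ?t) \<odot> transps (zip (blocks (j # js)) (ms1 @ ms2)))"
    by (rule block_val_eq[OF qz]) (use n ms in \<open>auto simp: L_def\<close>)
  also have "\<dots> = X (q \<odot> ?z \<odot> ((?t \<odot> ?W1) \<odot> ?W2))"
    using W n qc c by (simp add: B.m_assoc)
  also have "?t \<odot> ?W1 = ?W1' \<odot> ?t" by (rule transps_btr_move) (use ms i in auto)
  also have "q \<odot> ?z \<odot> ((?W1' \<odot> ?t) \<odot> ?W2) = q \<odot> (?z \<odot> ?W1') \<odot> (?t \<odot> ?W2)"
    using qc c by (simp add: B.m_assoc)
  also have "?z \<odot> ?W1' = ?W1' \<odot> ?z"
    by (rule B_commute[OF c(3,5)]) (use B_supp_bflip_pow[of e ?N] sW1' dj(1) in blast)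
  also have "q \<odot> (?W1' \<odot> ?z) \<odot> (?t \<odot> ?W2) = (q \<odot> ?W1') \<odot> ?z \<odot> ?t \<odot> ?W2"
    using qc c by (simp add: B.m_assoc)
  also have "X \<dots> = X ((q \<odot> ?W1') \<odot> ?zi \<odot> ?t \<odot> ?W2)"
  proof (rule X_flip_swap)
    show "?N \<notin> B_supp (q \<odot> ?W1')" using B_supp_mult[OF qc, of ?W1'] sW1' sq dj by blast
    show "?N \<notin> B_supp ?W2" using sW2 dj by blast
  qed (use qc c i in auto)
  also have "\<dots> = X (q \<odot> ?W1' \<odot> ?zi \<odot> (?t \<odot> ?W2))"
    using qc c by (simp add: B.m_assoc)
  also have "\<dots> = X (q \<odot> ?zi \<odot> ?W1' \<odot> (?t \<odot> ?W2))"
  proof (rule X_flip_move)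
    show "set ms1 \<inter> (B_supp q \<union> B_supp (?t \<odot> ?W2)) = {}"
      using B_supp_mult[OF c(6), of ?W2] B_supp_btr[of i ?N] sW2 sq dj(4) by blast
  qed (use qc c i ms in auto)
  also have "\<dots> = X ((q \<odot> ?zi) \<odot> (?W1' \<odot> (?t \<odot> ?W2)))"
    using qc c by (simp add: B.m_assoc)
  also have "?W1' \<odot> (?t \<odot> ?W2) = transps (zip (replicate j i @ i # blocks js) (ms1 @ ?N # ms2))"
  proof -
    have "zip (replicate j i @ i # blocks js) (ms1 @ ?N # ms2)
        = zip (replicate j i) ms1 @ ((i, ?N) # zip (blocks js) ms2)" using ms by simp
    then show ?thesis using transps_append[OF ok(3), of "(i, ?N) # zip (blocks js) ms2"] ok i by simp
  qed
  also have "X ((q \<odot> ?zi) \<odot> transps (zip (replicate j i @ i # blocks js) (ms1 @ ?N # ms2))) = block_val (q \<odot> ?zi) ?js"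
  proof (rule block_val_eq[symmetric, of _ n])
    show "q \<odot> ?zi \<in> B_upto n" by (intro B_upto_mult q B_upto_bflip_pow i)
    show "mset (replicate j i @ i # blocks js) = mset (blocks ?js)"
      using mset_blocks_update[of "n - i" js "Suc j"] n i by simp
  qed (use n ms i in \<open>auto simp: L_def\<close>)
  finally show ?thesis .
qed

text \<open>In the coset decomposition i = Suc n closes a separate cycle, and every other i merges
  two letters at the cost of one factor \<delta>. The sum over the flips e yields the factor 2: it
  averages to \<open>ptau\<close> in the first case and is absorbed by translating q in the
  second.\<close>

lemma block_sum_Cons:
  "block_sum (j # js) = 2 * (ptau (Suc j) * block_sum js
    + \<delta> * (\<Sum>k<length js. block_sum (js[k := js ! k + Suc j])))"
proof -
  define n where "n = length js"
  let ?N = "Suc n"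
  let ?f = "\<lambda>g. eps g * block_val g (j # js)"
  have UB: "(UNIV :: bit set) = {0, 1}" by (auto simp: set_eq_iff)
  have "block_sum (j # js) = (\<Sum>g\<in>B_upto ?N. ?f g)" by (simp add: block_sum_def n_def)
  also have "\<dots> = (\<Sum>(q, e, i)\<in>B_upto n \<times> UNIV \<times> {1..?N}. ?f (q \<odot> bflip_pow e ?N \<odot> btr i ?N))"
    by (subst sum.reindex_bij_betw[OF bij_betw_B_upto_Suc, symmetric]) (simp add: case_prod_unfold)
  also have "\<dots> = (\<Sum>q\<in>B_upto n. \<Sum>e\<in>UNIV. \<Sum>i\<in>{1..?N}. ?f (q \<odot> bflip_pow e ?N \<odot> btr i ?N))"
    by (simp only: sum.cartesian_product)
  also have "\<dots> = (\<Sum>q\<in>B_upto n. \<Sum>e\<in>UNIV. (\<Sum>i\<in>{1..n}. ?f (q \<odot> bflip_pow e ?N \<odot> btr i ?N))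
      + ?f (q \<odot> bflip_pow e ?N))"
  proof (intro sum.cong refl)
    fix q e assume q: "q \<in> B_upto n"
    have "q \<odot> bflip_pow e ?N \<odot> btr ?N ?N = q \<odot> bflip_pow e ?N" using B_upto_closed[OF q] by simp
    then show "(\<Sum>i\<in>{1..?N}. ?f (q \<odot> bflip_pow e ?N \<odot> btr i ?N))
      = (\<Sum>i\<in>{1..n}. ?f (q \<odot> bflip_pow e ?N \<odot> btr i ?N)) + ?f (q \<odot> bflip_pow e ?N)" by simp
  qed
  also have "\<dots> = (\<Sum>q\<in>B_upto n. \<Sum>e\<in>UNIV. (\<Sum>i\<in>{1..n}. ?f (q \<odot> bflip_pow e ?N \<odot> btr i ?N)))
      + (\<Sum>q\<in>B_upto n. \<Sum>e\<in>UNIV. ?f (q \<odot> bflip_pow e ?N))"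
    by (simp only: sum.distrib)
  also have "(\<Sum>q\<in>B_upto n. \<Sum>e\<in>UNIV. ?f (q \<odot> bflip_pow e ?N)) = 2 * (ptau (Suc j) * block_sum js)"
  proof -
    have "(\<Sum>e\<in>UNIV. ?f (q \<odot> bflip_pow e ?N)) = 2 * ptau (Suc j) * (eps q * block_val q js)" if q: "q \<in> B_upto n" for q
      using block_val_bflip_pow[OF q n_def[symmetric], of _ j] B_upto_closed[OF q]
      by (simp add: UB eps_mult eps_bflip_pow tp_def ptau_def field_simps)
    then show ?thesis by (simp add: block_sum_def sum_distrib_left n_def[symmetric] mult.assoc)
  qed
  also have "(\<Sum>q\<in>B_upto n. \<Sum>e\<in>UNIV. (\<Sum>i\<in>{1..n}. ?f (q \<odot> bflip_pow e ?N \<odot> btr i ?N)))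
      = (\<Sum>e\<in>UNIV. \<Sum>i\<in>{1..n}. \<Sum>q\<in>B_upto n. ?f (q \<odot> bflip_pow e ?N \<odot> btr i ?N))"
    by (subst sum.swap, intro sum.cong refl, rule sum.swap)
  also have "\<dots> = (\<Sum>e\<in>(UNIV::bit set). \<Sum>i\<in>{1..n}. \<delta> * block_sum (js[n - i := js ! (n - i) + Suc j]))"
  proof (intro sum.cong refl)
    fix e :: bit and i assume i: "i \<in> {1..n}"
    let ?js = "js[n - i := js ! (n - i) + Suc j]"
    have "(\<Sum>q\<in>B_upto n. ?f (q \<odot> bflip_pow e ?N \<odot> btr i ?N))
      = (\<Sum>q\<in>B_upto n. \<delta> * (eps (q \<odot> bflip_pow e i) * block_val (q \<odot> bflip_pow e i) ?js))"
    proof (intro sum.cong refl)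
      fix q assume q: "q \<in> B_upto n"
      show "?f (q \<odot> bflip_pow e ?N \<odot> btr i ?N) = \<delta> * (eps (q \<odot> bflip_pow e i) * block_val (q \<odot> bflip_pow e i) ?js)"
        using block_val_btr[OF q n_def[symmetric] i, of e j] B_upto_closed[OF q] i
        by (simp add: eps_mult eps_bflip_pow eps_btr)
    qed
    also have "\<dots> = \<delta> * (\<Sum>q\<in>B_upto n. eps (q \<odot> bflip_pow e i) * block_val (q \<odot> bflip_pow e i) ?js)"
      by (simp add: sum_distrib_left)
    also have "(\<Sum>q\<in>B_upto n. eps (q \<odot> bflip_pow e i) * block_val (q \<odot> bflip_pow e i) ?js) = (\<Sum>q\<in>B_upto n. eps q * block_val q ?js)"
      by (rule sum.reindex_bij_betw[OF bij_betw_B_upto_mult(2)[OF B_upto_bflip_pow[OF i]]])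
    finally show "(\<Sum>q\<in>B_upto n. ?f (q \<odot> bflip_pow e ?N \<odot> btr i ?N)) = \<delta> * block_sum ?js"
      by (simp add: block_sum_def n_def)
  qed
  also have "\<dots> = 2 * (\<delta> * (\<Sum>i\<in>{1..n}. block_sum (js[n - i := js ! (n - i) + Suc j])))"
    by (simp add: UB sum_distrib_left)
  also have "(\<Sum>i\<in>{1..n}. block_sum (js[n - i := js ! (n - i) + Suc j]))
      = (\<Sum>k<n. block_sum (js[k := js ! k + Suc j]))"
    by (rule sum.reindex_bij_witness[of _ "\<lambda>k. n - k" "\<lambda>i. n - i"]) auto
  finally show ?thesis by (simp add: n_def algebra_simps)
qed

lemma block_sum_eq: "block_sum js = 2 ^ length js * cycsum \<delta> ptau (map Suc js)"
proof (induction js rule: length_induct)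
  case (1 js)
  show ?case
  proof (cases js)
    case Nil
    have "B_upto 0 = {\<one>\<^bsub>B_grp\<^esub>}" using B_supp_empty by (auto simp: B_upto_def)
    then show ?thesis by (simp add: block_sum_def block_val_def Nil X_one)
  next
    case (Cons j js')
    have "block_sum (js'[k := js' ! k + Suc j])
        = 2 ^ length js' * cycsum \<delta> ptau ((map Suc js')[k := map Suc js' ! k + Suc j])"
      if "k < length js'" for k
      using 1 that Cons by (simp add: map_update)
    then show ?thesis using 1 Cons by (simp add: block_sum_Cons sum_distrib_left algebra_simps)
  qed
qed

text \<open>
  The group elements \<open>q \<odot> G r js\<close>, with words \<open>G r js\<close> on disjoint sets of letters for different \<open>r\<close>,
  are averaged over \<open>r < R\<close>; the diagonal terms become negligible as \<open>R\<close> grows.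
\<close>

lemma block_sum_positive:
  assumes fin: "finite S" and len: "\<And>js. js \<in> S \<Longrightarrow> length js = n"
  shows "0 \<le> (\<Sum>js\<in>S. \<Sum>ks\<in>S. C js * C ks * block_sum (map2 (+) js ks))"
proof -
  define T where "T = (\<Sum>js\<in>S. \<Sum>ks\<in>S. C js * C ks * block_sum (map2 (+) js ks))"
  define M where "M = (\<Sum>js\<in>S. length (blocks js))"
  have M: "length (blocks js) \<le> M" if "js \<in> S" for js
    unfolding M_def using fin that by (intro member_le_sum) auto
  define bl where "bl r js = [Suc n + r * M..<Suc n + r * M + length (blocks js)]" for r js
  have bl: "length (bl r js) = length (blocks js)" "distinct (bl r js)"
    "set (bl r js) \<subseteq> {Suc n + r * M..<Suc n + r * M + M}" if "js \<in> S" for r js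
    using M[OF that] by (auto simp: bl_def simp del: upt_Suc)
  define G where "G r js = transps (zip (blocks js) (bl r js))" for r js
  have ok: "transps_ok (zip (blocks js) (bl r js))" if "js \<in> S" for r js
    using set_blocks[of js] by (intro transps_ok_zip) (auto simp: bl_def simp del: upt_Suc)
  have Gc: "G r js \<in> Bc" if "js \<in> S" for r js using ok[OF that] by (simp add: G_def)
  define F where "F h r js r' ks = X (binv (G r js) \<odot> h \<odot> G r' ks)" for h r js r' ks
  \<comment> \<open>For different r and r' the words use disjoint fresh letters; after a cyclic
    rotation they form one word in which the weights add up.\<close>
  have F: "F h r js r' ks = block_val h (map2 (+) js ks)"
    if h: "h \<in> B_upto n" and r: "r \<noteq> r'" and js: "js \<in> S" and ks: "ks \<in> S" for h r js r' ks
  proof -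
    have hc: "h \<in> Bc" using h B_upto_closed by blast
    let ?is = "blocks ks @ rev (blocks js)" and ?ms = "bl r' ks @ rev (bl r js)"
    have "F h r js r' ks = X (h \<odot> G r' ks \<odot> binv (G r js))"
      using X_comm[of "binv (G r js)" "h \<odot> G r' ks"] Gc[OF js] Gc[OF ks] hc by (simp add: F_def B.m_assoc)
    also have "binv (G r js) = transps (rev (zip (blocks js) (bl r js)))"
      unfolding G_def by (rule transps_inv[OF ok[OF js]])
    also have "rev (zip (blocks js) (bl r js)) = zip (rev (blocks js)) (rev (bl r js))"
      using bl(1)[OF js] by (simp add: zip_rev)
    also have "h \<odot> G r' ks \<odot> transps (zip (rev (blocks js)) (rev (bl r js))) = h \<odot> transps (zip ?is ?ms)"
    proof -
      have "transps_ok (zip (rev (blocks js)) (rev (bl r js)))"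
        by (simp only: zip_rev[OF bl(1)[OF js, symmetric]] transps_ok_simps ok[OF js])
      then show ?thesis
        using hc transps_append[OF ok[OF ks]] bl(1)[OF ks] ok[OF ks] by (simp add: G_def B.m_assoc)
    qed
    also have "X (h \<odot> transps (zip ?is ?ms)) = block_val h (map2 (+) js ks)"
    proof (rule block_val_eq[symmetric, OF h])
      show "length (map2 (+) js ks) = n" using len js ks by simp
      show "mset ?is = mset (blocks (map2 (+) js ks))"
        using mset_blocks_add[of js ks] len js ks by simp
      show "length ?ms = length ?is" using bl(1) js ks by simp
      have "{Suc n + r * M..<Suc n + r * M + M} \<inter> {Suc n + r' * M..<Suc n + r' * M + M} = {}"
      proof (rule ccontr)
        assume "{Suc n + r * M..<Suc n + r * M + M} \<inter> {Suc n + r' * M..<Suc n + r' * M + M} \<noteq> {}"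
        then have 1: "r * M < r' * M + M" "r' * M < r * M + M" by auto
        have "r * M < Suc r' * M" "r' * M < Suc r * M" using 1 by (simp_all add: add.commute)
        then have "r < Suc r'" "r' < Suc r" using mult_less_cancel2 by blast+
        then show False using r by simp
      qed
      then have "set (bl r' ks) \<inter> set (bl r js) = {}"
        using bl(3)[OF js, of r] bl(3)[OF ks, of r'] by blast
      then show "distinct ?ms" using bl(2)[OF js, of r] bl(2)[OF ks, of r'] by simp
      show "set ?ms \<inter> {0..n} = {}" using bl(3)[OF js, of r] bl(3)[OF ks, of r'] by auto
    qed
    finally show ?thesis .
  qed
  define K where "K = real (card (B_upto n))"
  have Kpos: "K > 0" using finite_B_upto B_upto_one unfolding K_def by (metis card_gt_0_iff empty_iff of_nat_0_less_iff)
  define Q where "Q r r' = (\<Sum>js\<in>S. \<Sum>ks\<in>S. C js * C ks * (\<Sum>h\<in>B_upto n. eps h * F h r js r' ks))" for r r'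
  have Qne: "Q r r' = T" if "r \<noteq> r'" for r r'
  proof -
    have "length (map2 (+) js ks) = n" if "js \<in> S" "ks \<in> S" for js ks using len that by simp
    then show ?thesis unfolding Q_def T_def
      by (intro sum.cong refl) (simp add: block_sum_def F[OF _ \<open>r \<noteq> r'\<close>])
  qed
  define D where "D = (\<Sum>js\<in>S. \<Sum>ks\<in>S. \<bar>C js\<bar> * \<bar>C ks\<bar> * K)"
  have Qle: "Q r r \<le> D" for r
    unfolding Q_def D_def
  proof (intro sum_mono)
    fix js ks assume js: "js \<in> S" "ks \<in> S"
    have "\<bar>\<Sum>h\<in>B_upto n. eps h * F h r js r ks\<bar> \<le> (\<Sum>h\<in>B_upto n. 1)"
    proof (rule order_trans[OF sum_abs sum_mono])
      fix h assume "h \<in> B_upto n"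
      then have hc: "h \<in> Bc" by (rule B_upto_closed)
      then show "\<bar>eps h * F h r js r ks\<bar> \<le> 1"
        using X_bound[of "binv (G r js) \<odot> h \<odot> G r ks"] Gc js by (simp add: abs_mult eps_abs F_def)
    qed
    then have "\<bar>C js\<bar> * \<bar>C ks\<bar> * \<bar>\<Sum>h\<in>B_upto n. eps h * F h r js r ks\<bar> \<le> \<bar>C js\<bar> * \<bar>C ks\<bar> * K"
      by (intro mult_left_mono) (auto simp: K_def)
    moreover have "C js * C ks * (\<Sum>h\<in>B_upto n. eps h * F h r js r ks)
        \<le> \<bar>C js\<bar> * \<bar>C ks\<bar> * \<bar>\<Sum>h\<in>B_upto n. eps h * F h r js r ks\<bar>"
      unfolding abs_mult[symmetric] by (rule abs_ge_self)
    ultimately show "C js * C ks * (\<Sum>h\<in>B_upto n. eps h * F h r js r ks) \<le> \<bar>C js\<bar> * \<bar>C ks\<bar> * K"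
      by linarith
  qed
  \<comment> \<open>The double sum over q and q' depends only on h =
    \<open>binv q \<odot> q'\<close> and gives the factor K. Of the remaining terms R are diagonal
    and at most D, and R (R - 1) are off-diagonal and equal to T.\<close>
  have pos: "0 \<le> real R * D + real R * (real R - 1) * T" for R
  proof -
    let ?I = "B_upto n \<times> ({..<R} \<times> S)"
    define u where "u = (\<lambda>(q, r, js). q \<odot> G r js)"
    define c where "c = (\<lambda>(q, r::nat, js). eps q * C js)"
    have "0 \<le> (\<Sum>a\<in>?I. \<Sum>b\<in>?I. c a * c b * X (binv (u a) \<odot> u b))"
      by (rule X_pd_index) (use fin finite_B_upto B_upto_closed Gc in \<open>auto simp: u_def\<close>)
    also have "\<dots> = (\<Sum>q\<in>B_upto n. \<Sum>a\<in>{..<R} \<times> S. \<Sum>q'\<in>B_upto n. \<Sum>b\<in>{..<R} \<times> S.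
        c (q, a) * c (q', b) * X (binv (u (q, a)) \<odot> u (q', b)))"
      by (simp add: sum.cartesian_product')
    also have "\<dots> = (\<Sum>q\<in>B_upto n. \<Sum>a\<in>{..<R} \<times> S. \<Sum>b\<in>{..<R} \<times> S. \<Sum>q'\<in>B_upto n.
        c (q, a) * c (q', b) * X (binv (u (q, a)) \<odot> u (q', b)))"
      by (intro sum.cong refl sum.swap)
    also have "\<dots> = (\<Sum>q\<in>B_upto n. \<Sum>a\<in>{..<R} \<times> S. \<Sum>b\<in>{..<R} \<times> S. \<Sum>h\<in>B_upto n.
        C (snd a) * C (snd b) * (eps h * F h (fst a) (snd a) (fst b) (snd b)))"
    proof (rule sum.cong[OF refl], rule sum.cong[OF refl], rule sum.cong[OF refl])
      fix q a b assume q: "q \<in> B_upto n" and a: "a \<in> {..<R} \<times> S" and b: "b \<in> {..<R} \<times> S"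
      have qc: "q \<in> Bc" using q B_upto_closed by blast
      have t: "c (q, a) * c (q', b) * X (binv (u (q, a)) \<odot> u (q', b))
          = C (snd a) * C (snd b) * (eps (binv q \<odot> q') * F (binv q \<odot> q') (fst a) (snd a) (fst b) (snd b))"
        if "q' \<in> B_upto n" for q'
      proof -
        have q'c: "q' \<in> Bc" using that B_upto_closed by blast
        have "binv (u (q, a)) \<odot> u (q', b)
            = binv (G (fst a) (snd a)) \<odot> (binv q \<odot> q') \<odot> G (fst b) (snd b)"
          using a b qc q'c Gc by (auto simp: u_def case_prod_unfold B.inv_mult_group B.m_assoc)
        then show ?thesis using eps_binv_mult[OF qc q'c] by (simp add: c_def F_def case_prod_unfold)
      qed
      show "(\<Sum>q'\<in>B_upto n. c (q, a) * c (q', b) * X (binv (u (q, a)) \<odot> u (q', b)))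
          = (\<Sum>h\<in>B_upto n. C (snd a) * C (snd b) * (eps h * F h (fst a) (snd a) (fst b) (snd b)))"
        using sum.reindex_bij_betw[OF bij_betw_B_upto_mult(1)[OF B_upto_inv[OF q]],
            of "\<lambda>h. C (snd a) * C (snd b) * (eps h * F h (fst a) (snd a) (fst b) (snd b))"]
        by (simp add: t)
    qed
    also have "\<dots> = K * (\<Sum>a\<in>{..<R} \<times> S. \<Sum>b\<in>{..<R} \<times> S. 
        C (snd a) * C (snd b) * (\<Sum>h\<in>B_upto n. eps h * F h (fst a) (snd a) (fst b) (snd b)))"
      by (simp add: K_def sum_distrib_left)
    also have "\<dots> = K * (\<Sum>r<R. \<Sum>js\<in>S. \<Sum>r'<R. \<Sum>ks\<in>S.
        C js * C ks * (\<Sum>h\<in>B_upto n. eps h * F h r js r' ks))"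
      by (simp add: sum.cartesian_product')
    also have "(\<Sum>r<R. \<Sum>js\<in>S. \<Sum>r'<R. \<Sum>ks\<in>S.
        C js * C ks * (\<Sum>h\<in>B_upto n. eps h * F h r js r' ks)) = (\<Sum>r<R. \<Sum>r'<R. Q r r')"
      unfolding Q_def by (intro sum.cong refl sum.swap)
    also have "\<dots> = (\<Sum>r<R. (real R - 1) * T + Q r r)"
    proof (intro sum.cong refl)
      fix r assume r: "r \<in> {..<R}"
      have "(\<Sum>r'<R. Q r r') = Q r r + (\<Sum>r'\<in>{..<R} - {r}. Q r r')"
        using r by (intro sum.remove) auto
      also have "(\<Sum>r'\<in>{..<R} - {r}. Q r r') = (\<Sum>r'\<in>{..<R} - {r}. T)"
        by (intro sum.cong refl Qne) auto
      also have "\<dots> = (real R - 1) * T" using r by (simp add: of_nat_diff)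
      finally show "(\<Sum>r'<R. Q r r') = (real R - 1) * T + Q r r" by simp
    qed
    also have "K * \<dots> \<le> K * (\<Sum>r<R. (real R - 1) * T + D)"
      using Kpos Qle by (intro mult_left_mono sum_mono add_left_mono) auto
    finally have "0 \<le> K * (real R * D + real R * (real R - 1) * T)" by (simp add: algebra_simps)
    then show ?thesis using Kpos by (simp add: zero_le_mult_iff)
  qed
  show ?thesis
  proof (rule ccontr)
    assume "\<not> ?thesis"
    then have T: "T < 0" by (simp add: T_def)
    obtain R :: nat where R: "D / (- T) + 1 < real R" using reals_Archimedean2 by blast
    have "D \<ge> 0" unfolding D_def K_def by (intro sum_nonneg mult_nonneg_nonneg) auto
    then have "D / (- T) \<ge> 0" using T by (intro divide_nonneg_pos) auto
    then have "real R > 0" using R by linarith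
    moreover have "D < (real R - 1) * (- T)"
    proof -
      have "D / (- T) < real R - 1" using R by linarith
      then show ?thesis using T by (subst (asm) pos_divide_less_eq) auto
    qed
    ultimately have "real R * (D + (real R - 1) * T) < 0" by (intro mult_pos_neg) auto
    then show False using pos[of R] by (simp add: algebra_simps)
  qed
qed

theorem cycsum_positive:
  assumes fin: "finite S" and len: "\<And>js. js \<in> S \<Longrightarrow> length js = n"
  shows "0 \<le> (\<Sum>js\<in>S. \<Sum>ks\<in>S. C js * C ks * cycsum \<delta> ptau (map Suc (map2 (+) js ks)))"
proof -
  have "0 \<le> (\<Sum>js\<in>S. \<Sum>ks\<in>S. C js * C ks * block_sum (map2 (+) js ks))"
    by (rule block_sum_positive[OF assms])
  also have "\<dots> = (\<Sum>js\<in>S. \<Sum>ks\<in>S. 2 ^ n * (C js * C ks * cycsum \<delta> ptau (map Suc (map2 (+) js ks))))"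
    using len by (intro sum.cong refl) (simp add: block_sum_eq)
  also have "\<dots> = 2 ^ n * (\<Sum>js\<in>S. \<Sum>ks\<in>S. C js * C ks * cycsum \<delta> ptau (map Suc (map2 (+) js ks)))"
    by (simp add: sum_distrib_left)
  finally have "2 ^ n * 0 \<le> 2 ^ n * (\<Sum>js\<in>S. \<Sum>ks\<in>S. C js * C ks * cycsum \<delta> ptau (map Suc (map2 (+) js ks)))"
    by simp
  then show ?thesis by (rule mult_left_le_imp_le) simp
qed

end

section \<open>Moment functionals on polynomials\<close>

definition mfun :: "(nat \<Rightarrow> real) \<Rightarrow> real poly \<Rightarrow> real"
  where "mfun m q = (\<Sum>i\<le>degree q. coeff q i * m i)"

lemma mfun_superset: "degree q \<le> N \<Longrightarrow> mfun m q = (\<Sum>i\<le>N. coeff q i * m i)"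
  unfolding mfun_def by (rule sum.mono_neutral_left) (auto simp: coeff_eq_0)

lemma mfun_add: "mfun m (p + q) = mfun m p + mfun m q"
proof -
  let ?N = "max (degree p) (degree q)"
  have "degree (p + q) \<le> ?N" by (rule degree_add_le) auto
  then show ?thesis
    by (simp add: mfun_superset[of _ ?N] sum.distrib algebra_simps)
qed

lemma mfun_smult: "mfun m (smult c q) = c * mfun m q"
  by (simp add: mfun_superset[of "smult c q" "degree q"] degree_smult_le mfun_def sum_distrib_left mult.assoc)

lemma mfun_zero [simp]: "mfun m 0 = 0"
  by (simp add: mfun_def)

lemma mfun_minus: "mfun m (- q) = - mfun m q"
  using mfun_smult[of m "-1" q] by simp

lemma mfun_diff: "mfun m (p - q) = mfun m p - mfun m q"
  using mfun_add[of m p "- q"] by (simp add: mfun_minus)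

lemma mfun_sum: "mfun m (\<Sum>i\<in>I. f i) = (\<Sum>i\<in>I. mfun m (f i))"
  by (induction I rule: infinite_finite_induct) (auto simp: mfun_add)

lemma mfun_monom [simp]: "mfun m (monom c j) = c * m j"
proof -
  have "mfun m (monom c j) = (\<Sum>i\<le>j. coeff (monom c j) i * m i)"
    by (rule mfun_superset) (rule degree_monom_le)
  also have "\<dots> = (\<Sum>i\<le>j. if i = j then c * m j else 0)" by (intro sum.cong) auto
  finally show ?thesis by simp
qed

definition polyX :: "real poly" where "polyX = [:0, 1:]"

lemma polyX_power: "polyX ^ j = monom 1 j"
  by (simp add: polyX_def monom_altdef)

lemma polyX_monom: "polyX = monom 1 1"
  using polyX_power[of 1] by simp

lemma poly_polyX [simp]: "poly polyX x = x"
  by (simp add: polyX_def)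

text \<open>The recursion of \<open>cycsum\<close> with polynomials in place of weights. Weight k
  corresponds to X^(k-1), so merging weights k and l, which must give X^(k+l-1), costs one extra
  factor X.\<close>

function polysum :: "real \<Rightarrow> (real poly \<Rightarrow> real) \<Rightarrow> real poly list \<Rightarrow> real" where
  "polysum \<delta> L [] = 1"
| "polysum \<delta> L (q # qs) = L q * polysum \<delta> L qs + \<delta> * (\<Sum>i<length qs. polysum \<delta> L (qs[i := qs ! i * q * polyX]))"
  by pat_completeness auto
termination by (relation "Wellfounded.measure (\<lambda>(\<delta>, p, as). length as)") auto

text \<open>Linearity in each entry survives the recursion because the head enters a merged entry as
  a factor. In the tail case the entry may itself receive the head.\<close>

lemma polysum_linear:
  assumes "\<And>c p q. L (smult c p + q) = c * L p + L q" "i < length qs"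
  shows "polysum \<delta> L (qs[i := smult c a + b]) = c * polysum \<delta> L (qs[i := a]) + polysum \<delta> L (qs[i := b])"
  using assms(2)
proof (induction qs arbitrary: i a b rule: length_induct)
  case (1 qs)
  obtain q r where qs: "qs = q # r" using 1(2) by (cases qs) auto
  have IH: "polysum \<delta> L (r'[k := smult c a + b]) = c * polysum \<delta> L (r'[k := a]) + polysum \<delta> L (r'[k := b])"
    if "length r' = length r" "k < length r" for r' k a b
    using 1(1) that by (simp add: qs)
  show ?case
  proof (cases i)
    case 0
    have e: "(q # r)[0 := x] = x # r" for x by simp
    have "polysum \<delta> L (r[k := r ! k * (smult c a + b) * polyX])
        = c * polysum \<delta> L (r[k := r ! k * a * polyX]) + polysum \<delta> L (r[k := r ! k * b * polyX])"
      if "k < length r" for k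
    proof -
      have "r ! k * (smult c a + b) * polyX = smult c (r ! k * a * polyX) + r ! k * b * polyX"
        by (simp add: algebra_simps smult_add_right)
      then show ?thesis by (simp only: IH[OF refl that])
    qed
    then have "(\<Sum>k<length r. polysum \<delta> L (r[k := r ! k * (smult c a + b) * polyX]))
      = (\<Sum>k<length r. c * polysum \<delta> L (r[k := r ! k * a * polyX]) + polysum \<delta> L (r[k := r ! k * b * polyX]))"
      by (intro sum.cong refl) simp_all
    then have S: "(\<Sum>k<length r. polysum \<delta> L (r[k := r ! k * (smult c a + b) * polyX]))
      = c * (\<Sum>k<length r. polysum \<delta> L (r[k := r ! k * a * polyX]))
        + (\<Sum>k<length r. polysum \<delta> L (r[k := r ! k * b * polyX]))"
      by (simp only: sum.distrib sum_distrib_left)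
    show ?thesis by (simp only: qs 0 e polysum.simps assms(1) S) (simp add: algebra_simps)
  next
    case (Suc i')
    have i': "i' < length r" using 1(2) by (simp add: qs Suc)
    let ?u = "\<lambda>x k. r[i' := x, k := r[i' := x] ! k * q * polyX]"
    have "polysum \<delta> L (?u (smult c a + b) k) = c * polysum \<delta> L (?u a k) + polysum \<delta> L (?u b k)"
      if k: "k < length r" for k
    proof (cases "k = i'")
      case True
      have "(smult c a + b) * q * polyX = smult c (a * q * polyX) + b * q * polyX"
        by (simp add: algebra_simps smult_add_right)
      then have "polysum \<delta> L (r[i' := (smult c a + b) * q * polyX])
        = c * polysum \<delta> L (r[i' := a * q * polyX]) + polysum \<delta> L (r[i' := b * q * polyX])"
        by (simp only: IH[OF refl i'])
      then show ?thesis using True i' by simp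
    next
      case False
      then have "?u x k = r[k := r ! k * q * polyX, i' := x]" for x by (simp add: list_update_swap)
      then show ?thesis using IH[of "r[k := r ! k * q * polyX]" i'] i' by simp
    qed
    then have "(\<Sum>k<length r. polysum \<delta> L (?u (smult c a + b) k))
      = c * (\<Sum>k<length r. polysum \<delta> L (?u a k)) + (\<Sum>k<length r. polysum \<delta> L (?u b k))"
      by (simp add: sum.distrib sum_distrib_left)
    then show ?thesis using IH[OF refl i'] by (simp add: qs Suc algebra_simps)
  qed
qed

lemma polysum_sum:
  assumes L: "\<And>c p q. L (smult c p + q) = c * L p + L q" and A: "finite A"
  shows "polysum \<delta> L (us @ (\<Sum>a\<in>A. smult (c a) (q a)) # vs) = (\<Sum>a\<in>A. c a * polysum \<delta> L (us @ q a # vs))"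
proof -
  have lin: "polysum \<delta> L (us @ (smult d a + b) # vs) = d * polysum \<delta> L (us @ a # vs) + polysum \<delta> L (us @ b # vs)"
    for d a b using polysum_linear[OF L, where qs = "us @ 0 # vs" and i = "length us"] by simp
  have z: "polysum \<delta> L (us @ 0 # vs) = 0" using lin[of 1 0 0] by simp
  show ?thesis using A by induction (simp_all add: z lin)
qed

definition nlists :: "'a set \<Rightarrow> nat \<Rightarrow> 'a list set"
  where "nlists A n = {xs. set xs \<subseteq> A \<and> length xs = n}"

lemma finite_nlists: "finite A \<Longrightarrow> finite (nlists A n)"
  unfolding nlists_def by (rule finite_lists_length_eq)

lemma sum_nlists_Suc: "(\<Sum>xs\<in>nlists A (Suc n). f xs) = (\<Sum>a\<in>A. \<Sum>xs\<in>nlists A n. f (a # xs))"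
proof -
  have "(\<Sum>xs\<in>nlists A (Suc n). f xs) = (\<Sum>(a, xs)\<in>A \<times> nlists A n. f (a # xs))"
    by (rule sum.reindex_bij_witness[of _ "\<lambda>(a, xs). a # xs" "\<lambda>xs. (hd xs, tl xs)"])
      (auto simp: nlists_def length_Suc_conv)
  then show ?thesis by (simp add: sum.cartesian_product)
qed

lemma polysum_expand:
  assumes L: "\<And>c p q. L (smult c p + q) = c * L p + L q" and A: "finite A"
  shows "polysum \<delta> L (us @ replicate n (\<Sum>a\<in>A. smult (c a) (q a)))
    = (\<Sum>as\<in>nlists A n. prod_list (map c as) * polysum \<delta> L (us @ map q as))"
proof (induction n arbitrary: us)
  case 0
  have "nlists A 0 = {[]}" by (auto simp: nlists_def)
  then show ?case by simp
next
  case (Suc n)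
  let ?S = "\<Sum>a\<in>A. smult (c a) (q a)"
  have "polysum \<delta> L (us @ replicate (Suc n) ?S) = (\<Sum>a\<in>A. c a * polysum \<delta> L ((us @ [q a]) @ replicate n ?S))"
    using polysum_sum[OF L A] by simp
  also have "\<dots> = (\<Sum>a\<in>A. \<Sum>as\<in>nlists A n. prod_list (map c (a # as)) * polysum \<delta> L (us @ map q (a # as)))"
    by (simp only: Suc.IH) (simp add: sum_distrib_left mult.assoc)
  finally show ?case by (simp only: sum_nlists_Suc)
qed

lemma sum_nlists_pair:
  "(\<Sum>as\<in>nlists (A \<times> B) n. f (map fst as) (map snd as)) = (\<Sum>js\<in>nlists A n. \<Sum>ks\<in>nlists B n. f js ks)"
proof -
  have "(\<Sum>as\<in>nlists (A \<times> B) n. f (map fst as) (map snd as)) = (\<Sum>(js, ks)\<in>nlists A n \<times> nlists B n. f js ks)"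
    by (rule sum.reindex_bij_witness[of _ "\<lambda>(js, ks). zip js ks" "\<lambda>as. (map fst as, map snd as)"])
      (auto simp: nlists_def zip_map_fst_snd dest: set_zip_leftD set_zip_rightD)
  then show ?thesis by (simp add: sum.cartesian_product)
qed

lemma polysum_monom:
  "polysum \<delta> (mfun m) (map (monom 1) js) = cycsum \<delta> (\<lambda>k. m (k - 1)) (map Suc js)"
proof (induction js rule: length_induct)
  case (1 js)
  show ?case
  proof (cases js)
    case (Cons j r)
    have "polysum \<delta> (mfun m) ((map (monom 1) r)[i := map (monom 1) r ! i * monom 1 j * polyX])
      = cycsum \<delta> (\<lambda>k. m (k - 1)) ((map Suc r)[i := map Suc r ! i + Suc j])" if "i < length r" for i
    proof -
      have "monom (1::real) (r ! i) * monom 1 j * polyX = monom 1 (r ! i + Suc j)"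
        by (simp add: polyX_monom mult_monom)
      then show ?thesis using 1 that Cons by (simp add: map_update[symmetric])
    qed
    then show ?thesis using 1 Cons by simp
  qed simp
qed

text \<open>Merging k copies of f leaves f^k and the k - 1 factors X gained on the way.\<close>

lemma polysum_powers:
  "polysum \<delta> L (map (\<lambda>j. f ^ Suc j * polyX ^ j) js) = cycsum \<delta> (\<lambda>k. L (f ^ k * polyX ^ (k - 1))) (map Suc js)"
proof (induction js rule: length_induct)
  case (1 js)
  let ?g = "\<lambda>j. f ^ Suc j * polyX ^ j"
  show ?case
  proof (cases js)
    case (Cons j r)
    have "polysum \<delta> L ((map ?g r)[i := map ?g r ! i * ?g j * polyX])
      = cycsum \<delta> (\<lambda>k. L (f ^ k * polyX ^ (k - 1))) ((map Suc r)[i := map Suc r ! i + Suc j])" if "i < length r" for i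
    proof -
      have "?g (r ! i) * ?g j * polyX = ?g (r ! i + Suc j)"
        by (simp add: power_add mult_ac)
      then have "(map ?g r)[i := map ?g r ! i * ?g j * polyX] = map ?g (r[i := r ! i + Suc j])"
        using that by (simp add: map_update del: power_Suc)
      moreover have "(map Suc r)[i := map Suc r ! i + Suc j] = map Suc (r[i := r ! i + Suc j])"
        using that by (simp add: map_update)
      ultimately show ?thesis using 1(1) Cons by simp
    qed
    then show ?thesis using 1 Cons by (simp del: power_Suc)
  qed simp
qed

text \<open>The two signs \<open>\<delta> = 1\<close> and \<open>\<delta> = - 1\<close> correspond to symmetrisation and antisymmetrisation.\<close>

locale cycsum_moments =
  fixes m :: "nat \<Rightarrow> real"
  assumes m_bound: "\<bar>m j\<bar> \<le> 1"
    and m_pos: "\<delta> = 1 \<or> \<delta> = - 1 \<Longrightarrow> finite S \<Longrightarrow> (\<And>js. js \<in> S \<Longrightarrow> length js = n) \<Longrightarrow>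
      0 \<le> (\<Sum>js\<in>S. \<Sum>ks\<in>S. C js * C ks * cycsum \<delta> (\<lambda>k. m (k - 1)) (map Suc (map2 (+) js ks)))"
begin

abbreviation L where "L \<equiv> mfun m"

lemma L_linear: "L (smult c p + q) = c * L p + L q"
  by (simp add: mfun_add mfun_smult)

text \<open>Expanding each of the n entries g g into pairs of monomials turns the sum into a
  quadratic form in lists of exponents, whose vector C consists of products of coefficients of g;
  then \<open>m_pos\<close> applies.\<close>

lemma cycsum_poly_nonneg:
  assumes \<delta>: "\<delta> = 1 \<or> \<delta> = - 1"
  shows "0 \<le> cycsum \<delta> (\<lambda>k. L ((g * g) ^ k * polyX ^ (k - 1))) (replicate n 1)"
proof -
  let ?A = "{..degree g}"
  define c where "c = coeff g"
  define F where "F js ks = prod_list (map c js) * prod_list (map c ks)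
    * cycsum \<delta> (\<lambda>k. m (k - 1)) (map Suc (map2 (+) js ks))" for js ks
  have g: "g = (\<Sum>j\<in>?A. smult (c j) (monom 1 j))"
    by (simp add: smult_monom c_def poly_as_sum_of_monoms)
  have gg: "g * g = (\<Sum>a\<in>?A \<times> ?A. smult (c (fst a) * c (snd a)) (monom 1 (fst a + snd a)))"
    by (subst (1 2) g) (simp add: sum_product sum.cartesian_product case_prod_unfold mult_monom smult_monom)
  have "cycsum \<delta> (\<lambda>k. L ((g * g) ^ k * polyX ^ (k - 1))) (replicate n 1) = polysum \<delta> L (replicate n (g * g))"
    using polysum_powers[of \<delta> L "g * g" "replicate n 0"] by (simp add: map_replicate_const)
  also have "\<dots> = (\<Sum>as\<in>nlists (?A \<times> ?A) n. prod_list (map (\<lambda>a. c (fst a) * c (snd a)) as)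
      * polysum \<delta> L (map (\<lambda>a. monom 1 (fst a + snd a)) as))"
    unfolding gg using polysum_expand[OF L_linear, of "?A \<times> ?A" \<delta> "[]"] by simp
  also have "\<dots> = (\<Sum>as\<in>nlists (?A \<times> ?A) n. F (map fst as) (map snd as))"
  proof (intro sum.cong refl)
    fix as :: "(nat \<times> nat) list"
    have "map (\<lambda>a. monom (1::real) (fst a + snd a)) as = map (monom 1) (map2 (+) (map fst as) (map snd as))"
      by (induction as) auto
    moreover have "prod_list (map (\<lambda>a. c (fst a) * c (snd a)) as)
        = prod_list (map c (map fst as)) * prod_list (map c (map snd as))"
      by (induction as) auto
    ultimately show "prod_list (map (\<lambda>a. c (fst a) * c (snd a)) as) * polysum \<delta> L (map (\<lambda>a. monom 1 (fst a + snd a)) as)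
      = F (map fst as) (map snd as)"
      unfolding F_def polysum_monom[symmetric] by (simp only:)
  qed
  also have "\<dots> = (\<Sum>js\<in>nlists ?A n. \<Sum>ks\<in>nlists ?A n. F js ks)"
    by (rule sum_nlists_pair)
  also have "\<dots> = (\<Sum>js\<in>nlists ?A n. \<Sum>ks\<in>nlists ?A n. prod_list (map c js) * prod_list (map c ks)
      * cycsum \<delta> (\<lambda>k. m (k - 1)) (map Suc (map2 (+) js ks)))"
    by (simp only: F_def)
  also have "\<dots> \<ge> 0"
    by (rule m_pos[OF \<delta> finite_nlists]) (auto simp: nlists_def)
  finally show ?thesis .
qed

lemma L_square: "0 \<le> L (q * q)"
  using cycsum_poly_nonneg[of 1 q 1] by simp

text \<open>Iterating the Cauchy--Schwarz inequality, as the moments of \<open>q\<^sup>2\<close> are bounded.\<close>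

lemma L_X_square: "\<bar>L (polyX * (q * q))\<bar> \<le> L (q * q)"
proof -
  define a where "a j = L (polyX ^ j * (q * q))" for j
  define K where "K = (\<Sum>i\<le>degree (q * q). \<bar>coeff (q * q) i\<bar>)"
  have K: "\<bar>a j\<bar> \<le> K" for j
  proof -
    have "polyX ^ j * (q * q) = (\<Sum>i\<le>degree (q * q). smult (coeff (q * q) i) (monom 1 (i + j)))"
    proof -
      have "polyX ^ j = monom 1 j" by (rule polyX_power)
      then have "polyX ^ j * (q * q) = monom 1 j * (\<Sum>i\<le>degree (q * q). monom (coeff (q * q) i) i)"
        by (simp add: poly_as_sum_of_monoms)
      then show ?thesis by (simp add: sum_distrib_left mult_monom smult_monom add.commute)
    qed
    then have "a j = (\<Sum>i\<le>degree (q * q). coeff (q * q) i * m (i + j))"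
      by (simp add: a_def mfun_sum smult_monom)
    also have "\<bar>\<dots>\<bar> \<le> K" unfolding K_def
      by (rule order_trans[OF sum_abs sum_mono]) (simp add: abs_mult mult_left_le m_bound)
    finally show ?thesis .
  qed
  have a0: "0 \<le> a (2 * j)" for j
  proof -
    have "polyX ^ (2 * j) * (q * q) = (polyX ^ j * q) * (polyX ^ j * q)"
      unfolding mult_2 power_add by (simp only: mult_ac)
    then show ?thesis unfolding a_def by (simp only: L_square)
  qed
  \<comment> \<open>Cauchy--Schwarz, from the square of q + t X^j q being nonnegative for all
    t.\<close>
  have cs: "(a j)\<^sup>2 \<le> a 0 * a (2 * j)" for j
  proof -
    have "0 \<le> a 0 + 2 * t * a j + t\<^sup>2 * a (2 * j)" for t
    proof -
      let ?p = "q + smult t (polyX ^ j * q)"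
      have "?p * ?p = q * q + smult (2 * t) (polyX ^ j * (q * q)) + smult (t\<^sup>2) (polyX ^ (2 * j) * (q * q))"
      proof -
        have "smult (2 * t) p = smult t p + smult t p" for p :: "real poly"
          by (simp add: smult_add_left[symmetric])
        then have "(q + smult t r) * (q + smult t r) = q * q + smult (2 * t) (r * q) + smult (t\<^sup>2) (r * r)" for r
          by (simp add: algebra_simps power2_eq_square)
        moreover have "(polyX ^ j * q) * (polyX ^ j * q) = polyX ^ (2 * j) * (q * q)"
          unfolding mult_2 power_add by (simp only: mult_ac)
        ultimately show ?thesis by (simp only: mult.assoc)
      qed
      then have "L (?p * ?p) = a 0 + 2 * t * a j + t\<^sup>2 * a (2 * j)"
        by (simp add: mfun_add mfun_smult a_def)
      then show ?thesis using L_square[of ?p] by simp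
    qed
    note q = this
    show ?thesis
    proof (cases "a (2 * j) = 0")
      case True
      have "a j = 0"
      proof (rule ccontr)
        assume "a j \<noteq> 0"
        then show False using q[of "- (a 0 + 1) / (2 * a j)"] True by (simp add: field_simps)
      qed
      then show ?thesis using True by simp
    next
      case False
      then have p: "a (2 * j) > 0" using a0[of j] by simp
      have "0 \<le> a 0 + 2 * (- a j / a (2 * j)) * a j + (- a j / a (2 * j))\<^sup>2 * a (2 * j)" by (rule q)
      also have "\<dots> = a 0 - (a j)\<^sup>2 / a (2 * j)" using p by (simp add: field_simps power2_eq_square)
      finally show ?thesis using p by (simp add: field_simps)
    qed
  qed
  have a00: "0 \<le> a 0" using a0[of 0] by simp
  \<comment> \<open>Each application of Cauchy--Schwarz squares the estimate and doubles the index.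
    As a is bounded by K, a ratio |a 1| / a 0 above 1 would grow beyond all bounds.\<close>
  have it: "\<bar>a 1\<bar> ^ (2 ^ n) * a 0 \<le> a 0 ^ (2 ^ n) * a (2 ^ n)" if "n \<ge> 1" for n
    using that
  proof (induction n rule: dec_induct)
    case base
    show ?case using cs[of 1] a00 by (simp add: power2_eq_square mult_ac mult_left_mono)
  next
    case (step n)
    have an: "0 \<le> a (2 ^ n)" using a0[of "2 ^ (n - 1)"] step(1) by (cases n) auto
    show ?case
    proof (cases "a 0 = 0")
      case False
      then have pos: "a 0 > 0" using a00 by simp
      have "(\<bar>a 1\<bar> ^ (2 ^ n) * a 0)\<^sup>2 \<le> (a 0 ^ (2 ^ n) * a (2 ^ n))\<^sup>2"
        by (rule power_mono[OF step.IH]) (simp add: a00)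
      also have "\<dots> = (a 0 ^ (2 ^ n))\<^sup>2 * (a (2 ^ n))\<^sup>2" by (simp add: power_mult_distrib)
      also have "\<dots> \<le> (a 0 ^ (2 ^ n))\<^sup>2 * (a 0 * a (2 * 2 ^ n))"
        by (rule mult_left_mono[OF cs]) simp
      finally have "a 0 * (\<bar>a 1\<bar> ^ (2 ^ Suc n) * a 0) \<le> a 0 * (a 0 ^ (2 ^ Suc n) * a (2 ^ Suc n))"
        by (simp add: power_mult_distrib power2_eq_square power_mult[symmetric] mult_2 power_add mult_ac)
      then show ?thesis using pos by simp
    qed (simp add: power_0_left)
  qed
  have "\<bar>a 1\<bar> \<le> a 0"
  proof (rule ccontr)
    assume n: "\<not> \<bar>a 1\<bar> \<le> a 0"
    show False
    proof (cases "a 0 = 0")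
      case True
      then show False using cs[of 1] n by simp
    next
      case False
      then have pos: "a 0 > 0" using a00 by simp
      then have "\<bar>a 1\<bar> / a 0 > 1" using n by simp
      then obtain N where N: "K / a 0 < (\<bar>a 1\<bar> / a 0) ^ N" using real_arch_pow by blast
      have "Suc N \<le> 2 ^ Suc N" by (rule less_imp_le, rule less_exp)
      then have "(\<bar>a 1\<bar> / a 0) ^ N \<le> (\<bar>a 1\<bar> / a 0) ^ (2 ^ Suc N)"
        using \<open>\<bar>a 1\<bar> / a 0 > 1\<close> by (intro power_increasing) auto
      also have "\<dots> * a 0 \<le> K"
      proof -
        have "\<bar>a 1\<bar> ^ (2 ^ Suc N) * a 0 \<le> a 0 ^ (2 ^ Suc N) * a (2 ^ Suc N)" by (rule it) simp
        also have "\<dots> \<le> a 0 ^ (2 ^ Suc N) * K" using K[of "2 ^ Suc N"] a00 by (intro mult_left_mono) auto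
        finally show ?thesis using pos by (simp add: power_divide field_simps)
      qed
      finally have "(\<bar>a 1\<bar> / a 0) ^ N * a 0 \<le> K" using pos by simp
      then show False using N pos by (simp add: field_simps)
    qed
  qed
  then show ?thesis by (simp add: a_def)
qed

text \<open>Even powers go into the square q q, leaving at most one factor each of A = 1 + X and B =
  1 - X. Since A + B = 2, the mixed case follows from 2 A B = B A^2 + A B^2, a sum of single factors
  times squares.\<close>

lemma L_Bernstein: "0 \<le> L ((1 + polyX) ^ j * (1 - polyX) ^ k)"
proof -
  define q where "q = (1 + polyX) ^ (j div 2) * (1 - polyX) ^ (k div 2)"
  have plus: "0 \<le> L ((1 + polyX) * (r * r))" for r
    using L_X_square[of r] by (simp add: distrib_right mfun_add)
  have minus: "0 \<le> L ((1 - polyX) * (r * r))" for r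
    using L_X_square[of r] by (simp add: left_diff_distrib mfun_diff)
  have both: "0 \<le> L ((1 + polyX) * (1 - polyX) * (r * r))" for r
  proof -
    define A B where "A = 1 + polyX" and "B = 1 - polyX"
    have "A + B = smult 2 1" by (simp add: A_def B_def flip: numeral_One) (simp add: numeral_poly)
    moreover have "B * ((A * r) * (A * r)) + A * ((B * r) * (B * r)) = A * B * (r * r) * (A + B)"
      by (simp add: algebra_simps)
    ultimately have "B * ((A * r) * (A * r)) + A * ((B * r) * (B * r)) = smult 2 (A * B * (r * r))" by simp
    then have "L (smult 2 (A * B * (r * r))) = L (B * ((A * r) * (A * r))) + L (A * ((B * r) * (B * r)))"
      by (metis mfun_add)
    then have "2 * L (A * B * (r * r)) = L (B * ((A * r) * (A * r))) + L (A * ((B * r) * (B * r)))"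
      by (simp only: mfun_smult)
    moreover have "0 \<le> L (B * ((A * r) * (A * r)))" "0 \<le> L (A * ((B * r) * (B * r)))"
      unfolding A_def B_def by (rule minus, rule plus)
    ultimately have "0 \<le> L (A * B * (r * r))" by linarith
    then show ?thesis by (simp only: A_def B_def)
  qed
  have pw: "p ^ i = (if even i then 1 else p) * (p ^ (i div 2) * p ^ (i div 2))" for p :: "real poly" and i
  proof -
    have *: "p ^ (i div 2) * p ^ (i div 2) = p ^ (2 * (i div 2))" by (simp only: mult_2 power_add)
    show ?thesis
    proof (cases "even i")
      case True
      then show ?thesis by (simp add: *)
    next
      case False
      then have "p ^ i = p ^ Suc (2 * (i div 2))" by simp
      then show ?thesis using False by (simp only: * power_Suc if_False)
    qed
  qed
  have "(1 + polyX) ^ j * (1 - polyX) ^ k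
    = ((if even j then 1 else 1 + polyX) * (if even k then 1 else 1 - polyX)) * (q * q)"
    unfolding q_def by (subst (1 2) pw) (simp only: mult_ac)
  then show ?thesis
    using plus[of q] minus[of q] both[of q] L_square[of q]
    by (cases "even j"; cases "even k") (simp_all only: if_True if_False mult_1_left mult_1_right)
qed

end

section \<open>The Hausdorff moment problem\<close>

text \<open>Expansion of Y^r in the Bernstein basis of degree n: by \<open>choose_mult\<close> the
  factor n choose r cancels, and the binomial theorem for Y + (1 - Y) remains.\<close>

lemma Bernstein_sum:
  fixes Y :: "real poly"
  assumes r: "r \<le> n"
  shows "(\<Sum>i\<le>n. smult (real (n choose i) * real (i choose r) / real (n choose r)) (Y ^ i * (1 - Y) ^ (n - i))) = Y ^ r"
proof -
  let ?f = "\<lambda>i. smult (real (n choose i) * real (i choose r) / real (n choose r)) (Y ^ i * (1 - Y) ^ (n - i))"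
  have "(\<Sum>i\<le>n. ?f i) = (\<Sum>i\<in>{r..n}. ?f i)"
    by (rule sum.mono_neutral_right) (auto simp: binomial_eq_0)
  also have "\<dots> = (\<Sum>k\<le>n - r. ?f (k + r))"
    by (rule sum.reindex_bij_witness[of _ "\<lambda>k. k + r" "\<lambda>i. i - r"]) (use r in auto)
  also have "\<dots> = (\<Sum>k\<le>n - r. Y ^ r * (of_nat (n - r choose k) * Y ^ k * (1 - Y) ^ (n - r - k)))"
  proof (intro sum.cong refl)
    fix k assume k: "k \<in> {..n - r}"
    have "(n choose (k + r)) * (k + r choose r) = (n choose r) * (n - r choose k)"
      using choose_mult[of r "k + r" n] k r by simp
    then have "real (n choose (k + r)) * real (k + r choose r) = real (n choose r) * real (n - r choose k)"
      by (metis of_nat_mult)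
    moreover have "real (n choose r) \<noteq> 0" using r by simp
    ultimately have c: "real (n choose (k + r)) * real (k + r choose r) / real (n choose r) = real (n - r choose k)"
      by simp
    have e: "n - (k + r) = n - r - k" by simp
    show "?f (k + r) = Y ^ r * (of_nat (n - r choose k) * Y ^ k * (1 - Y) ^ (n - r - k))"
      unfolding c e by (simp add: of_nat_poly power_add mult_ac)
  qed
  also have "\<dots> = Y ^ r * (Y + (1 - Y)) ^ (n - r)"
    by (simp only: sum_distrib_left[symmetric] binomial_ring)
  finally show ?thesis by simp
qed

text \<open>Each factor (i - t) / (n - t) differs from i / n by at most r / (n - r), uniformly in i.
  This replaces the Bernstein coefficients of Y^r by the values of the power at i / n.\<close>

lemma choose_ratio_close:
  assumes i: "i \<le> n" and r: "1 \<le> r" "r < n"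
  shows "\<bar>real (i choose r) / real (n choose r) - (real i / real n) ^ r\<bar> \<le> real r * real r / (real n - real r)"
proof (cases "i < r")
  case True
  have "(real i / real n) ^ r \<le> (real i / real n) ^ 1"
    using i r by (intro power_decreasing) auto
  also have "\<dots> \<le> real r / (real n - real r)"
    using True r by (auto intro!: frac_le)
  also have "\<dots> \<le> real r * real r / (real n - real r)"
    using r by (intro divide_right_mono) auto
  finally show ?thesis using True by (simp add: binomial_eq_0)
next
  case False
  have "real (i choose r) / real (n choose r) = (\<Prod>t = 0..<r. real (i - t) / real (n - t))"
    using False r by (simp add: binomial_altdef_of_nat prod_dividef[symmetric])
  moreover have "(real i / real n) ^ r = (\<Prod>t = 0..<r. real i / real n)" by simp
  ultimately have "\<bar>real (i choose r) / real (n choose r) - (real i / real n) ^ r\<bar>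
    \<le> (\<Sum>t = 0..<r. \<bar>real (i - t) / real (n - t) - real i / real n\<bar>)"
    using norm_prod_diff[of "{0..<r}" "\<lambda>t. real (i - t) / real (n - t)" "\<lambda>t. real i / real n"] i r
    by (simp add: divide_le_eq)
  also have "\<dots> \<le> (\<Sum>t = 0..<r. real r / (real n - real r))"
  proof (rule sum_mono)
    fix t assume t: "t \<in> {0..<r}"
    have n0: "real n > 0" "real n - real t > 0" "real n - real r > 0" using r t by auto
    have "real (i - t) / real (n - t) = (real i - real t) / (real n - real t)"
      using t False r by (simp add: of_nat_diff)
    then have "real i / real n - real (i - t) / real (n - t) = (real t * (1 - real i / real n)) / (real n - real t)"
      using n0 by (simp add: field_simps)
    moreover have "0 \<le> real t * (1 - real i / real n)" "real t * (1 - real i / real n) \<le> real r"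
    proof -
      have q: "0 \<le> 1 - real i / real n" "1 - real i / real n \<le> 1" using i n0 by auto
      show "0 \<le> real t * (1 - real i / real n)" using q by simp
      have "real t * (1 - real i / real n) \<le> real t * 1" using q by (intro mult_left_mono) auto
      then show "real t * (1 - real i / real n) \<le> real r" using t by simp
    qed
    ultimately have "0 \<le> real i / real n - real (i - t) / real (n - t)"
      "real i / real n - real (i - t) / real (n - t) \<le> real r / (real n - real r)"
      using n0 t by (auto intro!: divide_nonneg_pos frac_le)
    moreover have "0 \<le> b - a \<Longrightarrow> b - a \<le> c \<Longrightarrow> \<bar>a - b\<bar> \<le> c" for a b c :: real by linarith
    ultimately show "\<bar>real (i - t) / real (n - t) - real i / real n\<bar> \<le> real r / (real n - real r)" by blast
  qed
  finally show ?thesis by simp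
qed

text \<open>The values of L on the Bernstein basis are nonnegative weights at the points i / n.
  Their distributions live on [0, 1], so Helly selection gives a limit measure, whose moments are
  found by \<open>choose_ratio_close\<close>.\<close>

theorem Hausdorff_moments:
  fixes Y :: "real poly" and L :: "real poly \<Rightarrow> real"
  assumes L: "\<And>c p q. L (smult c p + q) = c * L p + L q" and L1: "L 1 = 1"
    and pos: "\<And>i k. 0 \<le> L (Y ^ i * (1 - Y) ^ k)"
  shows "\<exists>M. real_distribution M \<and> (AE x in M. x \<in> {0..1}) \<and> (\<forall>r. (\<integral>x. x ^ r \<partial>M) = L (Y ^ r))"
proof -
  have L0: "L 0 = 0" using L[of 1 0 0] by simp
  have Lsm: "L (smult c p) = c * L p" for c p using L[of c p 0] L0 by simp
  have Lsum: "L (\<Sum>i\<in>I. smult (c i) (q i)) = (\<Sum>i\<in>I. c i * L (q i))" for c q and I :: "nat set"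
    by (induction I rule: infinite_finite_induct) (simp_all add: L0 L)
  define w where "w n i = real (n choose i) * L (Y ^ i * (1 - Y) ^ (n - i))" for n i
  have w: "0 \<le> w n i" for n i using pos by (simp add: w_def)
  have wr: "(\<Sum>i\<le>n. w n i * (real (i choose r) / real (n choose r))) = L (Y ^ r)" if "r \<le> n" for n r
  proof -
    have "L (Y ^ r) = (\<Sum>i\<le>n. real (n choose i) * real (i choose r) / real (n choose r) * L (Y ^ i * (1 - Y) ^ (n - i)))"
      unfolding Bernstein_sum[OF that, symmetric] by (rule Lsum)
    then show ?thesis by (simp add: w_def mult_ac)
  qed
  have w1: "(\<Sum>i\<le>n. w n i) = 1" for n using wr[of 0 n] by (simp add: L1)
  define \<mu> where "\<mu> n = distr (point_measure {..n} (\<lambda>i. ennreal (w n i))) borel (\<lambda>i. real i / real n)" for n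
  have meas: "(\<lambda>i. real i / real n) \<in> measurable (point_measure {..n} f) borel" for n f
    by (simp add: point_measure_def)
  have ps: "prob_space (point_measure {..n} (\<lambda>i. ennreal (w n i)))" for n
    by (rule prob_spaceI)
      (simp add: space_point_measure emeasure_point_measure_finite sum_ennreal w w1)
  have rd: "real_distribution (\<mu> n)" for n
    unfolding \<mu>_def by (rule prob_space.real_distribution_distr[OF ps meas])
  have int\<mu>: "(\<integral>x. f x \<partial>\<mu> n) = (\<Sum>i\<le>n. w n i * f (real i / real n))"
    if "f \<in> borel_measurable borel" for f :: "real \<Rightarrow> real" and n
    unfolding \<mu>_def by (subst integral_distr[OF meas that])
      (simp add: lebesgue_integral_point_measure_finite w)
  have "tight \<mu>"
    unfolding tight_def
  proof (intro conjI allI impI rd)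
    fix \<epsilon> :: real assume \<epsilon>: "\<epsilon> > 0"
    \<comment> \<open>The interval excludes its left end, so it starts at -1 in order to contain the
      point 0.\<close>
    have "measure (\<mu> n) {-1<..1} = 1" for n
    proof -
      have "{-1<..1} \<inter> (\<lambda>i. real i / real n) ` {..n} = (\<lambda>i. real i / real n) ` {..n}"
        by (auto simp: divide_le_eq intro!: less_le_trans[of "-1" 0 "real _ / real _"])
      then have "(\<lambda>i. real i / real n) -` {-1<..1} \<inter> {..n} = {..n}" by auto
      then show ?thesis
        unfolding \<mu>_def by (subst measure_distr[OF meas])
          (simp_all add: space_point_measure measure_point_measure_finite_if w w1)
    qed
    then show "\<exists>a b. a < b \<and> (\<forall>n. measure (\<mu> n) {a<..b} > 1 - \<epsilon>)"
      using \<epsilon> by (intro exI[of _ "-1"] exI[of _ 1]) auto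
  qed
  then obtain s M where s: "strict_mono (s :: nat \<Rightarrow> nat)" and M: "real_distribution M"
    and wc: "weak_conv_m (\<mu> \<circ> id \<circ> s) M"
    using tight_imp_convergent_subsubsequence[of \<mu> id] by (auto simp: strict_mono_def)
  interpret M: real_distribution M by (rule M)
  have conv: "(\<lambda>n. \<Sum>i\<le>s n. w (s n) i * f (real i / real (s n))) \<longlonglongrightarrow> (\<integral>x. f x \<partial>M)"
    if f: "\<And>x. isCont f x" "\<And>x. norm (f x) \<le> B" for f :: "real \<Rightarrow> real" and B
  proof -
    have "(\<lambda>n. integral\<^sup>L ((\<mu> \<circ> id \<circ> s) n) f) \<longlonglongrightarrow> integral\<^sup>L M f"
      by (rule weak_conv_imp_integral_bdd_continuous_conv[OF _ M wc]) (use rd f in auto)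
    moreover have "f \<in> borel_measurable borel"
      using f(1) by (intro borel_measurable_continuous_onI continuous_at_imp_continuous_on) auto
    ultimately show ?thesis by (simp add: int\<mu>)
  qed
  \<comment> \<open>Weak convergence needs bounded test functions; clamping to [0, 1] makes the
    powers bounded and changes nothing on the interval itself.\<close>
  define cl where "cl x = max 0 (min 1 x)" for x :: real
  have clc: "isCont cl x" for x unfolding cl_def[abs_def] by (intro continuous_intros)
  have cl01: "0 \<le> cl x" "cl x \<le> 1" for x by (auto simp: cl_def)
  have cli: "cl (real i / real n) = real i / real n" if "i \<le> n" for i n
    using that by (simp add: cl_def divide_le_eq)
  have AE01: "AE x in M. x \<in> {0..1}"
  proof -
    define f where "f x = min 1 \<bar>x - cl x\<bar>" for x
    have fc: "isCont f x" for x unfolding f_def[abs_def] by (intro continuous_intros clc)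
    have fm: "f \<in> borel_measurable borel"
      using fc by (intro borel_measurable_continuous_onI continuous_at_imp_continuous_on) auto
    have fb: "norm (f x) \<le> 1" for x by (simp add: f_def)
    have "(\<lambda>n. \<Sum>i\<le>s n. w (s n) i * f (real i / real (s n))) \<longlonglongrightarrow> (\<integral>x. f x \<partial>M)"
      by (rule conv[OF fc fb])
    moreover have "(\<Sum>i\<le>s n. w (s n) i * f (real i / real (s n))) = 0" for n
      by (rule sum.neutral) (simp add: f_def cli)
    ultimately have "(\<integral>x. f x \<partial>M) = 0" by (simp add: LIMSEQ_const_iff)
    moreover have "integrable M f"
      by (rule M.integrable_const_bound[of _ 1]) (use fb fm in auto)
    moreover have "AE x in M. 0 \<le> f x" by (simp add: f_def)
    ultimately have "AE x in M. f x = 0" using integral_nonneg_eq_0_iff_AE by blast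
    then show ?thesis
    proof (rule AE_mp, intro AE_I2 impI)
      fix x assume "f x = 0"
      then have "x = cl x" by (auto simp: f_def min_def split: if_splits)
      then show "x \<in> {0..1}" using cl01[of x] by auto
    qed
  qed
  have "(\<integral>x. x ^ r \<partial>M) = L (Y ^ r)" for r
  proof -
    have "(\<integral>x. x ^ r \<partial>M) = (\<integral>x. cl x ^ r \<partial>M)"
    proof (rule integral_cong_AE)
      show "AE x in M. x ^ r = cl x ^ r" using AE01 by eventually_elim (simp add: cl_def)
      have "cl \<in> borel_measurable borel"
        using clc by (intro borel_measurable_continuous_onI continuous_at_imp_continuous_on) auto
      then show "(\<lambda>x. cl x ^ r) \<in> borel_measurable M" by simp
    qed simp
    moreover have lim1: "(\<lambda>n. \<Sum>i\<le>s n. w (s n) i * cl (real i / real (s n)) ^ r) \<longlonglongrightarrow> (\<integral>x. cl x ^ r \<partial>M)"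
      by (rule conv[of "\<lambda>x. cl x ^ r" 1]) (use cl01 clc in \<open>auto simp: power_le_one intro!: continuous_intros\<close>)
    have "(\<lambda>n. \<Sum>i\<le>s n. w (s n) i * cl (real i / real (s n)) ^ r) \<longlonglongrightarrow> L (Y ^ r)"
    proof (cases "r = 0")
      case True
      then show ?thesis by (simp add: w1 L1)
    next
      case False
      define e where "e n = real r * real r / (real n - real r)" for n
      have "e \<longlonglongrightarrow> 0" unfolding e_def by real_asymp
      then have e0: "(\<lambda>n. e (s n)) \<longlonglongrightarrow> 0" using LIMSEQ_subseq_LIMSEQ[OF _ s] by (auto simp: o_def)
      have le: "norm ((\<Sum>i\<le>n. w n i * cl (real i / real n) ^ r) - L (Y ^ r)) \<le> e n" if n: "n > r" for n
      proof -
        have "(\<Sum>i\<le>n. w n i * cl (real i / real n) ^ r) - L (Y ^ r)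
          = (\<Sum>i\<le>n. w n i * ((real i / real n) ^ r - real (i choose r) / real (n choose r)))"
          using wr[of r n] n by (simp add: cli right_diff_distrib sum_subtractf)
        also have "norm \<dots> \<le> (\<Sum>i\<le>n. w n i * e n)"
        proof (rule order_trans[OF norm_sum sum_mono])
          fix i assume "i \<in> {..n}"
          then have "\<bar>real (i choose r) / real (n choose r) - (real i / real n) ^ r\<bar> \<le> e n"
            unfolding e_def using False n by (intro choose_ratio_close) auto
          then show "norm (w n i * ((real i / real n) ^ r - real (i choose r) / real (n choose r))) \<le> w n i * e n"
            using w[of n i] by (simp add: abs_mult abs_minus_commute mult_left_mono)
        qed
        also have "\<dots> = e n" by (simp add: sum_distrib_right[symmetric] w1)
        finally show ?thesis .
      qed
      have "eventually (\<lambda>n. s n > r) sequentially"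
        by (rule eventually_compose_filterlim[OF eventually_gt_at_top filterlim_subseq[OF s]])
      then have "eventually (\<lambda>n. norm ((\<Sum>i\<le>s n. w (s n) i * cl (real i / real (s n)) ^ r) - L (Y ^ r)) \<le> e (s n)) sequentially"
        by eventually_elim (rule le)
      then have "(\<lambda>n. (\<Sum>i\<le>s n. w (s n) i * cl (real i / real (s n)) ^ r) - L (Y ^ r)) \<longlonglongrightarrow> 0"
        using e0 by (rule Lim_null_comparison)
      then show ?thesis by (simp add: LIM_zero_iff)
    qed
    then have "(\<integral>x. cl x ^ r \<partial>M) = L (Y ^ r)" by (rule LIMSEQ_unique[OF lim1])
    ultimately show ?thesis by simp
  qed
  then show ?thesis using M AE01 by blast
qed

section \<open>Integer-valued tails\<close>

lemma cycsum_tendsto: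
  assumes "\<And>k. (\<lambda>j. p j k) \<longlonglongrightarrow> q k"
  shows "(\<lambda>j. cycsum \<delta> (p j) as) \<longlonglongrightarrow> cycsum \<delta> q as"
proof (induction as rule: length_induct)
  case (1 as)
  show ?case
  proof (cases as)
    case (Cons a r)
    then show ?thesis using 1 by (auto intro!: tendsto_intros assms)
  qed simp
qed

text \<open>A new letter starts its own cycle, with factor \<nu>, or joins one of the r other
  letters, each time with factor - \<sigma> and one more power of \<sigma>; so it contributes \<nu>
  - r. The weights enter only through the exponent of \<sigma>.\<close>

lemma cycsum_geometric:
  assumes s: "\<sigma> * \<sigma> = (1::real)"
  shows "cycsum (- \<sigma>) (\<lambda>k. \<sigma> ^ (k - 1) * \<nu>) (map Suc js) = \<sigma> ^ sum_list js * (\<Prod>i<length js. \<nu> - real i)"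
proof (induction js rule: length_induct)
  case (1 js)
  show ?case
  proof (cases js)
    case (Cons j r)
    let ?R = "\<Prod>i<length r. \<nu> - real i"
    have "cycsum (- \<sigma>) (\<lambda>k. \<sigma> ^ (k - 1) * \<nu>) ((map Suc r)[i := map Suc r ! i + Suc j])
      = \<sigma> * (\<sigma> ^ sum_list js * ?R)" if i: "i < length r" for i
    proof -
      have e: "(map Suc r)[i := map Suc r ! i + Suc j] = map Suc (r[i := r ! i + Suc j])"
        using i by (simp add: map_update)
      have "sum_list (r[i := r ! i + Suc j]) = sum_list r + Suc j"
        using i by (simp add: sum_list_update elem_le_sum_list)
      then show ?thesis unfolding e using 1 i Cons by (simp add: power_add mult_ac)
    qed
    then have "cycsum (- \<sigma>) (\<lambda>k. \<sigma> ^ (k - 1) * \<nu>) (map Suc js)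
      = \<sigma> ^ j * \<nu> * (\<sigma> ^ sum_list r * ?R) - \<sigma> * (real (length r) * (\<sigma> * (\<sigma> ^ sum_list js * ?R)))"
      using 1 Cons by simp
    also have "\<dots> = \<nu> * (\<sigma> ^ sum_list js * ?R) - (\<sigma> * \<sigma>) * (real (length r) * (\<sigma> ^ sum_list js * ?R))"
      by (simp add: Cons power_add mult_ac)
    also have "\<dots> = \<sigma> ^ sum_list js * (\<Prod>i<length js. \<nu> - real i)"
      by (simp add: s Cons algebra_simps)
    finally show ?thesis .
  qed simp
qed

text \<open>For \<nu> strictly between k and k + 1 the product of the first k + 2 factors has
  exactly one negative factor.\<close>

lemma falling_factorials_nonneg_imp_Nats:
  fixes \<nu> :: real
  assumes "\<And>n. 0 \<le> (\<Prod>i<n. \<nu> - real i)"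
  shows "\<nu> \<in> \<nat>"
proof -
  have "\<nu> \<ge> 0" using assms[of 1] by simp
  define k where "k = nat \<lfloor>\<nu>\<rfloor>"
  have k: "real k \<le> \<nu>" "\<nu> < real k + 1" using \<open>\<nu> \<ge> 0\<close> by (auto simp: k_def)
  have "\<nu> = real k"
  proof (rule ccontr)
    assume "\<nu> \<noteq> real k"
    then have "(\<Prod>i<Suc k. \<nu> - real i) > 0" using k by (intro prod_pos) auto
    moreover have "\<nu> - real (Suc k) < 0" using k by simp
    ultimately have "(\<Prod>i<Suc (Suc k). \<nu> - real i) < 0"
      by (simp only: prod.lessThan_Suc[of _ "Suc k"] mult_pos_neg)
    then show False using assms[of "Suc (Suc k)"] by simp
  qed
  then show ?thesis by simp
qed

section \<open>From polynomials to discontinuous functions\<close>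

locale moment_measure = cycsum_moments m + finite_measure M for m :: "nat \<Rightarrow> real" and M :: "real measure" +
  assumes sets_M: "sets M = sets borel"
    and AE_M: "AE x in M. \<bar>x\<bar> \<le> 1"
    and moments: "(\<integral>x. x ^ j \<partial>M) = m j"
begin

lemma meas_M: "f \<in> borel_measurable borel \<Longrightarrow> f \<in> borel_measurable M"
  using sets_M by (simp add: measurable_cong_sets[OF sets_M refl])

lemma integrable_bounded:
  fixes f :: "real \<Rightarrow> real"
  assumes "f \<in> borel_measurable borel" "\<And>x. \<bar>x\<bar> \<le> 1 \<Longrightarrow> \<bar>f x\<bar> \<le> B"
  shows "integrable M f"
  by (rule integrable_const_bound[of _ B])
    (use AE_M assms meas_M in \<open>auto elim!: eventually_mono\<close>)

lemma integrable_power: "integrable M (\<lambda>x. x ^ j)"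
  by (rule integrable_bounded[of _ 1]) (auto simp: power_abs power_le_one)

lemma L_integral: "L q = (\<integral>x. poly q x \<partial>M)"
proof -
  have "(\<integral>x. poly q x \<partial>M) = (\<Sum>i\<le>degree q. \<integral>x. coeff q i * x ^ i \<partial>M)"
    unfolding poly_altdef
    by (rule Bochner_Integration.integral_sum) (intro integrable_mult_right integrable_power)
  also have "\<dots> = (\<Sum>i\<le>degree q. coeff q i * m i)" by (simp add: moments)
  finally show ?thesis by (simp add: mfun_def)
qed

text \<open>Positivity for f = h h: squares are what the polynomial case provides, and the condition
  survives dominated limits.\<close>

definition good :: "(real \<Rightarrow> real) \<Rightarrow> bool" where
  "good h \<longleftrightarrow> (\<forall>n \<delta>. \<delta> = 1 \<or> \<delta> = - 1 \<longrightarrow>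
    0 \<le> cycsum \<delta> (\<lambda>k. \<integral>x. (h x * h x) ^ k * x ^ (k - 1) \<partial>M) (replicate n 1))"

lemma good_poly: "good (poly g)"
  using cycsum_poly_nonneg[of _ g] by (auto simp: good_def L_integral)

lemma good_limit:
  assumes good: "\<And>j. good (h j)" and meas: "\<And>j. h j \<in> borel_measurable borel" "g \<in> borel_measurable borel"
    and bound: "\<And>j x. \<bar>x\<bar> \<le> 1 \<Longrightarrow> \<bar>h j x\<bar> \<le> B"
    and lim: "\<And>x. \<bar>x\<bar> \<le> 1 \<Longrightarrow> (\<lambda>j. h j x) \<longlonglongrightarrow> g x"
  shows "good g"
  unfolding good_def
proof (intro allI impI)
  fix n and \<delta> :: real assume \<delta>: "\<delta> = 1 \<or> \<delta> = - 1"
  have "(\<lambda>j. \<integral>x. (h j x * h j x) ^ k * x ^ (k - 1) \<partial>M) \<longlonglongrightarrow> (\<integral>x. (g x * g x) ^ k * x ^ (k - 1) \<partial>M)" for k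
  proof (rule integral_dominated_convergence[where w = "\<lambda>_. (B * B) ^ k"])
    show "(\<lambda>x. (g x * g x) ^ k * x ^ (k - 1)) \<in> borel_measurable M"
      by (intro meas_M borel_measurable_times borel_measurable_power meas) simp
    show "(\<lambda>x. (h j x * h j x) ^ k * x ^ (k - 1)) \<in> borel_measurable M" for j
      by (intro meas_M borel_measurable_times borel_measurable_power meas) simp
    show "AE x in M. (\<lambda>j. (h j x * h j x) ^ k * x ^ (k - 1)) \<longlonglongrightarrow> (g x * g x) ^ k * x ^ (k - 1)"
      using AE_M by eventually_elim (intro tendsto_intros lim)
    show "AE x in M. norm ((h j x * h j x) ^ k * x ^ (k - 1)) \<le> (B * B) ^ k" for j
      using AE_M
    proof eventually_elim
      case (elim x)
      have b: "\<bar>h j x\<bar> \<le> B" by (rule bound[OF elim])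
      have "\<bar>h j x\<bar> * \<bar>h j x\<bar> \<le> B * B" by (rule mult_mono) (use b in auto)
      then have 1: "(\<bar>h j x\<bar> * \<bar>h j x\<bar>) ^ k \<le> (B * B) ^ k" by (rule power_mono) simp
      have 2: "\<bar>x\<bar> ^ (k - 1) \<le> 1" using elim by (simp add: power_le_one)
      have "0 \<le> (B * B) ^ k" by simp
      then have "(\<bar>h j x\<bar> * \<bar>h j x\<bar>) ^ k * \<bar>x\<bar> ^ (k - 1) \<le> (B * B) ^ k * 1"
        by (rule mult_mono[OF 1 2]) simp
      then show ?case by (simp add: abs_mult power_abs)
    qed
  qed simp
  then have "(\<lambda>j. cycsum \<delta> (\<lambda>k. \<integral>x. (h j x * h j x) ^ k * x ^ (k - 1) \<partial>M) (replicate n 1))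
    \<longlonglongrightarrow> cycsum \<delta> (\<lambda>k. \<integral>x. (g x * g x) ^ k * x ^ (k - 1) \<partial>M) (replicate n 1)"
    by (rule cycsum_tendsto)
  moreover have "0 \<le> cycsum \<delta> (\<lambda>k. \<integral>x. (h j x * h j x) ^ k * x ^ (k - 1) \<partial>M) (replicate n 1)" for j
    using good[of j] \<delta> by (auto simp: good_def)
  ultimately show "0 \<le> cycsum \<delta> (\<lambda>k. \<integral>x. (g x * g x) ^ k * x ^ (k - 1) \<partial>M) (replicate n 1)"
    by (intro LIMSEQ_le_const) auto
qed

lemma good_continuous:
  assumes h: "continuous_on UNIV h"
  shows "good h"
proof -
  have hc: "continuous_on {-1..1} h" using h continuous_on_subset by blast
  have "\<exists>g. \<forall>x\<in>{-1..1}. \<bar>h x - poly g x\<bar> < 1 / real (Suc j)" for j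
  proof -
    obtain f where f: "real_polynomial_function f" "\<And>x. x \<in> {-1..1} \<Longrightarrow> \<bar>h x - f x\<bar> < 1 / real (Suc j)"
      using Stone_Weierstrass_real_polynomial_function[OF compact_Icc hc, of "1 / real (Suc j)"] by auto
    obtain a n where "f = (\<lambda>x. \<Sum>i\<le>n. a i * x ^ i)"
      using f(1) real_polynomial_function_iff_sum by auto
    then have "f = poly (\<Sum>i\<le>n. monom (a i) i)" by (auto simp: poly_sum poly_monom)
    then show ?thesis using f(2) by blast
  qed
  then obtain G where G: "\<And>j x. x \<in> {-1..1} \<Longrightarrow> \<bar>h x - poly (G j) x\<bar> < 1 / real (Suc j)" by metis
  obtain B where B: "\<And>x. x \<in> {-1..1} \<Longrightarrow> \<bar>h x\<bar> \<le> B"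
    using compact_imp_bounded[OF compact_continuous_image[OF hc compact_Icc]]
    unfolding bounded_iff by (metis imageI real_norm_def)
  have one: "\<bar>h x - poly (G j) x\<bar> < 1" if "x \<in> {-1..1}" for j x
    using G[OF that, of j] by (rule less_le_trans) simp
  show ?thesis
  proof (rule good_limit[where h = "\<lambda>j. poly (G j)" and B = "B + 1"])
    show "\<bar>poly (G j) x\<bar> \<le> B + 1" if "\<bar>x\<bar> \<le> 1" for j x
      using B[of x] one[of x j] that by (simp add: abs_le_iff abs_less_iff)
    show "(\<lambda>j. poly (G j) x) \<longlonglongrightarrow> h x" if "\<bar>x\<bar> \<le> 1" for x
    proof -
      have "(\<lambda>j. poly (G j) x - h x) \<longlonglongrightarrow> 0"
      proof (rule Lim_null_comparison[OF _ LIMSEQ_Suc[OF lim_1_over_n]], intro always_eventually allI)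
        fix j
        have "\<bar>h x - poly (G j) x\<bar> < 1 / real (Suc j)" using that by (intro G) auto
        then show "norm (poly (G j) x - h x) \<le> 1 / real (Suc j)" by (simp add: abs_minus_commute)
      qed
      then show ?thesis by (simp add: LIM_zero_iff)
    qed
    show "h \<in> borel_measurable borel" by (rule borel_measurable_continuous_onI[OF h])
    show "poly (G j) \<in> borel_measurable borel" for j
      by (intro borel_measurable_continuous_onI continuous_intros)
  qed (rule good_poly)
qed

text \<open>A square root of 1 / |x| on the tail, because \<open>good\<close> refers to the square
  of its argument.\<close>

definition tailf :: "real \<Rightarrow> real \<Rightarrow> real \<Rightarrow> real"
  where "tailf \<sigma> a x = (if a \<le> \<sigma> * x then 1 / sqrt (\<sigma> * x) else 0)"

lemma tailf_measurable [measurable]: "tailf \<sigma> a \<in> borel_measurable borel"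
  unfolding tailf_def[abs_def] by measurable

text \<open>A ramp of slope j in \<sigma> x replaces the jump at a, and the maximum with a keeps the
  square root away from 0, so the approximants are continuous and bounded.\<close>

lemma good_tailf:
  assumes a: "a > 0" and s: "\<bar>\<sigma>\<bar> = 1"
  shows "good (tailf \<sigma> a)"
proof (rule good_limit)
  define h where "h j x = max 0 (min 1 (1 - real j * (a - \<sigma> * x))) / sqrt (max (\<sigma> * x) a)" for j :: nat and x
  have sq: "sqrt (max (\<sigma> * x) a) \<noteq> 0" for x using a by (auto simp: max_def)
  show "good (h j)" for j
    unfolding h_def[abs_def] by (rule good_continuous) (intro continuous_intros ballI sq)
  show "h j \<in> borel_measurable borel" for j
    unfolding h_def[abs_def] by (rule borel_measurable_continuous_onI) (intro continuous_intros ballI sq)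
  show "tailf \<sigma> a \<in> borel_measurable borel" by simp
  show "\<bar>h j x\<bar> \<le> 1 / sqrt a" for j x
  proof -
    have "sqrt a \<le> sqrt (max (\<sigma> * x) a)" by simp
    moreover have "0 \<le> max 0 (min 1 (1 - real j * (a - \<sigma> * x)))" "max 0 (min 1 (1 - real j * (a - \<sigma> * x))) \<le> 1"
      by auto
    ultimately have "h j x \<le> 1 / sqrt a" "0 \<le> h j x"
      using a unfolding h_def by (auto intro!: frac_le divide_nonneg_nonneg)
    then show ?thesis by simp
  qed
  show "(\<lambda>j. h j x) \<longlonglongrightarrow> tailf \<sigma> a x" for x
  proof (cases "a \<le> \<sigma> * x")
    case True
    have "0 \<le> real j * (\<sigma> * x - a)" for j using True by simp
    then have "h j x = tailf \<sigma> a x" for j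
      using True by (simp add: h_def tailf_def max_absorb1 algebra_simps)
    then show ?thesis by simp
  next
    case False
    then obtain N :: nat where N: "1 / (a - \<sigma> * x) < real N" using reals_Archimedean2 by blast
    have "h j x = tailf \<sigma> a x" if "j \<ge> N" for j
    proof -
      have "1 / (a - \<sigma> * x) < real j" using N that by linarith
      then have "1 < real j * (a - \<sigma> * x)" using False by (simp add: divide_less_eq)
      then show ?thesis using False by (simp add: h_def tailf_def)
    qed
    then have "eventually (\<lambda>j. h j x = tailf \<sigma> a x) sequentially"
      unfolding eventually_sequentially by blast
    then show ?thesis by (rule tendsto_eventually)
  qed
qed

text \<open>Here \<open>x * f x = \<sigma>\<close> for \<open>f = tailf\<^sup>2\<close>, so the cycle sum collapses to a falling factorial.\<close>

lemma tail_integral_Nats: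
  assumes a: "a > 0" and s: "\<sigma> = 1 \<or> \<sigma> = - 1"
  shows "(\<integral>x. (if a \<le> \<sigma> * x then 1 / (\<sigma> * x) else 0) \<partial>M) \<in> \<nat>"
proof -
  define \<nu> where "\<nu> = (\<integral>x. (if a \<le> \<sigma> * x then 1 / (\<sigma> * x) else 0) \<partial>M)"
  have ss: "\<sigma> * \<sigma> = 1" using s by auto
  have g: "good (tailf \<sigma> a)" using s by (intro good_tailf[OF a]) auto
  \<comment> \<open>Restricted to k at least 1: for k = 0 the integrand is the constant 1, which is
    not confined to the tail.\<close>
  have p: "(\<integral>x. (tailf \<sigma> a x * tailf \<sigma> a x) ^ k * x ^ (k - 1) \<partial>M) = \<sigma> ^ (k - 1) * \<nu>" if "k \<ge> 1" for k
  proof -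
    have "(tailf \<sigma> a x * tailf \<sigma> a x) ^ k * x ^ (k - 1) = \<sigma> ^ (k - 1) * (if a \<le> \<sigma> * x then 1 / (\<sigma> * x) else 0)" for x
    proof (cases "a \<le> \<sigma> * x")
      case True
      then have y: "\<sigma> * x > 0" using a by simp
      obtain j where k: "k = Suc j" using \<open>k \<ge> 1\<close> by (cases k) auto
      have "tailf \<sigma> a x * tailf \<sigma> a x = 1 / (\<sigma> * x)" using True y by (simp add: tailf_def)
      moreover have "(1 / (\<sigma> * x)) ^ j * x ^ j = \<sigma> ^ j"
      proof -
        have "1 / (\<sigma> * x) * x = \<sigma>" using y s by auto
        then show ?thesis by (metis power_mult_distrib)
      qed
      ultimately show ?thesis using True by (simp add: k mult_ac)
    next
      case False
      then show ?thesis using \<open>k \<ge> 1\<close> by (simp add: tailf_def)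
    qed
    then show ?thesis by (simp add: \<nu>_def)
  qed
  have "0 \<le> (\<Prod>i<n. \<nu> - real i)" for n
  proof -
    let ?p = "\<lambda>k. \<integral>x. (tailf \<sigma> a x * tailf \<sigma> a x) ^ k * x ^ (k - 1) \<partial>M"
    \<comment> \<open>All arguments met in the recursion are successors, so the sums agree although
      the two functions may differ at 0.\<close>
    have eq: "cycsum (- \<sigma>) ?p (map Suc js) = cycsum (- \<sigma>) (\<lambda>k. \<sigma> ^ (k - 1) * \<nu>) (map Suc js)" for js
    proof (induction js rule: length_induct)
      case (1 js)
      show ?case
      proof (cases js)
        case (Cons j r)
        have "(map Suc r)[i := map Suc r ! i + Suc j] = map Suc (r[i := r ! i + Suc j])" if "i < length r" for i
          using that by (simp add: map_update)
        then show ?thesis using 1 Cons p[of "Suc j"] by simp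
      qed simp
    qed
    have "0 \<le> cycsum (- \<sigma>) ?p (map Suc (replicate n 0))"
      using g s by (auto simp: good_def map_replicate_const)
    also have "\<dots> = (\<Prod>i<n. \<nu> - real i)" unfolding eq cycsum_geometric[OF ss] by (simp add: sum_list_replicate)
    finally show ?thesis .
  qed
  then show ?thesis using falling_factorials_nonneg_imp_Nats by (simp add: \<nu>_def)
qed

end

section \<open>Enumerating the atoms\<close>

context moment_measure
begin

definition tail_mass :: "real \<Rightarrow> real \<Rightarrow> real"
  where "tail_mass \<sigma> a = (\<integral>x. (if a \<le> \<sigma> * x then 1 / (\<sigma> * x) else 0) \<partial>M)"

lemma integrable_tail: "a > 0 \<Longrightarrow> integrable M (\<lambda>x. if a \<le> \<sigma> * x then 1 / (\<sigma> * x) else 0)"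
  by (rule integrable_bounded[of _ "1 / a"]) (auto intro!: frac_le)

lemma tail_mass_antimono: "0 < a \<Longrightarrow> a \<le> b \<Longrightarrow> tail_mass \<sigma> b \<le> tail_mass \<sigma> a"
  unfolding tail_mass_def by (rule integral_mono) (auto intro!: integrable_tail)

text \<open>The tail is closed at a, hence is the intersection of the larger tails. This left
  continuity makes the positive suprema in \<open>tail_sequence\<close> attained.\<close>

lemma tail_mass_left_limit:
  assumes a: "a > 0"
  shows "(\<lambda>j. tail_mass \<sigma> (a - a / real (j + 2))) \<longlonglongrightarrow> tail_mass \<sigma> a"
proof -
  \<comment> \<open>All cutoffs stay above a / 2, so 2 / a dominates the integrands.\<close>
  define b where "b j = a - a / real (j + 2)" for j
  have b: "a / 2 \<le> b j" "b j < a" for j using a by (auto simp: b_def field_simps)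
  have "(\<lambda>j. a - a * (1 / real (j + 2))) \<longlonglongrightarrow> a - a * 0"
    by (intro tendsto_intros LIMSEQ_ignore_initial_segment[OF lim_1_over_n])
  moreover have "b = (\<lambda>j. a - a * (1 / real (j + 2)))" by (auto simp: b_def)
  ultimately have blim: "b \<longlonglongrightarrow> a" by simp
  have "(\<lambda>j. tail_mass \<sigma> (b j)) \<longlonglongrightarrow> tail_mass \<sigma> a"
    unfolding tail_mass_def
  proof (rule integral_dominated_convergence[where w = "\<lambda>_. 2 / a"])
    show "AE x in M. (\<lambda>j. if b j \<le> \<sigma> * x then 1 / (\<sigma> * x) else 0) \<longlonglongrightarrow> (if a \<le> \<sigma> * x then 1 / (\<sigma> * x) else 0)"
    proof (rule AE_I2)
      fix x
      show "(\<lambda>j. if b j \<le> \<sigma> * x then 1 / (\<sigma> * x) else 0) \<longlonglongrightarrow> (if a \<le> \<sigma> * x then 1 / (\<sigma> * x) else 0)"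
      proof (cases "a \<le> \<sigma> * x")
        case True
        then have "b j \<le> \<sigma> * x" for j using b(2)[of j] by simp
        then show ?thesis using True by simp
      next
        case False
        then have "eventually (\<lambda>j. \<sigma> * x < b j) sequentially"
          using order_tendstoD(1)[OF blim] by simp
        then have "eventually (\<lambda>j. (if b j \<le> \<sigma> * x then 1 / (\<sigma> * x) else 0) = 0) sequentially"
          by eventually_elim simp
        then show ?thesis using False by (simp add: tendsto_eventually)
      qed
    qed
    show "AE x in M. norm (if b j \<le> \<sigma> * x then 1 / (\<sigma> * x) else 0) \<le> 2 / a" for j
    proof (rule AE_I2)
      fix x
      show "norm (if b j \<le> \<sigma> * x then 1 / (\<sigma> * x) else 0) \<le> 2 / a"
      proof (cases "b j \<le> \<sigma> * x")
        case True
        then have "a / 2 \<le> \<sigma> * x" using b(1)[of j] by simp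
        then have "1 / (\<sigma> * x) \<le> 1 / (a / 2)" using a by (intro frac_le) auto
        then show ?thesis using True \<open>a / 2 \<le> \<sigma> * x\<close> a by simp
      qed (use a in simp)
    qed
  qed (auto intro!: meas_M)
  then show ?thesis by (simp add: b_def)
qed

text \<open>With density 1 / |x|, the part of M where \<sigma> x > 0 becomes a counting measure:
  \<open>n a\<close> is the number of points with \<sigma> x at least a, and \<alpha> lists them in
  decreasing order. Undoing the density raises the exponent k to k + 1.\<close>

lemma tail_sequence:
  assumes s: "\<sigma> = 1 \<or> \<sigma> = - 1"
  shows "\<exists>\<alpha>. decseq \<alpha> \<and> (\<forall>i. 0 \<le> \<alpha> i) \<and>
    (\<forall>k. (\<lambda>i. \<alpha> i ^ Suc k) sums (\<integral>x. (if 0 < \<sigma> * x then (\<sigma> * x) ^ k else 0) \<partial>M))"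
proof -
  define n where "n a = nat \<lfloor>tail_mass \<sigma> a\<rfloor>" for a
  have n: "real (n a) = tail_mass \<sigma> a" if "a > 0" for a
    using tail_integral_Nats[OF that s] by (auto simp: n_def tail_mass_def elim!: Nats_cases)
  have nmono: "n b \<le> n a" if "0 < a" "a \<le> b" for a b
    using tail_mass_antimono[OF that, of \<sigma>] n[of a] n[of b] that by simp
  have nbig: "n a = 0" if "a > 1" for a
  proof -
    have "tail_mass \<sigma> a = (\<integral>x. 0 \<partial>M)"
      unfolding tail_mass_def
    proof (rule integral_cong_AE)
      show "AE x in M. (if a \<le> \<sigma> * x then 1 / (\<sigma> * x) else 0) = 0"
        using AE_M by eventually_elim (use s that in auto)
    qed (auto intro!: meas_M)
    then show ?thesis by (simp add: n_def)
  qed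
  \<comment> \<open>The element 0 keeps the set nonempty when at most i points exist, so that
    \<alpha> is padded with 0.\<close>
  define A where "A i = insert 0 {a. 0 < a \<and> i < n a}" for i
  define \<alpha> where "\<alpha> i = Sup (A i)" for i
  have bdd: "bdd_above (A i)" for i
    by (rule bdd_aboveI[of _ 1]) (use nbig in \<open>force simp: A_def not_le[symmetric]\<close>)
  have a0: "0 \<le> \<alpha> i" for i
    unfolding \<alpha>_def by (rule cSup_upper[OF _ bdd]) (simp add: A_def)
  \<comment> \<open>Tail counts and entries determine each other; the implication from left to right
    is the one that uses left continuity.\<close>
  have P: "a \<le> \<alpha> i \<longleftrightarrow> i < n a" if a: "a > 0" for a i
  proof
    assume "i < n a"
    then show "a \<le> \<alpha> i" unfolding \<alpha>_def by (intro cSup_upper bdd) (simp add: A_def a)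
  next
    assume le: "a \<le> \<alpha> i"
    have "real i + 1 \<le> tail_mass \<sigma> (a - a / real (j + 2))" for j
    proof -
      let ?b = "a - a / real (j + 2)"
      have "a / real (j + 2) \<le> a / 2" using a by (intro divide_left_mono) auto
      moreover have "a / real (j + 2) > 0" using a by simp
      ultimately have b: "0 < ?b" "?b < a" using a by linarith+
      have "?b < Sup (A i)" using le b(2) unfolding \<alpha>_def by (rule less_le_trans[rotated])
      moreover have "A i \<noteq> {}" by (simp add: A_def)
      ultimately obtain c where c: "c \<in> A i" "?b < c" using less_cSup_iff[OF _ bdd] by blast
      then have "i < n c" "0 < c" using b by (auto simp: A_def)
      then have "i < n ?b" using nmono[OF b(1), of c] c by simp
      then show ?thesis using n[OF b(1)] by linarith
    qed
    then have "real i + 1 \<le> tail_mass \<sigma> a"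
      using tail_mass_left_limit[OF a, of \<sigma>] by (intro LIMSEQ_le_const) auto
    then show "i < n a" using n[OF a] by linarith
  qed
  have dec: "decseq \<alpha>"
  proof (rule decseq_SucI)
    fix i
    show "\<alpha> (Suc i) \<le> \<alpha> i"
    proof (cases "\<alpha> (Suc i) > 0")
      case True
      then show ?thesis using P[OF True, of "Suc i"] P[OF True, of i] by simp
    qed (use a0[of i] in simp)
  qed
  \<comment> \<open>Beyond \<epsilon> two finite measures have the same mass on every ray to the
    right, hence agree. The cutoff avoids the infinite mass that may accumulate at 0.\<close>
  have trunc: "(\<integral>x. (if \<epsilon> \<le> \<sigma> * x then (\<sigma> * x) ^ k else 0) \<partial>M) = (\<Sum>i<n \<epsilon>. \<alpha> i ^ Suc k)"
    if e: "\<epsilon> > 0" for \<epsilon> k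
  proof -
    let ?w = "\<lambda>x. if \<epsilon> \<le> \<sigma> * x then 1 / (\<sigma> * x) else 0"
    have w0: "0 \<le> ?w x" for x using e by simp
    have wm: "?w \<in> borel_measurable M" by (rule meas_M) simp
    define D where "D = distr (density M (\<lambda>x. ennreal (?w x))) borel (\<lambda>x. \<sigma> * x)"
    define C where "C = distr (count_space {..<n \<epsilon>}) borel \<alpha>"
    have sm: "(\<lambda>x. \<sigma> * x) \<in> measurable (density M (\<lambda>x. ennreal (?w x))) borel"
      using meas_M[of "\<lambda>x. \<sigma> * x"] by simp
    have eD: "emeasure D {a..} = ennreal (real (n (max a \<epsilon>)))" for a
    proof -
      have m: "{x. a \<le> \<sigma> * x} \<in> sets M" unfolding sets_M by measurable
      have spM: "space M = UNIV" using sets_eq_imp_space_eq[OF sets_M] by simp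
      have "emeasure D {a..} = emeasure (density M (\<lambda>x. ennreal (?w x))) {x. a \<le> \<sigma> * x}"
        unfolding D_def by (subst emeasure_distr[OF sm]) (auto simp: spM vimage_def)
      also have "\<dots> = (\<integral>\<^sup>+x. ennreal (?w x) * indicator {x. a \<le> \<sigma> * x} x \<partial>M)"
        by (rule emeasure_density) (use wm m in auto)
      also have "\<dots> = (\<integral>\<^sup>+x. ennreal (if max a \<epsilon> \<le> \<sigma> * x then 1 / (\<sigma> * x) else 0) \<partial>M)"
        by (intro nn_integral_cong) (auto simp: indicator_def)
      also have "\<dots> = ennreal (tail_mass \<sigma> (max a \<epsilon>))"
        unfolding tail_mass_def using e by (intro nn_integral_eq_integral integrable_tail) auto
      finally show ?thesis using n[of "max a \<epsilon>"] e by simp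
    qed
    have eC: "emeasure C {a..} = ennreal (real (n (max a \<epsilon>)))" for a
    proof -
      have "{i. i < n \<epsilon> \<and> a \<le> \<alpha> i} = {..<n (max a \<epsilon>)}"
        using P[OF e] P[of "max a \<epsilon>"] e by fastforce
      moreover have "emeasure C {a..} = emeasure (count_space {..<n \<epsilon>}) {i. i < n \<epsilon> \<and> a \<le> \<alpha> i}"
        unfolding C_def by (subst emeasure_distr) (auto simp: vimage_def Int_def conj_commute)
      moreover have "n (max a \<epsilon>) \<le> n \<epsilon>" using nmono[OF e, of "max a \<epsilon>"] by simp
      ultimately show ?thesis by (simp add: emeasure_count_space_finite ennreal_of_nat_eq_real_of_nat)
    qed
    have "D = C"
    proof (rule measure_eqI_generator_eq[where E = "range (\<lambda>a. {a..})" and \<Omega> = UNIV and A = "\<lambda>i. {- real i..}"])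
      show "Int_stable (range (\<lambda>a::real. {a..}))"
      proof (rule Int_stableI_image)
        fix a b :: real
        show "\<exists>c\<in>UNIV. {a..} \<inter> {b..} = {c..}" by (rule bexI[of _ "max a b"]) auto
      qed
      have "sets borel = sigma_sets UNIV (range (\<lambda>a::real. {a..}))"
        by (subst borel_Ici) simp
      then show "sets D = sigma_sets UNIV (range (\<lambda>a. {a..}))" "sets C = sigma_sets UNIV (range (\<lambda>a. {a..}))"
        by (simp_all add: D_def C_def)
      show "(\<Union>i. {- real i..}) = UNIV"
      proof -
        have "x \<in> (\<Union>i. {- real i..})" for x :: real
        proof -
          obtain k :: nat where "- x \<le> real k" using real_arch_simple by blast
          then show ?thesis by (intro UN_I[of k]) auto
        qed
        then show ?thesis by blast
      qed
    qed (auto simp: eD eC)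
    then have "(\<integral>y. y ^ Suc k \<partial>D) = (\<integral>y. y ^ Suc k \<partial>C)" by simp
    also have "(\<integral>y. y ^ Suc k \<partial>C) = (\<Sum>i<n \<epsilon>. \<alpha> i ^ Suc k)"
      unfolding C_def by (subst integral_distr) (auto simp: lebesgue_integral_count_space_finite)
    also have "(\<integral>y. y ^ Suc k \<partial>D) = (\<integral>x. (\<sigma> * x) ^ Suc k \<partial>density M (\<lambda>x. ennreal (?w x)))"
      unfolding D_def by (rule integral_distr[OF sm]) simp
    also have "\<dots> = (\<integral>x. ?w x *\<^sub>R (\<sigma> * x) ^ Suc k \<partial>M)"
      by (rule integral_density) (use w0 wm in \<open>auto intro!: meas_M\<close>)
    also have "\<dots> = (\<integral>x. (if \<epsilon> \<le> \<sigma> * x then (\<sigma> * x) ^ k else 0) \<partial>M)"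
      by (intro Bochner_Integration.integral_cong refl) (use e in auto)
    finally show ?thesis by simp
  qed
  have "(\<lambda>i. \<alpha> i ^ Suc k) sums (\<integral>x. (if 0 < \<sigma> * x then (\<sigma> * x) ^ k else 0) \<partial>M)" (is "?f sums ?I") for k
  proof -
    define \<epsilon> where "\<epsilon> j = 1 / real (Suc j)" for j
    have e: "\<epsilon> j > 0" for j by (simp add: \<epsilon>_def)
    have elim: "\<epsilon> \<longlonglongrightarrow> 0" unfolding \<epsilon>_def by (rule LIMSEQ_Suc[OF lim_1_over_n])
    have "(\<lambda>j. \<integral>x. (if \<epsilon> j \<le> \<sigma> * x then (\<sigma> * x) ^ k else 0) \<partial>M) \<longlonglongrightarrow> ?I"
    proof (rule integral_dominated_convergence[where w = "\<lambda>_. 1"])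
      show "AE x in M. (\<lambda>j. if \<epsilon> j \<le> \<sigma> * x then (\<sigma> * x) ^ k else 0) \<longlonglongrightarrow> (if 0 < \<sigma> * x then (\<sigma> * x) ^ k else 0)"
      proof (rule AE_I2)
        fix x
        show "(\<lambda>j. if \<epsilon> j \<le> \<sigma> * x then (\<sigma> * x) ^ k else 0) \<longlonglongrightarrow> (if 0 < \<sigma> * x then (\<sigma> * x) ^ k else 0)"
        proof (cases "0 < \<sigma> * x")
          case True
          have "eventually (\<lambda>j. \<epsilon> j < \<sigma> * x) sequentially"
            using order_tendstoD(2)[OF elim True] .
          then have "eventually (\<lambda>j. (if \<epsilon> j \<le> \<sigma> * x then (\<sigma> * x) ^ k else 0) = (\<sigma> * x) ^ k) sequentially"
            by eventually_elim simp
          then show ?thesis using True by (simp add: tendsto_eventually)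
        next
          case False
          then have "\<not> \<epsilon> j \<le> \<sigma> * x" for j using e[of j] by linarith
          then show ?thesis using False by simp
        qed
      qed
      show "AE x in M. norm (if \<epsilon> j \<le> \<sigma> * x then (\<sigma> * x) ^ k else 0) \<le> 1" for j
        using AE_M by eventually_elim (use s in \<open>auto simp: power_abs power_le_one\<close>)
    qed (auto intro!: meas_M)
    then have T: "(\<lambda>j. \<Sum>i<n (\<epsilon> j). ?f i) \<longlonglongrightarrow> ?I" by (simp only: trunc[OF e])
    have f0: "0 \<le> ?f i" for i using a0 by simp
    \<comment> \<open>Entries equal to 0 contribute nothing, and each positive one is counted as
      soon as the cutoff falls below it.\<close>
    have part: "(\<Sum>i<K. ?f i) \<le> ?I" for K
    proof -
      have "eventually (\<lambda>j. \<forall>i\<in>{..<K}. 0 < \<alpha> i \<longrightarrow> i < n (\<epsilon> j)) sequentially"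
      proof (intro eventually_ball_finite ballI)
        fix i
        show "eventually (\<lambda>j. 0 < \<alpha> i \<longrightarrow> i < n (\<epsilon> j)) sequentially"
        proof (cases "0 < \<alpha> i")
          case True
          from order_tendstoD(2)[OF elim True] show ?thesis
            by eventually_elim (use P[OF e] less_imp_le in blast)
        qed simp
      qed simp
      then have "eventually (\<lambda>j. (\<Sum>i<K. ?f i) \<le> (\<Sum>i<n (\<epsilon> j). ?f i)) sequentially"
      proof eventually_elim
        case (elim j)
        have "(\<Sum>i<K. ?f i) = (\<Sum>i\<in>{i\<in>{..<K}. 0 < \<alpha> i}. ?f i)"
        proof (rule sum.mono_neutral_right)
          show "\<forall>i\<in>{..<K} - {i \<in> {..<K}. 0 < \<alpha> i}. ?f i = 0"
          proof
            fix i assume "i \<in> {..<K} - {i \<in> {..<K}. 0 < \<alpha> i}"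
            then have "\<alpha> i = 0" using a0[of i] by auto
            then show "?f i = 0" by simp
          qed
        qed auto
        also have "\<dots> \<le> (\<Sum>i<n (\<epsilon> j). ?f i)"
          using elim f0 by (intro sum_mono2) auto
        finally show ?case .
      qed
      then show ?thesis by (rule tendsto_lowerbound[OF T]) simp
    qed
    have sm: "summable ?f"
      by (rule summableI_nonneg_bounded[OF f0 part])
    have "suminf ?f \<le> ?I" by (rule suminf_le_const[OF sm part])
    moreover have "?I \<le> suminf ?f"
      by (rule LIMSEQ_le_const2[OF T]) (use sm f0 sum_le_suminf in blast)
    ultimately show ?thesis using sm by (simp add: sums_iff)
  qed
  then show ?thesis using dec a0 by blast
qed

text \<open>The line splits into two half lines and the point 0, whose mass \<gamma> enters only the
  moment of order 0, as 0^0 = 1.\<close>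

theorem moment_sequences:
  "\<exists>\<alpha> \<beta> \<gamma>. decseq \<alpha> \<and> (\<forall>i. 0 \<le> \<alpha> i) \<and> decseq \<beta> \<and> (\<forall>i. 0 \<le> \<beta> i) \<and> 0 \<le> \<gamma> \<and>
    (\<forall>k. summable (\<lambda>i. \<alpha> i ^ Suc k)) \<and> (\<forall>k. summable (\<lambda>i. \<beta> i ^ Suc k)) \<and>
    (\<forall>k. m k = (\<Sum>i. \<alpha> i ^ Suc k) + (- 1) ^ k * (\<Sum>i. \<beta> i ^ Suc k) + (if k = 0 then \<gamma> else 0))"
proof -
  obtain \<alpha> where "decseq \<alpha> \<and> (\<forall>i. 0 \<le> \<alpha> i) \<and>
    (\<forall>k. (\<lambda>i. \<alpha> i ^ Suc k) sums (\<integral>x. (if 0 < 1 * x then (1 * x) ^ k else 0) \<partial>M))"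
    using tail_sequence[of 1] by blast
  then have \<alpha>: "decseq \<alpha>" "\<And>i. 0 \<le> \<alpha> i"
    "\<And>k. (\<lambda>i. \<alpha> i ^ Suc k) sums (\<integral>x. (if 0 < x then x ^ k else 0) \<partial>M)"
    unfolding mult_1 by blast+
  obtain \<beta> where "decseq \<beta> \<and> (\<forall>i. 0 \<le> \<beta> i) \<and>
    (\<forall>k. (\<lambda>i. \<beta> i ^ Suc k) sums (\<integral>x. (if 0 < - 1 * x then (- 1 * x) ^ k else 0) \<partial>M))"
    using tail_sequence[of "- 1"] by blast
  then have \<beta>: "decseq \<beta>" "\<And>i. 0 \<le> \<beta> i"
    "\<And>k. (\<lambda>i. \<beta> i ^ Suc k) sums (\<integral>x. (if x < 0 then (- x) ^ k else 0) \<partial>M)"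
    unfolding mult_minus1 neg_0_less_iff_less by blast+
  define \<gamma> where "\<gamma> = (\<integral>x. (if x = 0 then 1 else 0 :: real) \<partial>M)"
  have "0 \<le> \<gamma>" unfolding \<gamma>_def by (rule integral_nonneg_AE) auto
  moreover have "m k = (\<Sum>i. \<alpha> i ^ Suc k) + (- 1) ^ k * (\<Sum>i. \<beta> i ^ Suc k) + (if k = 0 then \<gamma> else 0)" for k
  proof -
    have i1: "integrable M (\<lambda>x. if 0 < x then x ^ k else 0)"
      by (rule integrable_bounded[of _ 1]) (auto simp: power_abs power_le_one)
    have i2: "integrable M (\<lambda>x. if x < 0 then (- x) ^ k else 0)"
      by (rule integrable_bounded[of _ 1]) (auto simp: power_abs power_le_one)
    have i3: "integrable M (\<lambda>x. if x = 0 then 1 else (0::real))"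
      by (rule integrable_bounded[of _ 1]) auto
    have "x ^ k = (if 0 < x then x ^ k else 0) + (- 1) ^ k * (if x < 0 then (- x) ^ k else 0)
        + (if k = 0 then 1 else 0) * (if x = 0 then 1 else 0)" for x :: real
    proof -
      have "(- 1) ^ k * (- x) ^ k = x ^ k" by (simp flip: power_mult_distrib)
      then show ?thesis by (cases "x = 0"; cases "x < 0") (auto simp: power_0_left)
    qed
    then have "m k = (\<integral>x. (if 0 < x then x ^ k else 0) + (- 1) ^ k * (if x < 0 then (- x) ^ k else 0)
        + (if k = 0 then 1 else 0) * (if x = 0 then 1 else 0) \<partial>M)"
      using moments[of k] by simp
    also have "\<dots> = (\<integral>x. (if 0 < x then x ^ k else 0) \<partial>M)
        + (- 1) ^ k * (\<integral>x. (if x < 0 then (- x) ^ k else 0) \<partial>M) + (if k = 0 then 1 else 0) * \<gamma>"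
      using i1 i2 i3 by (subst Bochner_Integration.integral_add; simp add: \<gamma>_def)+
    finally show ?thesis using sums_unique[OF \<alpha>(3)[of k]] sums_unique[OF \<beta>(3)[of k]]
      by (simp del: power_Suc)
  qed
  moreover have "summable (\<lambda>i. \<alpha> i ^ Suc k)" "summable (\<lambda>i. \<beta> i ^ Suc k)" for k
    using \<alpha>(3) \<beta>(3) sums_summable by blast+
  ultimately show ?thesis
    using \<alpha>(1,2) \<beta>(1,2) by (intro exI[of _ \<alpha>] exI[of _ \<beta>] exI[of _ \<gamma>] conjI allI)
qed

end

context cycsum_moments
begin

text \<open>Y = (1 + X) / 2 carries [-1, 1] to [0, 1] and division by m 0 normalises the functional,
  as the moment theorem requires; M undoes both changes. The degenerate case m 0 = 0 is
  separate.\<close>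

theorem cycsum_moment_sequences:
  "\<exists>\<alpha> \<beta> \<gamma>. decseq \<alpha> \<and> (\<forall>i. 0 \<le> \<alpha> i) \<and> decseq \<beta> \<and> (\<forall>i. 0 \<le> \<beta> i) \<and> 0 \<le> \<gamma> \<and>
    (\<forall>k. summable (\<lambda>i. \<alpha> i ^ Suc k)) \<and> (\<forall>k. summable (\<lambda>i. \<beta> i ^ Suc k)) \<and>
    (\<forall>k. m k = (\<Sum>i. \<alpha> i ^ Suc k) + (- 1) ^ k * (\<Sum>i. \<beta> i ^ Suc k) + (if k = 0 then \<gamma> else 0))"
proof -
  have m00: "m 0 = L (1 * 1)" using mfun_monom[of m 1 0] by simp
  have m0: "0 \<le> m 0" unfolding m00 by (rule L_square)
  define Y where "Y = smult (1 / 2) (1 + polyX)"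
  have Y1: "1 - Y = smult (1 / 2) (1 - polyX)"
  proof (rule poly_eqI)
    fix k show "coeff (1 - Y) k = coeff (smult (1 / 2) (1 - polyX)) k"
      by (cases "k = 0") (auto simp: Y_def field_simps)
  qed
  have Ypos: "0 \<le> L (Y ^ i * (1 - Y) ^ k)" for i k
  proof -
    have "Y ^ i * (1 - Y) ^ k = smult ((1 / 2) ^ i * (1 / 2) ^ k) ((1 + polyX) ^ i * (1 - polyX) ^ k)"
      unfolding Y1 by (simp add: Y_def smult_power mult_ac)
    then show ?thesis using L_Bernstein[of i k] by (simp add: mfun_smult)
  qed
  have X: "polyX = smult 2 Y - 1" by (simp add: Y_def)
  show ?thesis
  proof (cases "m 0 = 0")
    case True
    have "m j = 0" for j
    proof -
      \<comment> \<open>With m 0 = 0 and m (2 j) at most 1, the square of 1 - (m j) X^j has value at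
        most - (m j)^2.\<close>
      let ?t = "- m j"
      let ?q = "1 + smult ?t (polyX ^ j)"
      have "smult (2 * ?t) p = smult ?t p + smult ?t p" for p :: "real poly"
        by (metis smult_add_left mult_2)
      moreover have e: "polyX ^ (2 * j) = polyX ^ j * polyX ^ j" unfolding mult_2 power_add ..
      ultimately have "?q * ?q = 1 * 1 + smult (2 * ?t) (polyX ^ j) + smult (?t\<^sup>2) (polyX ^ (2 * j))"
        unfolding e by (simp add: algebra_simps power2_eq_square)
      then have "L (?q * ?q) = m 0 + 2 * ?t * m j + ?t\<^sup>2 * m (2 * j)"
        by (simp only: mfun_add mfun_smult m00 polyX_power mfun_monom mult_1_left)
      then have "0 \<le> m 0 + 2 * ?t * m j + ?t\<^sup>2 * m (2 * j)" using L_square[of ?q] by (simp only:)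
      moreover have "(m j)\<^sup>2 * m (2 * j) \<le> (m j)\<^sup>2 * 1"
        by (rule mult_left_mono) (use m_bound[of "2 * j"] in auto)
      ultimately have "(m j)\<^sup>2 \<le> 0" using True by (simp add: power2_eq_square)
      then show ?thesis by simp
    qed
    then show ?thesis
      by (intro exI[of _ "\<lambda>_. 0"] exI[of _ 0]) (simp add: decseq_def)
  next
    case False
    then have m0p: "m 0 > 0" using m0 by simp
    define L' where "L' q = L q / m 0" for q
    have "\<exists>N. real_distribution N \<and> (AE x in N. x \<in> {0..1}) \<and> (\<forall>r. (\<integral>x. x ^ r \<partial>N) = L' (Y ^ r))"
    proof (rule Hausdorff_moments)
      show "L' (smult c p + q) = c * L' p + L' q" for c p q
        by (simp add: L'_def L_linear add_divide_distrib)
      show "L' 1 = 1" using m00 m0p by (simp add: L'_def)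
      show "0 \<le> L' (Y ^ i * (1 - Y) ^ k)" for i k using Ypos m0p by (simp add: L'_def)
    qed
    then obtain N where N: "real_distribution N" "AE y in N. y \<in> {0..1}"
      "\<And>r. (\<integral>y. y ^ r \<partial>N) = L' (Y ^ r)" by blast
    interpret N: real_distribution N by (rule N(1))
    define M where "M = density (distr N borel (\<lambda>y. 2 * y - 1)) (\<lambda>_. ennreal (m 0))"
    have tm: "(\<lambda>y. 2 * y - 1) \<in> measurable N borel" by simp
    have intN: "integrable N (\<lambda>y. y ^ r)" for r
    proof (rule N.integrable_const_bound[of _ 1])
      show "AE y in N. norm (y ^ r) \<le> 1"
        using N(2) by eventually_elim (auto simp: power_abs power_le_one)
    qed simp
    have polyN: "(\<integral>y. poly q y \<partial>N) = L' (pcompose q Y)" for q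
    proof -
      have "(\<integral>y. poly q y \<partial>N) = (\<Sum>i\<le>degree q. \<integral>y. coeff q i * y ^ i \<partial>N)"
        unfolding poly_altdef by (rule Bochner_Integration.integral_sum) (intro integrable_mult_right intN)
      also have "\<dots> = (\<Sum>i\<le>degree q. coeff q i * L' (Y ^ i))" by (simp add: N(3))
      also have "\<dots> = L' (\<Sum>i\<le>degree q. smult (coeff q i) (Y ^ i))"
        by (simp add: L'_def mfun_sum mfun_smult sum_divide_distrib)
      also have "(\<Sum>i\<le>degree q. smult (coeff q i) (Y ^ i)) = pcompose q Y"
        by (simp add: pcompose_altdef poly_altdef coeff_map_poly degree_map_poly)
      finally show ?thesis .
    qed
    have "moment_measure m M"
    proof (intro moment_measure.intro moment_measure_axioms.intro cycsum_moments_axioms finite_measureI)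
      show sM: "sets M = sets borel" by (simp add: M_def)
      have intM: "integral\<^sup>L M f = m 0 * (\<integral>y. f (2 * y - 1) \<partial>N)" if "f \<in> borel_measurable borel" for f :: "real \<Rightarrow> real"
        unfolding M_def
        by (subst integral_density) (use that m0 in \<open>auto simp: integral_distr[OF tm]\<close>)
      have "emeasure M (space M) = ennreal (m 0) * emeasure (distr N borel (\<lambda>y. 2 * y - 1)) UNIV"
        by (simp add: M_def emeasure_density_const)
      also have "emeasure (distr N borel (\<lambda>y. 2 * y - 1)) UNIV = 1"
        using N.emeasure_space_1 by (subst emeasure_distr) auto
      finally show "emeasure M (space M) \<noteq> \<infinity>" by simp
      have "AE x in distr N borel (\<lambda>y. 2 * y - 1). \<bar>x\<bar> \<le> 1"
      proof (subst AE_distr_iff[OF tm])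
        show "AE y in N. \<bar>2 * y - 1\<bar> \<le> 1" using N(2) by eventually_elim auto
      qed simp
      then show "AE x in M. \<bar>x\<bar> \<le> 1"
        unfolding M_def by (subst AE_density) (auto elim!: eventually_mono)
      show "(\<integral>x. x ^ j \<partial>M) = m j" for j
      proof -
        have "(\<integral>x. x ^ j \<partial>M) = m 0 * (\<integral>y. (2 * y - 1) ^ j \<partial>N)" by (rule intM) simp
        also have "(\<integral>y. (2 * y - 1) ^ j \<partial>N) = (\<integral>y. poly ([:-1, 2:] ^ j) y \<partial>N)"
          by (simp add: poly_power algebra_simps)
        also have "\<dots> = L' (pcompose ([:-1, 2:] ^ j) Y)" by (rule polyN)
        also have "pcompose ([:-1, 2:] ^ j) Y = polyX ^ j"
        proof -
          have "pcompose [:-1, 2:] Y = polyX" unfolding X by (simp add: pcompose_pCons algebra_simps one_pCons)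
          moreover have "pcompose (p ^ n) q = pcompose p q ^ n" for p q :: "real poly" and n
            by (induction n) (simp_all add: pcompose_mult pcompose_1)
          ultimately show ?thesis by simp
        qed
        finally show ?thesis using m0p by (simp add: L'_def polyX_power)
      qed
    qed
    then show ?thesis by (rule moment_measure.moment_sequences)
  qed
qed

end

section \<open>Cycle decomposition\<close>

text \<open>The last hypothesis says that D is the orbit of i. Induction on its size: conjugating by
  a flip at m, the image of i, clears the flip stored there, and multiplying by the transposition of
  i and m then cuts m out of the cycle.\<close>

lemma cycle_conj_canonical:
  assumes "finite D" "c \<in> Bc" "i \<in> D" "0 \<notin> D" "B_supp c \<subseteq> D" "snd c ` D \<subseteq> D"
    and "\<And>E. E \<subseteq> D \<Longrightarrow> i \<in> E \<Longrightarrow> snd c ` E \<subseteq> E \<Longrightarrow> E = D"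
  shows "\<exists>ms v. distinct ms \<and> set ms = D - {i} \<and> v \<in> Bc \<and> B_supp v \<subseteq> D - {i} \<and>
    c = v \<odot> (bflip_pow (\<Sum>k\<in>D. fst c k) i \<odot> transps (zip (replicate (length ms) i) ms)) \<odot> binv v"
  using assms
proof (induction "card D" arbitrary: D c rule: less_induct)
  case less
  note fin = less.prems(1) and c = less.prems(2) and iD = less.prems(3) and D0 = less.prems(4)
    and sc = less.prems(5) and inv = less.prems(6) and min = less.prems(7)
  have i0: "i \<noteq> 0" using iD D0 by metis
  define m where "m = snd c i"
  show ?case
  proof (cases "m = i")
    case True
    have D: "D = {i}" using min[of "{i}"] iD True by (auto simp: m_def)
    have "c = bflip_pow (fst c i) i"
    proof (rule prod_eqI)
      have "snd c k = k" for k
        using True sc B_supp_not_apply(1)[of k c] by (cases "k = i") (auto simp: m_def D)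
      then show "snd c = snd (bflip_pow (fst c i) i)" by auto
      show "fst c = fst (bflip_pow (fst c i) i)"
      proof
        fix k show "fst c k = fst (bflip_pow (fst c i) i) k"
        proof (cases "k = i")
          case False
          then have "k \<notin> B_supp c" using sc D by blast
          then show ?thesis using False by (simp add: fst_bflip_pow B_supp_not_apply)
        qed (simp add: fst_bflip_pow)
      qed
    qed
    moreover have "(\<Sum>k\<in>D. fst c k) = fst c i" by (simp add: D)
    moreover have "bflip_pow e i = \<one>\<^bsub>B_grp\<^esub> \<odot> (bflip_pow e i \<odot> transps (zip (replicate (length []) i) [])) \<odot> binv \<one>\<^bsub>B_grp\<^esub>" for e
      using i0 by simp
    ultimately have "c = \<one>\<^bsub>B_grp\<^esub> \<odot> (bflip_pow (\<Sum>k\<in>D. fst c k) i \<odot> transps (zip (replicate (length []) i) [])) \<odot> binv \<one>\<^bsub>B_grp\<^esub>"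
      by metis
    moreover have "distinct ([] :: nat list)" "set [] = D - {i}" by (simp_all add: D)
    moreover have "B_supp \<one>\<^bsub>B_grp\<^esub> \<subseteq> D - {i}" by simp
    ultimately show ?thesis using B.one_closed by blast
  next
    case False
    have mD: "m \<in> D" using inv iD by (auto simp: m_def)
    have m0: "m \<noteq> 0" using mD D0 by metis
    define f where "f = fst c m"
    define z where "z = bflip_pow f m"
    define c1 where "c1 = z \<odot> c \<odot> z"
    define c' where "c' = c1 \<odot> btr i m"
    define D' where "D' = D - {m}"
    have z: "z \<in> Bc" "z \<odot> z = \<one>\<^bsub>B_grp\<^esub>" "B_supp z \<subseteq> {m}" "binv z = z"
      using m0 B_supp_bflip_pow[of f m] by (auto simp: z_def)
    have t: "btr i m \<in> Bc" using i0 m0 by simp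
    have c1: "c1 \<in> Bc" and c': "c' \<in> Bc" using z c t by (auto simp: c1_def c'_def)
    have snd_c1: "snd c1 = snd c" by (simp add: c1_def z_def)
    have fst_c1: "fst c1 k = fst z k + fst c k + fst z (inv_into UNIV (snd c) k)" for k
      by (simp add: c1_def z_def fst_B_mult)
    have fst_c': "fst c' k = fst c1 k" for k by (simp add: c'_def fst_B_mult)
    have snd_c': "snd c' k = snd c (Transposition.transpose i m k)" for k by (simp add: c'_def snd_c1)
    have inv_m: "inv_into UNIV (snd c) m = i" using c by (simp add: m_def)
    have c1m: "fst c1 m = 0" using False by (simp add: fst_c1 inv_m z_def fst_bflip_pow f_def)
    have "B_supp c1 \<subseteq> D"
      using B_supp_mult[of "z \<odot> c" z] B_supp_mult[of z c] z c sc mD unfolding c1_def by auto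
    then have "B_supp c' \<subseteq> D"
      using B_supp_mult[OF c1, of "btr i m"] B_supp_btr[of i m] iD mD unfolding c'_def by auto
    moreover have "m \<notin> B_supp c'" by (simp add: B_supp_iff fst_c' c1m snd_c') (simp add: m_def)
    ultimately have sc': "B_supp c' \<subseteq> D'" by (auto simp: D'_def)
    have fin': "finite D'" and iD': "i \<in> D'" and D0': "0 \<notin> D'"
      using fin iD D0 False by (auto simp: D'_def)
    have cm: "snd c' m = m" by (simp add: snd_c' m_def)
    have inv': "snd c' ` D' \<subseteq> D'"
    proof
      fix y assume "y \<in> snd c' ` D'"
      then obtain k where k: "k \<in> D" "k \<noteq> m" "y = snd c' k" by (auto simp: D'_def)
      have "Transposition.transpose i m k \<in> D" using k iD mD by (auto simp: Transposition.transpose_def)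
      then have "y \<in> D" using inv k(3) by (auto simp: snd_c')
      moreover have "y \<noteq> m" using B_inj[OF c', of k m] cm k by auto
      ultimately show "y \<in> D'" by (simp add: D'_def)
    qed
    have min': "E = D'" if E: "E \<subseteq> D'" "i \<in> E" "snd c' ` E \<subseteq> E" for E
    proof -
      have "insert m E = D"
      proof (rule min)
        show "snd c ` insert m E \<subseteq> insert m E"
        proof
          fix y assume "y \<in> snd c ` insert m E"
          then consider "y = snd c m" | "y = snd c i" | k where "k \<in> E" "k \<noteq> i" "k \<noteq> m" "y = snd c k" by blast
          then show "y \<in> insert m E"
          proof cases
            case 1
            then have "y = snd c' i" by (simp add: snd_c')
            then show ?thesis using E by auto
          next
            case 2 then show ?thesis by (simp add: m_def)
          next
            case 3
            then have "y = snd c' k" by (simp add: snd_c' Transposition.transpose_def)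
            then show ?thesis using E 3 by auto
          qed
        qed
      qed (use E mD in \<open>auto simp: D'_def\<close>)
      then show ?thesis using E(1) by (auto simp: D'_def)
    qed
    have "card D' < card D" using fin mD unfolding D'_def by (rule card_Diff1_less)
    from less.hyps[OF this fin' c' iD' D0' sc' inv' min']
    obtain ms v where ms: "distinct ms" "set ms = D' - {i}" and v: "v \<in> Bc" "B_supp v \<subseteq> D' - {i}"
      and eq: "c' = v \<odot> (bflip_pow (\<Sum>k\<in>D'. fst c' k) i \<odot> transps (zip (replicate (length ms) i) ms)) \<odot> binv v"
      by blast
    have "(\<Sum>k\<in>D'. fst c' k) = (\<Sum>k\<in>D. fst c1 k)"
      using sum.remove[OF fin mD, of "fst c1"] by (simp add: c1m D'_def fst_c')
    also have "\<dots> = (\<Sum>k\<in>D. fst z k) + (\<Sum>k\<in>D. fst c k) + (\<Sum>k\<in>D. fst z (inv_into UNIV (snd c) k))"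
      by (simp only: fst_c1 sum.distrib)
    also have "(\<Sum>k\<in>D. fst z k) = f" using fin mD by (simp add: z_def fst_bflip_pow)
    also have "(\<Sum>k\<in>D. fst z (inv_into UNIV (snd c) k)) = f"
    proof -
      have "fst z (inv_into UNIV (snd c) k) = (if k = snd c m then f else 0)" for k
        using c by (auto simp: z_def fst_bflip_pow)
      then show ?thesis using fin mD inv by (simp add: image_subset_iff)
    qed
    \<comment> \<open>Conjugation by z changes the flips stored at m and at the image of m by the
      same amount f, so the total parity is kept.\<close>
    finally have S: "(\<Sum>k\<in>D'. fst c' k) = f + (\<Sum>k\<in>D. fst c k) + f" .
    define e0 where "e0 = (\<Sum>k\<in>D. fst c k)"
    have "a + b + a = b" for a b :: bit by (cases a; cases b; simp)
    then have eq': "c' = v \<odot> (bflip_pow e0 i \<odot> transps (zip (replicate (length ms) i) ms)) \<odot> binv v"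
      using eq unfolding S e0_def[symmetric] by simp
    let ?e = "bflip_pow e0 i" and ?W = "transps (zip (replicate (length ms) i) ms)"
    have ok: "transps_ok (zip (replicate (length ms) i) ms)"
      using ms D0' i0 by (intro transps_ok_zip) auto
    have e: "?e \<in> Bc" "?W \<in> Bc" using i0 ok by auto
    \<comment> \<open>The support of v avoids i by the induction hypothesis and m by the choice of
      D'.\<close>
    have vt: "binv v \<odot> btr i m = btr i m \<odot> binv v"
      using v t B_supp_btr[of i m] by (intro B_commute) (auto simp: D'_def)
    have W: "?W \<odot> btr i m = transps (zip (replicate (length (ms @ [m])) i) (ms @ [m]))"
    proof -
      have "zip (replicate (length (ms @ [m])) i) (ms @ [m]) = zip (replicate (length ms) i) ms @ [(i, m)]"
        by (simp add: replicate_append_same[symmetric])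
      then show ?thesis using transps_append[OF ok, of "[(i, m)]"] i0 m0 by simp
    qed
    have "c1 = c' \<odot> btr i m" using c1 t i0 m0 by (simp add: c'_def B.m_assoc)
    also have "\<dots> = v \<odot> (?e \<odot> ?W) \<odot> (binv v \<odot> btr i m)"
      unfolding eq' using v e t by (simp add: B.m_assoc)
    also have "\<dots> = v \<odot> (?e \<odot> (?W \<odot> btr i m)) \<odot> binv v"
      unfolding vt using v e t by (simp add: B.m_assoc)
    finally have c1_eq: "c1 = v \<odot> (?e \<odot> (?W \<odot> btr i m)) \<odot> binv v" .
    have "c = (z \<odot> z) \<odot> c \<odot> (z \<odot> z)" using c z(2) by simp
    also have "\<dots> = z \<odot> c1 \<odot> z" using z(1) c by (simp only: c1_def B.m_assoc B.m_closed)
    also have "\<dots> = (z \<odot> v) \<odot> (?e \<odot> (?W \<odot> btr i m)) \<odot> binv (z \<odot> v)"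
      unfolding c1_eq using v z(1) z(4) e t by (simp add: B.m_assoc B.inv_mult_group)
    finally have "c = (z \<odot> v) \<odot> (?e \<odot> (?W \<odot> btr i m)) \<odot> binv (z \<odot> v)" .
    moreover have "B_supp (z \<odot> v) \<subseteq> D - {i}"
      using B_supp_mult[OF z(1), of v] z(3) v(2) mD False by (auto simp: D'_def)
    moreover have "distinct (ms @ [m])" "set (ms @ [m]) = D - {i}"
      using ms mD False by (auto simp: D'_def)
    ultimately show ?thesis unfolding W e0_def[symmetric] using B.m_closed[OF z(1) v(1)] by blast
  qed
qed

context B_class
begin

text \<open>The inverse of a star of transpositions is the star of the reversed list, so the inverse
  of a cycle has the same length and parity, and X takes the same value there.\<close>

lemma X_single_cycle:
  assumes "finite D" "c \<in> Bc" "i \<in> D" "0 \<notin> D" "B_supp c \<subseteq> D" "snd c ` D \<subseteq> D"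
    and "\<And>E. E \<subseteq> D \<Longrightarrow> i \<in> E \<Longrightarrow> snd c ` E \<subseteq> E \<Longrightarrow> E = D"
  shows "X c = cycle_val (card D - 1) (\<Sum>k\<in>D. fst c k)" "X (binv c) = cycle_val (card D - 1) (\<Sum>k\<in>D. fst c k)"
proof -
  let ?e = "\<Sum>k\<in>D. fst c k"
  obtain ms v where ms: "distinct ms" "set ms = D - {i}" and v: "v \<in> Bc"
    and c: "c = v \<odot> (bflip_pow ?e i \<odot> transps (zip (replicate (length ms) i) ms)) \<odot> binv v"
    using cycle_conj_canonical[OF assms] by blast
  let ?W = "transps (zip (replicate (length ms) i) ms)"
  have i0: "i \<noteq> 0" using assms(3,4) by metis
  have len: "length ms = card D - 1"
    using ms distinct_card[of ms] assms(1,3) by simp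
  have ok: "transps_ok (zip (replicate (length ms) i) ms)" using ms assms(4) i0 by (intro transps_ok_zip) auto
  have cl: "bflip_pow ?e i \<in> Bc" "?W \<in> Bc" using i0 ok by auto
  have "X c = X (bflip_pow ?e i \<odot> ?W)"
    by (subst c) (rule X_conj[OF v], use cl in simp)
  also have "\<dots> = cycle_val (length ms) ?e" by (rule X_cycle) (use ms i0 assms(4) in auto)
  finally show "X c = cycle_val (card D - 1) ?e" by (simp add: len)
  have "binv c = v \<odot> (binv ?W \<odot> bflip_pow ?e i) \<odot> binv v"
    by (subst c) (use v cl i0 in \<open>simp add: B.inv_mult_group B.m_assoc\<close>)
  then have "X (binv c) = X (binv ?W \<odot> bflip_pow ?e i)" using X_conj[OF v] cl by simp
  also have "\<dots> = X (bflip_pow ?e i \<odot> binv ?W)" by (rule X_comm) (use cl in auto)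
  also have "binv ?W = transps (zip (replicate (length ms) i) (rev ms))"
    unfolding transps_inv[OF ok] by (simp add: zip_rev[symmetric])
  also have "X (bflip_pow ?e i \<odot> transps (zip (replicate (length ms) i) (rev ms))) = cycle_val (length ms) ?e"
    by (rule X_cycle) (use ms i0 assms(4) in auto)
  finally show "X (binv c) = cycle_val (card D - 1) ?e" by (simp add: len)
qed

end

section \<open>Splitting an element along its orbits\<close>

definition B_part :: "(nat \<Rightarrow> bit) \<times> (nat \<Rightarrow> nat) \<Rightarrow> nat set \<Rightarrow> (nat \<Rightarrow> bit) \<times> (nat \<Rightarrow> nat)"
  where "B_part g D = (\<lambda>k. if k \<in> D then fst g k else 0, \<lambda>k. if k \<in> D then snd g k else k)"

lemma snd_B_part: "snd (B_part g D) k = (if k \<in> D then snd g k else k)"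
  and fst_B_part: "fst (B_part g D) k = (if k \<in> D then fst g k else 0)"
  by (simp_all add: B_part_def)

lemma B_supp_part: "B_supp (B_part g D) = B_supp g \<inter> D"
proof (rule Set.set_eqI)
  show "k \<in> B_supp (B_part g D) \<longleftrightarrow> k \<in> B_supp g \<inter> D" for k
    by (cases "k \<in> D") (simp_all add: B_supp_iff snd_B_part fst_B_part)
qed

lemma B_part_closed:
  assumes g: "g \<in> Bc" and D: "snd g ` D = D" "0 \<notin> D"
  shows "B_part g D \<in> Bc"
proof -
  have "bij_betw (snd g) D D"
    using D(1) B_bij[OF g] by (auto simp: bij_betw_def bij_def intro: inj_on_subset)
  then have "bij_betw (snd (B_part g D)) D D"
    by (rule bij_betw_cong[THEN iffD1, rotated]) (simp add: snd_B_part)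
  then have "snd (B_part g D) permutes D" by (rule bij_imp_permutes) (simp add: snd_B_part)
  then have "snd (B_part g D) permutes {1..}"
    by (rule permutes_subset) (use D(2) in \<open>auto simp: Suc_le_eq intro: gr0I\<close>)
  moreover have "finite {i. fst (B_part g D) i \<noteq> 0}"
    by (rule finite_subset[of _ "{i. fst g i \<noteq> 0}"], rule Collect_mono)
      (use g in \<open>simp_all add: B_carrier_iff fst_B_part\<close>)
  moreover have "finite {i. snd (B_part g D) i \<noteq> i}"
    by (rule finite_subset[of _ "{i. snd g i \<noteq> i}"], rule Collect_mono)
      (use g in \<open>simp_all add: B_carrier_iff snd_B_part\<close>)
  ultimately show ?thesis using D(2) by (simp add: B_carrier_iff fst_B_part)
qed

lemma B_part_compl:
  assumes g: "g \<in> Bc" and D: "snd g ` D = D" "0 \<notin> D"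
  defines "D2 \<equiv> {1..} - D"
  shows "snd g ` D2 = D2" "g = B_part g D \<odot> B_part g D2"
proof -
  have "snd g ` {1..} = {1..}" by (rule permutes_image[OF B_permutes[OF g]])
  then show 2: "snd g ` D2 = D2"
    unfolding D2_def using D(1) image_set_diff[OF bij_is_inj[OF B_bij[OF g]], of "{1..}" D] by simp
  have pc: "B_part g D \<in> Bc" by (rule B_part_closed[OF g D])
  have in2: "k \<in> D2 \<longleftrightarrow> k \<noteq> 0 \<and> k \<notin> D" for k by (auto simp: D2_def Suc_le_eq)
  have sD: "snd g k \<in> D \<longleftrightarrow> k \<in> D" for k
    using D(1) B_inj[OF g] by (metis imageE imageI)
  have g0: "snd g 0 = 0" "fst g 0 = 0" using B_perm_zero[OF g, of 0] g by (auto simp: B_carrier_iff)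
  show "g = B_part g D \<odot> B_part g D2"
  proof (rule prod_eqI)
    show "snd g = snd (B_part g D \<odot> B_part g D2)"
      using sD g0 by (auto simp: fun_eq_iff snd_B_part in2)
    show "fst g = fst (B_part g D \<odot> B_part g D2)"
    proof
      fix k
      define j where "j = inv_into UNIV (snd (B_part g D)) k"
      have kj: "k = snd (B_part g D) j" using pc by (simp add: j_def)
      show "fst g k = fst (B_part g D \<odot> B_part g D2) k"
        using sD[of j] g0 unfolding fst_B_mult j_def[symmetric]
        by (auto simp: kj snd_B_part fst_B_part in2)
    qed
  qed
qed

lemma finite_cycle_supports: "g \<in> Bc \<Longrightarrow> finite (cycle_supports (snd g))"
proof -
  assume "g \<in> Bc"
  then have "finite {i. snd g i \<noteq> i}" by (simp add: B_carrier_iff)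
  moreover have "cycle_supports (snd g) = orbit (snd g) ` {i. snd g i \<noteq> i}" by (auto simp: cycle_supports_def)
  ultimately show ?thesis by simp
qed

lemma B_permutation: "g \<in> Bc \<Longrightarrow> permutation (snd g)"
  by (auto simp: permutation B_bij B_carrier_iff)

lemma orbit_facts:
  assumes g: "g \<in> Bc"
  shows "i \<in> orbit (snd g) i" "snd g ` orbit (snd g) i = orbit (snd g) i"
    "j \<in> orbit (snd g) i \<Longrightarrow> orbit (snd g) j = orbit (snd g) i"
    "i \<in> E \<Longrightarrow> snd g ` E \<subseteq> E \<Longrightarrow> orbit (snd g) i \<subseteq> E" "finite (orbit (snd g) i)"
proof -
  show i: "i \<in> orbit (snd g) i" for i by (rule permutation_self_in_orbit[OF B_permutation[OF g]])
  show sub: "i \<in> E \<Longrightarrow> snd g ` E \<subseteq> E \<Longrightarrow> orbit (snd g) i \<subseteq> E" for i E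
  proof
    fix x assume E: "i \<in> E" "snd g ` E \<subseteq> E" and "x \<in> orbit (snd g) i"
    from this(3) show "x \<in> E" by induction (use E in auto)
  qed
  show fin: "finite (orbit (snd g) i)"
    by (rule finite_orbit[OF i])
  show im: "snd g ` orbit (snd g) i = orbit (snd g) i" for i
  proof (rule card_subset_eq)
    show "finite (orbit (snd g) i)" by (rule finite_orbit[OF i])
    show "snd g ` orbit (snd g) i \<subseteq> orbit (snd g) i" by (auto intro: orbit.step)
    show "card (snd g ` orbit (snd g) i) = card (orbit (snd g) i)"
      by (rule card_image) (meson B_bij[OF g] bij_is_inj inj_on_subset subset_UNIV)
  qed
  show "orbit (snd g) j = orbit (snd g) i" if j: "j \<in> orbit (snd g) i"
  proof
    show "orbit (snd g) j \<subseteq> orbit (snd g) i" by (rule sub[OF j]) (simp add: im)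
    have "i \<in> orbit (snd g) j" using orbit_swap[OF i j] .
    then show "orbit (snd g) i \<subseteq> orbit (snd g) j" by (rule sub) (simp add: im)
  qed
qed

text \<open>The shape of \<open>thoma_character\<close> with unspecified values F; a flipped fixed
  point counts as a cycle of length 1.\<close>

definition cycle_prod :: "(nat \<Rightarrow> bit \<Rightarrow> 'v::comm_monoid_mult) \<Rightarrow> (nat \<Rightarrow> bit) \<times> (nat \<Rightarrow> nat) \<Rightarrow> 'v"
  where "cycle_prod F g = (\<Prod>C\<in>cycle_supports (perm_part g). F (card C) (\<Sum>j\<in>C. seq_part g j)) *
    (\<Prod>i | perm_part g i = i \<and> seq_part g i \<noteq> 0. F 1 (seq_part g i))"

text \<open>Treats nontrivial cycles and flipped fixed points alike, although the definition keeps
  them in separate products. Over an orbit \<open>seq_part g\<close> and \<open>fst g\<close> have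
  the same sum, as \<open>snd g\<close> permutes the orbit.\<close>

lemma cycle_prod_step:
  assumes g: "g \<in> Bc" and i: "i \<in> B_supp g"
  defines "D \<equiv> orbit (snd g) i"
  shows "cycle_prod F g = F (card D) (\<Sum>k\<in>D. fst g k) * cycle_prod F (B_part g ({1..} - D))"
proof -
  define h where "h = B_part g ({1..} - D)"
  note og = orbit_facts[OF g]
  have inv: "snd g ` D = D" unfolding D_def by (rule og)
  have "snd g ` B_supp g \<subseteq> B_supp g" using B_supp_apply[OF g] by auto
  then have Ds: "D \<subseteq> B_supp g" unfolding D_def by (rule og(4)[OF i])
  have D0: "0 \<notin> D" using Ds zero_notin_B_supp[OF g] by blast
  have sD: "snd g k \<in> D \<longleftrightarrow> k \<in> D" for k
    using inv B_inj[OF g] by (metis imageE imageI)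
  have g0: "snd g 0 = 0" "fst g 0 = 0" using B_perm_zero[OF g, of 0] g by (auto simp: B_carrier_iff)
  have sh: "snd h k = (if k \<in> D then k else snd g k)" and fh: "fst h k = (if k \<in> D then 0 else fst g k)" for k
    using g0 by (auto simp: h_def snd_B_part fst_B_part Suc_le_eq)
  have hc: "h \<in> Bc" unfolding h_def
    by (rule B_part_closed[OF g B_part_compl(1)[OF g inv D0]]) simp
  note oh = orbit_facts[OF hc]
  have orb: "orbit (snd h) j = orbit (snd g) j" if j: "j \<notin> D" for j
  proof
    have E: "snd g ` (- D) \<subseteq> - D" using sD by auto
    then have sub: "orbit (snd g) j \<subseteq> - D" using j by (intro og(4)) auto
    then show "orbit (snd h) j \<subseteq> orbit (snd g) j"
      using og(1)[of j] og(2)[of j] by (intro oh(4)) (auto simp: sh)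
    have "snd h ` (- D) \<subseteq> - D" using sD by (auto simp: sh)
    then have "orbit (snd h) j \<subseteq> - D" using j by (intro oh(4)) auto
    then show "orbit (snd g) j \<subseteq> orbit (snd h) j"
      using oh(1)[of j] oh(2)[of j] by (intro og(4)) (fastforce simp: sh)+
  qed
  have disj: "C \<inter> D = {}" if "C \<in> cycle_supports (snd h)" for C
  proof -
    obtain j where j: "C = orbit (snd h) j" "snd h j \<noteq> j" using \<open>C \<in> _\<close> by (auto simp: cycle_supports_def)
    then have "j \<notin> D" by (auto simp: sh split: if_splits)
    then have "snd g ` (- D) \<subseteq> - D" "j \<in> - D" using sD by auto
    then have "orbit (snd g) j \<subseteq> - D" by (intro og(4))
    then show ?thesis using orb[OF \<open>j \<notin> D\<close>] j by auto
  qed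
  have seq: "seq_part h j = (if j \<in> D then 0 else seq_part g j)" for j
    using sD by (auto simp: seq_part_def sh fh)
  have cs: "cycle_supports (snd h) = cycle_supports (snd g) - {D}"
  proof
    show "cycle_supports (snd h) \<subseteq> cycle_supports (snd g) - {D}"
    proof
      fix C assume C: "C \<in> cycle_supports (snd h)"
      then obtain j where j: "C = orbit (snd h) j" "snd h j \<noteq> j" by (auto simp: cycle_supports_def)
      then have jD: "j \<notin> D" "snd g j \<noteq> j" by (auto simp: sh split: if_splits)
      have "C \<noteq> D" using disj[OF C] og(1)[of i] by (auto simp: D_def)
      then show "C \<in> cycle_supports (snd g) - {D}" using jD orb[OF jD(1)] j by (auto simp: cycle_supports_def)
    qed
    show "cycle_supports (snd g) - {D} \<subseteq> cycle_supports (snd h)"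
    proof
      fix C assume "C \<in> cycle_supports (snd g) - {D}"
      then obtain j where j: "C = orbit (snd g) j" "snd g j \<noteq> j" "C \<noteq> D" by (auto simp: cycle_supports_def)
      have "j \<notin> D" using og(3)[of j i] j by (auto simp: D_def)
      then show "C \<in> cycle_supports (snd h)" using j orb[of j] by (auto simp: cycle_supports_def sh)
    qed
  qed
  have p1: "(\<Prod>C\<in>cycle_supports (snd h). F (card C) (\<Sum>j\<in>C. seq_part h j))
    = (\<Prod>C\<in>cycle_supports (snd g) - {D}. F (card C) (\<Sum>j\<in>C. seq_part g j))"
    unfolding cs
  proof (intro prod.cong refl arg_cong2[where f = F] sum.cong)
    fix C j assume "C \<in> cycle_supports (snd g) - {D}" "j \<in> C"
    then have "j \<notin> D" using disj[of C] unfolding cs by blast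
    then show "seq_part h j = seq_part g j" by (simp add: seq)
  qed
  have sumD: "(\<Sum>j\<in>D. seq_part g j) = (\<Sum>k\<in>D. fst g k)"
  proof -
    have "bij_betw (snd g) D D"
      using inv B_bij[OF g] by (auto simp: bij_betw_def bij_def intro: inj_on_subset)
    then show ?thesis unfolding seq_part_def by (rule sum.reindex_bij_betw)
  qed
  let ?fg = "{k. snd g k = k \<and> seq_part g k \<noteq> 0}" and ?fh = "{k. snd h k = k \<and> seq_part h k \<noteq> 0}"
  have fin: "finite ?fg"
    by (rule finite_subset[OF _ finite_B_supp[OF g]]) (auto simp: B_supp_iff seq_part_def)
  have fh': "?fh = ?fg - D" by (auto simp: sh seq)
  show ?thesis
  proof (cases "snd g i = i")
    case True
    then have D: "D = {i}" using og(4)[of i "{i}"] og(1)[of i] by (auto simp: D_def)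
    have "fst g i \<noteq> 0" using i True by (simp add: B_supp_iff)
    then have ifg: "i \<in> ?fg" using True by (simp add: seq_part_def)
    have "D \<notin> cycle_supports (snd g)"
    proof
      assume "D \<in> cycle_supports (snd g)"
      then obtain j where "{i} = orbit (snd g) j" "snd g j \<noteq> j" by (auto simp: cycle_supports_def D)
      then show False using og(1)[of j] True by auto
    qed
    then have "cycle_supports (snd g) - {D} = cycle_supports (snd g)" by simp
    then have p1': "(\<Prod>C\<in>cycle_supports (snd h). F (card C) (\<Sum>j\<in>C. seq_part h j))
      = (\<Prod>C\<in>cycle_supports (snd g). F (card C) (\<Sum>j\<in>C. seq_part g j))" using p1 by simp
    have p2: "(\<Prod>k\<in>?fg. F 1 (seq_part g k)) = F 1 (seq_part g i) * (\<Prod>k\<in>?fh. F 1 (seq_part h k))"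
    proof -
      have "(\<Prod>k\<in>?fg. F 1 (seq_part g k)) = F 1 (seq_part g i) * (\<Prod>k\<in>?fg - {i}. F 1 (seq_part g k))"
        by (rule prod.remove[OF fin ifg])
      also have "(\<Prod>k\<in>?fg - {i}. F 1 (seq_part g k)) = (\<Prod>k\<in>?fh. F 1 (seq_part h k))"
        unfolding fh' by (rule prod.cong) (auto simp: D seq)
      finally show ?thesis .
    qed
    have "seq_part g i = fst g i" using True by (simp add: seq_part_def)
    then show ?thesis
      unfolding cycle_prod_def perm_part_def h_def[symmetric] p1' p2 by (simp add: D mult_ac)
  next
    case False
    have DC: "D \<in> cycle_supports (snd g)" using False by (auto simp: cycle_supports_def D_def)
    have nf: "snd g k \<noteq> k" if "k \<in> D" for k
    proof
      assume "snd g k = k"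
      then have "orbit (snd g) k \<subseteq> {k}" by (intro og(4)) auto
      then have "D \<subseteq> {k}" using og(3)[of k i] that by (simp add: D_def)
      then have "i = k" "snd g i = k" using og(1)[of i] inv unfolding D_def by auto
      then show False using False by simp
    qed
    then have "?fg - D = ?fg" by auto
    then have "(\<Prod>k\<in>?fh. F 1 (seq_part h k)) = (\<Prod>k\<in>?fg. F 1 (seq_part g k))"
      unfolding fh' using nf by (intro prod.cong) (auto simp: seq)
    moreover have "(\<Prod>C\<in>cycle_supports (snd g). F (card C) (\<Sum>j\<in>C. seq_part g j))
      = F (card D) (\<Sum>k\<in>D. fst g k) * (\<Prod>C\<in>cycle_supports (snd h). F (card C) (\<Sum>j\<in>C. seq_part h j))"
      unfolding p1 sumD[symmetric] by (rule prod.remove[OF finite_cycle_supports[OF g] DC])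
    ultimately show ?thesis
      unfolding cycle_prod_def perm_part_def h_def[symmetric] by (simp add: mult_ac)
  qed
qed

text \<open>One orbit is removed at a time. The claim for the inverse is carried along because both
  claims share the value on each orbit; comparing them later shows that \<open>chi\<close> is
  real.\<close>

theorem (in B_mult_class) X_cycle_prod:
  assumes "g \<in> Bc"
  shows "X g = cycle_prod (\<lambda>k e. cycle_val (k - 1) e) g \<and> X (binv g) = cycle_prod (\<lambda>k e. cycle_val (k - 1) e) g"
  using assms
proof (induction "card (B_supp g)" arbitrary: g rule: less_induct)
  case less
  note g = less.prems
  show ?case
  proof (cases "B_supp g = {}")
    case True
    then have "g = \<one>\<^bsub>B_grp\<^esub>" by (rule B_supp_empty)
    moreover have "cycle_prod F \<one>\<^bsub>B_grp\<^esub> = 1" for F :: "nat \<Rightarrow> bit \<Rightarrow> 'v"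
      by (simp add: cycle_prod_def cycle_supports_def perm_part_def seq_part_def B_one)
    ultimately show ?thesis by (simp add: X_one)
  next
    case False
    then obtain i where i: "i \<in> B_supp g" by blast
    define D where "D = orbit (snd g) i"
    let ?c = "B_part g D" and ?h = "B_part g ({1..} - D)"
    note og = orbit_facts[OF g]
    have inv: "snd g ` D = D" unfolding D_def by (rule og)
    have "snd g ` B_supp g \<subseteq> B_supp g" using B_supp_apply[OF g] by auto
    then have Ds: "D \<subseteq> B_supp g" unfolding D_def by (rule og(4)[OF i])
    have D0: "0 \<notin> D" using Ds zero_notin_B_supp[OF g] by blast
    have iD: "i \<in> D" unfolding D_def by (rule og)
    have c: "?c \<in> Bc" by (rule B_part_closed[OF g inv D0])
    have h: "?h \<in> Bc" by (rule B_part_closed[OF g B_part_compl(1)[OF g inv D0]]) simp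
    have gch: "g = ?c \<odot> ?h" by (rule B_part_compl(2)[OF g inv D0])
    have dis: "B_supp ?c \<inter> B_supp ?h = {}" by (auto simp: B_supp_part)
    have "B_supp ?h \<subset> B_supp g" using i iD by (auto simp: B_supp_part)
    then have "card (B_supp ?h) < card (B_supp g)" by (rule psubset_card_mono[OF finite_B_supp[OF g]])
    note IH = less.hyps[OF this h]
    have sc: "snd ?c k = snd g k" "fst ?c k = fst g k" if "k \<in> D" for k
      using that by (simp_all add: snd_B_part fst_B_part)
    have cyc: "X ?c = cycle_val (card D - 1) (\<Sum>k\<in>D. fst ?c k)" "X (binv ?c) = cycle_val (card D - 1) (\<Sum>k\<in>D. fst ?c k)"
    proof (rule_tac [!] X_single_cycle[where i = i])
      show "finite D" "finite D" unfolding D_def by (rule og)+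
      show "snd ?c ` D \<subseteq> D" "snd ?c ` D \<subseteq> D" using inv sc by auto
      show "E = D" if "E \<subseteq> D" "i \<in> E" "snd ?c ` E \<subseteq> E" for E
      proof -
        have "snd g ` E = snd ?c ` E" using that(1) sc by (intro image_cong) auto
        then have "snd g ` E \<subseteq> E" using that(3) by simp
        then have "D \<subseteq> E" unfolding D_def by (rule og(4)[OF that(2)])
        then show ?thesis using that by blast
      qed
      then show "E = D" if "E \<subseteq> D" "i \<in> E" "snd ?c ` E \<subseteq> E" for E using that by blast
    qed (use c iD D0 in \<open>auto simp: B_supp_part\<close>)
    have s: "(\<Sum>k\<in>D. fst ?c k) = (\<Sum>k\<in>D. fst g k)" using sc by simp
    have "X g = X ?c * X ?h" by (subst gch) (rule X_mult[OF c h dis])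
    moreover have "X (binv g) = X (binv ?h) * X (binv ?c)"
    proof -
      have "binv g = binv ?h \<odot> binv ?c" by (subst gch) (rule B.inv_mult_group[OF c h])
      then show ?thesis using X_mult[of "binv ?h" "binv ?c"] c h dis by (simp add: Int_commute)
    qed
    moreover have "cycle_prod (\<lambda>k e. cycle_val (k - 1) e) g
        = cycle_val (card D - 1) (\<Sum>k\<in>D. fst g k) * cycle_prod (\<lambda>k e. cycle_val (k - 1) e) ?h"
      unfolding D_def by (rule cycle_prod_step[OF g i])
    ultimately show ?thesis using IH cyc s by (simp add: mult.commute)
  qed
qed

section \<open>Merging two decreasing sequences\<close>

text \<open>If the index I stalls, the sums stop short of the whole series; the last hypothesis says
  that the missing terms are then 0.\<close>

lemma incseq_partial_sums:
  fixes f :: "nat \<Rightarrow> real"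
  assumes I: "incseq I" and f: "summable f"
    and stable: "\<And>N. (\<And>n. n \<ge> N \<Longrightarrow> I n = I N) \<Longrightarrow> (\<And>i. i \<ge> I N \<Longrightarrow> f i = 0)"
  shows "(\<lambda>N. \<Sum>i<I N. f i) \<longlonglongrightarrow> suminf f"
proof (cases "\<exists>K. \<forall>n. I n \<le> K")
  case True
  then obtain K where "range I \<subseteq> {..K}" by auto
  then have fin: "finite (range I)" by (rule finite_subset) simp
  then have "Max (range I) \<in> range I" by (intro Max_in) auto
  then obtain N where N: "I N = Max (range I)" by auto
  have IN: "I n = I N" if "n \<ge> N" for n
    using Max_ge[OF fin, of "I n"] incseqD[OF I that] N by simp
  have "suminf f = (\<Sum>i<I N. f i)"
    by (rule suminf_finite) (auto intro: stable[OF IN])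
  moreover have "eventually (\<lambda>n. (\<Sum>i<I n. f i) = (\<Sum>i<I N. f i)) sequentially"
    unfolding eventually_sequentially using IN by metis
  ultimately show ?thesis by (simp add: tendsto_eventually)
next
  case False
  have "filterlim I sequentially sequentially"
    unfolding filterlim_at_top
  proof
    fix Z
    obtain n where "I n > Z" using False by (meson not_le)
    then have "I k \<ge> Z" if "k \<ge> n" for k using incseqD[OF I that] by simp
    then show "eventually (\<lambda>n. Z \<le> I n) sequentially" unfolding eventually_sequentially by blast
  qed
  then show ?thesis using filterlim_compose[OF summable_LIMSEQ[OF f]] by blast
qed

text \<open>The positions reached in a and b after n steps of a merge; ties go to a.\<close>

fun merge_state :: "(nat \<Rightarrow> real) \<Rightarrow> (nat \<Rightarrow> real) \<Rightarrow> nat \<Rightarrow> nat \<times> nat" where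
  "merge_state a b 0 = (0, 0)"
| "merge_state a b (Suc n) = (let (i, j) = merge_state a b n in if b j \<le> a i then (Suc i, j) else (i, Suc j))"

text \<open>\<open>thoma_params\<close> asks for decreasing sequences, so the entries are merged
  while s records their origin. If the position in a gets stuck, its entry is below all later
  entries of b, which tend to 0, so the rest of a vanishes and F ignores it.\<close>

lemma merge_sequences:
  fixes a b :: "nat \<Rightarrow> real"
  assumes a: "decseq a" "\<And>i. 0 \<le> a i" "a \<longlonglongrightarrow> 0" and b: "decseq b" "\<And>i. 0 \<le> b i" "b \<longlonglongrightarrow> 0"
  obtains c s where "decseq c" "\<And>i. 0 \<le> c i"
    "\<And>F :: real \<Rightarrow> bit \<Rightarrow> real. F 0 0 = 0 \<Longrightarrow> F 0 1 = 0 \<Longrightarrow>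
      summable (\<lambda>i. F (a i) 0) \<Longrightarrow> summable (\<lambda>i. F (b i) 1) \<Longrightarrow>
      (\<lambda>n. F (c n) (s n)) sums ((\<Sum>i. F (a i) 0) + (\<Sum>i. F (b i) 1))"
proof -
  define I where "I n = fst (merge_state a b n)" for n
  define J where "J n = snd (merge_state a b n)" for n
  define c where "c n = max (a (I n)) (b (J n))" for n
  define s :: "nat \<Rightarrow> bit" where "s n = (if b (J n) \<le> a (I n) then 0 else 1)" for n
  have I0: "I 0 = 0" "J 0 = 0" by (simp_all add: I_def J_def)
  have step: "I (Suc n) = (if b (J n) \<le> a (I n) then Suc (I n) else I n)"
    "J (Suc n) = (if b (J n) \<le> a (I n) then J n else Suc (J n))" for n
    by (simp_all add: I_def J_def case_prod_unfold Let_def)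
  have inc: "incseq I" "incseq J" by (auto intro!: incseq_SucI simp: step)
  have IJ: "I n + J n = n" for n by (induction n) (auto simp: I0 step)
  have "decseq c"
  proof (rule decseq_SucI)
    fix n
    have "a (Suc (I n)) \<le> a (I n)" "b (Suc (J n)) \<le> b (J n)" using a b by (auto simp: decseq_Suc_iff)
    then show "c (Suc n) \<le> c n" by (auto simp: c_def step)
  qed
  moreover have "0 \<le> c i" for i using a(2) by (simp add: c_def max.coboundedI1)
  moreover have "(\<lambda>n. F (c n) (s n)) sums ((\<Sum>i. F (a i) 0) + (\<Sum>i. F (b i) 1))"
    if F: "F 0 0 = 0" "F 0 1 = 0" "summable (\<lambda>i. F (a i) 0)" "summable (\<lambda>i. F (b i) 1)"
    for F :: "real \<Rightarrow> bit \<Rightarrow> real"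
  proof -
    have part: "(\<Sum>n<N. F (c n) (s n)) = (\<Sum>i<I N. F (a i) 0) + (\<Sum>j<J N. F (b j) 1)" for N
      by (induction N) (auto simp: I0 step c_def s_def max_def)
    have "(\<lambda>N. \<Sum>i<I N. F (a i) 0) \<longlonglongrightarrow> (\<Sum>i. F (a i) 0)"
    proof (rule incseq_partial_sums[OF inc(1) F(3)])
      fix N i assume st: "\<And>n. n \<ge> N \<Longrightarrow> I n = I N" and i: "i \<ge> I N"
      have lt: "a (I N) \<le> b (J n)" if n: "n \<ge> N" for n
        using st[OF n] st[of "Suc n"] n by (auto simp: step(1)[of n] split: if_splits)
      have "filterlim (\<lambda>n. n - I N) sequentially sequentially" by (rule filterlim_minus_const_nat_at_top)
      then have "(\<lambda>n. b (n - I N)) \<longlonglongrightarrow> 0" by (rule filterlim_compose[OF b(3)])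
      moreover have "a (I N) \<le> b (n - I N)" if "n \<ge> N" for n
      proof -
        have "J n = n - I N" using IJ[of n] st[OF that] by simp
        then show ?thesis using lt[OF that] by simp
      qed
      ultimately have "a (I N) \<le> 0" by (intro LIMSEQ_le_const) blast+
      then have "a i = 0" using decseqD[OF a(1) i] a(2)[of i] by simp
      then show "F (a i) 0 = 0" using F by simp
    qed
    moreover have "(\<lambda>N. \<Sum>i<J N. F (b i) 1) \<longlonglongrightarrow> (\<Sum>i. F (b i) 1)"
    proof (rule incseq_partial_sums[OF inc(2) F(4)])
      fix N i assume st: "\<And>n. n \<ge> N \<Longrightarrow> J n = J N" and i: "i \<ge> J N"
      have lt: "b (J N) \<le> a (I n)" if n: "n \<ge> N" for n
        using st[OF n] st[of "Suc n"] n by (auto simp: step(2)[of n] split: if_splits)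
      have "filterlim (\<lambda>n. n - J N) sequentially sequentially" by (rule filterlim_minus_const_nat_at_top)
      then have "(\<lambda>n. a (n - J N)) \<longlonglongrightarrow> 0" by (rule filterlim_compose[OF a(3)])
      moreover have "b (J N) \<le> a (n - J N)" if "n \<ge> N" for n
      proof -
        have "I n = n - J N" using IJ[of n] st[OF that] by simp
        then show ?thesis using lt[OF that] by simp
      qed
      ultimately have "b (J N) \<le> 0" by (intro LIMSEQ_le_const) blast+
      then have "b i = 0" using decseqD[OF b(1) i] b(2)[of i] by simp
      then show "F (b i) 1 = 0" using F by simp
    qed
    ultimately show ?thesis unfolding sums_def part by (rule tendsto_add)
  qed
  ultimately show thesis by (rule that)
qed

section \<open>Indecomposability of multiplicative characters\<close>

lemma positive_definite_index:
  assumes pd: "positive_definite G \<phi>" and I: "finite I" and u: "\<And>i. i \<in> I \<Longrightarrow> u i \<in> carrier G"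
  shows "(\<Sum>i\<in>I. \<Sum>j\<in>I. cnj (c i) * c j * \<phi> (inv\<^bsub>G\<^esub> (u i) \<otimes>\<^bsub>G\<^esub> u j)) \<in> \<real>\<^sub>\<ge>\<^sub>0"
proof -
  have "(\<Sum>i | i \<in> I \<and> u i = g. cnj (c i)) = cnj (\<Sum>i | i \<in> I \<and> u i = g. c i)" for g
    by simp
  then show ?thesis
    unfolding sum_sum_image_gen[OF I, where K = "\<lambda>g h. \<phi> (inv\<^bsub>G\<^esub> g \<otimes>\<^bsub>G\<^esub> h)" and a = "\<lambda>i. cnj (c i)"]
    by (simp only:) (rule pd[unfolded positive_definite_def, rule_format], use I u in auto)
qed

lemma group_character_conj:
  assumes "group G" "group_character G \<phi>" "u \<in> carrier G" "g \<in> carrier G"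
  shows "\<phi> (u \<otimes>\<^bsub>G\<^esub> g \<otimes>\<^bsub>G\<^esub> inv\<^bsub>G\<^esub> u) = \<phi> g"
proof -
  interpret group G by fact
  have "\<phi> ((u \<otimes>\<^bsub>G\<^esub> g) \<otimes>\<^bsub>G\<^esub> inv\<^bsub>G\<^esub> u) = \<phi> (inv\<^bsub>G\<^esub> u \<otimes>\<^bsub>G\<^esub> (u \<otimes>\<^bsub>G\<^esub> g))"
    using assms by (auto simp: group_character_def central_function_def)
  then show ?thesis using assms by simp
qed

text \<open>Positivity for the identity and g: the coefficients 1, 1 make the imaginary parts
  cancel, and 1, \<i> make the real parts agree.\<close>

lemma group_character_inv:
  assumes G: "group G" and \<phi>: "group_character G \<phi>" and g: "g \<in> carrier G"
  shows "\<phi> (inv\<^bsub>G\<^esub> g) = cnj (\<phi> g)"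
proof -
  interpret group G by fact
  have pd: "positive_definite G \<phi>" and one: "\<phi> \<one>\<^bsub>G\<^esub> = 1" using \<phi> by (auto simp: group_character_def)
  have *: "(\<Sum>i\<in>{0,1}. \<Sum>j\<in>{0,1::nat}. cnj (c i) * c j *
      \<phi> (inv\<^bsub>G\<^esub> (if i = 0 then \<one>\<^bsub>G\<^esub> else g) \<otimes>\<^bsub>G\<^esub> (if j = 0 then \<one>\<^bsub>G\<^esub> else g))) \<in> \<real>\<^sub>\<ge>\<^sub>0" for c
    by (rule positive_definite_index[OF pd]) (use g in auto)
  have "Im (\<phi> g) + Im (\<phi> (inv\<^bsub>G\<^esub> g)) = 0"
    using *[of "\<lambda>_. 1"] g by (simp add: one complex_nonneg_Reals_iff)
  moreover have "Re (\<phi> g) - Re (\<phi> (inv\<^bsub>G\<^esub> g)) = 0"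
    using *[of "\<lambda>i. if i = 0 then 1 else \<i>"] g by (simp add: one complex_nonneg_Reals_iff)
  ultimately show ?thesis by (simp add: complex_eq_iff)
qed

text \<open>Cauchy--Schwarz for \<open>\<phi>\<close> applied to the average of the conjugates \<open>u i\<close> of \<open>g\<close>.\<close>

lemma group_character_average:
  assumes G: "group G" and \<phi>: "group_character G \<phi>" and g: "g \<in> carrier G" and N: "N \<ge> 1"
    and u: "\<And>i::nat. i < N \<Longrightarrow> u i \<in> carrier G" "\<And>i. i < N \<Longrightarrow> \<phi> (u i) = \<phi> g"
  shows "(cmod (\<phi> g))\<^sup>2 \<le> Re (\<Sum>i<N. \<Sum>j<N. \<phi> (inv\<^bsub>G\<^esub> (u i) \<otimes>\<^bsub>G\<^esub> u j)) / (real N)\<^sup>2"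
proof -
  interpret group G by fact
  \<comment> \<open>The family u is preceded by the identity with coefficient
    -\<open>\<phi> g\<close>; the quadratic form is then the mean of the double sum minus the square
    modulus of \<open>\<phi> g\<close>.\<close>
  define v where "v i = (case i of 0 \<Rightarrow> \<one>\<^bsub>G\<^esub> | Suc i \<Rightarrow> u i)" for i
  define a where "a = - \<phi> g"
  define r where "r = 1 / complex_of_real (real N)"
  define c where "c i = (case i of 0 \<Rightarrow> a | Suc i \<Rightarrow> r)" for i :: nat
  define Y where "Y = (\<Sum>i<N. \<Sum>j<N. \<phi> (inv\<^bsub>G\<^esub> (u i) \<otimes>\<^bsub>G\<^esub> u j))"
  have pd: "positive_definite G \<phi>" and one: "\<phi> \<one>\<^bsub>G\<^esub> = 1" using \<phi> by (auto simp: group_character_def)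
  have inv: "\<phi> (inv\<^bsub>G\<^esub> (u i)) = cnj (\<phi> g)" if "i < N" for i
    using group_character_inv[OF G \<phi> u(1)[OF that]] u(2)[OF that] by simp
  have rN: "of_nat N * r = 1" using N by (simp add: r_def)
  have cr: "cnj r = r" by (simp add: r_def)
  have "(\<Sum>i<Suc N. \<Sum>j<Suc N. cnj (c i) * c j * \<phi> (inv\<^bsub>G\<^esub> (v i) \<otimes>\<^bsub>G\<^esub> v j)) \<in> \<real>\<^sub>\<ge>\<^sub>0"
    by (rule positive_definite_index[OF pd]) (use u in \<open>auto simp: v_def split: nat.splits\<close>)
  also have "(\<Sum>i<Suc N. \<Sum>j<Suc N. cnj (c i) * c j * \<phi> (inv\<^bsub>G\<^esub> (v i) \<otimes>\<^bsub>G\<^esub> v j))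
    = cnj a * a + (\<Sum>j<N. cnj a * r * \<phi> (u j)) + (\<Sum>i<N. cnj r * a * \<phi> (inv\<^bsub>G\<^esub> (u i))
      + (\<Sum>j<N. cnj r * r * \<phi> (inv\<^bsub>G\<^esub> (u i) \<otimes>\<^bsub>G\<^esub> u j)))"
    using u(1) by (simp only: sum.lessThan_Suc_shift) (simp add: v_def c_def one)
  also have "\<dots> = cnj a * a + cnj a * \<phi> g + a * cnj (\<phi> g) + r * r * Y"
  proof -
    have "(\<Sum>j<N. cnj a * r * \<phi> (u j)) = cnj a * (of_nat N * r) * \<phi> g" using u(2) by simp
    moreover have "(\<Sum>i<N. cnj r * a * \<phi> (inv\<^bsub>G\<^esub> (u i))) = (of_nat N * r) * a * cnj (\<phi> g)"
      using inv by (simp add: cr)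
    moreover have "(\<Sum>i<N. \<Sum>j<N. cnj r * r * \<phi> (inv\<^bsub>G\<^esub> (u i) \<otimes>\<^bsub>G\<^esub> u j)) = r * r * Y"
      by (simp add: Y_def sum_distrib_left cr)
    ultimately show ?thesis by (simp only: sum.distrib rN mult_1_left mult_1_right add.assoc)
  qed
  also have "\<dots> = r * r * Y - complex_of_real ((cmod (\<phi> g))\<^sup>2)"
    unfolding complex_norm_square by (simp add: a_def)
  finally have "0 \<le> Re (r * r * Y - complex_of_real ((cmod (\<phi> g))\<^sup>2))"
    by (simp only: complex_nonneg_Reals_iff)
  moreover have "r * r * Y = Y / complex_of_real ((real N)\<^sup>2)" by (simp add: r_def power2_eq_square)
  ultimately show ?thesis unfolding Y_def[symmetric] by (simp add: Re_divide_of_real del: of_real_power)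
qed

lemma shifted_conjugates:
  assumes g: "g \<in> Bc"
  shows "\<exists>p :: nat \<Rightarrow> nat \<Rightarrow> nat. (\<forall>i. bperm (p i) \<in> Bc) \<and> (\<forall>i j. i \<noteq> j \<longrightarrow>
    B_supp (bperm (p i) \<odot> g \<odot> binv (bperm (p i))) \<inter> B_supp (bperm (p j) \<odot> g \<odot> binv (bperm (p j))) = {})"
proof -
  obtain M where M: "B_supp g \<subseteq> {1..M}" using B_supp_bounded[of "{g}"] g by auto
  have "\<exists>p. bperm p \<in> Bc \<and> (\<forall>k\<in>{1..M}. p k = k + i * M)" for i by (rule bperm_shift)
  then obtain p where p: "\<And>i. bperm (p i) \<in> Bc" "\<And>i. \<forall>k\<in>{1..M}. p i k = k + i * M" by metis
  have s: "B_supp (bperm (p i) \<odot> g \<odot> binv (bperm (p i))) \<subseteq> {i * M + 1..i * M + M}" for i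
  proof -
    have "B_supp (bperm (p i) \<odot> g \<odot> binv (bperm (p i))) = p i ` B_supp g" using B_supp_conj[OF p(1) g] by simp
    then show ?thesis using p(2)[of i] M by force
  qed
  have d: "{i * M + 1..i * M + M} \<inter> {j * M + 1..j * M + M} = {}" if "i \<noteq> j" for i j
  proof (rule ccontr)
    assume "{i * M + 1..i * M + M} \<inter> {j * M + 1..j * M + M} \<noteq> {}"
    then have "i * M < j * M + M" "j * M < i * M + M" by auto
    then have "i * M < Suc j * M" "j * M < Suc i * M" by (simp_all add: add.commute)
    then have "i < Suc j" "j < Suc i" using mult_less_cancel2 by blast+
    then show False using that by simp
  qed
  show ?thesis
  proof (intro exI[of _ p] conjI allI impI p(1))
    fix i j :: nat assume "i \<noteq> j"
    then show "B_supp (bperm (p i) \<odot> g \<odot> binv (bperm (p i))) \<inter> B_supp (bperm (p j) \<odot> g \<odot> binv (bperm (p j))) = {}"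
      using d[of i j] s[of i] s[of j] by blast
  qed
qed

theorem multiplicative_imp_indecomposable:
  assumes chi: "group_character B_grp chi"
    and mult: "\<And>g h. g \<in> Bc \<Longrightarrow> h \<in> Bc \<Longrightarrow> B_supp g \<inter> B_supp h = {} \<Longrightarrow> chi (g \<odot> h) = chi g * chi h"
  shows "indecomposable_character B_grp chi"
  unfolding indecomposable_character_def
proof (intro conjI allI impI ballI chi)
  fix \<phi> \<psi> and t :: real and g
  assume A: "group_character B_grp \<phi> \<and> group_character B_grp \<psi> \<and> 0 < t \<and> t < 1 \<and>
      (\<forall>g\<in>Bc. chi g = of_real t * \<phi> g + of_real (1 - t) * \<psi> g)" and g: "g \<in> Bc"
  note conj = group_character_conj[OF group_B_grp]
  have dec: "chi g = of_real t * \<phi> g + of_real (1 - t) * \<psi> g" if "g \<in> Bc" for g using A that by blast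
  obtain p :: "nat \<Rightarrow> nat \<Rightarrow> nat" where p: "\<And>i. bperm (p i) \<in> Bc" and dis: "\<And>i j. i \<noteq> j \<Longrightarrow>
    B_supp (bperm (p i) \<odot> g \<odot> binv (bperm (p i))) \<inter> B_supp (bperm (p j) \<odot> g \<odot> binv (bperm (p j))) = {}"
    using shifted_conjugates[OF g] by blast
  define u where "u i = bperm (p i) \<odot> g \<odot> binv (bperm (p i))" for i :: nat
  have u: "u i \<in> Bc" for i using p g by (simp add: u_def)
  have ug: "\<theta> (u i) = \<theta> g" if "group_character B_grp \<theta>" for \<theta> i
    unfolding u_def by (rule conj[OF that p g])
  define Y where "Y \<theta> N = Re (\<Sum>i<N. \<Sum>j<N. \<theta> (binv (u i) \<odot> u j)) / (real N)\<^sup>2" for \<theta> :: "_ \<Rightarrow> complex" and N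
  have av: "(cmod (\<theta> g))\<^sup>2 \<le> Y \<theta> N" if "group_character B_grp \<theta>" "N \<ge> 1" for \<theta> N
    unfolding Y_def by (rule group_character_average[OF group_B_grp that(1) g that(2) u ug[OF that(1)]])
  have Ychi: "Y chi N = t * Y \<phi> N + (1 - t) * Y \<psi> N" for N
  proof -
    have "(\<Sum>i<N. \<Sum>j<N. chi (binv (u i) \<odot> u j)) = of_real t * (\<Sum>i<N. \<Sum>j<N. \<phi> (binv (u i) \<odot> u j))
        + of_real (1 - t) * (\<Sum>i<N. \<Sum>j<N. \<psi> (binv (u i) \<odot> u j))"
      using u by (simp add: dec sum.distrib sum_distrib_left)
    then show ?thesis by (simp add: Y_def add_divide_distrib del: of_real_diff)
  qed
  \<comment> \<open>Off-diagonal terms equal the square modulus of \<open>chi g\<close> by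
    multiplicativity; the N diagonal terms are 1 and weigh 1 / N in the mean.\<close>
  have Yle: "Y chi N \<le> (cmod (chi g))\<^sup>2 + 1 / real N" if N: "N \<ge> 1" for N
  proof -
    have "(\<Sum>j<N. Re (chi (binv (u i) \<odot> u j))) \<le> 1 + real N * (cmod (chi g))\<^sup>2" if i: "i < N" for i
    proof -
      have "Re (chi (binv (u i) \<odot> u j)) = (cmod (chi g))\<^sup>2" if "j \<noteq> i" for j
      proof -
        have "chi (binv (u i) \<odot> u j) = chi (binv (u i)) * chi (u j)"
          using dis[of i j] that u by (intro mult) (auto simp: u_def)
        also have "\<dots> = cnj (chi g) * chi g"
          using group_character_inv[OF group_B_grp chi u] ug[OF chi] by simp
        also have "\<dots> = complex_of_real ((cmod (chi g))\<^sup>2)"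
          unfolding complex_norm_square by (rule mult.commute)
        finally show ?thesis by simp
      qed
      then have "(\<Sum>j\<in>{..<N} - {i}. Re (chi (binv (u i) \<odot> u j))) = (real N - 1) * (cmod (chi g))\<^sup>2"
        using i by (simp add: of_nat_diff)
      moreover have "Re (chi (binv (u i) \<odot> u i)) = 1" using u chi by (simp add: group_character_def)
      ultimately have "(\<Sum>j<N. Re (chi (binv (u i) \<odot> u j))) = 1 + (real N - 1) * (cmod (chi g))\<^sup>2"
        using i by (subst sum.remove[of _ i]) auto
      also have "\<dots> \<le> 1 + real N * (cmod (chi g))\<^sup>2" by (intro add_left_mono mult_right_mono) auto
      finally show ?thesis .
    qed
    then have "(\<Sum>i<N. \<Sum>j<N. Re (chi (binv (u i) \<odot> u j))) \<le> (\<Sum>i<N. 1 + real N * (cmod (chi g))\<^sup>2)"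
      by (intro sum_mono) auto
    also have "\<dots> = real N + (real N)\<^sup>2 * (cmod (chi g))\<^sup>2" by (simp add: power2_eq_square algebra_simps)
    finally have "Y chi N \<le> (real N + (real N)\<^sup>2 * (cmod (chi g))\<^sup>2) / (real N)\<^sup>2"
      unfolding Y_def by (intro divide_right_mono) auto
    also have "\<dots> = (cmod (chi g))\<^sup>2 + 1 / real N" using N by (simp add: field_simps power2_eq_square)
    finally show ?thesis .
  qed
  define Q where "Q = t * (cmod (\<phi> g))\<^sup>2 + (1 - t) * (cmod (\<psi> g))\<^sup>2"
  have "Q \<le> (cmod (chi g))\<^sup>2 + 1 / real (Suc n)" for n
  proof -
    have "Q \<le> t * Y \<phi> (Suc n) + (1 - t) * Y \<psi> (Suc n)"
      unfolding Q_def using A by (intro add_mono mult_left_mono av) auto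
    then show ?thesis using Ychi[of "Suc n"] Yle[of "Suc n"] by linarith
  qed
  moreover have "(\<lambda>n. (cmod (chi g))\<^sup>2 + 1 / real (Suc n)) \<longlonglongrightarrow> (cmod (chi g))\<^sup>2 + 0"
    by (rule tendsto_add[OF tendsto_const LIMSEQ_Suc[OF lim_1_over_n]])
  ultimately have "Q \<le> (cmod (chi g))\<^sup>2 + 0" by (intro LIMSEQ_le_const) blast+
  \<comment> \<open>The variance of the two values \<open>\<phi> g\<close> and
    \<open>\<psi> g\<close> with weights t and 1 - t.\<close>
  moreover have "Q - (cmod (chi g))\<^sup>2 = t * (1 - t) * (cmod (\<phi> g - \<psi> g))\<^sup>2"
    unfolding Q_def dec[OF g] cmod_power2 by (simp add: power2_eq_square algebra_simps)
  ultimately have "t * (1 - t) * (cmod (\<phi> g - \<psi> g))\<^sup>2 \<le> 0" by simp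
  then have "\<phi> g = \<psi> g" using A by (auto simp: mult_le_0_iff zero_le_mult_iff)
  moreover have "chi g = \<psi> g" unfolding dec[OF g] calculation by (simp add: algebra_simps)
  ultimately show "\<phi> g = chi g" "\<psi> g = chi g" by simp_all
qed

section \<open>One-dimensional characters\<close>

definition B_parity :: "(nat \<Rightarrow> bit) \<times> (nat \<Rightarrow> nat) \<Rightarrow> bit"
  where "B_parity g = (\<Sum>i\<in>B_supp g. fst g i)"

lemma B_parity_superset: "finite A \<Longrightarrow> B_supp g \<subseteq> A \<Longrightarrow> B_parity g = (\<Sum>i\<in>A. fst g i)"
  unfolding B_parity_def by (rule sum.mono_neutral_left) (auto simp: B_supp_not_apply)

lemma B_parity_mult:
  assumes g: "g \<in> Bc" and h: "h \<in> Bc"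
  shows "B_parity (g \<odot> h) = B_parity g + B_parity h"
proof -
  let ?A = "B_supp g \<union> B_supp h"
  have fin: "finite ?A" using finite_B_supp g h by blast
  have A: "inv_into UNIV (snd g) k \<in> ?A" if "k \<in> ?A" for k
    using that B_supp_inv_into[OF g] B_supp_not_inv_into[OF g] by (metis UnE UnI1 UnI2)
  have A': "snd g k \<in> ?A" if "k \<in> ?A" for k
    using that B_supp_apply[OF g] B_supp_not_apply(1) by (metis UnE UnI1 UnI2)
  have "bij_betw (inv_into UNIV (snd g)) ?A ?A"
    by (rule bij_betw_byWitness[where f' = "snd g"]) (use A A' g in auto)
  then have "(\<Sum>k\<in>?A. fst h (inv_into UNIV (snd g) k)) = (\<Sum>k\<in>?A. fst h k)"
    by (rule sum.reindex_bij_betw)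
  then show ?thesis
    using B_parity_superset[OF fin B_supp_mult[OF g]] B_parity_superset[OF fin, of g] B_parity_superset[OF fin, of h]
    by (simp only: fst_B_mult sum.distrib Un_upper1 Un_upper2)
qed

lemma bit_sign_add: "bit_sign (a + b) = bit_sign a * bit_sign b"
  by (cases a; cases b) (auto simp: bit_sign_def)

lemma bit_sign_0: "bit_sign 0 = 1"
  by (simp add: bit_sign_def)

text \<open>The four one-dimensional characters: \<kappa> selects the sign \<delta> on
  transpositions, \<tau> the parity part that \<open>ptau\<close> extracts.\<close>

definition lin_char :: "bool \<Rightarrow> bool \<Rightarrow> (nat \<Rightarrow> bit) \<times> (nat \<Rightarrow> nat) \<Rightarrow> real"
  where "lin_char \<kappa> \<tau> g = (if \<kappa> then of_int (sign (snd g)) else 1) * (if \<tau> then bit_sign (B_parity g) else 1)"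

section \<open>From moments to parameters\<close>

context B_char
begin

definition moment :: "bool \<Rightarrow> nat \<Rightarrow> real"
  where "moment \<tau> j = (cycle_val j 0 + (if \<tau> then - 1 else 1) * cycle_val j 1) / 2"

lemma B_char_sign_lin_char:
  "B_char_sign X (lin_char \<kappa> \<tau>) (if \<kappa> then - 1 else 1) (if \<tau> then - 1 else 1)"
proof (intro B_char_sign.intro B_char_axioms B_char_sign_axioms.intro)
  fix g h :: "(nat \<Rightarrow> bit) \<times> (nat \<Rightarrow> nat)" assume g: "g \<in> Bc" and h: "h \<in> Bc"
  have "sign (snd g \<circ> snd h) = sign (snd g) * sign (snd h)"
    by (rule sign_compose[OF B_permutation[OF g] B_permutation[OF h]])
  then show "lin_char \<kappa> \<tau> (g \<odot> h) = lin_char \<kappa> \<tau> g * lin_char \<kappa> \<tau> h"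
    unfolding lin_char_def B_parity_mult[OF g h] bit_sign_add snd_B_mult by simp
next
  fix g :: "(nat \<Rightarrow> bit) \<times> (nat \<Rightarrow> nat)"
  show "lin_char \<kappa> \<tau> g * lin_char \<kappa> \<tau> g = 1" by (simp add: lin_char_def sign_def bit_sign_def)
next
  fix i j :: nat assume "i \<noteq> 0" "j \<noteq> 0" "i \<noteq> j"
  then show "lin_char \<kappa> \<tau> (btr i j) = (if \<kappa> then - 1 else 1)"
    by (simp add: lin_char_def sign_swap_id B_parity_def bit_sign_def)
next
  fix i :: nat assume "i \<noteq> 0"
  then show "lin_char \<kappa> \<tau> (bflip i) = (if \<tau> then - 1 else 1)"
    by (simp add: lin_char_def B_parity_def fst_bflip bit_sign_def)
qed

lemma cycle_val_bound: "\<bar>cycle_val j e\<bar> \<le> 1"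
proof -
  have "transps_ok (zip (replicate j 1) [2..<j + 2])" by (rule transps_ok_zip) auto
  then show ?thesis unfolding cycle_val_def by (intro X_bound) simp
qed

text \<open>\<open>m_pos\<close> demands both signs \<delta> for the same moments; \<kappa> follows
  \<delta>, while \<tau> stays fixed.\<close>

lemma cycsum_moments_moment: "cycsum_moments (moment \<tau>)"
proof
  show "\<bar>moment \<tau> j\<bar> \<le> 1" for j
    using cycle_val_bound[of j 0] cycle_val_bound[of j 1] by (auto simp: moment_def)
  fix \<delta> :: real and S :: "nat list set" and n C
  assume \<delta>: "\<delta> = 1 \<or> \<delta> = - 1" and S: "finite S" "\<And>js. js \<in> S \<Longrightarrow> length js = n"
  define \<kappa> where "\<kappa> \<longleftrightarrow> \<delta> = - 1"
  have d: "\<delta> = (if \<kappa> then - 1 else 1)" using \<delta> by (auto simp: \<kappa>_def)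
  interpret s: B_char_sign X "lin_char \<kappa> \<tau>" \<delta> "if \<tau> then - 1 else 1"
    unfolding d by (rule B_char_sign_lin_char)
  have "s.ptau = (\<lambda>k. moment \<tau> (k - 1))" by (rule ext) (simp only: s.ptau_def moment_def)
  then show "0 \<le> (\<Sum>js\<in>S. \<Sum>ks\<in>S. C js * C ks *
      cycsum \<delta> (\<lambda>k. moment \<tau> (k - 1)) (map Suc (map2 (+) js ks)))"
    using s.cycsum_positive[OF S, of C] by simp
qed

text \<open>The even part supplies the entries with sign bit 0 and the odd part those with sign bit
  1, because \<open>cycle_val\<close> is the even part plus the sign of e times the odd part. The
  two masses at 0 become \<gamma>0 and \<gamma>1.\<close>

theorem thoma_parameters:
  "\<exists>\<alpha> \<beta> \<gamma>0 \<gamma>1 \<sigma>\<alpha> \<sigma>\<beta>. thoma_params \<alpha> \<beta> \<gamma>0 \<gamma>1 \<and>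
    (\<forall>g\<in>Bc. X g = thoma_character \<alpha> \<beta> \<gamma>0 \<gamma>1 \<sigma>\<alpha> \<sigma>\<beta> g)"
proof -
  obtain a0 b0 c0 where p0: "decseq a0" "\<And>i. 0 \<le> a0 i" "decseq b0" "\<And>i. 0 \<le> b0 i" "0 \<le> c0"
    "\<And>k. summable (\<lambda>i. a0 i ^ Suc k)" "\<And>k. summable (\<lambda>i. b0 i ^ Suc k)"
    "\<And>k. moment False k = (\<Sum>i. a0 i ^ Suc k) + (- 1) ^ k * (\<Sum>i. b0 i ^ Suc k) + (if k = 0 then c0 else 0)"
    using cycsum_moments.cycsum_moment_sequences[OF cycsum_moments_moment[of False]] by blast
  obtain a1 b1 c1 where p1: "decseq a1" "\<And>i. 0 \<le> a1 i" "decseq b1" "\<And>i. 0 \<le> b1 i" "0 \<le> c1"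
    "\<And>k. summable (\<lambda>i. a1 i ^ Suc k)" "\<And>k. summable (\<lambda>i. b1 i ^ Suc k)"
    "\<And>k. moment True k = (\<Sum>i. a1 i ^ Suc k) + (- 1) ^ k * (\<Sum>i. b1 i ^ Suc k) + (if k = 0 then c1 else 0)"
    using cycsum_moments.cycsum_moment_sequences[OF cycsum_moments_moment[of True]] by blast
  have lim: "a0 \<longlonglongrightarrow> 0" "b0 \<longlonglongrightarrow> 0" "a1 \<longlonglongrightarrow> 0" "b1 \<longlonglongrightarrow> 0"
    using p0(6,7)[of 0] p1(6,7)[of 0] summable_LIMSEQ_zero by auto
  obtain \<alpha> \<sigma>\<alpha> where \<alpha>: "decseq \<alpha>" "\<And>i. 0 \<le> \<alpha> i"
    and F\<alpha>: "\<And>F :: real \<Rightarrow> bit \<Rightarrow> real. F 0 0 = 0 \<Longrightarrow> F 0 1 = 0 \<Longrightarrow> summable (\<lambda>i. F (a0 i) 0) \<Longrightarrow> summable (\<lambda>i. F (a1 i) 1) \<Longrightarrow>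
      (\<lambda>n. F (\<alpha> n) (\<sigma>\<alpha> n)) sums ((\<Sum>i. F (a0 i) 0) + (\<Sum>i. F (a1 i) 1))"
    by (rule merge_sequences[OF p0(1,2) lim(1) p1(1,2) lim(3)]) (rule that)
  obtain \<beta> \<sigma>\<beta> where \<beta>: "decseq \<beta>" "\<And>i. 0 \<le> \<beta> i"
    and F\<beta>: "\<And>F :: real \<Rightarrow> bit \<Rightarrow> real. F 0 0 = 0 \<Longrightarrow> F 0 1 = 0 \<Longrightarrow> summable (\<lambda>i. F (b0 i) 0) \<Longrightarrow> summable (\<lambda>i. F (b1 i) 1) \<Longrightarrow>
      (\<lambda>n. F (\<beta> n) (\<sigma>\<beta> n)) sums ((\<Sum>i. F (b0 i) 0) + (\<Sum>i. F (b1 i) 1))"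
    by (rule merge_sequences[OF p0(3,4) lim(2) p1(3,4) lim(4)]) (rule that)
  have s\<alpha>: "(\<lambda>n. \<alpha> n ^ Suc k * bit_sign (\<sigma>\<alpha> n * e)) sums ((\<Sum>i. a0 i ^ Suc k) + bit_sign e * (\<Sum>i. a1 i ^ Suc k))" for k e
  proof -
    have "(\<lambda>n. \<alpha> n ^ Suc k * bit_sign (\<sigma>\<alpha> n * e)) sums
        ((\<Sum>i. a0 i ^ Suc k * bit_sign (0 * e)) + (\<Sum>i. a1 i ^ Suc k * bit_sign (1 * e)))"
      by (rule F\<alpha>[of "\<lambda>x s. x ^ Suc k * bit_sign (s * e)"])
        (simp_all only: power_0_Suc mult_zero_left mult_1_left bit_sign_0 mult_1_right p0(6) summable_mult2[OF p1(6)])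
    then show ?thesis
      by (simp only: mult_zero_left mult_1_left bit_sign_0 mult_1_right suminf_mult2[OF p1(6)[of k], symmetric]
          mult.commute[of "bit_sign e"])
  qed
  have s\<beta>: "(\<lambda>n. \<beta> n ^ Suc k * bit_sign (\<sigma>\<beta> n * e)) sums ((\<Sum>i. b0 i ^ Suc k) + bit_sign e * (\<Sum>i. b1 i ^ Suc k))" for k e
  proof -
    have "(\<lambda>n. \<beta> n ^ Suc k * bit_sign (\<sigma>\<beta> n * e)) sums
        ((\<Sum>i. b0 i ^ Suc k * bit_sign (0 * e)) + (\<Sum>i. b1 i ^ Suc k * bit_sign (1 * e)))"
      by (rule F\<beta>[of "\<lambda>x s. x ^ Suc k * bit_sign (s * e)"])
        (simp_all only: power_0_Suc mult_zero_left mult_1_left bit_sign_0 mult_1_right p0(7) summable_mult2[OF p1(7)])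
    then show ?thesis
      by (simp only: mult_zero_left mult_1_left bit_sign_0 mult_1_right suminf_mult2[OF p1(7)[of k], symmetric]
          mult.commute[of "bit_sign e"])
  qed
  have cycle_val: "cycle_val k e = moment False k + bit_sign e * moment True k" for k e
    by (cases e) (simp_all add: moment_def bit_sign_def field_simps)
  have one: "cycle_val 0 0 = 1" by (simp add: cycle_val_def bflip_pow_def X_one)
  have \<alpha>1: "\<alpha> sums ((\<Sum>i. a0 i) + (\<Sum>i. a1 i))" and \<beta>1: "\<beta> sums ((\<Sum>i. b0 i) + (\<Sum>i. b1 i))"
    using s\<alpha>[of 0 0] s\<beta>[of 0 0] by (simp_all add: bit_sign_def)
  \<comment> \<open>The value 1 of X at the identity is the condition on the total mass.\<close>
  have tot: "(\<Sum>i. \<alpha> i) + (\<Sum>i. \<beta> i) + c0 + c1 = 1"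
    using cycle_val[of 0 0] one p0(8)[of 0] p1(8)[of 0] sums_unique[OF \<alpha>1] sums_unique[OF \<beta>1]
    by (simp add: bit_sign_def)
  have tp: "thoma_params \<alpha> \<beta> c0 c1"
    unfolding thoma_params_def using \<alpha> \<beta> p0(5) p1(5) tot sums_summable[OF \<alpha>1] sums_summable[OF \<beta>1] by simp
  \<comment> \<open>At k = 0 the two masses at 0 would enter as well; that case is
    \<open>point_value\<close>.\<close>
  have cv: "cycle_val k e = cycle_value \<alpha> \<beta> \<sigma>\<alpha> \<sigma>\<beta> (Suc k) e" if "k \<ge> 1" for k e
    unfolding cycle_value_def sums_unique[OF s\<alpha>[of k e], symmetric] sums_unique[OF s\<beta>[of k e], symmetric] cycle_val p0(8) p1(8)
    using that by (simp add: algebra_simps)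
  have pv: "cycle_val 0 e = point_value \<alpha> \<beta> c0 c1 \<sigma>\<alpha> \<sigma>\<beta> e" for e
    using sums_unique[OF s\<alpha>[of 0 e]] sums_unique[OF s\<beta>[of 0 e]] p0(8)[of 0] p1(8)[of 0]
    unfolding point_value_def cycle_val by (simp add: algebra_simps)
  have "X g = thoma_character \<alpha> \<beta> c0 c1 \<sigma>\<alpha> \<sigma>\<beta> g" if g: "g \<in> Bc" for g
  proof -
    have "X g = cycle_prod (\<lambda>k e. cycle_val (k - 1) e) g" using X_cycle_prod[OF g] by simp
    also have "\<dots> = thoma_character \<alpha> \<beta> c0 c1 \<sigma>\<alpha> \<sigma>\<beta> g"
      unfolding cycle_prod_def thoma_character_def
    proof (intro arg_cong2[where f = times] prod.cong refl)
      fix C assume "C \<in> cycle_supports (perm_part g)"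
      then obtain i where i: "C = orbit (snd g) i" "snd g i \<noteq> i" by (auto simp: cycle_supports_def perm_part_def)
      have "{i, snd g i} \<subseteq> C" using orbit_facts(1)[OF g, of i] by (auto simp: i intro: orbit.base)
      then have "card {i, snd g i} \<le> card C" by (rule card_mono[rotated]) (simp add: i orbit_facts(5)[OF g])
      then have "card C \<ge> 2" using i(2) by simp
      then show "cycle_val (card C - 1) (\<Sum>j\<in>C. seq_part g j) = cycle_value \<alpha> \<beta> \<sigma>\<alpha> \<sigma>\<beta> (card C) (\<Sum>j\<in>C. seq_part g j)"
        using cv[of "card C - 1"] by simp
    qed (simp add: pv)
    finally show ?thesis .
  qed
  then show ?thesis using tp by blast
qed

end

section \<open>The character of a stable factor representation\<close>

context stable_factor_rep
begin

lemma chi_central: "central_function B_grp chi"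
  unfolding central_function_def
proof (intro ballI)
  fix g h assume g: "g \<in> Bc" and h: "h \<in> Bc"
  then show "chi (g \<odot> h) = chi (h \<odot> g)" using chi_conj[of h "g \<odot> h"] by (simp add: B.m_assoc)
qed

lemma chi_character: "group_character B_grp chi"
  unfolding group_character_def using chi_positive_definite chi_central chi_one by blast

sublocale chi: B_mult_class chi
  by unfold_locales (use chi_conj chi_one chi_mult in auto)

lemma chi_inv: "g \<in> Bc \<Longrightarrow> chi (binv g) = chi g"
  using chi.X_cycle_prod[of g] by simp

text \<open>Inversion fixes \<open>chi\<close> by the cycle product and conjugates it by positive
  definiteness.\<close>

lemma chi_real: "g \<in> Bc \<Longrightarrow> chi g = complex_of_real (Re (chi g))"
  using chi_inv[of g] group_character_inv[OF group_B_grp chi_character, of g]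
  by (simp add: complex_eq_iff)

lemma B_char_Re_chi: "B_char (\<lambda>g. Re (chi g))"
proof
  fix g h :: "(nat \<Rightarrow> bit) \<times> (nat \<Rightarrow> nat)"
  assume g: "g \<in> Bc" "h \<in> Bc" "B_supp g \<inter> B_supp h = {}"
  have "chi (g \<odot> h) = complex_of_real (Re (chi g) * Re (chi h))"
    using chi_mult[OF g] chi_real[OF g(1)] chi_real[OF g(2)] by simp
  then show "Re (chi (g \<odot> h)) = Re (chi g) * Re (chi h)" by simp
next
  fix S and c :: "_ \<Rightarrow> real" assume S: "finite S" "S \<subseteq> Bc"
  have "(\<Sum>g\<in>S. \<Sum>h\<in>S. cnj (complex_of_real (c g)) * complex_of_real (c h) * chi (binv g \<odot> h)) \<in> \<real>\<^sub>\<ge>\<^sub>0"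
    by (rule chi_positive_definite[unfolded positive_definite_def, rule_format]) (use S in simp)
  then show "0 \<le> (\<Sum>g\<in>S. \<Sum>h\<in>S. c g * c h * Re (chi (binv g \<odot> h)))"
    by (simp add: complex_nonneg_Reals_iff flip: of_real_mult)
qed (simp_all add: chi_conj chi_one chi_inv)

end

text \<open>Independence of the sequence lies in the order of the quantifiers: \<open>chi\<close> is
  chosen before g and \<open>gs\<close>.\<close>

theorem proposition57:
  fixes \<pi> :: "(nat \<Rightarrow> bit) \<times> (nat \<Rightarrow> nat) \<Rightarrow> 'h::complex_hilbert \<Rightarrow> 'h"
  assumes "stable_rep B_grp \<pi>"
    and "factor_rep B_grp \<pi>"
  shows "\<exists>chi.
    (\<forall>g\<in>carrier B_grp. \<forall>gs. (\<forall>n\<ge>1. gs n \<in> Cl_tail n g) \<longrightarrow>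
      wot_limit (\<lambda>n. \<pi> (gs n)) (\<lambda>\<xi>. chi g *\<^sub>C \<xi>)) \<and>
    positive_definite B_grp chi \<and>
    central_function B_grp chi \<and>
    indecomposable_character B_grp chi \<and>
    (\<exists>\<alpha> \<beta> \<gamma>0 \<gamma>1 \<sigma>\<alpha> \<sigma>\<beta>. thoma_params \<alpha> \<beta> \<gamma>0 \<gamma>1 \<and>
      (\<forall>g\<in>carrier B_grp. chi g = complex_of_real (thoma_character \<alpha> \<beta> \<gamma>0 \<gamma>1 \<sigma>\<alpha> \<sigma>\<beta> g)))"
proof -
  interpret stable_factor_rep \<pi> using assms by unfold_locales
  have "\<exists>\<alpha> \<beta> \<gamma>0 \<gamma>1 \<sigma>\<alpha> \<sigma>\<beta>. thoma_params \<alpha> \<beta> \<gamma>0 \<gamma>1 \<and>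
      (\<forall>g\<in>Bc. chi g = complex_of_real (thoma_character \<alpha> \<beta> \<gamma>0 \<gamma>1 \<sigma>\<alpha> \<sigma>\<beta> g))"
    using B_char.thoma_parameters[OF B_char_Re_chi] chi_real by metis
  moreover have "indecomposable_character B_grp chi"
    by (rule multiplicative_imp_indecomposable[OF chi_character chi_mult])
  ultimately show ?thesis
    using chi_wot_limit chi_positive_definite chi_central by (intro exI[of _ chi]) blast
qed

end
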